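(* Let $m_0$ be a Borel probability measure on $\mathcal G$ with bounded support, let the costs satisfy the standing assumptions listed in the context, and assume that $G_i[m']\in C^1(\mathbb R_+)$ for all $i\in\{1,\dots,N\}$, $m'\in\mathcal P_1(\mathcal G)$. Let $C,V>0$, let $\mu\in\mathcal P_{m_0}(\Gamma^{\rm Lip}_{C,V})$ be a relaxed equilibrium and let $(u,m)$ be the related mild solution. 1. For every $i=1,\dots,N$, consider $\psi\in C^\infty(\mathcal G)$, supported in $J_i\setminus\{0\}$, such that $\psi(x)=1$ for all $x\in J_i$ with $d(x,0)\ge1$ and $\psi|_{J_i}$ is nondecreasing with respect to $d(x,0)$. For $\epsilon>0$ set $\psi_\epsilon(x)=\psi(x/\epsilon)$. The family of functions $$t\mapsto-\int_{J_i}D_x\psi_\epsilon(x)\,\partial_pH(x,D_xu(x,t),t)\,m(t)(dx)$$ converges in $\mathcal D'(0,T)$ as $\epsilon\to0$ to some distribution $q_i$, which does not depend on the choice of $\psi$. 2. With $q_i$ as in point 1, the following identities hold in $\mathcal D'(0,T)$: $$\frac{d}{dt}\Big(m(\cdot)(J_i\setminus\{0\})\Big)=\frac{d}{dt}\Big(\int_\Gamma\mathbf 1_{\gamma(\cdot)\in J_i\setminus\{0\}}\,\mu(d\gamma)\Big)=q_i.$$ 3. For every $\phi\in C^\infty(\mathcal G\times[0,T])$ such that $\operatorname{supp}(\phi(\cdot,t))$ is contained in a compact subset of $\mathcal G$ independent of $t$, the following identities hold in $\mathcal D'(0,T)$: for all $i=1,\dots,N$, $$\frac{d}{dt}\Big(\int_{\mathcal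 G}\mathbf 1_{x\in J_i\setminus\{0\}}\phi(x,\cdot)\,m(\cdot)(dx)\Big)=\phi(0,\cdot)\,q_i+\int_{\mathcal G}\mathbf 1_{x\in J_i\setminus\{0\}}\big[\partial_t\phi(x,\cdot)-\partial_pH(x,D_xu(x,\cdot),\cdot)D_x\phi(x,\cdot)\big]m(\cdot)(dx),$$ and $$\frac{d}{dt}\Big[\int_{\mathcal G}\phi(x,\cdot)\,m(\cdot)(dx)\Big]=m(\cdot)(\{0\})\,\partial_t\phi(0,\cdot)+\sum_{i=1}^N\int_{\mathcal G}\mathbf 1_{x\in J_i\setminus\{0\}}\big[\partial_t\phi(x,\cdot)-\partial_pH(x,D_xu(x,\cdot),\cdot)D_x\phi(x,\cdot)\big]m(\cdot)(dx),$$ $$\frac{d}{dt}\big[m(\cdot)(\{0\})\big]+\sum_{i=1}^Nq_i=0.$$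
   Context: Junction: $N>1$ is an integer, $(e_i)$ is the canonical basis of $\mathbb R^N$, $\mathbb R_+=[0,\infty)$, $J_i=\mathbb R_+e_i$, $\mathcal G=\bigcup_{i=1}^N J_i\subset\mathbb R^N$, vertex $0$; $d(x,y)=|x-y|$ if $x,y$ lie in the same edge, $d(x,y)=|x|+|y|$ otherwise. Fix $T>0$, $p>1$. $\mathcal D'(0,T)$ is the space of distributions on $(0,T)$. $C^\infty(\mathcal G)$ (resp. $C^\infty(\mathcal G\times[0,T])$) is the set of continuous functions whose restriction to each edge $J_i$ (resp. $J_i\times[0,T]$) is $C^\infty$. For $x\in J_i\setminus\{0\}$, $D_x$ denotes the derivative with respect to the coordinate $|x|$ along $J_i$. Trajectories: $\Gamma_t[x]$ is the set of $y\in C([t,T];\mathcal G)\cap W^{1,p}(t,T;\mathbb R^N)$ with $y(t)=x$; $\Gamma[x]=\Gamma_0[x]$; $\Gamma=\bigcup_x\Gamma[x]$; $\bar y=|y|$. For $C,V>0$: $\Gamma_C[x]=\{y\in\Gamma[x]:\|y\|_{L^\infty(0,T)}\le C,\ \|y'\|_{L^p(0,T)}\le C\}$, $\Gamma_C=\bigcup_x\Gamma_C[x]$, $\Gamma^{\rm Lip}_{C,V}=\{y\in\Gamma_C:\|y'\|_{L^\infty(0,T)}\le V\}$, with the topology of uniform convergence. Measures: $\mathcal P(X)$ is the set of Borel probability measures on $X$; $\mathcal P_1(\mathcal G)$ is the set of those on $\mathcal G$ with finite first moment, with the Kantorovich–Rubinstein distance $d_1$. $m^\mu(t)=e_t\sharp\mu$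 with $e_t(y)=y(t)$. $\mathcal P_{m_0}(\Gamma_C)$ (resp. $\mathcal P_{m_0}(\Gamma^{\rm Lip}_{C,V})$) is the set of $\mu\in\mathcal P(\Gamma_C)$ (resp. $\mathcal P(\Gamma^{\rm Lip}_{C,V})$) with $e_0\sharp\mu=m_0$; measures on $\Gamma^{\rm Lip}_{C,V}$ are also viewed as measures on $\Gamma_C$ and on $\Gamma$. Costs: $m\mapsto L_i[m]$ is continuous from $\mathcal P_1(\mathcal G)$ to $C^1(\mathbb R_+\times\mathbb R)$ (functions of $(x,a)$; $C^1$ convergence on compact sets), $G_i\in C_b(\mathcal P_1(\mathcal G);C_b(\mathbb R_+))$, $L_*,G_*\in C_b(\mathcal P_1(\mathcal G);\mathbb R)$, where $C_b$ denotes bounded continuous functions. Standing assumptions: (1) there is $C_0>0$ with $L_i[m](x,a)\ge C_0(|a|^p-1)$ and $L_*[m]\ge-C_0$ for all $i,m,x,a$; (2) for any $r>0$ there is a modulus $\omega_r$ with $|L_i[m_1](x,a)-L_i[m_2](x,a)|\le(1+|a|^p)\omega_r(d_1(m_1,m_2))$ for all $i$, $m_1,m_2\in\mathcal P_1(\mathcal G)$, $x\in[0,r]$, $a\in\mathbb R$; (3) for any $r>0$ there is $\tilde c(r)\ge0$ with $|\partial_xL_i[m](x,a)|\le\tilde c(r)(|a|^p+1)$ and $|\partial_aL_i[m](x,a)|\le\tilde c(r)(|a|^{p-1}+1)$ for all $i,m$, $x\in[0,r]$, $a\in\mathbb R$; (4) $a\mapsto L_i[m](x,a)$ is strictly convex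 for all $i$, $m$, $x\in\mathbb R_+$. $L_0[m]=\min\{L_*[m],\min_iL_i[m](0,0)\}$; $L[m](y(t),y'(t))=\sum_iL_i[m](\bar y(t),\bar y'(t))\mathbf 1_{y(t)\in J_i\setminus\{0\}}+L_0[m]\mathbf 1_{y(t)=0}$; $G[m](x)=\sum_iG_i[m](|x|)\mathbf 1_{x\in J_i\setminus\{0\}}+\min\{G_*[m],\min_iG_i[m](0)\}\mathbf 1_{x=0}$; $J_t^\mu(x;y)=\int_t^TL[m^\mu(\tau)](y(\tau),y'(\tau))\,d\tau+G[m^\mu(T)](y(T))$ for $y\in\Gamma_t[x]$. Relaxed equilibrium: $\mu\in\mathcal P_{m_0}(\Gamma_C)$ such that every $y\in\operatorname{supp}(\mu)$ belongs, for some $x\in\operatorname{supp}(m_0)$, to $\{y\in\Gamma_C[x]:J_0^\mu(x;y)=\min_{\tilde y\in\Gamma[x]}J_0^\mu(x;\tilde y)\}$. The related mild solution is $(u,m)$ with $m(t)=m^\mu(t)$, $u(x,t)=\inf_{y\in\Gamma_t[x]}J_t^\mu(x;y)$. Hamiltonian: $H_i(r,q,t)=\sup_{\zeta\in\mathbb R}\{-q\zeta-L_i[m(t)](r,\zeta)\}$ for $r\in\mathbb R_+$, $q\in\mathbb R$; for $x\in J_i\setminus\{0\}$, $H(x,q,t)=H_i(|x|,q,t)$ and $\partial_pH$ is its derivative in $q$. (For $t\in(0,T)$, $u$ is differentiable at $(x,t)$ for all $x\in\operatorname{supp}(m(t))\setminus\{0\}$, so that $D_xu(x,t)$ is defined for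 $m(t)$-a.e. $x\ne0$.) *)

theory Defs
  imports "HOL-Analysis.Analysis" "HOL-Probability.Essential_Supremum" "HOL-Probability.Probability_Measure"
begin

section \<open>The junction\<close>

text \<open>
  The edges are indexed by the finite type \<^typ>\<open>'n\<close>, so that N is \<open>CARD('n)\<close> and the ambient space
  is \<open>real ^ 'n\<close> with its Euclidean norm.
\<close>

definition edge :: "'n::finite \<Rightarrow> (real ^ 'n) set" where
  "edge i = {r *\<^sub>R axis i 1 | r. 0 \<le> r}"

definition junction :: "(real ^ 'n::finite) set" where
  "junction = (\<Union>i. edge i)"

definition jdist :: "real ^ 'n::finite \<Rightarrow> real ^ 'n \<Rightarrow> real" where
  "jdist x y = (if \<exists>i. x \<in> edge i \<and> y \<in> edge i then norm (x - y) else norm x + norm y)"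

text \<open>
  Derivative along an edge with respect to the coordinate \<open>\<bar>x\<bar>\<close>. It only uses values of
  \<open>f\<close> on the edge; away from the vertex it is the usual two-sided derivative.
\<close>

definition edge_deriv :: "'n::finite \<Rightarrow> (real ^ 'n \<Rightarrow> real) \<Rightarrow> real ^ 'n \<Rightarrow> real" where
  "edge_deriv i f x = vector_derivative (\<lambda>r. f (r *\<^sub>R axis i 1)) (at (norm x) within {0..})"

text \<open>The junction is closed, so the closure may be taken in the ambient space.\<close>

definition jsupp :: "(real ^ 'n::finite \<Rightarrow> real) \<Rightarrow> (real ^ 'n) set" where
  "jsupp f = closure {x \<in> junction. f x \<noteq> 0}"

section \<open>Smooth functions\<close>

text \<open>
  Smoothness up to the boundary: \<open>D k\<close> is the \<open>k\<close>-th derivative (one-sided at the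
  boundary points of \<open>S\<close>), respectively \<open>D j k\<close> is the mixed partial derivative of order
  \<open>j\<close> in the first and \<open>k\<close> in the second variable.
\<close>

definition smooth_on :: "real set \<Rightarrow> (real \<Rightarrow> real) \<Rightarrow> bool" where
  "smooth_on S f \<longleftrightarrow> (\<exists>D :: nat \<Rightarrow> real \<Rightarrow> real.
     (\<forall>s\<in>S. D 0 s = f s) \<and>
     (\<forall>k. \<forall>s\<in>S. (D k has_real_derivative D (Suc k) s) (at s within S)))"

definition smooth_on2 :: "real set \<Rightarrow> real set \<Rightarrow> (real \<Rightarrow> real \<Rightarrow> real) \<Rightarrow> bool" where
  "smooth_on2 R S f \<longleftrightarrow> (\<exists>D :: nat \<Rightarrow> nat \<Rightarrow> real \<Rightarrow> real \<Rightarrow> real.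
     (\<forall>r\<in>R. \<forall>s\<in>S. D 0 0 r s = f r s) \<and>
     (\<forall>j k. continuous_on (R \<times> S) (\<lambda>(r, s). D j k r s) \<and>
        (\<forall>r\<in>R. \<forall>s\<in>S.
           ((\<lambda>r'. D j k r' s) has_real_derivative D (Suc j) k r s) (at r within R) \<and>
           ((\<lambda>s'. D j k r s') has_real_derivative D j (Suc k) r s) (at s within S))))"

definition smooth_junction :: "(real ^ 'n::finite \<Rightarrow> real) \<Rightarrow> bool" where
  "smooth_junction f \<longleftrightarrow> continuous_on junction f \<and> (\<forall>i. smooth_on {0..} (\<lambda>r. f (r *\<^sub>R axis i 1)))"

definition smooth_junction_time :: "real \<Rightarrow> (real ^ 'n::finite \<Rightarrow> real \<Rightarrow> real) \<Rightarrow> bool" where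
  "smooth_junction_time T f \<longleftrightarrow>
     continuous_on (junction \<times> {0..T}) (\<lambda>(x, t). f x t) \<and>
     (\<forall>i. smooth_on2 {0..} {0..T} (\<lambda>r t. f (r *\<^sub>R axis i 1) t))"

section \<open>Distributions on an open interval\<close>

definition test_fun :: "real \<Rightarrow> real \<Rightarrow> (real \<Rightarrow> real) set" where
  "test_fun a b = {\<eta>. smooth_on UNIV \<eta> \<and>
     compact (closure {s. \<eta> s \<noteq> 0}) \<and> closure {s. \<eta> s \<noteq> 0} \<subseteq> {a<..<b}}"

definition distribution :: "real \<Rightarrow> real \<Rightarrow> ((real \<Rightarrow> real) \<Rightarrow> real) \<Rightarrow> bool" where
  "distribution a b q \<longleftrightarrow>
     (\<forall>\<eta>\<in>test_fun a b. \<forall>\<theta>\<in>test_fun a b. \<forall>c d.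
        q (\<lambda>s. c * \<eta> s + d * \<theta> s) = c * q \<eta> + d * q \<theta>) \<and>
     (\<forall>K. compact K \<and> K \<subseteq> {a<..<b} \<longrightarrow>
        (\<exists>B n. \<forall>\<eta>\<in>test_fun a b. closure {s. \<eta> s \<noteq> 0} \<subseteq> K \<longrightarrow>
           \<bar>q \<eta>\<bar> \<le> B * (\<Sum>k\<le>n. SUP s. \<bar>(deriv ^^ k) \<eta> s\<bar>)))"

definition loc_integrable :: "real \<Rightarrow> real \<Rightarrow> (real \<Rightarrow> 'a::euclidean_space) \<Rightarrow> bool" where
  "loc_integrable a b f \<longleftrightarrow> f \<in> borel_measurable (lebesgue_on {a<..<b}) \<and>
     (\<forall>K. compact K \<and> K \<subseteq> {a<..<b} \<longrightarrow> set_integrable lebesgue K f)"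

definition dist_of_fun :: "real \<Rightarrow> real \<Rightarrow> (real \<Rightarrow> real) \<Rightarrow> (real \<Rightarrow> real) \<Rightarrow> real" where
  "dist_of_fun a b f \<eta> = (LINT s:{a<..<b}|lebesgue. f s * \<eta> s)"

definition dist_deriv :: "((real \<Rightarrow> real) \<Rightarrow> real) \<Rightarrow> (real \<Rightarrow> real) \<Rightarrow> real" where
  "dist_deriv q \<eta> = - q (deriv \<eta>)"

definition dist_mult :: "(real \<Rightarrow> real) \<Rightarrow> ((real \<Rightarrow> real) \<Rightarrow> real) \<Rightarrow> (real \<Rightarrow> real) \<Rightarrow> real" where
  "dist_mult f q \<eta> = q (\<lambda>s. f s * \<eta> s)"

section \<open>Sobolev functions\<close>

definition Lp_fun :: "real \<Rightarrow> real \<Rightarrow> real \<Rightarrow> (real \<Rightarrow> 'a::euclidean_space) \<Rightarrow> bool" where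
  "Lp_fun a b p f \<longleftrightarrow> f \<in> borel_measurable (lebesgue_on {a<..<b}) \<and>
     integrable (lebesgue_on {a<..<b}) (\<lambda>s. norm (f s) powr p)"

definition Lp_norm :: "real \<Rightarrow> real \<Rightarrow> real \<Rightarrow> (real \<Rightarrow> 'a::euclidean_space) \<Rightarrow> real" where
  "Lp_norm a b p f = (LINT s|lebesgue_on {a<..<b}. norm (f s) powr p) powr (1 / p)"

definition Linf_norm :: "real \<Rightarrow> real \<Rightarrow> (real \<Rightarrow> 'a::euclidean_space) \<Rightarrow> ereal" where
  "Linf_norm a b f = esssup (lebesgue_on {a<..<b}) (\<lambda>s. ereal (norm (f s)))"

definition is_weak_deriv ::
    "real \<Rightarrow> real \<Rightarrow> (real \<Rightarrow> 'a::euclidean_space) \<Rightarrow> (real \<Rightarrow> 'a) \<Rightarrow> bool" where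
  "is_weak_deriv a b f g \<longleftrightarrow> loc_integrable a b g \<and>
     (\<forall>\<eta>\<in>test_fun a b.
        (LINT s:{a<..<b}|lebesgue. deriv \<eta> s *\<^sub>R f s) = - (LINT s:{a<..<b}|lebesgue. \<eta> s *\<^sub>R g s))"

text \<open>The weak derivative is unique up to a null set; the choice below fixes one representative.\<close>

definition weak_deriv :: "real \<Rightarrow> real \<Rightarrow> (real \<Rightarrow> 'a::euclidean_space) \<Rightarrow> real \<Rightarrow> 'a" where
  "weak_deriv a b f = (SOME g. is_weak_deriv a b f g)"

definition sobolev_W1 :: "real \<Rightarrow> real \<Rightarrow> real \<Rightarrow> (real \<Rightarrow> 'a::euclidean_space) \<Rightarrow> bool" where
  "sobolev_W1 a b p f \<longleftrightarrow> Lp_fun a b p f \<and> (\<exists>g. Lp_fun a b p g \<and> is_weak_deriv a b f g)"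

section \<open>Trajectories\<close>

text \<open>
  A continuous curve on \<open>[t, T]\<close> is identified with its extension to the real line that is constant
  on both sides of the interval. This embeds the curves on \<open>[t, T]\<close> isometrically into the bounded
  continuous functions with the supremum distance, whose topology and Borel sets are used.
\<close>

definition Gamma_from :: "real \<Rightarrow> real \<Rightarrow> real \<Rightarrow> real ^ 'n::finite \<Rightarrow> (real \<Rightarrow>\<^sub>C (real ^ 'n)) set" where
  "Gamma_from T p t x = {y.
     (\<forall>s\<le>t. apply_bcontfun y s = apply_bcontfun y t) \<and>
     (\<forall>s\<ge>T. apply_bcontfun y s = apply_bcontfun y T) \<and>
     (\<forall>s\<in>{t..T}. apply_bcontfun y s \<in> junction) \<and>
     sobolev_W1 t T p (apply_bcontfun y) \<and>
     apply_bcontfun y t = x}"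

definition Gamma_all :: "real \<Rightarrow> real \<Rightarrow> (real \<Rightarrow>\<^sub>C (real ^ 'n::finite)) set" where
  "Gamma_all T p = (\<Union>x\<in>junction. Gamma_from T p 0 x)"

definition Gamma_C_at :: "real \<Rightarrow> real \<Rightarrow> real \<Rightarrow> real ^ 'n::finite \<Rightarrow> (real \<Rightarrow>\<^sub>C (real ^ 'n)) set" where
  "Gamma_C_at T p C x = {y \<in> Gamma_from T p 0 x.
     Linf_norm 0 T (apply_bcontfun y) \<le> ereal C \<and>
     Lp_norm 0 T p (weak_deriv 0 T (apply_bcontfun y)) \<le> C}"

definition Gamma_C :: "real \<Rightarrow> real \<Rightarrow> real \<Rightarrow> (real \<Rightarrow>\<^sub>C (real ^ 'n::finite)) set" where
  "Gamma_C T p C = (\<Union>x\<in>junction. Gamma_C_at T p C x)"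

definition Gamma_Lip :: "real \<Rightarrow> real \<Rightarrow> real \<Rightarrow> real \<Rightarrow> (real \<Rightarrow>\<^sub>C (real ^ 'n::finite)) set" where
  "Gamma_Lip T p C V = {y \<in> Gamma_C T p C.
     Linf_norm 0 T (weak_deriv 0 T (apply_bcontfun y)) \<le> ereal V}"

section \<open>Measures\<close>

definition borel_prob_on :: "'a::topological_space set \<Rightarrow> 'a measure set" where
  "borel_prob_on X = {M. prob_space M \<and> sets M = sets (restrict_space borel X)}"

definition measure_supp :: "'a::topological_space measure \<Rightarrow> 'a set" where
  "measure_supp M = {x \<in> space M. \<forall>U. open U \<and> x \<in> U \<longrightarrow> 0 < emeasure M (U \<inter> space M)}"

text \<open>A measure on a subspace of \<open>X\<close>, viewed as a measure on \<open>X\<close>.\<close>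

definition view_on :: "'a::topological_space set \<Rightarrow> 'a measure \<Rightarrow> 'a measure" where
  "view_on X M = distr M (restrict_space borel X) (\<lambda>y. y)"

definition P1 :: "(real ^ 'n::finite) measure set" where
  "P1 = {m \<in> borel_prob_on junction. integrable m (\<lambda>x. jdist x 0)}"

definition kr_dist :: "(real ^ 'n::finite) measure \<Rightarrow> (real ^ 'n) measure \<Rightarrow> real" where
  "kr_dist m1 m2 = (SUP f\<in>{f. \<forall>x\<in>junction. \<forall>y\<in>junction. \<bar>f x - f y\<bar> \<le> jdist x y}.
     (LINT x|m1. f x) - (LINT x|m2. f x))"

definition push_eval ::
    "(real \<Rightarrow>\<^sub>C (real ^ 'n::finite)) measure \<Rightarrow> real \<Rightarrow> (real ^ 'n) measure" where
  "push_eval \<mu> t = distr \<mu> (restrict_space borel junction) (\<lambda>y. apply_bcontfun y t)"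

definition prob_with_start ::
    "(real ^ 'n::finite) measure \<Rightarrow> (real \<Rightarrow>\<^sub>C (real ^ 'n)) set \<Rightarrow> (real \<Rightarrow>\<^sub>C (real ^ 'n)) measure set" where
  "prob_with_start m0 X = {\<mu> \<in> borel_prob_on X. push_eval \<mu> 0 = m0}"

section \<open>Costs\<close>

text \<open>
  Running costs have type \<open>'n \<Rightarrow> (real ^ 'n) measure \<Rightarrow> real \<Rightarrow> real \<Rightarrow> real\<close>, with arguments the edge,
  the measure, the position \<open>x \<ge> 0\<close> on the edge and the velocity \<open>a\<close>; only measures in \<^const>\<open>P1\<close>
  and positions \<open>x \<ge> 0\<close> matter.
\<close>

definition partial_x :: "(real \<Rightarrow> real \<Rightarrow> real) \<Rightarrow> real \<Rightarrow> real \<Rightarrow> real" where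
  "partial_x f x a = vector_derivative (\<lambda>r. f r a) (at x within {0..})"

definition partial_a :: "(real \<Rightarrow> real \<Rightarrow> real) \<Rightarrow> real \<Rightarrow> real \<Rightarrow> real" where
  "partial_a f x a = deriv (f x) a"

definition C1_halfplane :: "(real \<Rightarrow> real \<Rightarrow> real) \<Rightarrow> bool" where
  "C1_halfplane f \<longleftrightarrow>
     (\<forall>x\<ge>0. \<forall>a. (\<lambda>r. f r a) differentiable (at x within {0..}) \<and> f x differentiable (at a)) \<and>
     continuous_on ({0..} \<times> UNIV) (\<lambda>(x, a). f x a) \<and>
     continuous_on ({0..} \<times> UNIV) (\<lambda>(x, a). partial_x f x a) \<and>
     continuous_on ({0..} \<times> UNIV) (\<lambda>(x, a). partial_a f x a)"

definition C1_halfline :: "(real \<Rightarrow> real) \<Rightarrow> bool" where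
  "C1_halfline f \<longleftrightarrow>
     (\<forall>x\<ge>0. f differentiable (at x within {0..})) \<and>
     continuous_on {0..} (\<lambda>x. vector_derivative f (at x within {0..}))"

definition cont_P1_C1 :: "((real ^ 'n::finite) measure \<Rightarrow> real \<Rightarrow> real \<Rightarrow> real) \<Rightarrow> bool" where
  "cont_P1_C1 L \<longleftrightarrow> (\<forall>m\<in>P1. C1_halfplane (L m)) \<and>
     (\<forall>m\<in>P1. \<forall>R>0. \<forall>e>0. \<exists>\<delta>>0. \<forall>m'\<in>P1. kr_dist m m' < \<delta> \<longrightarrow>
        (\<forall>x\<in>{0..R}. \<forall>a\<in>{-R..R}.
           \<bar>L m' x a - L m x a\<bar> < e \<and>
           \<bar>partial_x (L m') x a - partial_x (L m) x a\<bar> < e \<and>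
           \<bar>partial_a (L m') x a - partial_a (L m) x a\<bar> < e))"

definition Cb_P1_Cb :: "((real ^ 'n::finite) measure \<Rightarrow> real \<Rightarrow> real) \<Rightarrow> bool" where
  "Cb_P1_Cb G \<longleftrightarrow> (\<forall>m\<in>P1. continuous_on {0..} (G m)) \<and>
     (\<exists>B. \<forall>m\<in>P1. \<forall>x\<ge>0. \<bar>G m x\<bar> \<le> B) \<and>
     (\<forall>m\<in>P1. \<forall>e>0. \<exists>\<delta>>0. \<forall>m'\<in>P1. kr_dist m m' < \<delta> \<longrightarrow> (\<forall>x\<ge>0. \<bar>G m' x - G m x\<bar> < e))"

definition Cb_P1 :: "((real ^ 'n::finite) measure \<Rightarrow> real) \<Rightarrow> bool" where
  "Cb_P1 F \<longleftrightarrow> (\<exists>B. \<forall>m\<in>P1. \<bar>F m\<bar> \<le> B) \<and>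
     (\<forall>m\<in>P1. \<forall>e>0. \<exists>\<delta>>0. \<forall>m'\<in>P1. kr_dist m m' < \<delta> \<longrightarrow> \<bar>F m' - F m\<bar> < e)"

definition modulus :: "(real \<Rightarrow> real) \<Rightarrow> bool" where
  "modulus \<omega> \<longleftrightarrow> mono_on {0..} \<omega> \<and> \<omega> 0 = 0 \<and> (\<omega> \<longlongrightarrow> 0) (at_right 0)"

definition strictly_convex :: "(real \<Rightarrow> real) \<Rightarrow> bool" where
  "strictly_convex f \<longleftrightarrow>
     (\<forall>a b s. a \<noteq> b \<and> 0 < s \<and> s < 1 \<longrightarrow> f ((1 - s) * a + s * b) < (1 - s) * f a + s * f b)"

definition standing_assumptions ::
    "real \<Rightarrow> ('n::finite \<Rightarrow> (real ^ 'n) measure \<Rightarrow> real \<Rightarrow> real \<Rightarrow> real) \<Rightarrow> ((real ^ 'n) measure \<Rightarrow> real) \<Rightarrow>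
     ('n \<Rightarrow> (real ^ 'n) measure \<Rightarrow> real \<Rightarrow> real) \<Rightarrow> ((real ^ 'n) measure \<Rightarrow> real) \<Rightarrow> bool" where
  "standing_assumptions p L Lstar G Gstar \<longleftrightarrow>
     (\<forall>i. cont_P1_C1 (L i)) \<and> (\<forall>i. Cb_P1_Cb (G i)) \<and> Cb_P1 Lstar \<and> Cb_P1 Gstar \<and>
     (\<exists>C0>0. \<forall>m\<in>P1. Lstar m \<ge> - C0 \<and>
        (\<forall>i. \<forall>x\<ge>0. \<forall>a. L i m x a \<ge> C0 * (\<bar>a\<bar> powr p - 1))) \<and>
     (\<forall>r>0. \<exists>\<omega>. modulus \<omega> \<and>
        (\<forall>i. \<forall>m1\<in>P1. \<forall>m2\<in>P1. \<forall>x\<in>{0..r}. \<forall>a.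
           \<bar>L i m1 x a - L i m2 x a\<bar> \<le> (1 + \<bar>a\<bar> powr p) * \<omega> (kr_dist m1 m2))) \<and>
     (\<forall>r>0. \<exists>c\<ge>0. \<forall>i. \<forall>m\<in>P1. \<forall>x\<in>{0..r}. \<forall>a.
        \<bar>partial_x (L i m) x a\<bar> \<le> c * (\<bar>a\<bar> powr p + 1) \<and>
        \<bar>partial_a (L i m) x a\<bar> \<le> c * (\<bar>a\<bar> powr (p - 1) + 1)) \<and>
     (\<forall>i. \<forall>m\<in>P1. \<forall>x\<ge>0. strictly_convex (L i m x))"

definition vertex_cost ::
    "('n::finite \<Rightarrow> (real ^ 'n) measure \<Rightarrow> real \<Rightarrow> real \<Rightarrow> real) \<Rightarrow> ((real ^ 'n) measure \<Rightarrow> real) \<Rightarrow>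
     (real ^ 'n) measure \<Rightarrow> real" where
  "vertex_cost L Lstar m = min (Lstar m) (Min (range (\<lambda>i. L i m 0 0)))"

text \<open>
  \<open>y\<close> is the position and \<open>v\<close> the derivative of \<open>\<bar>y\<bar>\<close> at the same time.
\<close>

definition running_cost ::
    "('n::finite \<Rightarrow> (real ^ 'n) measure \<Rightarrow> real \<Rightarrow> real \<Rightarrow> real) \<Rightarrow> ((real ^ 'n) measure \<Rightarrow> real) \<Rightarrow>
     (real ^ 'n) measure \<Rightarrow> real ^ 'n \<Rightarrow> real \<Rightarrow> real" where
  "running_cost L Lstar m y v =
     (\<Sum>i\<in>UNIV. L i m (norm y) v * indicator (edge i - {0}) y) + vertex_cost L Lstar m * indicator {0} y"

definition terminal_cost ::
    "('n::finite \<Rightarrow> (real ^ 'n) measure \<Rightarrow> real \<Rightarrow> real) \<Rightarrow> ((real ^ 'n) measure \<Rightarrow> real) \<Rightarrow>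
     (real ^ 'n) measure \<Rightarrow> real ^ 'n \<Rightarrow> real" where
  "terminal_cost G Gstar m x =
     (\<Sum>i\<in>UNIV. G i m (norm x) * indicator (edge i - {0}) x) +
     min (Gstar m) (Min (range (\<lambda>i. G i m 0))) * indicator {0} x"

definition total_cost ::
    "real \<Rightarrow> ('n::finite \<Rightarrow> (real ^ 'n) measure \<Rightarrow> real \<Rightarrow> real \<Rightarrow> real) \<Rightarrow> ((real ^ 'n) measure \<Rightarrow> real) \<Rightarrow>
     ('n \<Rightarrow> (real ^ 'n) measure \<Rightarrow> real \<Rightarrow> real) \<Rightarrow> ((real ^ 'n) measure \<Rightarrow> real) \<Rightarrow>
     (real \<Rightarrow>\<^sub>C (real ^ 'n)) measure \<Rightarrow> real \<Rightarrow> (real \<Rightarrow>\<^sub>C (real ^ 'n)) \<Rightarrow> real" where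
  "total_cost T L Lstar G Gstar \<mu> t y =
     (LINT \<tau>:{t<..<T}|lebesgue.
        running_cost L Lstar (push_eval \<mu> \<tau>) (apply_bcontfun y \<tau>)
          (weak_deriv t T (\<lambda>s. norm (apply_bcontfun y s)) \<tau>)) +
     terminal_cost G Gstar (push_eval \<mu> T) (apply_bcontfun y T)"

section \<open>Relaxed equilibria and mild solutions\<close>

definition relaxed_equilibrium ::
    "real \<Rightarrow> real \<Rightarrow> real \<Rightarrow> ('n::finite \<Rightarrow> (real ^ 'n) measure \<Rightarrow> real \<Rightarrow> real \<Rightarrow> real) \<Rightarrow>
     ((real ^ 'n) measure \<Rightarrow> real) \<Rightarrow> ('n \<Rightarrow> (real ^ 'n) measure \<Rightarrow> real \<Rightarrow> real) \<Rightarrow>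
     ((real ^ 'n) measure \<Rightarrow> real) \<Rightarrow> (real ^ 'n) measure \<Rightarrow> (real \<Rightarrow>\<^sub>C (real ^ 'n)) measure \<Rightarrow> bool" where
  "relaxed_equilibrium T p C L Lstar G Gstar m0 \<mu> \<longleftrightarrow>
     \<mu> \<in> prob_with_start m0 (Gamma_C T p C) \<and>
     (\<forall>y\<in>measure_supp \<mu>. \<exists>x\<in>measure_supp m0.
        y \<in> Gamma_C_at T p C x \<and>
        (\<forall>z\<in>Gamma_from T p 0 x.
           total_cost T L Lstar G Gstar \<mu> 0 y \<le> total_cost T L Lstar G Gstar \<mu> 0 z))"

definition mild_solution ::
    "real \<Rightarrow> real \<Rightarrow> ('n::finite \<Rightarrow> (real ^ 'n) measure \<Rightarrow> real \<Rightarrow> real \<Rightarrow> real) \<Rightarrow>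
     ((real ^ 'n) measure \<Rightarrow> real) \<Rightarrow> ('n \<Rightarrow> (real ^ 'n) measure \<Rightarrow> real \<Rightarrow> real) \<Rightarrow>
     ((real ^ 'n) measure \<Rightarrow> real) \<Rightarrow> (real \<Rightarrow>\<^sub>C (real ^ 'n)) measure \<Rightarrow>
     (real ^ 'n \<Rightarrow> real \<Rightarrow> real) \<Rightarrow> (real \<Rightarrow> (real ^ 'n) measure) \<Rightarrow> bool" where
  "mild_solution T p L Lstar G Gstar \<mu> u m \<longleftrightarrow>
     (\<forall>t\<in>{0..T}. m t = push_eval \<mu> t) \<and>
     (\<forall>x\<in>junction. \<forall>t\<in>{0..T}.
        u x t = (INF y\<in>Gamma_from T p t x. total_cost T L Lstar G Gstar \<mu> t y))"

definition hamiltonian ::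
    "('n::finite \<Rightarrow> (real ^ 'n) measure \<Rightarrow> real \<Rightarrow> real \<Rightarrow> real) \<Rightarrow> (real \<Rightarrow> (real ^ 'n) measure) \<Rightarrow>
     'n \<Rightarrow> real \<Rightarrow> real \<Rightarrow> real \<Rightarrow> real" where
  "hamiltonian L m i r q t = (SUP \<zeta>. - q * \<zeta> - L i (m t) r \<zeta>)"

text \<open>The drift coefficient \<open>\<partial>\<^sub>p H (x, D\<^sub>x u (x, t), t)\<close> at a point \<open>x\<close> of the edge \<open>i\<close>.\<close>

definition Hp ::
    "('n::finite \<Rightarrow> (real ^ 'n) measure \<Rightarrow> real \<Rightarrow> real \<Rightarrow> real) \<Rightarrow> (real \<Rightarrow> (real ^ 'n) measure) \<Rightarrow>
     (real ^ 'n \<Rightarrow> real \<Rightarrow> real) \<Rightarrow> 'n \<Rightarrow> real ^ 'n \<Rightarrow> real \<Rightarrow> real" where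
  "Hp L m u i x t =
     deriv (\<lambda>q. hamiltonian L m i (norm x) q t) (edge_deriv i (\<lambda>z. u z t) x)"

text \<open>
  The function \<open>t \<mapsto> \<integral> F t x m(t)(dx)\<close> is well defined for almost every \<open>t\<close> and defines a
  distribution. Without this, integrals that do not exist would silently be zero.
\<close>

definition slice_integrable ::
    "real \<Rightarrow> (real \<Rightarrow> 'a measure) \<Rightarrow> (real \<Rightarrow> 'a \<Rightarrow> real) \<Rightarrow> bool" where
  "slice_integrable T m F \<longleftrightarrow>
     (AE t in lebesgue_on {0<..<T}. integrable (m t) (F t)) \<and>
     loc_integrable 0 T (\<lambda>t. LINT x|m t. F t x)"

definition cutoff :: "'n::finite \<Rightarrow> (real ^ 'n \<Rightarrow> real) \<Rightarrow> bool" where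
  "cutoff i \<psi> \<longleftrightarrow> smooth_junction \<psi> \<and> jsupp \<psi> \<subseteq> edge i - {0} \<and>
     (\<forall>x\<in>edge i. jdist x 0 \<ge> 1 \<longrightarrow> \<psi> x = 1) \<and>
     (\<forall>x\<in>edge i. \<forall>y\<in>edge i. jdist x 0 \<le> jdist y 0 \<longrightarrow> \<psi> x \<le> \<psi> y)"

end

theory Submission
  imports Defs
begin

text \<open>
  Write \<open>q\<^sub>i\<close> for the distributional derivative of \<open>m(t)(J\<^sub>i - {0})\<close>. Almost every curve \<open>\<gamma>\<close> of the
  equilibrium minimises the cost. Inside an edge the Euler-Lagrange equation makes \<open>\<partial>\<^sub>a L(\<gamma>, \<gamma>')\<close>
  absolutely continuous, and strict convexity turns this into continuity of \<open>\<gamma>'\<close>. Competitors that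
  reach, or start from, points close to \<open>\<gamma>(t)\<close> show that \<open>u(\<cdot>, t)\<close> is differentiable at \<open>\<gamma>(t)\<close>
  with derivative \<open>- \<partial>\<^sub>a L(\<gamma>, \<gamma>')\<close>, so that \<open>\<gamma>' = - \<partial>\<^sub>p H(\<gamma>, D\<^sub>x u, t)\<close> by Legendre duality.

  The coordinate \<open>w\<close> of \<open>\<gamma>\<close> on the edge \<open>i\<close> is Lipschitz and \<open>w' = 0\<close> almost everywhere on
  \<open>{w = 0}\<close>. Hence \<open>\<Phi>(w(t), t) - \<Phi>(0, t)\<close> is absolutely continuous for smooth \<open>\<Phi>\<close>, also when \<open>\<gamma>\<close>
  visits the vertex infinitely often, and its derivative only charges the times with \<open>w > 0\<close>.
  Testing against \<open>\<eta>\<close> and averaging over the equilibrium gives the balance on each edge. For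
  \<open>\<Phi> = \<psi>\<^sub>\<epsilon>\<close>, which vanishes at the vertex and tends to the indicator of \<open>w > 0\<close>, it gives the limit
  of point 1.
\<close>

section \<open>Smooth step functions\<close>

text \<open>Weak derivatives are chosen representatives, fixed only up to null sets. Curves are
  therefore handled as pairs of a function and an integrable density (\<open>ac_on\<close>), and
  uniqueness of the density replaces pointwise differentiation theorems. Three obstacles shape the
  rest. The value function is known to be differentiable only at points of optimal curves, while the
  drift must be Borel on the whole open edge before it can be integrated against \<open>m t\<close>;
  continuity of the value function, obtained by rescaling curves, and a countable Cauchy criterion
  provide this. Optimality is given on the support of \<open>\<mu>\<close>, and full measure of the
  support is not automatic without separability; the common Lipschitz constant supplies it. Fubini
  needs joint measurability in time and curve, which chosen weak derivatives do not offer; hence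
  \<open>velocity\<close>, a limit of difference quotients. Integrals over an edge then become
  averages \<open>avg i A B\<close> over curves, and the single weak identity
  \<open>avg_weak\<close> yields both the limit of the cutoffs and the balance laws.\<close>

lemma smooth_onI_class:
  assumes X: "\<And>f. f \<in> X \<Longrightarrow> \<exists>g\<in>X. \<forall>s\<in>S. (f has_real_derivative g s) (at s within S)"
    and f: "f \<in> X"
  shows "smooth_on S f"
proof -
  obtain d where d: "\<And>f. f \<in> X \<Longrightarrow> d f \<in> X"
      "\<And>f s. f \<in> X \<Longrightarrow> s \<in> S \<Longrightarrow> (f has_real_derivative d f s) (at s within S)"
    using X by metis
  \<comment> \<open>Iterating a choice of derivative inside the class produces the whole tower, so a
    class closed under differentiation consists of smooth functions. All smoothness proofs below use
    this coinduction.\<close>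
  define D where "D k = (d ^^ k) f" for k
  have "D k \<in> X" for k
    by (induction k) (auto simp: D_def d f)
  then show ?thesis
    unfolding smooth_on_def by (intro exI[of _ D]) (auto simp: D_def d(2))
qed

lemma smooth_on_derivE:
  assumes "smooth_on S f"
  obtains f' where "smooth_on S f'" "\<And>s. s \<in> S \<Longrightarrow> (f has_real_derivative f' s) (at s within S)"
proof -
  from assms obtain D where D: "\<forall>s\<in>S. D 0 s = f s"
    "\<forall>k. \<forall>s\<in>S. (D k has_real_derivative D (Suc k) s) (at s within S)"
    unfolding smooth_on_def by blast
  have "smooth_on S (D 1)"
    unfolding smooth_on_def using D(2) by (intro exI[of _ "\<lambda>k. D (Suc k)"]) auto
  moreover have "(f has_real_derivative D 1 s) (at s within S)" if "s \<in> S" for s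
  proof -
    have "(D 0 has_real_derivative D 1 s) (at s within S)"
      using D(2) that by (metis One_nat_def)
    then show ?thesis
      by (rule has_field_derivative_transform_within[where d = 1]) (use D(1) that in auto)
  qed
  ultimately show ?thesis using that by blast
qed

lemma smooth_on_add:
  assumes "smooth_on S f" "smooth_on S g"
  shows "smooth_on S (\<lambda>x. f x + g x)"
proof (rule smooth_onI_class[where X = "{\<lambda>x. f x + g x | f g. smooth_on S f \<and> smooth_on S g}"])
  fix h assume "h \<in> {\<lambda>x. f x + g x | f g. smooth_on S f \<and> smooth_on S g}"
  then obtain f g where fg: "h = (\<lambda>x. f x + g x)" "smooth_on S f" "smooth_on S g" by blast
  obtain f' where f': "smooth_on S f'" "\<And>s. s \<in> S \<Longrightarrow> (f has_real_derivative f' s) (at s within S)"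
    using smooth_on_derivE[OF fg(2)] by blast
  obtain g' where g': "smooth_on S g'" "\<And>s. s \<in> S \<Longrightarrow> (g has_real_derivative g' s) (at s within S)"
    using smooth_on_derivE[OF fg(3)] by blast
  show "\<exists>k\<in>{\<lambda>x. f x + g x | f g. smooth_on S f \<and> smooth_on S g}.
      \<forall>s\<in>S. (h has_real_derivative k s) (at s within S)"
    using f' g' fg(1) by (intro bexI[of _ "\<lambda>x. f' x + g' x"]) (auto intro!: DERIV_add)
qed (use assms in blast)

lemma smooth_on_affine:
  assumes "smooth_on UNIV f"
  shows "smooth_on UNIV (\<lambda>x. k * f (c * x + d))"
proof -
  from assms obtain D where D: "\<forall>s. D 0 s = f s"
    "\<And>k s. (D k has_real_derivative D (Suc k) s) (at s)"
    unfolding smooth_on_def by auto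
  show ?thesis
    unfolding smooth_on_def
  proof (intro exI[of _ "\<lambda>j x. k * c ^ j * D j (c * x + d)"] conjI allI ballI)
    fix j and s :: real
    have "((\<lambda>x. D j (c * x + d)) has_real_derivative D (Suc j) (c * s + d) * c) (at s)"
      by (rule DERIV_chain2[OF D(2)]) (auto intro!: derivative_eq_intros)
    then have "((\<lambda>x. k * c ^ j * D j (c * x + d)) has_real_derivative k * c ^ j * (D (Suc j) (c * s + d) * c)) (at s)"
      by (rule DERIV_cmult)
    then show "((\<lambda>x. k * c ^ j * D j (c * x + d)) has_real_derivative k * c ^ Suc j * D (Suc j) (c * s + d)) (at s)"
      by (simp add: mult_ac)
  qed (use D in auto)
qed

text \<open>Products alone are not stable under differentiation; by the Leibniz rule their finite
  sums are, which is what \<open>smooth_onI_class\<close> asks for.\<close>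

inductive_set sums_of_products :: "real set \<Rightarrow> (real \<Rightarrow> real) set" for S where
  prod: "smooth_on S f \<Longrightarrow> smooth_on S g \<Longrightarrow> (\<lambda>x. f x * g x) \<in> sums_of_products S"
| add: "f \<in> sums_of_products S \<Longrightarrow> g \<in> sums_of_products S \<Longrightarrow> (\<lambda>x. f x + g x) \<in> sums_of_products S"

lemma smooth_on_mult:
  assumes "smooth_on S f" "smooth_on S g"
  shows "smooth_on S (\<lambda>x. f x * g x)"
proof (rule smooth_onI_class[where X = "sums_of_products S"])
  fix h assume "h \<in> sums_of_products S"
  then show "\<exists>k\<in>sums_of_products S. \<forall>s\<in>S. (h has_real_derivative k s) (at s within S)"
  proof induction
    case (prod f g)
    obtain f' where f': "smooth_on S f'" "\<And>s. s \<in> S \<Longrightarrow> (f has_real_derivative f' s) (at s within S)"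
      using smooth_on_derivE[OF prod(1)] by blast
    obtain g' where g': "smooth_on S g'" "\<And>s. s \<in> S \<Longrightarrow> (g has_real_derivative g' s) (at s within S)"
      using smooth_on_derivE[OF prod(2)] by blast
    show ?case
    proof (intro bexI[of _ "\<lambda>x. f' x * g x + g' x * f x"] ballI)
      show "(\<lambda>x. f' x * g x + g' x * f x) \<in> sums_of_products S"
        using f' g' prod by (intro sums_of_products.intros) auto
    qed (use f' g' in \<open>auto intro!: DERIV_mult\<close>)
  next
    case (add f g)
    then obtain f' g' where "f' \<in> sums_of_products S" "g' \<in> sums_of_products S"
      "\<forall>s\<in>S. (f has_real_derivative f' s) (at s within S)"
      "\<forall>s\<in>S. (g has_real_derivative g' s) (at s within S)" by blast
    then show ?case
      by (intro bexI[of _ "\<lambda>x. f' x + g' x"]) (auto intro!: DERIV_add sums_of_products.add)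
  qed
qed (use assms in \<open>auto intro: sums_of_products.prod\<close>)

lemma poly_mult_exp_minus_tendsto_0:
  fixes p :: "real poly"
  shows "((\<lambda>y. poly p y * exp (- y)) \<longlongrightarrow> 0) at_top"
proof -
  have "((\<lambda>y::real. \<Sum>i\<le>degree p. coeff p i * (y ^ i / exp y)) \<longlongrightarrow> (\<Sum>i\<le>degree p. coeff p i * 0)) at_top"
    by (intro tendsto_sum tendsto_mult tendsto_const tendsto_power_div_exp_0)
  then show ?thesis
    by (simp add: poly_altdef sum_distrib_right sum_divide_distrib exp_minus field_simps)
qed

lemma smooth_on_exp_inverse:
  "smooth_on UNIV (\<lambda>x::real. if x > 0 then exp (- (1 / x)) else 0)"
proof (rule smooth_onI_class[where X = "range (\<lambda>p x. if x > 0 then poly p (1 / x) * exp (- (1 / x)) else 0)"])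
  fix f :: "real \<Rightarrow> real"
  assume "f \<in> range (\<lambda>p x. if x > 0 then poly p (1 / x) * exp (- (1 / x)) else 0)"
  then obtain p where f: "f = (\<lambda>x. if x > 0 then poly p (1 / x) * exp (- (1 / x)) else 0)" by blast
  \<comment> \<open>Differentiating p(1/x) exp(-1/x) gives (1/x)^2 (p - p')(1/x) exp(-1/x).\<close>
  define q where "q = [:0, 0, 1:] * (p - pderiv p)"
  define g where "g = (\<lambda>x::real. if x > 0 then poly q (1 / x) * exp (- (1 / x)) else 0)"
  have "(f has_real_derivative g x) (at x)" for x
  proof (cases x "0::real" rule: linorder_cases)
    case greater
    have "((\<lambda>x. poly p (1 / x) * exp (- (1 / x))) has_real_derivative
        poly (pderiv p) (1 / x) * (- (1 / x\<^sup>2)) * exp (- (1 / x)) + exp (- (1 / x)) * (1 / x\<^sup>2) * poly p (1 / x)) (at x)"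
      using greater
      by (auto intro!: derivative_eq_intros DERIV_chain2[OF poly_DERIV] simp: power2_eq_square field_simps)
    also have "poly (pderiv p) (1 / x) * (- (1 / x\<^sup>2)) * exp (- (1 / x)) + exp (- (1 / x)) * (1 / x\<^sup>2) * poly p (1 / x) = g x"
      using greater by (simp add: g_def q_def field_simps power2_eq_square)
    finally have "((\<lambda>x. poly p (1 / x) * exp (- (1 / x))) has_real_derivative g x) (at x)" .
    then show ?thesis
      by (rule has_field_derivative_transform_within_open[where S = "{0<..}"])
        (use greater in \<open>auto simp: f\<close>)
  next
    case less
    have "((\<lambda>x. 0) has_real_derivative g x) (at x)"
      using less by (simp add: g_def)
    then show ?thesis
      by (rule has_field_derivative_transform_within_open[where S = "{..<0}"])
        (use less in \<open>auto simp: f\<close>)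
  next
    case equal
    \<comment> \<open>With y = 1/h the right difference quotient at 0 is y p(y) exp(-y).\<close>
    have "((\<lambda>y. poly ([:0, 1:] * p) y * exp (- y)) \<longlongrightarrow> 0) at_top"
      by (rule poly_mult_exp_minus_tendsto_0)
    then have "((\<lambda>h. poly ([:0, 1:] * p) (inverse h) * exp (- inverse h)) \<longlongrightarrow> 0) (at_right 0)"
      by (subst filterlim_at_right_to_top) simp
    moreover have "\<forall>\<^sub>F h in at_right 0. poly ([:0, 1:] * p) (inverse h) * exp (- inverse h) = (f (0 + h) - f 0) / h"
      by (auto simp: eventually_at_filter f field_simps)
    ultimately have R: "((\<lambda>h. (f (0 + h) - f 0) / h) \<longlongrightarrow> 0) (at_right 0)"
      by (rule Lim_transform_eventually)
    have L: "((\<lambda>h. (f (0 + h) - f 0) / h) \<longlongrightarrow> 0) (at_left 0)"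
      by (rule tendsto_eventually) (auto simp: eventually_at_filter f)
    show ?thesis
      using R L unfolding equal DERIV_def filterlim_at_split by (simp add: g_def)
  qed
  then show "\<exists>g\<in>range (\<lambda>p x. if x > 0 then poly p (1 / x) * exp (- (1 / x)) else 0).
      \<forall>s\<in>UNIV. (f has_real_derivative g s) (at s)"
    by (intro bexI[of _ g]) (auto simp: g_def)
next
  show "(\<lambda>x::real. if x > 0 then exp (- (1 / x)) else 0) \<in>
      range (\<lambda>p x. if x > 0 then poly p (1 / x) * exp (- (1 / x)) else 0)"
    by (rule image_eqI[of _ _ 1]) auto
qed

text \<open>The bump E(x) E(1 - x), with E(x) = exp(-1/x) for x > 0 and 0 otherwise, is normalised
  to integral one and integrated. Its derivative \<open>\<beta>\<close> is returned as well, since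
  rescaled copies of it serve as mollifiers.\<close>

lemma smooth_step_exists:
  obtains \<sigma> \<beta> :: "real \<Rightarrow> real" where
    "smooth_on UNIV \<sigma>" "\<And>x. x \<le> 0 \<Longrightarrow> \<sigma> x = 0" "\<And>x. x \<ge> 1 \<Longrightarrow> \<sigma> x = 1"
    "\<And>x. 0 \<le> \<sigma> x" "\<And>x. \<sigma> x \<le> 1"
    "\<And>x. (\<sigma> has_real_derivative \<beta> x) (at x)" "\<And>x. 0 \<le> \<beta> x" "continuous_on UNIV \<beta>"
    "\<And>x. x \<le> 0 \<Longrightarrow> \<beta> x = 0" "\<And>x. x \<ge> 1 \<Longrightarrow> \<beta> x = 0"
proof -
  define E where "E = (\<lambda>x::real. if x > 0 then exp (- (1 / x)) else 0)"
  have sE: "smooth_on UNIV E" unfolding E_def by (rule smooth_on_exp_inverse)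
  define b where "b x = E x * E (1 - x)" for x
  have sb: "smooth_on UNIV b"
    using smooth_on_mult[OF sE smooth_on_affine[OF sE, of 1 "-1" 1]] by (simp add: b_def[abs_def])
  have b0: "0 \<le> b x" for x by (simp add: b_def E_def)
  have bz: "b x = 0" if "x \<le> 0 \<or> x \<ge> 1" for x using that by (auto simp: b_def E_def)
  have cont: "continuous_on UNIV f" if "smooth_on UNIV f" for f
    using smooth_on_derivE[OF that] by (metis DERIV_isCont continuous_at_imp_continuous_on UNIV_I)
  have cb: "continuous_on A b" for A using cont[OF sb] continuous_on_subset by blast
  define I where "I = integral {0..1} b"
  have I: "I > 0"
  proof (rule ccontr)
    assume "\<not> I > 0"
    moreover have "I \<ge> 0" unfolding I_def by (rule integral_nonneg) (auto intro: integrable_continuous_real cb b0)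
    ultimately have "I = 0" by simp
    then have "b (1/2) = 0"
      using integral_eq_0_iff[of 0 1 b] cb b0 unfolding I_def by auto
    then show False by (simp add: b_def E_def)
  qed
  define \<beta> where "\<beta> x = 1 / I * b (1 * x + 0)" for x
  have s\<beta>: "smooth_on UNIV \<beta>" unfolding \<beta>_def[abs_def] by (rule smooth_on_affine[OF sb])
  have c\<beta>: "continuous_on A \<beta>" for A using cont[OF s\<beta>] continuous_on_subset by blast
  have \<beta>0: "0 \<le> \<beta> x" for x using b0 I by (simp add: \<beta>_def)
  have \<beta>z: "\<beta> x = 0" if "x \<le> 0 \<or> x \<ge> 1" for x using bz that by (simp add: \<beta>_def)
  have \<beta>I: "integral {0..1} \<beta> = 1" using I by (simp add: \<beta>_def[abs_def] I_def)
  define \<sigma> where "\<sigma> x = integral {0..x} \<beta>" for x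
  have int: "\<beta> integrable_on {x..y}" for x y by (intro integrable_continuous_real c\<beta>)
  \<comment> \<open>The interval \<open>{0..x}\<close> degenerates for negative x. Starting at -n
    makes the fundamental theorem of calculus two-sided around 0 and changes nothing, because
    \<open>\<beta>\<close> vanishes on the negative axis.\<close>
  have \<sigma>_alt: "\<sigma> x = integral {-n..x} \<beta>" if "0 < n" for n x
  proof -
    have "\<sigma> x = integral {-n..x} (\<lambda>y. if y \<in> {0..x} then \<beta> y else 0)"
      unfolding \<sigma>_def using that by (intro integral_restrict_Int[symmetric, where S = "{0..x}" and T = "{-n..x}", THEN trans[rotated]]) (auto simp: inf_absorb1)
    also have "\<dots> = integral {-n..x} \<beta>"
      by (rule integral_cong) (use \<beta>z in auto)
    finally show ?thesis .
  qed
  have d\<sigma>: "(\<sigma> has_real_derivative \<beta> x) (at x)" for x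
  proof -
    define n where "n = \<bar>x\<bar> + 1"
    have "((\<lambda>x. integral {-n..x} \<beta>) has_real_derivative \<beta> x) (at x within {-n..n})"
      by (rule integral_has_real_derivative[OF c\<beta>]) (auto simp: n_def)
    then have "((\<lambda>x. integral {-n..x} \<beta>) has_real_derivative \<beta> x) (at x)"
      by (subst (asm) at_within_Icc_at) (auto simp: n_def)
    moreover have "0 < n" by (simp add: n_def)
    then have "(\<lambda>x. integral {-n..x} \<beta>) = \<sigma>" using \<sigma>_alt[of n] by (intro ext) simp
    ultimately show ?thesis by (simp only:)
  qed
  have \<sigma>0: "\<sigma> x = 0" if "x \<le> 0" for x
    using that by (cases "x = 0") (auto simp: \<sigma>_def)
  have \<sigma>1: "\<sigma> x = 1" if "x \<ge> 1" for x
  proof -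
    have "\<sigma> x = integral {0..1} \<beta> + integral {1..x} \<beta>"
      unfolding \<sigma>_def using that by (intro Henstock_Kurzweil_Integration.integral_combine[symmetric] int) simp_all
    also have "integral {1..x} \<beta> = integral {1..x} (\<lambda>_. 0)" by (rule integral_cong) (use \<beta>z in auto)
    finally show ?thesis by (simp add: \<beta>I)
  qed
  have mono: "\<sigma> x \<le> \<sigma> y" if "x \<le> y" for x y
    by (rule DERIV_nonneg_imp_nondecreasing[OF that]) (use d\<sigma> \<beta>0 in blast)
  have ge0: "0 \<le> \<sigma> x" for x using mono[of 0 x] \<sigma>0[of x] \<sigma>0[of 0] by (cases "x \<ge> 0") auto
  have le1: "\<sigma> x \<le> 1" for x using mono[of x 1] \<sigma>1[of x] \<sigma>1[of 1] by (cases "x \<ge> 1") auto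
  have s\<sigma>: "smooth_on UNIV \<sigma>"
  proof (rule smooth_onI_class[where X = "insert \<sigma> {f. smooth_on UNIV f}"])
    fix f assume "f \<in> insert \<sigma> {f. smooth_on UNIV f}"
    then consider "f = \<sigma>" | "smooth_on UNIV f" by blast
    then show "\<exists>g\<in>insert \<sigma> {f. smooth_on UNIV f}. \<forall>s\<in>UNIV. (f has_real_derivative g s) (at s)"
    proof cases
      case 1
      then show ?thesis using d\<sigma> s\<beta> by (intro bexI[of _ \<beta>]) simp_all
    next
      case 2
      obtain f' where "smooth_on UNIV f'" "\<And>s. s \<in> UNIV \<Longrightarrow> (f has_real_derivative f' s) (at s)"
        using smooth_on_derivE[OF 2] by metis
      then show ?thesis by (intro bexI[of _ f']) simp_all
    qed
  qed simp
  show ?thesis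
    by (rule that[OF s\<sigma> \<sigma>0 \<sigma>1 ge0 le1 d\<sigma> \<beta>0 c\<beta>]) (use \<beta>z in auto)
qed

section \<open>Increments of functions with a weak derivative\<close>

text \<open>A smooth stand-in for the indicator of [t, s]. Both steps rise within width \<delta>, so
  the difference lives in [t, s + \<delta>]; this is the origin of the bound
  \<open>s + \<delta> < b\<close>.\<close>

lemma test_fun_difference_of_steps:
  assumes \<sigma>: "smooth_on UNIV \<sigma>" "\<And>x. x \<le> 0 \<Longrightarrow> \<sigma> x = 0" "\<And>x. x \<ge> 1 \<Longrightarrow> \<sigma> x = 1"
    and ab: "a < t" "t \<le> s" "s + \<delta> < b" "0 < \<delta>"
  shows "(\<lambda>x. \<sigma> ((x - t) / \<delta>) - \<sigma> ((x - s) / \<delta>)) \<in> test_fun a b"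
proof -
  let ?\<eta> = "\<lambda>x. \<sigma> ((x - t) / \<delta>) - \<sigma> ((x - s) / \<delta>)"
  have "smooth_on UNIV (\<lambda>x. 1 * \<sigma> (1 / \<delta> * x + - t / \<delta>) + (-1) * \<sigma> (1 / \<delta> * x + - s / \<delta>))"
    by (intro smooth_on_add smooth_on_affine \<sigma>)
  then have sm: "smooth_on UNIV ?\<eta>" by (simp add: diff_divide_distrib)
  have "x \<in> {t..s + \<delta>}" if "?\<eta> x \<noteq> 0" for x
  proof (rule ccontr)
    assume "x \<notin> {t..s + \<delta>}"
    then consider "x < t" | "x > s + \<delta>" by fastforce
    then show False
    proof cases
      case 1
      then show False using that \<sigma>(2)[of "(x - t) / \<delta>"] \<sigma>(2)[of "(x - s) / \<delta>"] ab
        by (simp add: divide_simps)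
    next
      case 2
      then show False using that \<sigma>(3)[of "(x - t) / \<delta>"] \<sigma>(3)[of "(x - s) / \<delta>"] ab
        by (simp add: divide_simps)
    qed
  qed
  then have sub: "closure {x. ?\<eta> x \<noteq> 0} \<subseteq> {t..s + \<delta>}"
    by (intro closure_minimal) auto
  then have "compact (closure {x. ?\<eta> x \<noteq> 0})"
    using bounded_subset[OF bounded_closed_interval] by (auto simp: compact_eq_bounded_closed)
  then show ?thesis
    using sm sub ab unfolding test_fun_def by auto
qed

lemma set_integral_support:
  fixes f :: "real \<Rightarrow> 'b::euclidean_space"
  assumes "B \<subseteq> A" "\<And>x. x \<in> A \<Longrightarrow> x \<notin> B \<Longrightarrow> f x = 0"
  shows "(LINT x:A|M. f x) = (LINT x:B|M. f x)"
  unfolding set_lebesgue_integral_def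
  by (rule Bochner_Integration.integral_cong) (use assms in \<open>auto simp: indicator_def\<close>)

lemma set_integral_eq_integral_support:
  fixes f :: "real \<Rightarrow> 'b::euclidean_space"
  assumes "{c..d} \<subseteq> A" "\<And>x. x \<in> A \<Longrightarrow> x \<notin> {c..d} \<Longrightarrow> f x = 0"
    and "f absolutely_integrable_on {c..d}"
  shows "(LINT x:A|lebesgue. f x) = integral {c..d} f"
  using set_integral_support[of "{c..d}" A f lebesgue] assms set_lebesgue_integral_eq_integral(2)[OF assms(3)]
  by simp

text \<open>The derivative of a rescaled step is a nonnegative kernel of mass one supported in
  [t, t + d / (n + 1)]. It mollifies from the right, so only the values of f on [t, t + d]
  enter.\<close>

lemma integral_approximate_identity:
  fixes f :: "real \<Rightarrow> 'b::euclidean_space"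
  assumes \<sigma>: "\<And>x. x \<le> 0 \<Longrightarrow> \<sigma> x = 0" "\<And>x. x \<ge> 1 \<Longrightarrow> \<sigma> x = (1::real)"
    and d\<sigma>: "\<And>x. (\<sigma> has_real_derivative \<beta> x) (at x)" and \<beta>: "\<And>x. 0 \<le> \<beta> x" "continuous_on UNIV \<beta>"
    and \<beta>0: "\<And>x. x \<le> 0 \<Longrightarrow> \<beta> x = 0" "\<And>x. x \<ge> 1 \<Longrightarrow> \<beta> x = 0"
    and d: "0 < d" and f: "continuous_on {t..t + d} f" and A: "{t..t + d} \<subseteq> A"
  shows "(\<lambda>n. LINT x:A|lebesgue. (\<beta> ((x - t) / (d / Suc n)) / (d / Suc n)) *\<^sub>R f x) \<longlonglongrightarrow> f t"
proof (rule LIMSEQ_I)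
  fix r :: real assume "r > 0"
  have "continuous (at t within {t..t + d}) f" using f d by (simp add: continuous_on_eq_continuous_within)
  then obtain \<delta> where \<delta>: "\<delta> > 0" "\<And>x. x \<in> {t..t + d} \<Longrightarrow> dist x t < \<delta> \<Longrightarrow> dist (f x) (f t) < r / 2"
    unfolding continuous_within_eps_delta using \<open>r > 0\<close> by (meson half_gt_zero)
  obtain N :: nat where N: "d / \<delta> < N" using reals_Archimedean2 by blast
  show "\<exists>no. \<forall>n\<ge>no. norm ((LINT x:A|lebesgue. (\<beta> ((x - t) / (d / Suc n)) / (d / Suc n)) *\<^sub>R f x) - f t) < r"
  proof (intro exI allI impI)
    fix n assume "N \<le> n"
    define e where "e = d / Suc n"
    have e: "0 < e" "e \<le> d" using d by (auto simp: e_def divide_simps mult_le_cancel_left1)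
    have "d / \<delta> < Suc n" using N \<open>N \<le> n\<close> by linarith
    then have e\<delta>: "e < \<delta>" using \<delta>(1) by (simp add: e_def field_simps)
    define \<rho> where "\<rho> x = \<beta> ((x - t) / e) / e" for x
    have c\<rho>: "continuous_on S \<rho>" for S
      unfolding \<rho>_def[abs_def] using e
      by (intro continuous_intros continuous_on_compose2[OF \<beta>(2)]) auto
    have \<rho>0: "\<rho> x \<ge> 0" for x using \<beta> e by (simp add: \<rho>_def)
    have cf: "continuous_on {t..t + e} f" using f e by (auto intro: continuous_on_subset)
    have "((\<lambda>x. \<sigma> ((x - t) / e)) has_real_derivative \<rho> x) (at x)" for x
    proof -
      have "((\<lambda>x. (x - t) / e) has_real_derivative 1 / e) (at x)"
        using e by (auto intro!: derivative_eq_intros)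
      from DERIV_chain2[OF d\<sigma> this] show ?thesis by (simp add: \<rho>_def)
    qed
    then have "(\<rho> has_integral (\<sigma> ((t + e - t) / e) - \<sigma> ((t - t) / e))) {t..t + e}"
      using e by (intro fundamental_theorem_of_calculus)
        (auto simp: has_real_derivative_iff_has_vector_derivative[symmetric] intro: has_field_derivative_at_within)
    then have int1: "(\<rho> has_integral 1) {t..t + e}" using e \<sigma> by simp
    have "(LINT x:A|lebesgue. \<rho> x *\<^sub>R f x) = integral {t..t + e} (\<lambda>x. \<rho> x *\<^sub>R f x)"
    proof (rule set_integral_eq_integral_support)
      show "{t..t + e} \<subseteq> A" using A e by auto
      fix x assume "x \<in> A" "x \<notin> {t..t + e}"
      then have "(x - t) / e \<le> 0 \<or> (x - t) / e \<ge> 1" using e by (auto simp: divide_simps)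
      then show "\<rho> x *\<^sub>R f x = 0" using \<beta>0 by (auto simp: \<rho>_def)
    qed (intro absolutely_integrable_continuous_real continuous_intros c\<rho> cf)
    moreover have "integral {t..t + e} (\<lambda>x. \<rho> x *\<^sub>R f x) - f t = integral {t..t + e} (\<lambda>x. \<rho> x *\<^sub>R (f x - f t))"
    proof -
      have "((\<lambda>x. \<rho> x *\<^sub>R f x) has_integral integral {t..t + e} (\<lambda>x. \<rho> x *\<^sub>R f x)) {t..t + e}"
        by (intro integrable_integral integrable_continuous_real continuous_intros c\<rho> cf)
      from has_integral_diff[OF this has_integral_scaleR_left[OF int1, of "f t"]] show ?thesis
        by (simp add: scaleR_diff_right has_integral_iff)
    qed
    moreover have "norm (integral {t..t + e} (\<lambda>x. \<rho> x *\<^sub>R (f x - f t))) \<le> integral {t..t + e} (\<lambda>x. \<rho> x * (r / 2))"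
    proof (rule integral_norm_bound_integral)
      show "(\<lambda>x. \<rho> x *\<^sub>R (f x - f t)) integrable_on {t..t + e}"
        by (intro integrable_continuous_real continuous_intros c\<rho> cf)
      show "(\<lambda>x. \<rho> x * (r / 2)) integrable_on {t..t + e}"
        by (intro integrable_continuous_real continuous_intros c\<rho>)
      fix x assume "x \<in> {t..t + e}"
      then have "norm (f x - f t) \<le> r / 2"
        using \<delta>(2)[of x] e e\<delta> by (auto simp: dist_norm less_imp_le)
      then show "norm (\<rho> x *\<^sub>R (f x - f t)) \<le> \<rho> x * (r / 2)"
        using \<rho>0[of x] mult_left_mono[of "norm (f x - f t)" "r / 2" "\<rho> x"] by simp
    qed
    moreover have "integral {t..t + e} (\<lambda>x. \<rho> x * (r / 2)) = r / 2"
      using has_integral_mult_left[OF int1, of "r / 2"] by (simp add: has_integral_iff)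
    ultimately have "norm ((LINT x:A|lebesgue. \<rho> x *\<^sub>R f x) - f t) \<le> r / 2"
      by (simp only:)
    then have "norm ((LINT x:A|lebesgue. \<rho> x *\<^sub>R f x) - f t) < r"
      using \<open>r > 0\<close> by linarith
    then show "norm ((LINT x:A|lebesgue. (\<beta> ((x - t) / (d / Suc n)) / (d / Suc n)) *\<^sub>R f x) - f t) < r"
      unfolding \<rho>_def e_def .
  qed
qed

text \<open>Test functions approximating the indicator function of an interval recover the increments.\<close>

lemma weak_deriv_increment:
  fixes f :: "real \<Rightarrow> 'b::euclidean_space"
  assumes g: "is_weak_deriv a b f g" and f: "continuous_on {a<..<b} f" and ts: "a < t" "t \<le> s" "s < b"
  shows "g absolutely_integrable_on {t..s}" "f s = f t + integral {t..s} g"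
proof -
  have li: "set_integrable lebesgue K g" if "compact K" "K \<subseteq> {a<..<b}" for K
    using g that unfolding is_weak_deriv_def loc_integrable_def by blast
  show ai: "g absolutely_integrable_on {t..s}" by (rule li) (use ts in auto)
  obtain \<sigma> \<beta> :: "real \<Rightarrow> real" where \<sigma>: "smooth_on UNIV \<sigma>" "\<And>x. x \<le> 0 \<Longrightarrow> \<sigma> x = 0" "\<And>x. x \<ge> 1 \<Longrightarrow> \<sigma> x = 1"
    "\<And>x. 0 \<le> \<sigma> x" "\<And>x. \<sigma> x \<le> 1" and
    \<beta>: "\<And>x. (\<sigma> has_real_derivative \<beta> x) (at x)" "\<And>x. 0 \<le> \<beta> x" "continuous_on UNIV \<beta>"
    "\<And>x. x \<le> 0 \<Longrightarrow> \<beta> x = 0" "\<And>x. x \<ge> 1 \<Longrightarrow> \<beta> x = 0"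
    by (rule smooth_step_exists) blast
  \<comment> \<open>Room to the right of s, so that the test functions \<open>\<eta> n\<close>,
    supported in [t, s + e n], stay inside (a, b).\<close>
  define d where "d = (b - s) / 2"
  have d: "0 < d" "s + d < b" using ts by (auto simp: d_def field_simps)
  define e where "e n = d / Suc n" for n :: nat
  have e: "0 < e n" "e n \<le> d" for n using d by (auto simp: e_def divide_simps mult_le_cancel_left1)
  define \<eta> where "\<eta> n x = \<sigma> ((x - t) / e n) - \<sigma> ((x - s) / e n)" for n x
  define \<rho> where "\<rho> r n x = \<beta> ((x - r) / e n) / e n" for r n x
  have D\<eta>: "(\<eta> n has_real_derivative \<rho> t n x - \<rho> s n x) (at x)" for n x
  proof -
    have "((\<lambda>x. \<sigma> ((x - r) / e n)) has_real_derivative \<rho> r n x) (at x)" for r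
    proof -
      have "((\<lambda>x. (x - r) / e n) has_real_derivative 1 / e n) (at x)"
        using e[of n] by (auto intro!: derivative_eq_intros)
      from DERIV_chain2[OF \<beta>(1) this] show ?thesis by (simp add: \<rho>_def)
    qed
    then show ?thesis unfolding \<eta>_def[abs_def] by (intro DERIV_diff)
  qed
  then have D: "deriv (\<eta> n) x = \<rho> t n x - \<rho> s n x" for n x
    by (rule DERIV_imp_deriv)
  have test: "\<eta> n \<in> test_fun a b" for n
    unfolding \<eta>_def[abs_def] using e[of n] d ts by (intro test_fun_difference_of_steps \<sigma>) auto
  have eq: "(LINT x:{a<..<b}|lebesgue. \<rho> t n x *\<^sub>R f x) - (LINT x:{a<..<b}|lebesgue. \<rho> s n x *\<^sub>R f x)
      = - (LINT x:{a<..<b}|lebesgue. \<eta> n x *\<^sub>R g x)" for n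
  proof -
    have si: "set_integrable lebesgue {a<..<b} (\<lambda>x. \<rho> r n x *\<^sub>R f x)" if "r = t \<or> r = s" for r
    proof -
      have sub: "{r..r + e n} \<subseteq> {a<..<b}" using that ts d e[of n] by auto
      have "continuous_on {r..r + e n} (\<lambda>x. \<rho> r n x *\<^sub>R f x)"
        unfolding \<rho>_def using e[of n]
        by (intro continuous_intros continuous_on_compose2[OF \<beta>(3)] continuous_on_subset[OF f sub]) auto
      then have "set_integrable lebesgue {r..r + e n} (\<lambda>x. \<rho> r n x *\<^sub>R f x)"
        by (rule absolutely_integrable_continuous_real)
      then show ?thesis unfolding set_integrable_def
      proof (rule Bochner_Integration.integrable_cong[THEN iffD1, rotated -1])
        fix x
        have "\<rho> r n x = 0" if "x \<notin> {r..r + e n}"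
        proof -
          have "(x - r) / e n \<le> 0 \<or> (x - r) / e n \<ge> 1" using e[of n] that by (auto simp: divide_simps)
          then show ?thesis using \<beta> by (auto simp: \<rho>_def)
        qed
        then show "indicat_real {r..r + e n} x *\<^sub>R \<rho> r n x *\<^sub>R f x = indicat_real {a<..<b} x *\<^sub>R \<rho> r n x *\<^sub>R f x"
          using sub by (auto simp: indicator_def)
      qed simp
    qed
    have "(LINT x:{a<..<b}|lebesgue. deriv (\<eta> n) x *\<^sub>R f x) = - (LINT x:{a<..<b}|lebesgue. \<eta> n x *\<^sub>R g x)"
      using g test unfolding is_weak_deriv_def by blast
    then show ?thesis
      using set_integral_diff(2)[OF si[of t] si[of s]] by (simp add: D scaleR_diff_left)
  qed
  have lim1: "(\<lambda>n. LINT x:{a<..<b}|lebesgue. \<rho> r n x *\<^sub>R f x) \<longlonglongrightarrow> f r" if "r = t \<or> r = s" for r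
    unfolding \<rho>_def e_def
    by (rule integral_approximate_identity[OF \<sigma>(2,3) \<beta>])
      (use that ts d in \<open>auto intro!: continuous_on_subset[OF f]\<close>)
  have "(\<lambda>n. LINT x|lebesgue. indicator {a<..<b} x *\<^sub>R \<eta> n x *\<^sub>R g x) \<longlonglongrightarrow> (LINT x|lebesgue. indicator {t..s} x *\<^sub>R g x)"
  proof (rule integral_dominated_convergence[where w = "\<lambda>x. norm (indicator {t..s + d} x *\<^sub>R g x)"])
    have gm: "set_integrable lebesgue {t..s + d} g" by (rule li) (use ts d in auto)
    then show "integrable lebesgue (\<lambda>x. norm (indicator {t..s + d} x *\<^sub>R g x))"
      unfolding set_integrable_def by (rule integrable_norm)
    show "(\<lambda>x. indicator {t..s} x *\<^sub>R g x) \<in> borel_measurable lebesgue"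
      using ai unfolding set_integrable_def by (rule borel_measurable_integrable)
    have supp: "\<eta> n x = 0" if x: "x \<notin> {t..s + d}" for n x
    proof -
      consider "x < t" | "x > s + d" using x by fastforce
      then show ?thesis
      proof cases
        case 1
        then show ?thesis using e[of n] ts by (simp add: \<eta>_def \<sigma>(2) divide_simps)
      next
        case 2
        then show ?thesis using e[of n] ts by (simp add: \<eta>_def \<sigma>(3) divide_simps)
      qed
    qed
    have \<eta>_eq: "indicat_real {a<..<b} x *\<^sub>R \<eta> n x *\<^sub>R g x = \<eta> n x *\<^sub>R (indicator {t..s + d} x *\<^sub>R g x)" for n x
      using supp[of x n] ts d by (auto simp: indicator_def)
    have "continuous_on UNIV (\<eta> n)" for n
      using DERIV_isCont[OF D\<eta>] by (simp add: continuous_at_imp_continuous_on)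
    then have "\<eta> n \<in> borel_measurable lebesgue" for n
      by (intro measurable_completion) (simp add: borel_measurable_continuous_onI)
    then show "(\<lambda>x. indicat_real {a<..<b} x *\<^sub>R \<eta> n x *\<^sub>R g x) \<in> borel_measurable lebesgue" for n
      unfolding \<eta>_eq
      by (rule borel_measurable_scaleR) (use gm in \<open>auto simp: set_integrable_def dest: borel_measurable_integrable\<close>)
    show "AE x in lebesgue. norm (indicat_real {a<..<b} x *\<^sub>R \<eta> n x *\<^sub>R g x) \<le> norm (indicator {t..s + d} x *\<^sub>R g x)" for n
    proof (rule AE_I2)
      fix x
      have "\<bar>\<eta> n x\<bar> \<le> 1" using \<sigma>(4,5)[of "(x - t) / e n"] \<sigma>(4,5)[of "(x - s) / e n"] by (simp add: \<eta>_def)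
      then show "norm (indicat_real {a<..<b} x *\<^sub>R \<eta> n x *\<^sub>R g x) \<le> norm (indicator {t..s + d} x *\<^sub>R g x)"
        unfolding \<eta>_eq norm_scaleR[of "\<eta> n x"] by (intro mult_left_le_one_le) auto
    qed
    have lim0: "(\<lambda>n. \<sigma> ((x - r) / e n)) \<longlonglongrightarrow> (if x > r then 1 else 0)" for x r
    proof (cases "x > r")
      case True
      obtain N :: nat where N: "d / (x - r) < N" using reals_Archimedean2 by blast
      have "\<sigma> ((x - r) / e n) = 1" if "n \<ge> N" for n
      proof -
        have "d / (x - r) < Suc n" using N that by linarith
        then show ?thesis using True d by (intro \<sigma>(3)) (simp add: e_def field_simps)
      qed
      then show ?thesis using True by (intro tendsto_eventually eventually_sequentiallyI) auto
    next
      case False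
      then have "\<sigma> ((x - r) / e n) = 0" for n using e[of n] by (intro \<sigma>(2)) (simp add: divide_simps)
      then show ?thesis using False by simp
    qed
    \<comment> \<open>The limit of \<open>\<eta> n\<close> is the indicator of (t, s]; only the
      point t has to be discarded.\<close>
    have "AE x in lebesgue. x \<noteq> t"
      by (rule AE_I[where N = "{t}"]) auto
    then show "AE x in lebesgue. (\<lambda>n. indicat_real {a<..<b} x *\<^sub>R \<eta> n x *\<^sub>R g x) \<longlonglongrightarrow> indicator {t..s} x *\<^sub>R g x"
    proof eventually_elim
      case (elim x)
      have "(\<lambda>n. \<eta> n x) \<longlonglongrightarrow> (if x > t then 1 else 0) - (if x > s then 1 else 0)"
        unfolding \<eta>_def by (intro tendsto_diff lim0)
      then have "(\<lambda>n. \<eta> n x *\<^sub>R (indicator {t..s + d} x *\<^sub>R g x)) \<longlonglongrightarrow>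
          ((if x > t then 1 else 0) - (if x > s then 1 else 0)) *\<^sub>R (indicator {t..s + d} x *\<^sub>R g x)"
        by (intro tendsto_scaleR tendsto_const)
      also have "((if x > t then 1 else 0) - (if x > s then 1 else 0)) *\<^sub>R (indicator {t..s + d} x *\<^sub>R g x) = indicator {t..s} x *\<^sub>R g x"
        using elim ts d by (auto simp: indicator_def)
      finally show ?case unfolding \<eta>_eq .
    qed
  qed
  then have "(\<lambda>n. - (LINT x:{a<..<b}|lebesgue. \<eta> n x *\<^sub>R g x)) \<longlonglongrightarrow> - (LINT x:{t..s}|lebesgue. g x)"
    unfolding set_lebesgue_integral_def by (rule tendsto_minus)
  moreover have "(\<lambda>n. - (LINT x:{a<..<b}|lebesgue. \<eta> n x *\<^sub>R g x)) \<longlonglongrightarrow> f t - f s"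
    unfolding eq[symmetric] by (intro tendsto_diff lim1) auto
  ultimately have "f t - f s = - (LINT x:{t..s}|lebesgue. g x)"
    by (rule LIMSEQ_unique[rotated])
  then show "f s = f t + integral {t..s} g"
    using set_lebesgue_integral_eq_integral(2)[OF ai] by (simp add: algebra_simps)
qed

section \<open>Absolutely continuous functions\<close>

text \<open>Absolute continuity is encoded by the function together with a density, so that no
  pointwise derivative has to exist. The density is determined up to null sets
  (\<open>ac_on_deriv_unique\<close>), and on an empty interval the condition is vacuous.\<close>

definition ac_on :: "real \<Rightarrow> real \<Rightarrow> (real \<Rightarrow> 'b::euclidean_space) \<Rightarrow> (real \<Rightarrow> 'b) \<Rightarrow> bool" where
  "ac_on a b f g \<longleftrightarrow> g absolutely_integrable_on {a..b} \<and> (\<forall>s\<in>{a..b}. f s - f a = integral {a..s} g)"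

lemma absolutely_integrable_on_subIcc:
  fixes g :: "real \<Rightarrow> 'b::euclidean_space"
  assumes "g absolutely_integrable_on {a..b}" "a \<le> s" "t \<le> b"
  shows "g absolutely_integrable_on {s..t}"
  by (rule set_integrable_subset[OF assms(1)]) (use assms in auto)

lemma integrable_on_subIcc:
  fixes g :: "real \<Rightarrow> 'b::euclidean_space"
  assumes "g absolutely_integrable_on {a..b}" "a \<le> s" "t \<le> b"
  shows "g integrable_on {s..t}"
  using absolutely_integrable_on_subIcc[OF assms] set_lebesgue_integral_eq_integral(1) by blast

lemma ac_on_absolutely_integrable: "ac_on a b f g \<Longrightarrow> g absolutely_integrable_on {a..b}"
  unfolding ac_on_def by (rule conjunct1)

lemma ac_on_integrable: "ac_on a b f g \<Longrightarrow> a \<le> s \<Longrightarrow> t \<le> b \<Longrightarrow> g integrable_on {s..t}"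
  by (rule integrable_on_subIcc[where a = a and b = b]) (auto intro: ac_on_absolutely_integrable)

lemma ac_on_increment:
  assumes "ac_on a b f g" "a \<le> s" "s \<le> t" "t \<le> b"
  shows "f t - f s = integral {s..t} g"
proof -
  have "integral {a..s} g + integral {s..t} g = integral {a..t} g"
    using assms ac_on_integrable[OF assms(1), of a t]
    by (intro Henstock_Kurzweil_Integration.integral_combine) auto
  moreover have "f t - f a = integral {a..t} g" "f s - f a = integral {a..s} g"
    using assms unfolding ac_on_def by simp_all
  ultimately show ?thesis by (simp add: algebra_simps)
qed

lemma ac_onI:
  assumes "g absolutely_integrable_on {a..b}"
    and "\<And>s. a \<le> s \<Longrightarrow> s \<le> b \<Longrightarrow> f s - f a = integral {a..s} g"
  shows "ac_on a b f g"
  unfolding ac_on_def using assms by simp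

lemma ac_on_subinterval:
  assumes "ac_on a b f g" "a \<le> s" "t \<le> b"
  shows "ac_on s t f g"
proof (rule ac_onI)
  show "g absolutely_integrable_on {s..t}"
    by (rule absolutely_integrable_on_subIcc[OF ac_on_absolutely_integrable[OF assms(1)] assms(2,3)])
qed (use assms in \<open>auto intro!: ac_on_increment\<close>)

lemma ac_on_continuous:
  assumes "ac_on a b f g"
  shows "continuous_on {a..b} f"
proof -
  have "continuous_on {a..b} (\<lambda>s. f a + integral {a..s} g)"
    by (intro continuous_intros indefinite_integral_continuous_1 ac_on_integrable[OF assms]) auto
  then show ?thesis
  proof (rule continuous_on_eq)
    fix s assume "s \<in> {a..b}"
    then show "f a + integral {a..s} g = f s"
      using ac_on_increment[OF assms, of a s] by (simp add: algebra_simps)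
  qed
qed

lemma ac_on_cong:
  assumes "\<And>s. a \<le> s \<Longrightarrow> s \<le> b \<Longrightarrow> f s = f' s"
  shows "ac_on a b f g \<longleftrightarrow> ac_on a b f' g"
  unfolding ac_on_def using assms by auto

lemma ac_on_cong_AE:
  assumes "ac_on a b f g"
    and ae: "AE x in lebesgue. x \<in> {a..b} \<longrightarrow> g' x = g x"
  shows "ac_on a b f g'"
proof -
  from ae obtain N where N: "{x \<in> space lebesgue. \<not> (x \<in> {a..b} \<longrightarrow> g' x = g x)} \<subseteq> N" "emeasure lebesgue N = 0" "N \<in> sets lebesgue"
    by (rule AE_E)
  then have neg: "negligible N" by (simp add: negligible_iff_null_sets null_sets_def)
  have eq: "g' x = g x" if "x \<in> {a..b} - N" for x using N that by auto
  show ?thesis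
  proof (rule ac_onI)
    show "g' absolutely_integrable_on {a..b}"
      by (rule absolutely_integrable_spike[OF ac_on_absolutely_integrable[OF assms(1)] neg eq])
    fix s assume s: "a \<le> s" "s \<le> b"
    have "integral {a..s} g' = integral {a..s} g"
      by (rule integral_spike[OF neg]) (use eq s in auto)
    then show "f s - f a = integral {a..s} g'"
      using ac_on_increment[OF assms(1), of a s] s by simp
  qed
qed

lemma ac_on_bounded_linear:
  assumes "ac_on a b f g" "bounded_linear h"
  shows "ac_on a b (\<lambda>x. h (f x)) (\<lambda>x. h (g x))"
proof (rule ac_onI)
  interpret bounded_linear h by fact
  show "(\<lambda>x. h (g x)) absolutely_integrable_on {a..b}"
    using absolutely_integrable_linear[OF ac_on_absolutely_integrable[OF assms(1)] assms(2)] by (simp add: o_def)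
  fix s assume s: "a \<le> s" "s \<le> b"
  have "h (integral {a..s} g) = integral {a..s} (\<lambda>x. h (g x))"
    using integral_linear[OF ac_on_integrable[OF assms(1)] assms(2), of a s] s by (simp add: o_def)
  then show "h (f s) - h (f a) = integral {a..s} (\<lambda>x. h (g x))"
    using ac_on_increment[OF assms(1), of a s] s by (simp add: diff[symmetric])
qed

lemma ac_on_add:
  assumes "ac_on a b f g" "ac_on a b f' g'"
  shows "ac_on a b (\<lambda>x. f x + f' x) (\<lambda>x. g x + g' x)"
proof (rule ac_onI)
  show "(\<lambda>x. g x + g' x) absolutely_integrable_on {a..b}"
    by (intro set_integral_add ac_on_absolutely_integrable[OF assms(1)] ac_on_absolutely_integrable[OF assms(2)])
  fix s assume s: "a \<le> s" "s \<le> b"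
  have "integral {a..s} (\<lambda>x. g x + g' x) = integral {a..s} g + integral {a..s} g'"
    using s ac_on_integrable[OF assms(1)] ac_on_integrable[OF assms(2)]
    by (intro Henstock_Kurzweil_Integration.integral_add) auto
  then show "f s + f' s - (f a + f' a) = integral {a..s} (\<lambda>x. g x + g' x)"
    using ac_on_increment[OF assms(1), of a s] ac_on_increment[OF assms(2), of a s] s by (simp add: algebra_simps)
qed

lemma ac_on_sum:
  assumes "finite I" "\<And>i. i \<in> I \<Longrightarrow> ac_on a b (f i) (g i)"
  shows "ac_on a b (\<lambda>x. \<Sum>i\<in>I. f i x) (\<lambda>x. \<Sum>i\<in>I. g i x)"
  using assms
proof (induction I rule: finite_induct)
  case empty
  show ?case by (simp add: ac_on_def)
next
  case (insert j I)
  then show ?case by (simp add: ac_on_add)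
qed

lemma ac_on_diff:
  assumes "ac_on a b f g" "ac_on a b f' g'"
  shows "ac_on a b (\<lambda>x. f x - f' x) (\<lambda>x. g x - g' x)"
  using ac_on_add[OF assms(1) ac_on_bounded_linear[OF assms(2) bounded_linear_minus[OF bounded_linear_ident]]] by simp

lemma ac_on_C1:
  fixes f :: "real \<Rightarrow> 'b::euclidean_space"
  assumes "\<And>x. x \<in> {a..b} \<Longrightarrow> (f has_vector_derivative g x) (at x within {a..b})" "continuous_on {a..b} g"
  shows "ac_on a b f g"
proof (rule ac_onI)
  fix s assume s: "a \<le> s" "s \<le> b"
  have "(g has_integral f s - f a) {a..s}"
  proof (rule fundamental_theorem_of_calculus[OF s(1)])
    fix x assume "x \<in> {a..s}"
    then show "(f has_vector_derivative g x) (at x within {a..s})"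
      using s by (intro has_vector_derivative_within_subset[OF assms(1)]) simp_all
  qed
  then show "f s - f a = integral {a..s} g" by (simp add: integral_unique)
qed (rule absolutely_integrable_continuous_real[OF assms(2)])

lemma ac_on_join:
  assumes "ac_on a c f g" "ac_on c b f h" "a \<le> c" "c \<le> b"
  shows "ac_on a b f (\<lambda>x. if x \<le> c then g x else h x)"
proof (rule ac_onI)
  let ?k = "\<lambda>x. if x \<le> c then g x else h x"
  have 1: "?k absolutely_integrable_on {a..c}"
    by (rule absolutely_integrable_spike[where f = g and S = "{}"]) (use assms ac_on_absolutely_integrable in auto)
  have 2: "?k absolutely_integrable_on {c..b}"
    by (rule absolutely_integrable_spike[where f = h and S = "{c}"]) (use assms ac_on_absolutely_integrable in auto)
  show k: "?k absolutely_integrable_on {a..b}"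
    using set_integrable_Un[OF 1 2] assms(3,4) by (simp add: ivl_disj_un_two_touch)
  have I1: "integral {a..s} ?k = f s - f a" if "a \<le> s" "s \<le> c" for s
  proof -
    have "integral {a..s} ?k = integral {a..s} g" by (rule integral_cong) (use that in auto)
    then show ?thesis using ac_on_increment[OF assms(1), of a s] that by simp
  qed
  fix s assume s: "a \<le> s" "s \<le> b"
  show "f s - f a = integral {a..s} ?k"
  proof (cases "s \<le> c")
    case True
    then show ?thesis using I1 s by simp
  next
    case False
    have "integral {c..s} ?k = integral {c..s} h"
      by (rule integral_spike[of "{c}"]) auto
    then have "integral {c..s} ?k = f s - f c" using ac_on_increment[OF assms(2), of c s] False s by simp
    moreover have "integral {a..c} ?k + integral {c..s} ?k = integral {a..s} ?k"
      using False s assms by (intro Henstock_Kurzweil_Integration.integral_combine integrable_on_subIcc[OF k]) auto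
    ultimately show ?thesis using I1[of c] assms by (simp add: algebra_simps)
  qed
qed

text \<open>The defect h t - h s - integral k is additive over adjacent intervals. If on short
  intervals it is at most e times the integral of \<open>\<kappa>\<close>, it is so on all
  intervals, and e is arbitrary. Product and chain rule are thereby reduced to a local
  estimate.\<close>

lemma ac_onI_local:
  fixes h k :: "real \<Rightarrow> 'b::euclidean_space"
  assumes k: "k absolutely_integrable_on {a..b}" and \<kappa>: "\<kappa> integrable_on {a..b}"
    and loc: "\<And>e. e > 0 \<Longrightarrow> \<exists>\<delta>>0. \<forall>s t. a \<le> s \<longrightarrow> s \<le> t \<longrightarrow> t \<le> b \<longrightarrow> t - s < \<delta> \<longrightarrow>
        norm (h t - h s - integral {s..t} k) \<le> e * integral {s..t} \<kappa>"
  shows "ac_on a b h k"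
proof (rule ac_onI[OF k])
  have \<kappa>i: "\<kappa> integrable_on {s..t}" if "a \<le> s" "t \<le> b" for s t
    using integrable_on_subinterval[OF \<kappa>] that by auto
  have est: "norm (h t - h a - integral {a..t} k) \<le> e * integral {a..t} \<kappa>" if e: "e > 0" and t: "a \<le> t" "t \<le> b" for e t
  proof -
    obtain \<delta> where \<delta>: "\<delta> > 0" "\<And>s t. a \<le> s \<Longrightarrow> s \<le> t \<Longrightarrow> t \<le> b \<Longrightarrow> t - s < \<delta> \<Longrightarrow>
        norm (h t - h s - integral {s..t} k) \<le> e * integral {s..t} \<kappa>"
      using loc[OF e] by blast
    \<comment> \<open>The induction advances in steps of length \<delta>/2, strictly below the
      admissible length \<delta>.\<close>
    have *: "norm (h t - h a - integral {a..t} k) \<le> e * integral {a..t} \<kappa>"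
      if "a \<le> t" "t \<le> b" "t - a < real n * (\<delta> / 2)" for n t
      using that
    proof (induction n arbitrary: t)
      case 0
      then show ?case by simp
    next
      case (Suc n)
      show ?case
      proof (cases "t - a < \<delta>")
        case True
        then show ?thesis using \<delta>(2)[of a t] Suc.prems by simp
      next
        case False
        define u where "u = t - \<delta> / 2"
        have u: "a \<le> u" "u \<le> t" using False \<delta>(1) by (auto simp: u_def)
        have 1: "norm (h u - h a - integral {a..u} k) \<le> e * integral {a..u} \<kappa>"
          by (rule Suc.IH) (use u Suc.prems in \<open>auto simp: u_def algebra_simps\<close>)
        have 2: "norm (h t - h u - integral {u..t} k) \<le> e * integral {u..t} \<kappa>"
          by (rule \<delta>(2)) (use u Suc.prems \<delta>(1) in \<open>auto simp: u_def\<close>)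
        have 3: "integral {a..u} k + integral {u..t} k = integral {a..t} k"
          "integral {a..u} \<kappa> + integral {u..t} \<kappa> = integral {a..t} \<kappa>"
          using u Suc.prems
          by (auto intro!: Henstock_Kurzweil_Integration.integral_combine integrable_on_subIcc[OF k] \<kappa>i)
        have "h t - h a - integral {a..t} k = (h u - h a - integral {a..u} k) + (h t - h u - integral {u..t} k)"
          unfolding 3(1)[symmetric] by simp
        then have "norm (h t - h a - integral {a..t} k) \<le> e * integral {a..u} \<kappa> + e * integral {u..t} \<kappa>"
          using norm_triangle_mono[OF 1 2] by (simp only:)
        then show ?thesis unfolding 3(2)[symmetric] by (simp add: distrib_left)
      qed
    qed
    obtain n :: nat where "(t - a) / (\<delta> / 2) < n" using reals_Archimedean2 by blast
    then have "t - a < real n * (\<delta> / 2)" using \<delta>(1) by (simp add: field_simps)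
    then show ?thesis using * t by blast
  qed
  fix t assume t: "a \<le> t" "t \<le> b"
  let ?N = "norm (h t - h a - integral {a..t} k)" and ?C = "integral {a..t} \<kappa>"
  have "?N \<le> 0"
  proof (rule field_le_epsilon)
    fix e :: real assume e: "e > 0"
    have "?N \<le> e / (\<bar>?C\<bar> + 1) * ?C" by (rule est) (use e t in auto)
    also have "\<dots> \<le> e / (\<bar>?C\<bar> + 1) * (\<bar>?C\<bar> + 1)" using e by (intro mult_left_mono) auto
    finally show "?N \<le> 0 + e" by simp
  qed
  then show "h t - h a = integral {a..t} k" by simp
qed

lemma uniformly_continuous_IccE:
  fixes f :: "real \<Rightarrow> 'b::metric_space"
  assumes "continuous_on {a..b} f" "e > 0"
  obtains \<delta> where "\<delta> > 0" "\<And>s t. s \<in> {a..b} \<Longrightarrow> t \<in> {a..b} \<Longrightarrow> \<bar>s - t\<bar> < \<delta> \<Longrightarrow> dist (f s) (f t) < e"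
  using compact_uniformly_continuous[OF assms(1)] assms(2)
  unfolding uniformly_continuous_on_def by (metis compact_Icc dist_real_def dist_commute)

lemma continuous_on_Icc_bounded_measurable:
  fixes f :: "real \<Rightarrow> 'b::euclidean_space"
  assumes "continuous_on {a..b} f"
  shows "bounded (f ` {a..b})" "f \<in> borel_measurable (lebesgue_on {a..b})"
  using compact_imp_bounded[OF compact_continuous_image[OF assms]]
    continuous_imp_measurable_on_sets_lebesgue[OF assms] by auto

text \<open>The local estimate freezes g at the right end and f at the left end of a short interval:
  the increment of the product is then exact, and the error is controlled by the oscillation of f
  and g.\<close>

lemma ac_on_scaleR:
  fixes f :: "real \<Rightarrow> real" and g :: "real \<Rightarrow> 'b::euclidean_space"
  assumes f: "ac_on a b f f'" and g: "ac_on a b g g'"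
  shows "ac_on a b (\<lambda>x. f x *\<^sub>R g x) (\<lambda>x. f' x *\<^sub>R g x + f x *\<^sub>R g' x)"
proof (rule ac_onI_local[where \<kappa> = "\<lambda>x. norm (f' x) + norm (g' x)"])
  let ?k = "\<lambda>x. f' x *\<^sub>R g x + f x *\<^sub>R g' x"
  have cf: "continuous_on {a..b} f" and cg: "continuous_on {a..b} g"
    using f g ac_on_continuous by blast+
  have af: "f' absolutely_integrable_on {a..b}" and ag: "g' absolutely_integrable_on {a..b}"
    using f g ac_on_absolutely_integrable by blast+
  have bil: "bilinear (\<lambda>(y::'b) (x::real). x *\<^sub>R y)"
    by (auto simp: bilinear_def intro!: linearI simp: algebra_simps)
  have 1: "(\<lambda>x. f' x *\<^sub>R g x) absolutely_integrable_on {a..b}"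
    by (rule absolutely_integrable_bounded_measurable_product[OF bil])
      (use continuous_on_Icc_bounded_measurable[OF cg] af in auto)
  have bil: "bilinear (\<lambda>(x::real) (y::'b). x *\<^sub>R y)"
    by (auto simp: bilinear_def intro!: linearI simp: algebra_simps)
  have 2: "(\<lambda>x. f x *\<^sub>R g' x) absolutely_integrable_on {a..b}"
    by (rule absolutely_integrable_bounded_measurable_product[OF bil])
      (use continuous_on_Icc_bounded_measurable[OF cf] ag in auto)
  show k: "?k absolutely_integrable_on {a..b}" using set_integral_add(1)[OF 1 2] .
  show "(\<lambda>x. norm (f' x) + norm (g' x)) integrable_on {a..b}"
    using af ag by (intro integrable_add) (auto simp: absolutely_integrable_on_def)
  fix e :: real assume e: "e > 0"
  obtain d1 where d1: "d1 > 0" "\<And>s t. s \<in> {a..b} \<Longrightarrow> t \<in> {a..b} \<Longrightarrow> \<bar>s - t\<bar> < d1 \<Longrightarrow> dist (f s) (f t) < e"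
    using uniformly_continuous_IccE[OF cf e] by blast
  obtain d2 where d2: "d2 > 0" "\<And>s t. s \<in> {a..b} \<Longrightarrow> t \<in> {a..b} \<Longrightarrow> \<bar>s - t\<bar> < d2 \<Longrightarrow> dist (g s) (g t) < e"
    using uniformly_continuous_IccE[OF cg e] by blast
  show "\<exists>\<delta>>0. \<forall>s t. a \<le> s \<longrightarrow> s \<le> t \<longrightarrow> t \<le> b \<longrightarrow> t - s < \<delta> \<longrightarrow>
      norm (f t *\<^sub>R g t - f s *\<^sub>R g s - integral {s..t} ?k) \<le> e * integral {s..t} (\<lambda>x. norm (f' x) + norm (g' x))"
  proof (intro exI[of _ "min d1 d2"] conjI allI impI)
    fix s t assume st: "a \<le> s" "s \<le> t" "t \<le> b" "t - s < min d1 d2"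
    have if': "f' integrable_on {s..t}" and ig': "g' integrable_on {s..t}"
      using st ac_on_integrable[OF f] ac_on_integrable[OF g] by auto
    have ik: "?k integrable_on {s..t}"
      using integrable_on_subIcc[OF k, of s t] st by blast
    have "f t *\<^sub>R g t - f s *\<^sub>R g s = (f t - f s) *\<^sub>R g t + f s *\<^sub>R (g t - g s)" by (simp add: algebra_simps)
    also have "\<dots> = integral {s..t} f' *\<^sub>R g t + f s *\<^sub>R integral {s..t} g'"
      using ac_on_increment[OF f, of s t] ac_on_increment[OF g, of s t] st by simp
    finally have *: "f t *\<^sub>R g t - f s *\<^sub>R g s = \<dots>" .
    have "((\<lambda>x. f' x *\<^sub>R g t + f s *\<^sub>R g' x) has_integral (integral {s..t} f' *\<^sub>R g t + f s *\<^sub>R integral {s..t} g')) {s..t}"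
      using if' ig' by (intro has_integral_add has_integral_scaleR_left has_integral_cmul integrable_integral)
    from has_integral_diff[OF this integrable_integral[OF ik]]
    have hi: "((\<lambda>x. f' x *\<^sub>R (g t - g x) + (f s - f x) *\<^sub>R g' x) has_integral
        (f t *\<^sub>R g t - f s *\<^sub>R g s - integral {s..t} ?k)) {s..t}"
      unfolding * by (simp add: algebra_simps)
    have "norm (integral {s..t} (\<lambda>x. f' x *\<^sub>R (g t - g x) + (f s - f x) *\<^sub>R g' x)) \<le>
        integral {s..t} (\<lambda>x. e * (norm (f' x) + norm (g' x)))"
    proof (rule integral_norm_bound_integral)
      show "(\<lambda>x. f' x *\<^sub>R (g t - g x) + (f s - f x) *\<^sub>R g' x) integrable_on {s..t}" using hi by blast
      show "(\<lambda>x. e * (norm (f' x) + norm (g' x))) integrable_on {s..t}"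
        using absolutely_integrable_on_subIcc[OF af] absolutely_integrable_on_subIcc[OF ag] st
        by (intro integrable_on_mult_right integrable_add) (auto simp: absolutely_integrable_on_def)
      fix x assume x: "x \<in> {s..t}"
      have "norm (g t - g x) \<le> e" "\<bar>f s - f x\<bar> \<le> e"
        using d2(2)[of t x] d1(2)[of s x] x st by (auto simp: dist_norm less_imp_le)
      then have "norm (f' x *\<^sub>R (g t - g x)) \<le> norm (f' x) * e" "norm ((f s - f x) *\<^sub>R g' x) \<le> e * norm (g' x)"
        by (auto intro!: mult_left_mono mult_right_mono)
      then have "norm (f' x *\<^sub>R (g t - g x) + (f s - f x) *\<^sub>R g' x) \<le> norm (f' x) * e + e * norm (g' x)"
        by (rule norm_triangle_mono)
      then show "norm (f' x *\<^sub>R (g t - g x) + (f s - f x) *\<^sub>R g' x) \<le> e * (norm (f' x) + norm (g' x))"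
        by (simp add: algebra_simps)
    qed
    then show "norm (f t *\<^sub>R g t - f s *\<^sub>R g s - integral {s..t} ?k) \<le> e * integral {s..t} (\<lambda>x. norm (f' x) + norm (g' x))"
      using integral_unique[OF hi] by simp
  qed (use d1 d2 in auto)
qed

lemma mvt_Icc_exists:
  fixes f f' :: "real \<Rightarrow> real"
  assumes d: "\<And>x. x \<in> {l..u} \<Longrightarrow> (f has_real_derivative f' x) (at x within {l..u})"
    and xy: "x \<in> {l..u}" "y \<in> {l..u}"
  shows "\<exists>z\<in>{min x y..max x y}. f y - f x = f' z * (y - x)"
proof (cases "x \<le> y")
  case True
  have "\<exists>z\<in>{x..y}. f y - f x = f' z * (y - x)"
  proof (rule mvt_very_simple[OF True])
    fix z assume "x \<le> z" "z \<le> y"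
    then have "(f has_real_derivative f' z) (at z within {x..y})"
      using xy by (intro DERIV_subset[OF d]) auto
    then show "(f has_derivative (*) (f' z)) (at z within {x..y})" by (simp add: has_field_derivative_def)
  qed
  then show ?thesis using True by (simp add: min_absorb1 max_absorb2)
next
  case False
  then have le: "y \<le> x" by simp
  have "\<exists>z\<in>{y..x}. f x - f y = f' z * (x - y)"
  proof (rule mvt_very_simple[OF le])
    fix z assume "y \<le> z" "z \<le> x"
    then have "(f has_real_derivative f' z) (at z within {y..x})"
      using xy by (intro DERIV_subset[OF d]) auto
    then show "(f has_derivative (*) (f' z)) (at z within {y..x})" by (simp add: has_field_derivative_def)
  qed
  then obtain z where "z \<in> {y..x}" "f x - f y = f' z * (x - y)" by blast
  then show ?thesis using le by (intro bexI[of _ z]) (auto simp: algebra_simps)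
qed

lemma dist_real_pair_le: "dist (x, y) (x', y') \<le> \<bar>x - x'\<bar> + \<bar>y - y'\<bar>" for x x' y y' :: real
  unfolding dist_Pair_Pair dist_real_def by (rule order_trans[OF sqrt_sum_squares_le_sum_abs]) simp

text \<open>Over a short interval the increment is a mean value step in r at the final time plus one
  in t at the initial position. Uniform continuity of both partial derivatives on the compact
  rectangle bounds the error by e (1 + |w'|).\<close>

lemma ac_on_chain:
  fixes w w' :: "real \<Rightarrow> real" and \<Phi> \<Phi>r \<Phi>t :: "real \<Rightarrow> real \<Rightarrow> real"
  assumes w: "ac_on a b w w'" and wl: "\<And>s. s \<in> {a..b} \<Longrightarrow> w s \<in> {l..u}"
    and cr: "continuous_on ({l..u} \<times> {a..b}) (\<lambda>(r, t). \<Phi>r r t)"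
    and ct: "continuous_on ({l..u} \<times> {a..b}) (\<lambda>(r, t). \<Phi>t r t)"
    and dr: "\<And>r t. r \<in> {l..u} \<Longrightarrow> t \<in> {a..b} \<Longrightarrow> ((\<lambda>r. \<Phi> r t) has_real_derivative \<Phi>r r t) (at r within {l..u})"
    and dt: "\<And>r t. r \<in> {l..u} \<Longrightarrow> t \<in> {a..b} \<Longrightarrow> ((\<lambda>t. \<Phi> r t) has_real_derivative \<Phi>t r t) (at t within {a..b})"
  shows "ac_on a b (\<lambda>t. \<Phi> (w t) t) (\<lambda>t. \<Phi>t (w t) t + \<Phi>r (w t) t * w' t)"
proof (rule ac_onI_local[where \<kappa> = "\<lambda>x. 1 + norm (w' x)"])
  let ?k = "\<lambda>t. \<Phi>t (w t) t + \<Phi>r (w t) t * w' t"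
  have cw: "continuous_on {a..b} w" using ac_on_continuous[OF w] .
  have aw: "w' absolutely_integrable_on {a..b}" using ac_on_absolutely_integrable[OF w] .
  have cpair: "continuous_on {a..b} (\<lambda>t. (w t, t))" by (intro continuous_intros cw)
  have crw: "continuous_on {a..b} (\<lambda>t. \<Phi>r (w t) t)" and ctw: "continuous_on {a..b} (\<lambda>t. \<Phi>t (w t) t)"
  proof -
    have sub: "(\<lambda>t. (w t, t)) ` {a..b} \<subseteq> {l..u} \<times> {a..b}" using wl by blast
    show "continuous_on {a..b} (\<lambda>t. \<Phi>r (w t) t)" "continuous_on {a..b} (\<lambda>t. \<Phi>t (w t) t)"
      using continuous_on_compose2[OF cr cpair sub] continuous_on_compose2[OF ct cpair sub] by simp_all
  qed
  have k2: "(\<lambda>t. \<Phi>r (w t) t * w' t) absolutely_integrable_on {a..b}"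
    by (rule absolutely_integrable_bounded_measurable_product_real)
      (use continuous_on_Icc_bounded_measurable[OF crw] aw in auto)
  have k1: "(\<lambda>t. \<Phi>t (w t) t) absolutely_integrable_on {a..b}"
    by (intro absolutely_integrable_continuous_real ctw)
  show k: "?k absolutely_integrable_on {a..b}" using set_integral_add(1)[OF k1 k2] .
  show "(\<lambda>x. 1 + norm (w' x)) integrable_on {a..b}"
    using aw by (intro integrable_add) (auto simp: absolutely_integrable_on_def)
  fix e :: real assume e: "e > 0"
  have comp: "compact ({l..u} \<times> {a..b})" by (intro compact_Times) auto
  obtain d1 where d1: "d1 > 0" "\<And>p q. p \<in> {l..u} \<times> {a..b} \<Longrightarrow> q \<in> {l..u} \<times> {a..b} \<Longrightarrow> dist q p < d1 \<Longrightarrow>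
      dist ((\<lambda>(r, t). \<Phi>r r t) q) ((\<lambda>(r, t). \<Phi>r r t) p) < e"
    using compact_uniformly_continuous[OF cr comp, unfolded uniformly_continuous_on_def, THEN spec, THEN mp, OF e] by metis
  obtain d2 where d2: "d2 > 0" "\<And>p q. p \<in> {l..u} \<times> {a..b} \<Longrightarrow> q \<in> {l..u} \<times> {a..b} \<Longrightarrow> dist q p < d2 \<Longrightarrow>
      dist ((\<lambda>(r, t). \<Phi>t r t) q) ((\<lambda>(r, t). \<Phi>t r t) p) < e"
    using compact_uniformly_continuous[OF ct comp, unfolded uniformly_continuous_on_def, THEN spec, THEN mp, OF e] by metis
  \<comment> \<open>Half of the tolerance, because the pairs compared below differ by less than d in
    each of their two coordinates.\<close>
  define d where "d = min d1 d2 / 2"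
  have d: "d > 0" using d1 d2 by (simp add: d_def)
  obtain d3 where d3: "d3 > 0" "\<And>s t. s \<in> {a..b} \<Longrightarrow> t \<in> {a..b} \<Longrightarrow> \<bar>s - t\<bar> < d3 \<Longrightarrow> dist (w s) (w t) < d"
    using uniformly_continuous_IccE[OF cw d] by blast
  show "\<exists>\<delta>>0. \<forall>s t. a \<le> s \<longrightarrow> s \<le> t \<longrightarrow> t \<le> b \<longrightarrow> t - s < \<delta> \<longrightarrow>
      norm (\<Phi> (w t) t - \<Phi> (w s) s - integral {s..t} ?k) \<le> e * integral {s..t} (\<lambda>x. 1 + norm (w' x))"
  proof (intro exI[of _ "min d d3"] conjI allI impI)
    fix s t assume st: "a \<le> s" "s \<le> t" "t \<le> b" "t - s < min d d3"
    have sm: "s \<in> {a..b}" "t \<in> {a..b}" using st by auto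
    have iw: "w' integrable_on {s..t}" using st ac_on_integrable[OF w] by auto
    have ik: "?k integrable_on {s..t}"
      using integrable_on_subIcc[OF k, of s t] st by blast
    obtain z where z: "z \<in> {min (w s) (w t)..max (w s) (w t)}" "\<Phi> (w t) t - \<Phi> (w s) t = \<Phi>r z t * (w t - w s)"
      using mvt_Icc_exists[OF dr[OF _ sm(2)] wl[OF sm(1)] wl[OF sm(2)]] by blast
    obtain y where y: "y \<in> {min s t..max s t}" "\<Phi> (w s) t - \<Phi> (w s) s = \<Phi>t (w s) y * (t - s)"
      using mvt_Icc_exists[OF dt[OF wl[OF sm(1)]] sm] by blast
    have zl: "z \<in> {l..u}" using z(1) wl[OF sm(1)] wl[OF sm(2)] by auto
    have yl: "y \<in> {s..t}" using y(1) st by auto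
    have "\<Phi> (w t) t - \<Phi> (w s) s = \<Phi>t (w s) y * (t - s) + \<Phi>r z t * integral {s..t} w'"
      using z y ac_on_increment[OF w, of s t] st by simp
    moreover have "((\<lambda>x. \<Phi>t (w s) y + \<Phi>r z t * w' x) has_integral (\<Phi>t (w s) y * (t - s) + \<Phi>r z t * integral {s..t} w')) {s..t}"
      using has_integral_const_real[of "\<Phi>t (w s) y" s t] st iw
      by (intro has_integral_add has_integral_mult_right integrable_integral) (auto simp: mult.commute)
    ultimately have "((\<lambda>x. \<Phi>t (w s) y + \<Phi>r z t * w' x) has_integral (\<Phi> (w t) t - \<Phi> (w s) s)) {s..t}" by simp
    from has_integral_diff[OF this integrable_integral[OF ik]]
    have hi: "((\<lambda>x. (\<Phi>t (w s) y - \<Phi>t (w x) x) + (\<Phi>r z t - \<Phi>r (w x) x) * w' x) has_integral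
        (\<Phi> (w t) t - \<Phi> (w s) s - integral {s..t} ?k)) {s..t}"
      by (simp add: algebra_simps)
    have "norm (integral {s..t} (\<lambda>x. (\<Phi>t (w s) y - \<Phi>t (w x) x) + (\<Phi>r z t - \<Phi>r (w x) x) * w' x)) \<le>
        integral {s..t} (\<lambda>x. e * (1 + norm (w' x)))"
    proof (rule integral_norm_bound_integral)
      show "(\<lambda>x. (\<Phi>t (w s) y - \<Phi>t (w x) x) + (\<Phi>r z t - \<Phi>r (w x) x) * w' x) integrable_on {s..t}" using hi by blast
      show "(\<lambda>x. e * (1 + norm (w' x))) integrable_on {s..t}"
        using absolutely_integrable_on_subIcc[OF aw] st
        by (intro integrable_on_mult_right integrable_add) (auto simp: absolutely_integrable_on_def)
      fix x assume x: "x \<in> {s..t}"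
      then have xm: "x \<in> {a..b}" using st by auto
      have "\<bar>w s - w x\<bar> < d" "\<bar>w t - w x\<bar> < d"
        using d3(2)[OF sm(1) xm] d3(2)[OF sm(2) xm] x st by (auto simp: dist_real_def)
      then have "dist (w s, y) (w x, x) < d + d" "dist (z, t) (w x, x) < d + d"
        using dist_real_pair_le[of "w s" y "w x" x] dist_real_pair_le[of z t "w x" x] x yl z(1) st by auto
      then have "dist (w s, y) (w x, x) < d2" "dist (z, t) (w x, x) < d1" by (auto simp: d_def)
      then have "\<bar>\<Phi>t (w s) y - \<Phi>t (w x) x\<bar> \<le> e" "\<bar>\<Phi>r z t - \<Phi>r (w x) x\<bar> \<le> e"
        using d2(2)[of "(w x, x)" "(w s, y)"] d1(2)[of "(w x, x)" "(z, t)"] wl[OF sm(1)] wl[OF xm] sm xm zl yl st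
        by (auto simp: dist_real_def less_imp_le)
      then have "norm (\<Phi>t (w s) y - \<Phi>t (w x) x) \<le> e" "norm ((\<Phi>r z t - \<Phi>r (w x) x) * w' x) \<le> e * norm (w' x)"
        by (auto simp: abs_mult intro!: mult_right_mono)
      then have "norm ((\<Phi>t (w s) y - \<Phi>t (w x) x) + (\<Phi>r z t - \<Phi>r (w x) x) * w' x) \<le> e + e * norm (w' x)"
        by (rule norm_triangle_mono)
      then show "norm ((\<Phi>t (w s) y - \<Phi>t (w x) x) + (\<Phi>r z t - \<Phi>r (w x) x) * w' x) \<le> e * (1 + norm (w' x))"
        by (simp add: algebra_simps)
    qed
    then show "norm (\<Phi> (w t) t - \<Phi> (w s) s - integral {s..t} ?k) \<le> e * integral {s..t} (\<lambda>x. 1 + norm (w' x))"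
      using integral_unique[OF hi] by simp
  qed (use d d3 in auto)
qed

section \<open>Uniqueness of densities and their vanishing on the zero set\<close>

lemma enn2real_inject: "enn2real x = enn2real y \<Longrightarrow> x \<noteq> \<infinity> \<Longrightarrow> y \<noteq> \<infinity> \<Longrightarrow> x = y"
  by (cases x; cases y) auto

text \<open>The positive and the negative part of k are densities of two measures that agree and are
  finite on all half-lines, hence coincide; equality of the densities forces k = 0. The comparison
  is made on \<open>lborel\<close> for a Borel version \<open>h'\<close> of k.\<close>

lemma AE_zero_if_interval_integrals_zero_real:
  fixes k :: "real \<Rightarrow> real"
  assumes k: "k absolutely_integrable_on {a..b}" and z: "\<And>s. s \<in> {a..b} \<Longrightarrow> integral {a..s} k = 0"
  shows "AE x in lebesgue. x \<in> {a..b} \<longrightarrow> k x = 0"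
proof -
  define h where "h x = indicat_real {a..b} x *\<^sub>R k x" for x
  have h: "integrable lebesgue h"
    using k unfolding set_integrable_def h_def[abs_def] .
  then obtain h' where h': "h' \<in> borel_measurable lborel" "AE x in lborel. h x = h' x"
    using completion_ex_borel_measurable_real[OF borel_measurable_integrable] by blast
  have ae: "AE x in lebesgue. h x = h' x" using h'(2) by (rule AE_completion)
  have h'm: "h' \<in> borel_measurable lebesgue" using h'(1) by (rule measurable_completion)
  have "integrable lebesgue h'"
    using h by (rule Bochner_Integration.integrable_cong_AE_imp[OF _ h'm ae])
  then have h'i: "integrable lborel h'" using integrable_completion[OF h'(1)] by simp
  have I0: "(LINT y|lborel. indicator {x<..} y * h' y) = 0" for x
  proof -
    have kx: "k absolutely_integrable_on {max a x..b}" using absolutely_integrable_on_subIcc[OF k] by auto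
    have "(LINT y|lborel. indicator {x<..} y * h' y) = (LINT y|lebesgue. indicator {x<..} y * h' y)"
      by (rule integral_completion[symmetric]) (use h' in measurable)
    also have "\<dots> = (LINT y|lebesgue. indicat_real {max a x..b} y *\<^sub>R k y)"
    proof (rule Bochner_Integration.integral_cong_AE)
      show "(\<lambda>y. indicator {x<..} y * h' y) \<in> borel_measurable lebesgue"
        by (rule measurable_completion) (use h' in measurable)
      show "(\<lambda>y. indicat_real {max a x..b} y *\<^sub>R k y) \<in> borel_measurable lebesgue"
        using kx unfolding set_integrable_def by (rule borel_measurable_integrable)
      have "AE y in lebesgue. y \<noteq> x" by (rule AE_I[where N = "{x}"]) auto
      with ae show "AE y in lebesgue. indicator {x<..} y * h' y = indicat_real {max a x..b} y *\<^sub>R k y"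
        by eventually_elim (auto simp: h_def indicator_def)
    qed
    also have "\<dots> = integral {max a x..b} k"
      using set_lebesgue_integral_eq_integral(2)[OF kx] by (simp add: set_lebesgue_integral_def)
    also have "\<dots> = 0"
    proof (cases "max a x \<le> b")
      case True
      have "integral {a..max a x} k + integral {max a x..b} k = integral {a..b} k"
        using True by (intro Henstock_Kurzweil_Integration.integral_combine integrable_on_subIcc[OF k]) auto
      then show ?thesis using z[of "max a x"] z[of b] True by auto
    qed auto
    finally show ?thesis .
  qed
  have fin: "integrable lborel (\<lambda>y. indicator {x<..} y * h' y)" for x
    using integrable_mult_indicator[OF _ h'i, of "{x<..}"] by simp
  have d: "density lborel (\<lambda>y. ennreal (h' y)) = density lborel (\<lambda>y. ennreal (- h' y))"
  proof (rule measure_eqI_lessThan)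
    fix x :: real
    have m: "(\<lambda>y. ennreal (h' y)) \<in> borel_measurable lborel" "(\<lambda>y. ennreal (- h' y)) \<in> borel_measurable lborel"
      using h'(1) by measurable
    have e1: "emeasure (density lborel (\<lambda>y. ennreal (h' y))) {x<..} = (\<integral>\<^sup>+y. ennreal (indicator {x<..} y * h' y) \<partial>lborel)"
      by (subst emeasure_density[OF m(1)]) (auto intro!: nn_integral_cong simp: indicator_def)
    have e2: "emeasure (density lborel (\<lambda>y. ennreal (- h' y))) {x<..} = (\<integral>\<^sup>+y. ennreal (- (indicator {x<..} y * h' y)) \<partial>lborel)"
      by (subst emeasure_density[OF m(2)]) (auto intro!: nn_integral_cong simp: indicator_def)
    have f: "(\<integral>\<^sup>+y. ennreal (indicator {x<..} y * h' y) \<partial>lborel) \<noteq> \<infinity>"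
      "(\<integral>\<^sup>+y. ennreal (- (indicator {x<..} y * h' y)) \<partial>lborel) \<noteq> \<infinity>"
      using fin[of x] by (auto dest: integrableD)
    show "emeasure (density lborel (\<lambda>y. ennreal (h' y))) {x<..} < \<infinity>"
      unfolding e1 using f(1) by (simp add: less_top)
    have "enn2real (\<integral>\<^sup>+y. ennreal (indicator {x<..} y * h' y) \<partial>lborel) =
        enn2real (\<integral>\<^sup>+y. ennreal (- (indicator {x<..} y * h' y)) \<partial>lborel)"
      using real_lebesgue_integral_def[OF fin[of x]] I0[of x] by simp
    then show "emeasure (density lborel (\<lambda>y. ennreal (h' y))) {x<..} = emeasure (density lborel (\<lambda>y. ennreal (- h' y))) {x<..}"
      unfolding e1 e2 using f
      by (intro enn2real_inject)
  qed auto
  have "AE y in lborel. ennreal (h' y) = ennreal (- h' y)"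
  proof (rule sigma_finite_measure.density_unique_iff[OF lborel.sigma_finite_measure_axioms, THEN iffD1])
    show "(\<lambda>y. ennreal (h' y)) \<in> borel_measurable lborel" "(\<lambda>y. ennreal (- h' y)) \<in> borel_measurable lborel"
      using h'(1) by measurable
  qed (rule d)
  then have "AE y in lborel. h' y = 0"
  proof eventually_elim
    case (elim y)
    show ?case
    proof (cases "h' y \<ge> 0")
      case True
      then have "ennreal (h' y) = 0" using elim by (simp add: ennreal_neg)
      then show ?thesis using True by (simp add: ennreal_eq_0_iff)
    next
      case False
      then have "ennreal (- h' y) = 0" using elim by (simp add: ennreal_neg)
      then show ?thesis using False by (simp add: ennreal_eq_0_iff)
    qed
  qed
  from AE_completion[OF this] ae show ?thesis
    by eventually_elim (auto simp: h_def)
qed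

lemma AE_zero_if_interval_integrals_zero:
  fixes k :: "real \<Rightarrow> 'b::euclidean_space"
  assumes k: "k absolutely_integrable_on {a..b}" and z: "\<And>s. s \<in> {a..b} \<Longrightarrow> integral {a..s} k = 0"
  shows "AE x in lebesgue. x \<in> {a..b} \<longrightarrow> k x = 0"
proof -
  have "AE x in lebesgue. x \<in> {a..b} \<longrightarrow> k x \<bullet> i = 0" if "i \<in> Basis" for i
  proof (rule AE_zero_if_interval_integrals_zero_real)
    show "(\<lambda>x. k x \<bullet> i) absolutely_integrable_on {a..b}"
      using absolutely_integrable_linear[OF k bounded_linear_inner_left[of i]] by (simp add: o_def)
    fix s assume s: "s \<in> {a..b}"
    then have "k integrable_on {a..s}" using integrable_on_subIcc[OF k] by auto
    then have "integral {a..s} (\<lambda>x. k x \<bullet> i) = integral {a..s} k \<bullet> i"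
      using integral_linear[OF _ bounded_linear_inner_left[of i]] by (simp add: o_def)
    then show "integral {a..s} (\<lambda>x. k x \<bullet> i) = 0" using z[OF s] by simp
  qed
  then have "AE x in lebesgue. \<forall>i\<in>Basis. x \<in> {a..b} \<longrightarrow> k x \<bullet> i = 0"
    by (intro AE_finite_allI) auto
  then show ?thesis by eventually_elim (auto intro: euclidean_eqI)
qed

lemma ac_on_deriv_unique:
  assumes "ac_on a b f g" "ac_on a b f g'"
  shows "AE x in lebesgue. x \<in> {a..b} \<longrightarrow> g x = g' x"
proof -
  have d: "ac_on a b (\<lambda>x. f x - f x) (\<lambda>x. g x - g' x)" by (rule ac_on_diff[OF assms])
  have "AE x in lebesgue. x \<in> {a..b} \<longrightarrow> g x - g' x = 0"
  proof (rule AE_zero_if_interval_integrals_zero)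
    show "(\<lambda>x. g x - g' x) absolutely_integrable_on {a..b}" using ac_on_absolutely_integrable[OF d] .
    fix s assume "s \<in> {a..b}"
    then show "integral {a..s} (\<lambda>x. g x - g' x) = 0" using ac_on_increment[OF d, of a s] by simp
  qed
  then show ?thesis by eventually_elim auto
qed

text \<open>The functions r^2 / (r + \<epsilon>) tend to r while their derivatives lie in [0, 1],
  vanish at r = 0 and tend to 1 for r > 0. Passing to the limit in the chain rule shows that g set
  to zero on the zeros of w is again a density of w, and uniqueness concludes. This is what makes
  infinitely many visits to the vertex harmless.\<close>

lemma ac_on_nonneg_zero_set:
  fixes w g :: "real \<Rightarrow> real"
  assumes w: "ac_on a b w g" and pos: "\<And>s. s \<in> {a..b} \<Longrightarrow> 0 \<le> w s"
  shows "AE x in lebesgue. x \<in> {a..b} \<longrightarrow> w x = 0 \<longrightarrow> g x = 0"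
proof -
  have cw: "continuous_on {a..b} w" using ac_on_continuous[OF w] .
  have ag: "g absolutely_integrable_on {a..b}" using ac_on_absolutely_integrable[OF w] .
  obtain u where u: "\<And>s. s \<in> {a..b} \<Longrightarrow> w s \<le> u"
    using continuous_on_Icc_bounded_measurable(1)[OF cw] unfolding bounded_iff
    by (metis abs_le_D1 imageI real_norm_def)
  define \<epsilon> where "\<epsilon> n = 1 / real (Suc n)" for n
  have \<epsilon>: "\<epsilon> n > 0" for n by (simp add: \<epsilon>_def)
  have \<epsilon>0: "\<epsilon> \<longlonglongrightarrow> 0" unfolding \<epsilon>_def[abs_def] using LIMSEQ_inverse_real_of_nat by (simp add: inverse_eq_divide)
  define \<Phi> where "\<Phi> n r = r\<^sup>2 / (r + \<epsilon> n)" for n r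
  define \<Phi>r where "\<Phi>r n r = (r\<^sup>2 + 2 * r * \<epsilon> n) / (r + \<epsilon> n)\<^sup>2" for n r
  have \<Phi>r01: "0 \<le> \<Phi>r n r \<and> \<Phi>r n r \<le> 1" if "r \<ge> 0" for n r
  proof -
    have "r\<^sup>2 + 2 * r * \<epsilon> n \<le> (r + \<epsilon> n)\<^sup>2" by (simp add: power2_sum)
    moreover have "0 < (r + \<epsilon> n)\<^sup>2" using that \<epsilon>[of n] by (intro zero_less_power) simp
    ultimately show ?thesis using that \<epsilon>[of n] by (simp add: \<Phi>r_def divide_le_eq)
  qed
  have ch: "ac_on a b (\<lambda>t. \<Phi> n (w t)) (\<lambda>t. 0 + \<Phi>r n (w t) * g t)" for n
  proof (rule ac_on_chain[OF w, where l = 0 and u = u])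
    show "w s \<in> {0..u}" if "s \<in> {a..b}" for s using pos u that by auto
    show "continuous_on ({0..u} \<times> {a..b}) (\<lambda>(r, t). \<Phi>r n r)"
      unfolding \<Phi>r_def case_prod_beta using \<epsilon>[of n]
      by (intro continuous_intros) (auto simp: add_nonneg_pos less_imp_neq[symmetric])
    show "((\<lambda>r. \<Phi> n r) has_real_derivative \<Phi>r n r) (at r within {0..u})" if "r \<in> {0..u}" for r
    proof -
      have "r + \<epsilon> n \<noteq> 0" using that \<epsilon>[of n] by auto
      then show ?thesis unfolding \<Phi>_def \<Phi>r_def
        by (auto intro!: derivative_eq_intros simp: power2_eq_square field_simps)
    qed
  qed (auto simp: case_prod_beta)
  define G where "G x = (if w x = 0 then 0 else g x)" for x
  have lim: "(\<lambda>n. \<Phi>r n (w x) * g x) \<longlonglongrightarrow> G x" if "x \<in> {a..b}" for x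
  proof (cases "w x = 0")
    case True
    then show ?thesis by (simp add: G_def \<Phi>r_def)
  next
    case False
    then have "(\<lambda>n. \<Phi>r n (w x) * g x) \<longlonglongrightarrow> ((w x)\<^sup>2 + 2 * w x * 0) / (w x + 0)\<^sup>2 * g x"
      unfolding \<Phi>r_def by (intro tendsto_intros \<epsilon>0) auto
    then show ?thesis using False by (simp add: G_def)
  qed
  have limw: "(\<lambda>n. \<Phi> n (w x)) \<longlonglongrightarrow> w x" if "x \<in> {a..b}" for x
  proof (cases "w x = 0")
    case True
    then show ?thesis by (simp add: \<Phi>_def)
  next
    case False
    then have "(\<lambda>n. \<Phi> n (w x)) \<longlonglongrightarrow> (w x)\<^sup>2 / (w x + 0)"
      unfolding \<Phi>_def by (intro tendsto_intros \<epsilon>0) auto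
    then show ?thesis using False by (simp add: power2_eq_square)
  qed
  have "ac_on a b w G"
  proof (rule ac_onI)
    have dc: "G integrable_on {a..s} \<and> (\<lambda>n. integral {a..s} (\<lambda>x. \<Phi>r n (w x) * g x)) \<longlonglongrightarrow> integral {a..s} G"
      if s: "s \<le> b" for s
    proof -
      have i: "(\<lambda>x. \<Phi>r n (w x) * g x) integrable_on {a..s}" for n
        using ac_on_integrable[OF ch[of n], of a s] s by simp
      have j: "(\<lambda>x. norm (g x)) integrable_on {a..s}"
        using absolutely_integrable_on_subIcc[OF ag, of a s] s by (simp add: absolutely_integrable_on_def)
      have bd: "norm (\<Phi>r n (w x) * g x) \<le> norm (g x)" if "x \<in> {a..s}" for n x
        using \<Phi>r01[of "w x" n] pos[of x] that s by (auto simp: abs_mult intro!: mult_left_le_one_le)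
      have l: "(\<lambda>n. \<Phi>r n (w x) * g x) \<longlonglongrightarrow> G x" if "x \<in> {a..s}" for x using lim that s by auto
      show ?thesis
        using dominated_convergence(1)[OF i j bd l] dominated_convergence(2)[OF i j bd l] by blast
    qed
    show "G absolutely_integrable_on {a..b}"
      by (rule absolutely_integrable_integrable_bound[of _ _ "\<lambda>x. norm (g x)"])
        (use dc[of b] ag in \<open>auto simp: G_def absolutely_integrable_on_def\<close>)
    fix s assume s: "a \<le> s" "s \<le> b"
    have "(\<lambda>n. \<Phi> n (w s) - \<Phi> n (w a)) \<longlonglongrightarrow> w s - w a"
      using s by (intro tendsto_diff limw) auto
    moreover have "\<Phi> n (w s) - \<Phi> n (w a) = integral {a..s} (\<lambda>x. \<Phi>r n (w x) * g x)" for n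
      using ac_on_increment[OF ch[of n], of a s] s by simp
    ultimately show "w s - w a = integral {a..s} G"
      using dc[of s] s LIMSEQ_unique by auto
  qed
  from ac_on_deriv_unique[OF w this] show ?thesis
    by eventually_elim (auto simp: G_def)
qed

section \<open>Sobolev functions and absolutely continuous functions\<close>

lemma test_funD:
  assumes "\<eta> \<in> test_fun a b"
  shows "(\<eta> has_real_derivative deriv \<eta> x) (at x)" "continuous_on S (deriv \<eta>)" "continuous_on S \<eta>"
    "x \<notin> {a<..<b} \<Longrightarrow> \<eta> x = 0" "x \<notin> {a<..<b} \<Longrightarrow> deriv \<eta> x = 0"
proof -
  have sm: "smooth_on UNIV \<eta>" and cl: "closure {s. \<eta> s \<noteq> 0} \<subseteq> {a<..<b}"
    using assms by (auto simp: test_fun_def)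
  obtain f' where f': "smooth_on UNIV f'" "\<And>s. s \<in> UNIV \<Longrightarrow> (\<eta> has_real_derivative f' s) (at s within UNIV)"
    using smooth_on_derivE[OF sm] by blast
  have eq: "deriv \<eta> = f'" using f'(2) by (auto intro!: DERIV_imp_deriv)
  show d: "(\<eta> has_real_derivative deriv \<eta> x) (at x)" for x using f'(2) by (simp add: eq)
  have c: "continuous_on S f" if "smooth_on UNIV f" for f and S :: "real set"
    using smooth_on_derivE[OF that] by (metis DERIV_isCont continuous_at_imp_continuous_on UNIV_I)
  show "continuous_on S (deriv \<eta>)" "continuous_on S \<eta>" using c f' sm by (auto simp: eq)
  show z: "\<eta> x = 0" if "x \<notin> {a<..<b}" for x
    using cl that closure_subset[of "{s. \<eta> s \<noteq> 0}"] by blast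
  show "deriv \<eta> x = 0" if "x \<notin> {a<..<b}"
  proof -
    have x: "x \<in> - closure {s. \<eta> s \<noteq> 0}" using cl that by blast
    have "0 = \<eta> y" if "y \<in> - closure {s. \<eta> s \<noteq> 0}" for y
      using that closure_subset[of "{s. \<eta> s \<noteq> 0}"] by force
    from has_field_derivative_transform_within_open[OF DERIV_const open_Compl[OF closed_closure] x this]
    have "(\<eta> has_real_derivative 0) (at x)" .
    then show ?thesis by (rule DERIV_imp_deriv)
  qed
qed

lemma ac_on_test_fun: "\<eta> \<in> test_fun a b \<Longrightarrow> ac_on c d \<eta> (deriv \<eta>)"
proof (rule ac_on_C1)
  fix x assume \<eta>: "\<eta> \<in> test_fun a b"
  have "(\<eta> has_vector_derivative deriv \<eta> x) (at x)"
    using test_funD(1)[OF \<eta>] by (simp only: has_real_derivative_iff_has_vector_derivative)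
  then show "(\<eta> has_vector_derivative deriv \<eta> x) (at x within {c..d})"
    by (rule has_vector_derivative_at_within)
qed (rule test_funD(2))

lemma AE_lebesgue_neq: "AE x in lebesgue. x \<noteq> (c::real)"
  by (rule AE_I[where N = "{c}"]) auto

lemma set_integrable_Ioo_iff:
  fixes f :: "real \<Rightarrow> 'b::euclidean_space"
  shows "set_integrable lebesgue {a<..<b} f \<longleftrightarrow> f absolutely_integrable_on {a..b}"
  by (rule absolutely_integrable_spike_set_eq) (auto intro: negligible_subset[of "{a, b}"])

lemma set_integral_Ioo:
  fixes f :: "real \<Rightarrow> 'b::euclidean_space"
  assumes "f absolutely_integrable_on {a..b}"
  shows "(LINT x:{a<..<b}|lebesgue. f x) = integral {a..b} f"
proof -
  have "f absolutely_integrable_on {a<..<b}" using assms by (simp add: set_integrable_Ioo_iff)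
  then have "(LINT x:{a<..<b}|lebesgue. f x) = integral {a<..<b} f"
    by (rule set_lebesgue_integral_eq_integral(2))
  then show ?thesis by (simp add: integral_open_interval_real)
qed

lemma ac_on_loc_integrable:
  assumes "ac_on a b f g"
  shows "loc_integrable a b g"
proof -
  have i: "set_integrable lebesgue {a<..<b} g"
    using ac_on_absolutely_integrable[OF assms] by (simp add: set_integrable_Ioo_iff)
  then have "g \<in> borel_measurable (lebesgue_on {a<..<b})"
    by (simp add: absolutely_integrable_measurable)
  moreover have "set_integrable lebesgue K g" if "compact K" "K \<subseteq> {a<..<b}" for K
    using set_integrable_subset[OF i] that by (simp add: compact_imp_closed lmeasurable_compact fmeasurableD)
  ultimately show ?thesis by (simp add: loc_integrable_def)
qed

lemma ac_on_imp_weak_deriv: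
  fixes f :: "real \<Rightarrow> 'b::euclidean_space"
  assumes f: "ac_on a b f g" and ab: "a \<le> b"
  shows "is_weak_deriv a b f g"
  unfolding is_weak_deriv_def
proof (intro conjI ballI)
  show "loc_integrable a b g" using ac_on_loc_integrable[OF f] .
  fix \<eta> assume \<eta>: "\<eta> \<in> test_fun a b"
  have cf: "continuous_on {a..b} f" using ac_on_continuous[OF f] .
  have p: "ac_on a b (\<lambda>x. \<eta> x *\<^sub>R f x) (\<lambda>x. deriv \<eta> x *\<^sub>R f x + \<eta> x *\<^sub>R g x)"
    by (rule ac_on_scaleR[OF ac_on_test_fun[OF \<eta>] f])
  have 1: "(\<lambda>x. deriv \<eta> x *\<^sub>R f x) absolutely_integrable_on {a..b}"
    by (intro absolutely_integrable_continuous_real continuous_intros cf test_funD[OF \<eta>])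
  have "(\<lambda>x. (deriv \<eta> x *\<^sub>R f x + \<eta> x *\<^sub>R g x) - deriv \<eta> x *\<^sub>R f x) absolutely_integrable_on {a..b}"
    by (intro set_integral_diff ac_on_absolutely_integrable[OF p] 1)
  then have 2: "(\<lambda>x. \<eta> x *\<^sub>R g x) absolutely_integrable_on {a..b}" by simp
  have "integral {a..b} (\<lambda>x. deriv \<eta> x *\<^sub>R f x) + integral {a..b} (\<lambda>x. \<eta> x *\<^sub>R g x) =
      integral {a..b} (\<lambda>x. deriv \<eta> x *\<^sub>R f x + \<eta> x *\<^sub>R g x)"
    using 1 2 by (intro Henstock_Kurzweil_Integration.integral_add[symmetric] set_lebesgue_integral_eq_integral(1))
  also have "\<dots> = 0"
    using ac_on_increment[OF p, of a b] ab test_funD(4)[OF \<eta>, of a] test_funD(4)[OF \<eta>, of b] by simp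
  finally show "(LINT x:{a<..<b}|lebesgue. deriv \<eta> x *\<^sub>R f x) = - (LINT x:{a<..<b}|lebesgue. \<eta> x *\<^sub>R g x)"
    using set_integral_Ioo[OF 1] set_integral_Ioo[OF 2] by (simp add: eq_neg_iff_add_eq_0)
qed

lemma weak_deriv_imp_ac_on:
  assumes "is_weak_deriv a b f g" "continuous_on {a<..<b} f" "a < t" "s < b"
  shows "ac_on t s f g"
proof (cases "t \<le> s")
  case True
  show ?thesis
  proof (rule ac_onI)
    show "g absolutely_integrable_on {t..s}"
      using weak_deriv_increment[OF assms(1-3) True assms(4)] by blast
    fix r assume "t \<le> r" "r \<le> s"
    then show "f r - f t = integral {t..r} g"
      using weak_deriv_increment(2)[OF assms(1-3), of r] assms(4) by simp
  qed
qed (simp add: ac_on_def not_le)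

text \<open>A weak derivative is only locally integrable in the open interval, so the densities are
  compared on compact subintervals; rational endpoints keep the union of exceptional sets
  null.\<close>

lemma weak_deriv_AE_unique:
  assumes wd: "is_weak_deriv a b f g" and f: "ac_on a b f h"
  shows "AE x in lebesgue. x \<in> {a<..<b} \<longrightarrow> g x = h x"
proof -
  have c: "continuous_on {a<..<b} f"
    using ac_on_continuous[OF f] by (rule continuous_on_subset) auto
  have "AE x in lebesgue. x \<in> {t..s} \<longrightarrow> g x = h x" if "a < t" "s < b" for t s
    using ac_on_deriv_unique[OF weak_deriv_imp_ac_on[OF wd c that] ac_on_subinterval[OF f]] that by auto
  then have "AE x in lebesgue. \<forall>q\<in>\<rat> \<times> \<rat>. a < fst q \<longrightarrow> snd q < b \<longrightarrow> x \<in> {fst q..snd q} \<longrightarrow> g x = h x"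
    by (subst AE_ball_countable) (auto intro: countable_SIGMA countable_rat)
  then show ?thesis
  proof eventually_elim
    case (elim x)
    show ?case
    proof
      assume x: "x \<in> {a<..<b}"
      obtain t where t: "t \<in> \<rat>" "a < t" "t < x" using Rats_dense_in_real[of a x] x by auto
      obtain s where s: "s \<in> \<rat>" "x < s" "s < b" using Rats_dense_in_real[of x b] x by auto
      show "g x = h x" using elim[rule_format, of "(t, s)"] t s by auto
    qed
  qed
qed

lemma weak_deriv_AE_eq:
  assumes "ac_on a b f g" "a \<le> b"
  shows "is_weak_deriv a b f (weak_deriv a b f)"
    and "AE x in lebesgue. x \<in> {a<..<b} \<longrightarrow> weak_deriv a b f x = g x"
proof -
  show w: "is_weak_deriv a b f (weak_deriv a b f)"
    unfolding weak_deriv_def by (rule someI[of _ g]) (rule ac_on_imp_weak_deriv[OF assms])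
  show "AE x in lebesgue. x \<in> {a<..<b} \<longrightarrow> weak_deriv a b f x = g x"
    using weak_deriv_AE_unique[OF w assms(1)] .
qed

lemma integrable_const_Ioo: "integrable (lebesgue_on {a<..<b}) (\<lambda>_. c)" for a b c :: real
  by (intro finite_measure.integrable_const finite_measure_lebesgue_on bounded_set_imp_lmeasurable) auto

lemma Lp_fun_absolutely_integrable:
  fixes g :: "real \<Rightarrow> 'b::euclidean_space"
  assumes g: "Lp_fun a b p g" and p: "p \<ge> 1"
  shows "g absolutely_integrable_on {a..b}"
proof -
  have m: "g \<in> borel_measurable (lebesgue_on {a<..<b})"
    and i: "integrable (lebesgue_on {a<..<b}) (\<lambda>s. norm (g s) powr p)"
    using g by (auto simp: Lp_fun_def)
  have "integrable (lebesgue_on {a<..<b}) (\<lambda>s. 1 + norm (g s) powr p)"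
    by (intro Bochner_Integration.integrable_add i) (rule integrable_const_Ioo)
  then have "integrable (lebesgue_on {a<..<b}) g"
  proof (rule Bochner_Integration.integrable_bound[OF _ m])
    have "norm x \<le> 1 + norm x powr p" for x :: 'b
    proof (cases "norm x \<le> 1")
      case False
      then have "norm x powr 1 \<le> norm x powr p" using p by (intro powr_mono) auto
      then show ?thesis using False by simp
    qed (simp add: add_increasing2)
    then show "AE x in lebesgue_on {a<..<b}. norm (g x) \<le> norm (1 + norm (g x) powr p)"
      by (intro AE_I2) (metis abs_of_nonneg add_nonneg_nonneg powr_ge_zero real_norm_def zero_le_one)
  qed
  then have "set_integrable lebesgue {a<..<b} g"
    by (simp add: set_integrable_def integrable_restrict_space)
  then show ?thesis by (simp add: set_integrable_Ioo_iff)
qed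

text \<open>Subtracting the primitive of g leaves a function that is constant inside the interval
  and, by continuity, up to the endpoints. The primitive reaches the endpoints because an L^p
  density is integrable on the whole bounded interval.\<close>

lemma sobolev_W1_imp_ac_on:
  fixes f :: "real \<Rightarrow> 'b::euclidean_space"
  assumes W: "sobolev_W1 a b p f" and c: "continuous_on {a..b} f" and p: "p \<ge> 1" and ab: "a < b"
  obtains g where "ac_on a b f g" "Lp_fun a b p g"
proof -
  obtain g where g: "Lp_fun a b p g" "is_weak_deriv a b f g" using W by (auto simp: sobolev_W1_def)
  have ai: "g absolutely_integrable_on {a..b}" using Lp_fun_absolutely_integrable[OF g(1) p] .
  have c': "continuous_on {a<..<b} f" using c by (rule continuous_on_subset) auto
  define F where "F s = f s - integral {a..s} g" for s
  have cF: "continuous_on (closure {a<..<b}) F"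
    using ab integrable_on_subIcc[OF ai]
    unfolding F_def[abs_def] closure_greaterThanLessThan[OF ab]
    by (intro continuous_intros c indefinite_integral_continuous_1) auto
  define m where "m = (a + b) / 2"
  have m: "a < m" "m < b" using ab by (auto simp: m_def)
  have inc: "F s = F t" if "a < t" "t \<le> s" "s < b" for s t
  proof -
    have "integral {a..t} g + integral {t..s} g = integral {a..s} g"
      using that by (intro Henstock_Kurzweil_Integration.integral_combine integrable_on_subIcc[OF ai]) auto
    then show ?thesis using weak_deriv_increment(2)[OF g(2) c' that] by (simp add: F_def algebra_simps)
  qed
  have const: "F s = F m" if "s \<in> {a..b}" for s
  proof (rule continuous_constant_on_closure[OF cF])
    fix x assume "x \<in> {a<..<b}"
    then show "F x = F m" using inc[of x m] inc[of m x] m by (cases "x \<le> m") auto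
  qed (use that ab in auto)
  have "ac_on a b f g"
  proof (rule ac_onI[OF ai])
    fix s assume "a \<le> s" "s \<le> b"
    then have "F s = F a" using const[of s] const[of a] ab by auto
    then show "f s - f a = integral {a..s} g" by (simp add: F_def algebra_simps)
  qed
  then show ?thesis using g that by blast
qed

lemma Lp_fun_bounded:
  fixes f :: "real \<Rightarrow> 'b::euclidean_space"
  assumes m: "f \<in> borel_measurable (lebesgue_on {a<..<b})" and B: "\<And>x. x \<in> {a<..<b} \<Longrightarrow> norm (f x) \<le> B" and p: "p \<ge> 0"
  shows "Lp_fun a b p f"
  unfolding Lp_fun_def
proof
  show "integrable (lebesgue_on {a<..<b}) (\<lambda>s. norm (f s) powr p)"
  proof (rule Bochner_Integration.integrable_bound[where f = "\<lambda>_. B powr p"])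
    show "integrable (lebesgue_on {a<..<b}) (\<lambda>_. B powr p)" by (rule integrable_const_Ioo)
    show "(\<lambda>s. norm (f s) powr p) \<in> borel_measurable (lebesgue_on {a<..<b})" using m by measurable
    show "AE x in lebesgue_on {a<..<b}. norm (norm (f x) powr p) \<le> norm (B powr p)"
      using B p by (intro AE_I2) (auto intro!: powr_mono2)
  qed
qed fact

lemma ac_on_imp_sobolev_W1:
  fixes f :: "real \<Rightarrow> 'b::euclidean_space"
  assumes f: "ac_on a b f g" and g: "Lp_fun a b p g" and ab: "a \<le> b" and p: "p \<ge> 0"
  shows "sobolev_W1 a b p f"
proof -
  have c: "continuous_on {a..b} f" using ac_on_continuous[OF f] .
  obtain B where B: "\<And>x. x \<in> {a..b} \<Longrightarrow> norm (f x) \<le> B"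
    using continuous_on_Icc_bounded_measurable(1)[OF c] unfolding bounded_iff by blast
  have "continuous_on {a<..<b} f" using c by (rule continuous_on_subset) auto
  then have m: "f \<in> borel_measurable (lebesgue_on {a<..<b})"
    by (rule continuous_imp_measurable_on_sets_lebesgue) auto
  show ?thesis
    unfolding sobolev_W1_def using g ac_on_imp_weak_deriv[OF f ab] Lp_fun_bounded[OF m _ p, of B] B by auto
qed

lemma powr_add_le: "\<lbrakk>0 \<le> x; 0 \<le> y; 0 \<le> p\<rbrakk> \<Longrightarrow> (x + y) powr p \<le> 2 powr p * (x powr p + y powr p)" for x y p :: real
proof -
  assume a: "0 \<le> x" "0 \<le> y" "0 \<le> p"
  have "(x + y) powr p \<le> (2 * max x y) powr p" using a by (intro powr_mono2) auto
  also have "\<dots> = 2 powr p * max x y powr p" using a by (intro powr_mult) 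
  also have "\<dots> \<le> 2 powr p * (x powr p + y powr p)" by (intro mult_left_mono) (auto simp: max_def)
  finally show ?thesis .
qed

lemma Lp_fun_add:
  fixes f g :: "real \<Rightarrow> 'b::euclidean_space"
  assumes f: "Lp_fun a b p f" and g: "Lp_fun a b p g" and p: "p \<ge> 0"
  shows "Lp_fun a b p (\<lambda>x. f x + g x)"
  unfolding Lp_fun_def
proof
  show m: "(\<lambda>x. f x + g x) \<in> borel_measurable (lebesgue_on {a<..<b})"
    using f g by (auto simp: Lp_fun_def)
  show "integrable (lebesgue_on {a<..<b}) (\<lambda>s. norm (f s + g s) powr p)"
  proof (rule Bochner_Integration.integrable_bound[where f = "\<lambda>s. 2 powr p * (norm (f s) powr p + norm (g s) powr p)"])
    show "integrable (lebesgue_on {a<..<b}) (\<lambda>s. 2 powr p * (norm (f s) powr p + norm (g s) powr p))"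
      using f g by (auto simp: Lp_fun_def)
    show "(\<lambda>s. norm (f s + g s) powr p) \<in> borel_measurable (lebesgue_on {a<..<b})" using m by measurable
    have "norm (x + y) powr p \<le> 2 powr p * (norm x powr p + norm y powr p)" for x y :: 'b
    proof -
      have "norm (x + y) powr p \<le> (norm x + norm y) powr p"
        using p by (intro powr_mono2 norm_triangle_ineq) auto
      also have "\<dots> \<le> 2 powr p * (norm x powr p + norm y powr p)" using p by (intro powr_add_le) auto
      finally show ?thesis .
    qed
    then show "AE s in lebesgue_on {a<..<b}. norm (norm (f s + g s) powr p) \<le> norm (2 powr p * (norm (f s) powr p + norm (g s) powr p))"
      by (intro AE_I2) (simp add: abs_of_nonneg)
  qed
qed

lemma Lp_fun_bounded_linear:
  fixes f :: "real \<Rightarrow> 'b::euclidean_space" and h :: "'b \<Rightarrow> 'c::euclidean_space"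
  assumes f: "Lp_fun a b p f" and h: "bounded_linear h" and p: "p \<ge> 0"
  shows "Lp_fun a b p (\<lambda>x. h (f x))"
  unfolding Lp_fun_def
proof
  have ch: "h \<in> borel_measurable borel"
    using h by (intro borel_measurable_continuous_onI linear_continuous_on)
  show m: "(\<lambda>x. h (f x)) \<in> borel_measurable (lebesgue_on {a<..<b})"
    using f by (intro measurable_compose[OF _ ch]) (auto simp: Lp_fun_def)
  obtain K where K: "K > 0" "\<And>x. norm (h x) \<le> norm x * K" using bounded_linear.pos_bounded[OF h] by blast
  show "integrable (lebesgue_on {a<..<b}) (\<lambda>s. norm (h (f s)) powr p)"
  proof (rule Bochner_Integration.integrable_bound[where f = "\<lambda>s. K powr p * norm (f s) powr p"])
    show "integrable (lebesgue_on {a<..<b}) (\<lambda>s. K powr p * norm (f s) powr p)"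
      using f by (auto simp: Lp_fun_def)
    show "(\<lambda>s. norm (h (f s)) powr p) \<in> borel_measurable (lebesgue_on {a<..<b})" using m by measurable
    have "norm (h x) powr p \<le> K powr p * norm x powr p" for x
    proof -
      have "norm (h x) powr p \<le> (K * norm x) powr p"
        using K(2)[of x] p by (intro powr_mono2) (auto simp: mult.commute)
      then show ?thesis using K(1) by (simp add: powr_mult)
    qed
    then show "AE s in lebesgue_on {a<..<b}. norm (norm (h (f s)) powr p) \<le> norm (K powr p * norm (f s) powr p)"
      by (intro AE_I2) (simp add: abs_of_nonneg)
  qed
qed

section \<open>The junction\<close>

lemma axis_component: "axis i (1 :: real) $ j = (if j = i then 1 else 0)"
  by (simp add: axis_def)

lemma axis_scaleR_in_edge: "0 \<le> r \<Longrightarrow> r *\<^sub>R axis i 1 \<in> edge i"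
  by (auto simp: edge_def)

lemma edgeD:
  assumes "x \<in> edge i"
  shows "x = norm x *\<^sub>R axis i 1" "x $ i = norm x" "j \<noteq> i \<Longrightarrow> x $ j = 0"
proof -
  obtain r where r: "x = r *\<^sub>R axis i 1" "0 \<le> r" using assms by (auto simp: edge_def)
  then have n: "norm x = r" by simp
  show "x = norm x *\<^sub>R axis i 1" using r n by simp
  show "x $ i = norm x" using r by (simp add: n axis_component)
  show "x $ j = 0" if "j \<noteq> i" using r that by (simp add: axis_component)
qed

lemma junction_cases:
  assumes "x \<in> junction"
  obtains "x = 0" | i r where "r > 0" "x = r *\<^sub>R axis i 1"
proof -
  obtain i where i: "x \<in> edge i" using assms by (auto simp: junction_def)
  show ?thesis
  proof (cases "x = 0")
    case False
    then show ?thesis using edgeD(1)[OF i] that(2)[of "norm x" i] by simp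
  qed (use that in blast)
qed

lemma scaleR_axis_edge_iff: "r > 0 \<Longrightarrow> r *\<^sub>R axis i 1 \<in> edge j - {0} \<longleftrightarrow> i = j"
proof (cases "i = j")
  case False
  assume "r > 0"
  then have "r *\<^sub>R axis i 1 \<notin> edge j"
    using edgeD(3)[of "r *\<^sub>R axis i 1" j i] False by (auto simp: axis_component)
  then show ?thesis using False by simp
qed (simp add: axis_scaleR_in_edge axis_eq_0_iff)

lemma edge_subset_junction: "edge i \<subseteq> junction"
  by (auto simp: junction_def)

lemma axis_scaleR_in_junction: "0 \<le> r \<Longrightarrow> r *\<^sub>R axis i 1 \<in> junction"
  using axis_scaleR_in_edge edge_subset_junction by blast

lemma zero_in_junction: "0 \<in> junction"
  using axis_scaleR_in_junction[of 0] by simp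

lemma junction_component:
  assumes "x \<in> junction"
  shows "0 \<le> x $ i" "x $ i \<le> norm x" "norm x = (\<Sum>j\<in>UNIV. x $ j)"
proof -
  have *: "0 \<le> x $ i \<and> x $ i \<le> norm x \<and> norm x = (\<Sum>j\<in>UNIV. x $ j)"
    using assms
  proof (cases rule: junction_cases)
    case (2 k r)
    have "(\<Sum>j\<in>UNIV. x $ j) = (\<Sum>j\<in>UNIV. if j = k then r else 0)"
      unfolding 2 by (intro sum.cong) (auto simp: axis_component)
    then show ?thesis using 2 by (simp add: axis_component)
  qed simp
  then show "0 \<le> x $ i" "x $ i \<le> norm x" "norm x = (\<Sum>j\<in>UNIV. x $ j)" by blast+
qed

lemma junction_component_pos:
  assumes "x \<in> junction" "x $ i > 0"
  shows "x \<in> edge i - {0}" "x = (x $ i) *\<^sub>R axis i 1" "norm x = x $ i"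
proof -
  show "x \<in> edge i - {0}"
    using assms(1)
  proof (cases rule: junction_cases)
    case (2 j r)
    then have "j = i" using assms(2) by (auto simp: axis_component split: if_splits)
    then show ?thesis using scaleR_axis_edge_iff[OF 2(1), of i i] by (simp add: 2(2))
  qed (use assms in simp)
  then have x: "x \<in> edge i" by blast
  then show "norm x = x $ i" using edgeD(2) by metis
  then show "x = (x $ i) *\<^sub>R axis i 1" using edgeD(1)[OF x] by simp
qed

text \<open>Membership in an open edge becomes the sign of a coordinate. Coordinates are linear,
  hence absolutely continuous along curves, while the indicator of the edge is not.\<close>

lemma edge_minus_zero_iff: "x \<in> edge i - {0} \<longleftrightarrow> x \<in> junction \<and> x $ i > 0"
proof
  assume x: "x \<in> edge i - {0}"
  then have "x $ i = norm x" by (intro edgeD(2)) simp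
  then show "x \<in> junction \<and> x $ i > 0" using x edge_subset_junction[of i] by auto
qed (use junction_component_pos(1) in blast)

lemma scaleR_junction: "x \<in> junction \<Longrightarrow> 0 \<le> c \<Longrightarrow> c *\<^sub>R x \<in> junction"
  by (erule junction_cases) (auto simp: zero_in_junction intro!: axis_scaleR_in_junction)

lemma closed_edge: "closed (edge i :: (real ^ 'n::finite) set)"
proof -
  have "edge i = {x :: real ^ 'n. 0 \<le> x $ i} \<inter> (\<Inter>j\<in>-{i}. {x. x $ j = 0})"
  proof (intro set_eqI iffI)
    fix x :: "real ^ 'n" assume x: "x \<in> {x. 0 \<le> x $ i} \<inter> (\<Inter>j\<in>-{i}. {x. x $ j = 0})"
    then have "x = (x $ i) *\<^sub>R axis i 1" by (auto simp: vec_eq_iff axis_component)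
    then show "x \<in> edge i" using x by (metis (no_types) IntD1 axis_scaleR_in_edge mem_Collect_eq)
  qed (auto dest: edgeD)
  moreover have "closed {x :: real ^ 'n. 0 \<le> x $ j}" "closed {x :: real ^ 'n. x $ j = 0}" for j :: 'n
    by (auto intro!: closed_Collect_le closed_Collect_eq continuous_intros)
  ultimately show ?thesis by (auto intro!: closed_Int closed_INT)
qed

lemma jdist_zero: "x \<in> junction \<Longrightarrow> jdist x 0 = norm x"
  unfolding jdist_def by simp

text \<open>For points on different edges the difference has x and y as orthogonal components, so
  each of the two norms is at most the norm of x - y. This is the origin of the factor 2.\<close>

lemma jdist_le:
  assumes "x \<in> junction" "y \<in> junction"
  shows "jdist x y \<le> 2 * norm (x - y)"
proof (cases "\<exists>i. x \<in> edge i \<and> y \<in> edge i")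
  case False
  obtain i where i: "x \<in> edge i" using assms by (auto simp: junction_def)
  obtain j where j: "y \<in> edge j" using assms by (auto simp: junction_def)
  have "i \<noteq> j" using False i j by auto
  have "norm x \<le> norm (x - y)"
    using component_le_norm_cart[of "x - y" i] edgeD(2)[OF i] edgeD(3)[OF j, of i] \<open>i \<noteq> j\<close> by simp
  moreover have "norm y \<le> norm (x - y)"
    using component_le_norm_cart[of "x - y" j] edgeD(2)[OF j] edgeD(3)[OF i, of j] \<open>i \<noteq> j\<close> by simp
  ultimately show ?thesis using False by (simp add: jdist_def)
qed (simp add: jdist_def)

section \<open>Admissible curves\<close>

text \<open>The counterpart of \<open>Gamma_from\<close> for plain functions: gluing, restricting,
  scaling and perturbing curves can be done without constructing bounded continuous functions each
  time. \<open>Gamma_from_adm\<close> and \<open>adm_Gamma_from\<close> translate between the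
  two.\<close>

definition adm :: "real \<Rightarrow> real \<Rightarrow> real \<Rightarrow> (real \<Rightarrow> real ^ 'n::finite) \<Rightarrow> bool" where
  "adm T p t y \<longleftrightarrow> (\<forall>s\<le>t. y s = y t) \<and> (\<forall>s\<ge>T. y s = y T) \<and> (\<forall>s\<in>{t..T}. y s \<in> junction) \<and>
     (\<exists>h. ac_on t T y h \<and> (\<lambda>s. norm (h s) powr p) absolutely_integrable_on {t..T})"

lemma admI:
  assumes "\<And>s. s \<le> t \<Longrightarrow> y s = y t" "\<And>s. s \<ge> T \<Longrightarrow> y s = y T" "\<And>s. s \<in> {t..T} \<Longrightarrow> y s \<in> junction"
    and "ac_on t T y h" "(\<lambda>s. norm (h s) powr p) absolutely_integrable_on {t..T}"
  shows "adm T p t y"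
  unfolding adm_def using assms by blast

lemma admD:
  assumes "adm T p t y"
  shows "s \<le> t \<Longrightarrow> y s = y t" "s \<ge> T \<Longrightarrow> y s = y T" "s \<in> {t..T} \<Longrightarrow> y s \<in> junction"
  using assms unfolding adm_def by blast+

lemma admE:
  assumes "adm T p t y"
  obtains h where "ac_on t T y h" "(\<lambda>s. norm (h s) powr p) absolutely_integrable_on {t..T}"
  using assms unfolding adm_def by blast

lemma absolutely_integrable_imp_measurable_Ioo:
  fixes f :: "real \<Rightarrow> 'b::euclidean_space"
  assumes "f absolutely_integrable_on {a..b}"
  shows "f \<in> borel_measurable (lebesgue_on {a<..<b})"
proof -
  have "f absolutely_integrable_on {a<..<b}" using assms by (simp add: set_integrable_Ioo_iff)
  then show ?thesis by (simp add: absolutely_integrable_measurable)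
qed

lemma Lp_fun_iff:
  fixes f :: "real \<Rightarrow> 'b::euclidean_space"
  assumes "f absolutely_integrable_on {a..b}"
  shows "Lp_fun a b p f \<longleftrightarrow> (\<lambda>s. norm (f s) powr p) absolutely_integrable_on {a..b}"
proof -
  have "integrable (lebesgue_on {a<..<b}) (\<lambda>s. norm (f s) powr p) \<longleftrightarrow>
      set_integrable lebesgue {a<..<b} (\<lambda>s. norm (f s) powr p)"
    by (simp add: set_integrable_def integrable_restrict_space)
  then show ?thesis
    unfolding Lp_fun_def set_integrable_Ioo_iff using absolutely_integrable_imp_measurable_Ioo[OF assms] by blast
qed

lemma AE_negligibleE:
  assumes "AE x in lebesgue. P x"
  obtains N where "negligible N" "\<And>x. x \<notin> N \<Longrightarrow> P x"
proof -
  from assms obtain N where N: "{x \<in> space lebesgue. \<not> P x} \<subseteq> N" "emeasure lebesgue N = 0" "N \<in> sets lebesgue"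
    by (rule AE_E)
  have "negligible N" using N by (simp add: negligible_iff_null_sets null_sets_def)
  moreover have "P x" if "x \<notin> N" for x using N(1) that by auto
  ultimately show ?thesis using that by blast
qed

lemma absolutely_integrable_AE:
  fixes f g :: "real \<Rightarrow> 'b::euclidean_space"
  assumes "f absolutely_integrable_on {a..b}" "AE x in lebesgue. x \<in> {a..b} \<longrightarrow> g x = f x"
  shows "g absolutely_integrable_on {a..b}" "integral {a..b} g = integral {a..b} f"
proof -
  obtain N where N: "negligible N" "\<And>x. x \<notin> N \<Longrightarrow> x \<in> {a..b} \<longrightarrow> g x = f x"
    using AE_negligibleE[OF assms(2)] by metis
  show "g absolutely_integrable_on {a..b}"
    by (rule absolutely_integrable_spike[OF assms(1) N(1)]) (use N(2) in blast)
  show "integral {a..b} g = integral {a..b} f"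
    by (rule integral_spike[OF N(1)]) (use N(2) in force)
qed

lemma absolutely_integrable_join:
  fixes f g :: "real \<Rightarrow> 'b::euclidean_space"
  assumes f: "f absolutely_integrable_on {a..c}" and g: "g absolutely_integrable_on {c..b}" and "a \<le> c" "c \<le> b"
  shows "(\<lambda>x. if x \<le> c then f x else g x) absolutely_integrable_on {a..b}"
proof -
  let ?k = "\<lambda>x. if x \<le> c then f x else g x"
  have 1: "?k absolutely_integrable_on {a..c}"
    by (rule absolutely_integrable_spike[OF f, of "{}"]) auto
  have 2: "?k absolutely_integrable_on {c..b}"
    by (rule absolutely_integrable_spike[OF g, of "{c}"]) auto
  show ?thesis
    using set_integrable_Un[OF 1 2] assms(3,4) by (simp add: ivl_disj_un_two_touch)
qed

lemma Gamma_from_adm: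
  assumes z: "z \<in> Gamma_from T p t x" and tT: "t < T" and p: "p > 1"
  shows "adm T p t (apply_bcontfun z)" "apply_bcontfun z t = x"
proof -
  let ?y = "apply_bcontfun z"
  have W: "sobolev_W1 t T p ?y" using z by (simp add: Gamma_from_def)
  have "continuous_on {t..T} ?y"
    using apply_bcontfun[of z] unfolding bcontfun_def by (auto intro: continuous_on_subset)
  then obtain h where h: "ac_on t T ?y h" "Lp_fun t T p h"
    using sobolev_W1_imp_ac_on[OF W _ _ tT] p by auto
  show "adm T p t ?y"
  proof (rule admI[OF _ _ _ h(1)])
    show "(\<lambda>s. norm (h s) powr p) absolutely_integrable_on {t..T}"
      using Lp_fun_iff[OF ac_on_absolutely_integrable[OF h(1)], of p] h(2) by blast
  qed (use z[unfolded Gamma_from_def] in blast)+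
  show "?y t = x" using z by (simp add: Gamma_from_def)
qed

lemma adm_Gamma_from:
  assumes y: "adm T p t y" and tT: "t < T" and p: "p > 1"
  shows "\<exists>z\<in>Gamma_from T p t (y t). apply_bcontfun z = y"
proof -
  obtain h where h: "ac_on t T y h" "(\<lambda>s. norm (h s) powr p) absolutely_integrable_on {t..T}"
    by (rule admE[OF y])
  have L: "Lp_fun t T p h" using Lp_fun_iff[OF ac_on_absolutely_integrable[OF h(1)]] h(2) by simp
  have W: "sobolev_W1 t T p y" using ac_on_imp_sobolev_W1[OF h(1) L] tT p by simp
  have c: "continuous_on {t..T} y" using ac_on_continuous[OF h(1)] .
  \<comment> \<open>Projection of the line onto [t, T]. The curve factors through it, which gives
    continuity and boundedness on the whole line at once.\<close>
  define k where "k s = max t (min T s)" for s :: real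
  have k: "k s \<in> {t..T}" for s using tT by (auto simp: k_def)
  have yk: "y s = y (k s)" for s
  proof -
    consider "s \<le> t" | "t \<le> s" "s \<le> T" | "T \<le> s" by linarith
    then show ?thesis
    proof cases
      case 1
      then show ?thesis using admD(1)[OF y 1] tT by (simp add: k_def)
    next
      case 2
      then show ?thesis by (simp add: k_def)
    next
      case 3
      then show ?thesis using admD(2)[OF y 3] tT by (simp add: k_def)
    qed
  qed
  have "continuous_on UNIV (\<lambda>s. y (k s))"
    by (rule continuous_on_compose2[OF c]) (use k in \<open>auto simp: k_def intro!: continuous_intros\<close>)
  then have "continuous_on UNIV y" using yk by simp
  moreover have "bounded (range y)"
  proof (rule bounded_subset)
    show "bounded (y ` {t..T})" using continuous_on_Icc_bounded_measurable(1)[OF c] .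
    show "range y \<subseteq> y ` {t..T}" using yk k by blast
  qed
  ultimately have "y \<in> bcontfun" by (simp add: bcontfun_def)
  then have a: "apply_bcontfun (Bcontfun y) = y" by (rule Bcontfun_inverse)
  have "Bcontfun y \<in> Gamma_from T p t (y t)"
    unfolding Gamma_from_def mem_Collect_eq a using admD[OF y] W by blast
  then show ?thesis using a by blast
qed

lemma adm_glue:
  assumes y: "adm T p a y" and z: "adm T p t z" and eq: "y t = z t" and at: "a \<le> t" "t \<le> T"
  shows "adm T p a (\<lambda>s. if s \<le> t then y s else z s)"
proof -
  obtain h where h: "ac_on a T y h" "(\<lambda>s. norm (h s) powr p) absolutely_integrable_on {a..T}"
    by (rule admE[OF y])
  obtain k where k: "ac_on t T z k" "(\<lambda>s. norm (k s) powr p) absolutely_integrable_on {t..T}"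
    by (rule admE[OF z])
  let ?g = "\<lambda>s. if s \<le> t then y s else z s"
  have "ac_on a t ?g h"
    using ac_on_cong[of a t ?g y] ac_on_subinterval[OF h(1), of a t] at by simp
  moreover have "ac_on t T ?g k"
    using ac_on_cong[of t T ?g z] k(1) eq by auto
  ultimately have ac: "ac_on a T ?g (\<lambda>s. if s \<le> t then h s else k s)"
    by (rule ac_on_join[OF _ _ at])
  have "(\<lambda>s. if s \<le> t then norm (h s) powr p else norm (k s) powr p) absolutely_integrable_on {a..T}"
    by (rule absolutely_integrable_join[OF absolutely_integrable_on_subIcc[OF h(2)] k(2) at]) (use at in auto)
  then have Lp: "(\<lambda>s. norm (if s \<le> t then h s else k s) powr p) absolutely_integrable_on {a..T}"
    by (rule back_subst[of "\<lambda>f. f absolutely_integrable_on {a..T}"]) auto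
  show ?thesis
  proof (rule admI[OF _ _ _ ac Lp])
    show "?g s = ?g a" if "s \<le> a" for s using admD(1)[OF y that] that at by simp
    show "?g s = ?g T" if "s \<ge> T" for s
    proof (cases "t = T")
      case True
      then show ?thesis using admD(2)[OF z that] that eq by auto
    next
      case False
      then show ?thesis using admD(2)[OF z that] that at by auto
    qed
    show "?g s \<in> junction" if "s \<in> {a..T}" for s
      using admD(3)[OF y that] admD(3)[OF z, of s] that by auto
  qed
qed

lemma adm_restrict:
  assumes y: "adm T p a y" and at: "a \<le> t" "t \<le> T"
  shows "adm T p t (\<lambda>s. y (max s t))"
proof -
  obtain h where h: "ac_on a T y h" "(\<lambda>s. norm (h s) powr p) absolutely_integrable_on {a..T}"
    by (rule admE[OF y])
  have "ac_on t T (\<lambda>s. y (max s t)) h"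
    using ac_on_cong[of t T "\<lambda>s. y (max s t)" y] ac_on_subinterval[OF h(1), of t T] at by (auto simp: max_def)
  moreover have "(\<lambda>s. norm (h s) powr p) absolutely_integrable_on {t..T}"
    using absolutely_integrable_on_subIcc[OF h(2)] at by auto
  ultimately show ?thesis
  proof (rule admI[rotated 3])
    show "y (max s t) = y (max T t)" if "s \<ge> T" for s
      using admD(2)[OF y that] that at by (simp add: max_absorb1)
    show "y (max s t) \<in> junction" if "s \<in> {t..T}" for s
      using admD(3)[OF y, of s] that at by (simp add: max_absorb1)
  qed (simp add: max_def)
qed

lemma adm_scaleR:
  assumes y: "adm T p t y" and c: "0 \<le> c"
  shows "adm T p t (\<lambda>s. c *\<^sub>R y s)"
proof -
  obtain h where h: "ac_on t T y h" "(\<lambda>s. norm (h s) powr p) absolutely_integrable_on {t..T}"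
    by (rule admE[OF y])
  have "ac_on t T (\<lambda>s. c *\<^sub>R y s) (\<lambda>s. c *\<^sub>R h s)"
    by (rule ac_on_bounded_linear[OF h(1) bounded_linear_scaleR_right])
  moreover have "(\<lambda>s. norm (c *\<^sub>R h s) powr p) absolutely_integrable_on {t..T}"
    using absolutely_integrable_scaleR_left[OF h(2), of "c powr p"] c by (simp add: powr_mult)
  ultimately show ?thesis
  proof (rule admI[rotated 3])
    show "c *\<^sub>R y s = c *\<^sub>R y t" if "s \<le> t" for s using admD(1)[OF y that] by (rule arg_cong)
    show "c *\<^sub>R y s = c *\<^sub>R y T" if "s \<ge> T" for s using admD(2)[OF y that] by (rule arg_cong)
    show "c *\<^sub>R y s \<in> junction" if "s \<in> {t..T}" for s using scaleR_junction[OF admD(3)[OF y that] c] .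
  qed
qed

lemma adm_const: "x \<in> junction \<Longrightarrow> p > 0 \<Longrightarrow> adm T p t (\<lambda>_. x)"
  by (rule admI[where h = "\<lambda>_. 0"]) (auto simp: ac_on_def)

lemma adm_add_axis:
  assumes y: "adm T p t y" and \<xi>: "ac_on t T \<xi> \<zeta>" and \<zeta>: "\<And>s. s \<in> {t..T} \<Longrightarrow> \<bar>\<zeta> s\<bar> \<le> B"
    and const: "\<And>s. s \<le> t \<Longrightarrow> \<xi> s = \<xi> t" "\<And>s. s \<ge> T \<Longrightarrow> \<xi> s = \<xi> T"
    and J: "\<And>s. s \<in> {t..T} \<Longrightarrow> y s + \<xi> s *\<^sub>R axis i 1 \<in> junction" and p: "p \<ge> 0"
  shows "adm T p t (\<lambda>s. y s + \<xi> s *\<^sub>R axis i 1)"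
proof -
  obtain h where h: "ac_on t T y h" "(\<lambda>s. norm (h s) powr p) absolutely_integrable_on {t..T}"
    by (rule admE[OF y])
  have \<xi>': "ac_on t T (\<lambda>s. \<xi> s *\<^sub>R axis i 1 :: real ^ 'a) (\<lambda>s. \<zeta> s *\<^sub>R axis i 1)"
    by (rule ac_on_bounded_linear[OF \<xi> bounded_linear_scaleR_left])
  have ac: "ac_on t T (\<lambda>s. y s + \<xi> s *\<^sub>R axis i 1) (\<lambda>s. h s + \<zeta> s *\<^sub>R axis i 1)"
    by (rule ac_on_add[OF h(1) \<xi>'])
  have "Lp_fun t T p (\<lambda>s. \<zeta> s *\<^sub>R axis i 1 :: real ^ 'a)"
    by (rule Lp_fun_bounded[where B = B])
      (use \<zeta> p absolutely_integrable_imp_measurable_Ioo[OF ac_on_absolutely_integrable[OF \<xi>']] in auto)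
  moreover have "Lp_fun t T p h"
    using Lp_fun_iff[OF ac_on_absolutely_integrable[OF h(1)]] h(2) by simp
  ultimately have "Lp_fun t T p (\<lambda>s. h s + \<zeta> s *\<^sub>R axis i 1)"
    using p by (intro Lp_fun_add)
  then have "(\<lambda>s. norm (h s + \<zeta> s *\<^sub>R axis i 1) powr p) absolutely_integrable_on {t..T}"
    using Lp_fun_iff[OF ac_on_absolutely_integrable[OF ac]] by simp
  moreover have "y s + \<xi> s *\<^sub>R axis i 1 = y t + \<xi> t *\<^sub>R axis i 1" if "s \<le> t" for s
    using admD(1)[OF y that] const(1)[OF that] by simp
  moreover have "y s + \<xi> s *\<^sub>R axis i 1 = y T + \<xi> T *\<^sub>R axis i 1" if "s \<ge> T" for s
    using admD(2)[OF y that] const(2)[OF that] by simp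
  ultimately show ?thesis
    using ac J by (intro admI) blast+
qed

text \<open>On the junction the norm is the sum of the coordinates, hence linear along curves.\<close>

lemma ac_on_norm:
  assumes "ac_on t T y h" "\<And>s. s \<in> {t..T} \<Longrightarrow> y s \<in> junction"
  shows "ac_on t T (\<lambda>s. norm (y s)) (\<lambda>s. \<Sum>j\<in>UNIV. h s $ j)"
proof -
  have "ac_on t T (\<lambda>s. \<Sum>j\<in>UNIV. y s $ j) (\<lambda>s. \<Sum>j\<in>UNIV. h s $ j)"
    by (rule ac_on_sum) (auto intro: ac_on_bounded_linear[OF assms(1) bounded_linear_vec_nth])
  then show ?thesis
    using ac_on_cong[of t T "\<lambda>s. norm (y s)" "\<lambda>s. \<Sum>j\<in>UNIV. y s $ j"] assms(2) junction_component(3) by auto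
qed

lemma adm_norm_ac:
  assumes y: "adm T p t y" and p: "p \<ge> 0"
  obtains v where "ac_on t T (\<lambda>s. norm (y s)) v"
proof -
  obtain h where h: "ac_on t T y h" using admE[OF y] by blast
  show ?thesis using that[OF ac_on_norm[OF h]] admD(3)[OF y] by blast
qed

lemma adm_norm_Lp:
  assumes y: "adm T p t y" and p: "p \<ge> 0" and v: "ac_on t T (\<lambda>s. norm (y s)) v"
  shows "(\<lambda>s. \<bar>v s\<bar> powr p) absolutely_integrable_on {t..T}"
proof -
  obtain h where h: "ac_on t T y h" "(\<lambda>s. norm (h s) powr p) absolutely_integrable_on {t..T}"
    by (rule admE[OF y])
  have v': "ac_on t T (\<lambda>s. norm (y s)) (\<lambda>s. \<Sum>j\<in>UNIV. h s $ j)"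
    using ac_on_norm[OF h(1)] admD(3)[OF y] by blast
  have "Lp_fun t T p h" using Lp_fun_iff[OF ac_on_absolutely_integrable[OF h(1)]] h(2) by simp
  then have "Lp_fun t T p (\<lambda>s. \<Sum>j\<in>UNIV. h s $ j)"
    by (rule Lp_fun_bounded_linear) (auto intro!: bounded_linear_sum bounded_linear_vec_nth p)
  then have "(\<lambda>s. norm (\<Sum>j\<in>UNIV. h s $ j) powr p) absolutely_integrable_on {t..T}"
    using Lp_fun_iff[OF ac_on_absolutely_integrable[OF v']] by simp
  moreover have "AE s in lebesgue. s \<in> {t..T} \<longrightarrow> \<bar>v s\<bar> powr p = norm (\<Sum>j\<in>UNIV. h s $ j) powr p"
    using ac_on_deriv_unique[OF v v'] by eventually_elim auto
  ultimately show ?thesis by (rule absolutely_integrable_AE(1))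
qed

section \<open>The control problem on the junction\<close>

text \<open>With the flow of measures frozen, a player faces an ordinary control problem with
  time-dependent costs: \<open>F\<close> on the edges with partial derivatives \<open>Fx\<close>
  (one-sided at r = 0) and \<open>Fa\<close>, \<open>K\<close> at the vertex, and terminal costs
  \<open>g\<close> and \<open>g0\<close>. The equilibrium enters only through an interpretation of
  this locale.\<close>

locale control =
  fixes T p C0 :: real
    and F Fx Fa :: "'n::finite \<Rightarrow> real \<Rightarrow> real \<Rightarrow> real \<Rightarrow> real"
    and K :: "real \<Rightarrow> real" and g :: "'n \<Rightarrow> real \<Rightarrow> real" and g0 :: real
  assumes T: "T > 0" and p: "p > 1" and C0: "C0 > 0"
    and cont_F: "\<And>i. continuous_on ({0..T} \<times> {0..} \<times> UNIV) (\<lambda>(\<tau>, r, a). F i \<tau> r a)"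
    and cont_Fx: "\<And>i. continuous_on ({0..T} \<times> {0..} \<times> UNIV) (\<lambda>(\<tau>, r, a). Fx i \<tau> r a)"
    and cont_Fa: "\<And>i. continuous_on ({0..T} \<times> {0..} \<times> UNIV) (\<lambda>(\<tau>, r, a). Fa i \<tau> r a)"
    and deriv_x: "\<And>i \<tau> r a. \<tau> \<in> {0..T} \<Longrightarrow> 0 \<le> r \<Longrightarrow> ((\<lambda>r. F i \<tau> r a) has_real_derivative Fx i \<tau> r a) (at r within {0..})"
    and deriv_a: "\<And>i \<tau> r a. \<tau> \<in> {0..T} \<Longrightarrow> 0 \<le> r \<Longrightarrow> (F i \<tau> r has_real_derivative Fa i \<tau> r a) (at a)"
    and coercive: "\<And>i \<tau> r a. \<tau> \<in> {0..T} \<Longrightarrow> 0 \<le> r \<Longrightarrow> C0 * (\<bar>a\<bar> powr p - 1) \<le> F i \<tau> r a"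
    and K_lower: "\<And>\<tau>. \<tau> \<in> {0..T} \<Longrightarrow> - C0 \<le> K \<tau>"
    and cont_K: "continuous_on {0..T} K"
    and growth: "\<And>R. R > 0 \<Longrightarrow> \<exists>c\<ge>0. \<forall>i. \<forall>\<tau>\<in>{0..T}. \<forall>r\<in>{0..R}. \<forall>a.
        \<bar>Fx i \<tau> r a\<bar> \<le> c * (\<bar>a\<bar> powr p + 1) \<and> \<bar>Fa i \<tau> r a\<bar> \<le> c * (\<bar>a\<bar> powr (p - 1) + 1)"
    and convex_F: "\<And>i \<tau> r. \<tau> \<in> {0..T} \<Longrightarrow> 0 \<le> r \<Longrightarrow> strictly_convex (F i \<tau> r)"
    and cont_g: "\<And>i. continuous_on {0..} (g i)"
    and bounded_g: "\<exists>B. \<forall>i. \<forall>r\<ge>0. \<bar>g i r\<bar> \<le> B"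
begin

definition run :: "real \<Rightarrow> real ^ 'n \<Rightarrow> real \<Rightarrow> real" where
  "run \<tau> y v = (\<Sum>i\<in>UNIV. F i \<tau> (norm y) v * indicator (edge i - {0}) y) + K \<tau> * indicator {0} y"

definition terminal :: "real ^ 'n \<Rightarrow> real" where
  "terminal x = (\<Sum>i\<in>UNIV. g i (norm x) * indicator (edge i - {0}) x) + g0 * indicator {0} x"

definition J :: "real \<Rightarrow> (real \<Rightarrow> real ^ 'n) \<Rightarrow> real" where
  "J t y = (LINT \<tau>:{t<..<T}|lebesgue. run \<tau> (y \<tau>) (weak_deriv t T (\<lambda>s. norm (y s)) \<tau>)) + terminal (y T)"

definition U :: "real ^ 'n \<Rightarrow> real \<Rightarrow> real" where
  "U x t = (INF z\<in>Gamma_from T p t x. J t (apply_bcontfun z))"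

lemma indicator_edge_axis:
  assumes "r > 0"
  shows "indicator (edge j - {0}) (r *\<^sub>R axis i 1) = (if j = i then 1 else 0 :: real)"
  using scaleR_axis_edge_iff[OF assms, of i j] by (auto simp: indicator_def)

lemma run_edge: "r > 0 \<Longrightarrow> run \<tau> (r *\<^sub>R axis i 1) v = F i \<tau> r v"
  by (simp add: run_def indicator_edge_axis axis_eq_0_iff if_distrib[of "(*) _"] cong: if_cong)

lemma run_zero: "run \<tau> 0 v = K \<tau>"
  by (simp add: run_def)

lemma terminal_edge: "r > 0 \<Longrightarrow> terminal (r *\<^sub>R axis i 1) = g i r"
  by (simp add: terminal_def indicator_edge_axis axis_eq_0_iff if_distrib[of "(*) _"] cong: if_cong)

lemma terminal_zero: "terminal 0 = g0"
  by (simp add: terminal_def)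

lemma run_lower:
  assumes "\<tau> \<in> {0..T}" "y \<in> junction"
  shows "- C0 \<le> run \<tau> y v"
  using assms(2)
proof (cases rule: junction_cases)
  case 1
  then show ?thesis using K_lower[OF assms(1)] by (simp add: run_zero)
next
  case (2 i r)
  have "- C0 \<le> C0 * (\<bar>v\<bar> powr p - 1)" using C0 by (simp add: algebra_simps)
  also have "\<dots> \<le> F i \<tau> r v" using coercive[OF assms(1)] 2 by simp
  finally show ?thesis using 2 by (simp add: run_edge)
qed

lemma run_coercive:
  assumes "\<tau> \<in> {0..T}" "y \<in> junction" "y = 0 \<Longrightarrow> v = 0"
  shows "C0 * (\<bar>v\<bar> powr p - 1) \<le> run \<tau> y v"
  using assms(2)
proof (cases rule: junction_cases)
  case 1
  then show ?thesis using K_lower[OF assms(1)] assms(3) by (simp add: run_zero)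
next
  case (2 i r)
  then show ?thesis using coercive[OF assms(1)] by (simp add: run_edge)
qed

lemma terminal_bounded: "\<exists>B. \<forall>x\<in>junction. \<bar>terminal x\<bar> \<le> B"
proof -
  obtain B where B: "\<And>i r. r \<ge> 0 \<Longrightarrow> \<bar>g i r\<bar> \<le> B" using bounded_g by blast
  have "\<bar>terminal x\<bar> \<le> max B \<bar>g0\<bar>" if "x \<in> junction" for x
    using that
  proof (cases rule: junction_cases)
    case (2 i r)
    then have "terminal x = g i r" by (simp add: terminal_edge)
    then show ?thesis using B[of r i] 2 by simp
  qed (simp add: terminal_zero)
  then show ?thesis by blast
qed

lemma abs_le_powr: "\<bar>a :: real\<bar> \<le> 1 + \<bar>a\<bar> powr p"
proof (cases "\<bar>a\<bar> \<le> 1")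
  case False
  then have "\<bar>a\<bar> powr 1 \<le> \<bar>a\<bar> powr p" using p by (intro powr_mono) auto
  then show ?thesis using False by simp
qed (simp add: add_increasing2)

text \<open>Integrating the growth of order p - 1 of \<open>Fa\<close> from a = 0 gives growth of
  order p, and |a| itself is absorbed by 1 + |a|^p. Summing the bounds at a = 0 over the edges makes
  M uniform in i.\<close>

lemma F_bound:
  assumes "R \<ge> 0"
  shows "\<exists>M\<ge>0. \<forall>i. \<forall>\<tau>\<in>{0..T}. \<forall>r\<in>{0..R}. \<forall>a. \<bar>F i \<tau> r a\<bar> \<le> M * (1 + \<bar>a\<bar> powr p)"
proof -
  obtain c where c: "c \<ge> 0" "\<And>i \<tau> r a. \<tau> \<in> {0..T} \<Longrightarrow> r \<in> {0..R + 1} \<Longrightarrow> \<bar>Fa i \<tau> r a\<bar> \<le> c * (\<bar>a\<bar> powr (p - 1) + 1)"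
    using growth[of "R + 1"] assms by auto
  have "\<exists>B\<ge>0. \<forall>\<tau>\<in>{0..T}. \<forall>r\<in>{0..R}. \<bar>F i \<tau> r 0\<bar> \<le> B" for i
  proof -
    have cp: "continuous_on ({0..T} \<times> {0..R}) (\<lambda>(\<tau>, r). (\<tau>, r, 0::real))"
      unfolding case_prod_beta by (intro continuous_intros)
    have "continuous_on ({0..T} \<times> {0..R}) (\<lambda>q. (\<lambda>(\<tau>, r, a). F i \<tau> r a) ((\<lambda>(\<tau>, r). (\<tau>, r, 0)) q))"
      by (rule continuous_on_compose2[OF cont_F cp]) auto
    then have "bounded ((\<lambda>q. (\<lambda>(\<tau>, r, a). F i \<tau> r a) ((\<lambda>(\<tau>, r). (\<tau>, r, 0)) q)) ` ({0..T} \<times> {0..R}))"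
      by (intro compact_imp_bounded compact_continuous_image compact_Times) auto
    then obtain B where B: "\<And>q. q \<in> {0..T} \<times> {0..R} \<Longrightarrow> \<bar>(\<lambda>(\<tau>, r, a). F i \<tau> r a) ((\<lambda>(\<tau>, r). (\<tau>, r, 0)) q)\<bar> \<le> B"
      unfolding bounded_iff by auto
    have "\<bar>F i \<tau> r 0\<bar> \<le> max B 0" if "\<tau> \<in> {0..T}" "r \<in> {0..R}" for \<tau> r
      using B[of "(\<tau>, r)"] that by auto
    then show ?thesis by (intro exI[of _ "max B 0"]) simp
  qed
  then obtain B where B: "\<And>i. B i \<ge> 0" "\<And>i \<tau> r. \<tau> \<in> {0..T} \<Longrightarrow> r \<in> {0..R} \<Longrightarrow> \<bar>F i \<tau> r 0\<bar> \<le> B i" by metis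
  define M where "M = (\<Sum>i\<in>UNIV. B i) + 2 * c"
  have "\<bar>F i \<tau> r a\<bar> \<le> M * (1 + \<bar>a\<bar> powr p)" if "\<tau> \<in> {0..T}" "r \<in> {0..R}" for i \<tau> r a
  proof -
    have "\<exists>z\<in>{min 0 a..max 0 a}. F i \<tau> r a - F i \<tau> r 0 = Fa i \<tau> r z * (a - 0)"
      by (rule mvt_Icc_exists[where l = "- \<bar>a\<bar>" and u = "\<bar>a\<bar>"])
        (use that deriv_a in \<open>auto intro: has_field_derivative_at_within\<close>)
    then obtain z where z: "z \<in> {min 0 a..max 0 a}" "F i \<tau> r a - F i \<tau> r 0 = Fa i \<tau> r z * a" by auto
    have "\<bar>z\<bar> \<le> \<bar>a\<bar>" using z(1) by auto
    then have "c * (\<bar>z\<bar> powr (p - 1) + 1) \<le> c * (\<bar>a\<bar> powr (p - 1) + 1)"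
      using c(1) p by (intro mult_left_mono add_right_mono powr_mono2) auto
    then have "\<bar>Fa i \<tau> r z\<bar> \<le> c * (\<bar>a\<bar> powr (p - 1) + 1)" using c(2)[of \<tau> r i z] that by auto
    then have "\<bar>Fa i \<tau> r z * a\<bar> \<le> c * (\<bar>a\<bar> powr (p - 1) + 1) * \<bar>a\<bar>"
      by (simp add: abs_mult mult_right_mono)
    also have "\<dots> = c * (\<bar>a\<bar> powr p + \<bar>a\<bar>)"
      using powr_mult_base[of "\<bar>a\<bar>" "p - 1"] by (simp add: algebra_simps)
    also have "\<dots> \<le> c * (2 * (1 + \<bar>a\<bar> powr p))"
      using c(1) abs_le_powr[of a] by (intro mult_left_mono) auto
    finally have 1: "\<bar>F i \<tau> r a - F i \<tau> r 0\<bar> \<le> 2 * c * (1 + \<bar>a\<bar> powr p)" using z(2) by (simp add: algebra_simps)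
    have "\<bar>F i \<tau> r 0\<bar> \<le> (\<Sum>i\<in>UNIV. B i)"
      using B(2)[of \<tau> r i] that member_le_sum[of i UNIV B] B(1) by force
    also have "\<dots> \<le> (\<Sum>i\<in>UNIV. B i) * (1 + \<bar>a\<bar> powr p)"
      using B(1) by (simp add: algebra_simps sum_nonneg)
    finally show ?thesis using 1 unfolding M_def by (simp add: algebra_simps)
  qed
  moreover have "M \<ge> 0" unfolding M_def using B(1) c(1) by (simp add: sum_nonneg)
  ultimately show ?thesis by blast
qed

lemma run_bound:
  assumes "R \<ge> 0"
  shows "\<exists>M\<ge>0. \<forall>\<tau>\<in>{0..T}. \<forall>y\<in>junction. norm y \<le> R \<longrightarrow> (\<forall>v. \<bar>run \<tau> y v\<bar> \<le> M * (1 + \<bar>v\<bar> powr p))"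
proof -
  obtain M where M: "M \<ge> 0" "\<And>i \<tau> r a. \<tau> \<in> {0..T} \<Longrightarrow> r \<in> {0..R} \<Longrightarrow> \<bar>F i \<tau> r a\<bar> \<le> M * (1 + \<bar>a\<bar> powr p)"
    using F_bound[OF assms] by blast
  obtain B where "\<forall>x\<in>K ` {0..T}. norm x \<le> B"
    using continuous_on_Icc_bounded_measurable(1)[OF cont_K] unfolding bounded_iff by blast
  then have B: "\<And>\<tau>. \<tau> \<in> {0..T} \<Longrightarrow> \<bar>K \<tau>\<bar> \<le> B" by simp
  have B0: "B \<ge> 0" using B[of 0] T by auto
  have "\<bar>run \<tau> y v\<bar> \<le> (M + B) * (1 + \<bar>v\<bar> powr p)" if "\<tau> \<in> {0..T}" "y \<in> junction" "norm y \<le> R" for \<tau> y v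
    using that(2)
  proof (cases rule: junction_cases)
    case 1
    have "\<bar>K \<tau>\<bar> \<le> B * 1" using B that by simp
    also have "\<dots> \<le> (M + B) * (1 + \<bar>v\<bar> powr p)" using M(1) B0 by (intro mult_mono) auto
    finally show ?thesis using 1 by (simp add: run_zero)
  next
    case (2 i r)
    then have "\<bar>F i \<tau> r v\<bar> \<le> M * (1 + \<bar>v\<bar> powr p)" using M(2)[of \<tau> r i v] that by simp
    also have "\<dots> \<le> (M + B) * (1 + \<bar>v\<bar> powr p)" using B0 by (intro mult_right_mono) auto
    finally show ?thesis using 2 by (simp add: run_edge)
  qed
  then show ?thesis using M(1) B0 by (intro exI[of _ "M + B"]) simp
qed

section \<open>Measurability and integrability of the running cost\<close>

lemma measurable_comp:
  fixes w v :: "real \<Rightarrow> real"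
  assumes H: "continuous_on ({0..T} \<times> {0..} \<times> UNIV) (\<lambda>(\<tau>, r, a). H \<tau> r a :: real)"
    and S: "S \<subseteq> {0..T}" and w: "w \<in> borel_measurable (lebesgue_on S)" "\<And>\<tau>. \<tau> \<in> S \<Longrightarrow> 0 \<le> w \<tau>"
    and v: "v \<in> borel_measurable (lebesgue_on S)"
  shows "(\<lambda>\<tau>. H \<tau> (w \<tau>) (v \<tau>)) \<in> borel_measurable (lebesgue_on S)"
proof -
  have id: "(\<lambda>\<tau>. \<tau>) \<in> borel_measurable (lebesgue_on S)"
    by (intro measurable_restrict_space1 measurable_completion) simp
  have "(\<lambda>\<tau>. (\<tau>, w \<tau>, v \<tau>)) \<in> lebesgue_on S \<rightarrow>\<^sub>M borel"
    by (intro borel_measurable_Pair id w v)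
  then have "(\<lambda>\<tau>. (\<tau>, w \<tau>, v \<tau>)) \<in> lebesgue_on S \<rightarrow>\<^sub>M restrict_space borel ({0..T} \<times> {0..} \<times> UNIV)"
    by (intro measurable_restrict_space2) (use S w in \<open>auto simp: space_restrict_space\<close>)
  from measurable_compose[OF this borel_measurable_continuous_on_restrict[OF H]]
  show ?thesis by simp
qed

lemma run_measurable:
  fixes y :: "real \<Rightarrow> real ^ 'n"
  assumes ab: "0 \<le> a" "b \<le> T" and y: "continuous_on {a..b} y" and v: "v \<in> borel_measurable (lebesgue_on {a..b})"
  shows "(\<lambda>\<tau>. run \<tau> (y \<tau>) (v \<tau>)) \<in> borel_measurable (lebesgue_on {a..b})"
proof -
  have ym: "y \<in> borel_measurable (lebesgue_on {a..b})"
    using continuous_on_Icc_bounded_measurable(2)[OF y] .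
  have ind: "(\<lambda>\<tau>. indicator A (y \<tau>) :: real) \<in> borel_measurable (lebesgue_on {a..b})" if "A \<in> sets borel" for A
    using measurable_compose[OF ym borel_measurable_indicator[OF that]] .
  have "continuous_on {a..b} K" using cont_K by (rule continuous_on_subset) (use ab in auto)
  then have Km: "K \<in> borel_measurable (lebesgue_on {a..b})"
    using continuous_on_Icc_bounded_measurable(2) by blast
  have nm: "(\<lambda>\<tau>. norm (y \<tau>)) \<in> borel_measurable (lebesgue_on {a..b})" using ym by measurable
  have e: "edge i - {0} \<in> sets borel" for i :: 'n
    using borel_closed[OF closed_edge[of i]] by auto
  show ?thesis
    unfolding run_def
    by (intro borel_measurable_add borel_measurable_sum borel_measurable_times measurable_comp[OF cont_F] ind e nm v Km)
      (use ab in auto)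
qed

lemma run_absolutely_integrable:
  fixes y :: "real \<Rightarrow> real ^ 'n"
  assumes ab: "0 \<le> a" "b \<le> T" and y: "continuous_on {a..b} y" "\<And>s. s \<in> {a..b} \<Longrightarrow> y s \<in> junction"
    and v: "v absolutely_integrable_on {a..b}" "(\<lambda>s. \<bar>v s\<bar> powr p) absolutely_integrable_on {a..b}"
  shows "(\<lambda>\<tau>. run \<tau> (y \<tau>) (v \<tau>)) absolutely_integrable_on {a..b}"
proof -
  obtain R where R: "\<And>s. s \<in> {a..b} \<Longrightarrow> norm (y s) \<le> R" "R \<ge> 0"
    using continuous_on_Icc_bounded_measurable(1)[OF y(1)] unfolding bounded_pos by fastforce
  obtain M where M: "\<And>\<tau> x v. \<tau> \<in> {0..T} \<Longrightarrow> x \<in> junction \<Longrightarrow> norm x \<le> R \<Longrightarrow> \<bar>run \<tau> x v\<bar> \<le> M * (1 + \<bar>v\<bar> powr p)"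
    using run_bound[OF R(2)] by blast
  have vm: "v \<in> borel_measurable (lebesgue_on {a..b})"
    using v(1) by (simp add: absolutely_integrable_measurable)
  show ?thesis
  proof (rule measurable_bounded_by_integrable_imp_absolutely_integrable)
    show "(\<lambda>\<tau>. run \<tau> (y \<tau>) (v \<tau>)) \<in> borel_measurable (lebesgue_on {a..b})"
      by (rule run_measurable[OF ab y(1) vm])
    show "(\<lambda>s. M * (1 + \<bar>v s\<bar> powr p)) integrable_on {a..b}"
      using v(2) by (intro integrable_on_mult_right integrable_add set_lebesgue_integral_eq_integral(1)) auto
    show "norm (run s (y s) (v s)) \<le> M * (1 + \<bar>v s\<bar> powr p)" if "s \<in> {a..b}" for s
      using M[of s "y s" "v s"] R(1)[OF that] y(2)[OF that] that ab by simp
  qed simp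
qed

lemma adm_continuous: "adm T p t y \<Longrightarrow> continuous_on {t..T} y"
  by (erule admE) (rule ac_on_continuous)

lemma adm_run_integrable:
  assumes y: "adm T p t y" and t: "0 \<le> t" and v: "ac_on t T (\<lambda>s. norm (y s)) v"
  shows "(\<lambda>\<tau>. run \<tau> (y \<tau>) (v \<tau>)) absolutely_integrable_on {t..T}"
  using p by (intro run_absolutely_integrable[OF t order_refl adm_continuous[OF y] admD(3)[OF y]]
      ac_on_absolutely_integrable[OF v] adm_norm_Lp[OF y _ v]) auto

text \<open>\<open>J\<close> refers to the representative picked by \<open>weak_deriv\<close>.
  Changing it on a null set does not change the integral, so the cost can be computed with any
  convenient density of the norm.\<close>

lemma J_eq:
  assumes y: "adm T p t y" and t: "0 \<le> t" "t < T" and v: "ac_on t T (\<lambda>s. norm (y s)) v"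
  shows "J t y = integral {t..T} (\<lambda>\<tau>. run \<tau> (y \<tau>) (v \<tau>)) + terminal (y T)"
proof -
  let ?wd = "weak_deriv t T (\<lambda>s. norm (y s))"
  have "AE x in lebesgue. x \<in> {t<..<T} \<longrightarrow> ?wd x = v x"
    using weak_deriv_AE_eq(2)[OF v] t by simp
  with AE_lebesgue_neq[of t] AE_lebesgue_neq[of T]
  have ae: "AE \<tau> in lebesgue. \<tau> \<in> {t..T} \<longrightarrow> run \<tau> (y \<tau>) (?wd \<tau>) = run \<tau> (y \<tau>) (v \<tau>)"
    by eventually_elim auto
  note wd = absolutely_integrable_AE[OF adm_run_integrable[OF y t(1) v] ae]
  show ?thesis
    unfolding J_def set_integral_Ioo[OF wd(1)] wd(2) ..
qed

lemma J_lower: "\<exists>B. \<forall>t y. 0 \<le> t \<longrightarrow> t < T \<longrightarrow> adm T p t y \<longrightarrow> B \<le> J t y"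
proof -
  obtain B where B: "\<And>x. x \<in> junction \<Longrightarrow> \<bar>terminal x\<bar> \<le> B" using terminal_bounded by blast
  have "- C0 * T - B \<le> J t y" if t: "0 \<le> t" "t < T" and y: "adm T p t y" for t y
  proof -
    obtain v where v: "ac_on t T (\<lambda>s. norm (y s)) v" using adm_norm_ac[OF y] p by auto
    have "integral {t..T} (\<lambda>_. - C0) \<le> integral {t..T} (\<lambda>\<tau>. run \<tau> (y \<tau>) (v \<tau>))"
      using set_lebesgue_integral_eq_integral(1)[OF adm_run_integrable[OF y t(1) v]] admD(3)[OF y] t
      by (intro integral_le run_lower) auto
    moreover have "- C0 * T \<le> - C0 * (T - t)" using C0 t by (intro mult_left_mono_neg) auto
    moreover have "- B \<le> terminal (y T)" using B[of "y T"] admD(3)[OF y, of T] t by auto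
    ultimately show ?thesis using J_eq[OF y t v] t by (simp add: mult.commute)
  qed
  then show ?thesis by blast
qed

lemma J_image_bdd_below: "0 \<le> t \<Longrightarrow> t < T \<Longrightarrow> bdd_below ((\<lambda>z. J t (apply_bcontfun z)) ` Gamma_from T p t x)"
proof -
  assume t: "0 \<le> t" "t < T"
  obtain B where B: "\<And>t y. 0 \<le> t \<Longrightarrow> t < T \<Longrightarrow> adm T p t y \<Longrightarrow> B \<le> J t y" using J_lower by blast
  show ?thesis
    by (rule bdd_belowI2) (rule B[OF t Gamma_from_adm(1)[OF _ t(2) p]])
qed

lemma U_le:
  assumes y: "adm T p t y" and t: "0 \<le> t" "t < T"
  shows "U (y t) t \<le> J t y"
proof -
  obtain z where "z \<in> Gamma_from T p t (y t)" "apply_bcontfun z = y"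
    using adm_Gamma_from[OF y t(2) p] by blast
  then show ?thesis
    unfolding U_def using cINF_lower[OF J_image_bdd_below[OF t]] by metis
qed

lemma Gamma_from_nonempty:
  assumes "x \<in> junction" "t < T"
  shows "Gamma_from T p t x \<noteq> {}"
  using adm_Gamma_from[OF adm_const[OF assms(1)] assms(2) p] p by auto

lemma U_greatest:
  assumes x: "x \<in> junction" and t: "0 \<le> t" "t < T"
    and c: "\<And>y. adm T p t y \<Longrightarrow> y t = x \<Longrightarrow> c \<le> J t y"
  shows "c \<le> U x t"
  unfolding U_def
  by (rule cINF_greatest[OF Gamma_from_nonempty[OF x t(2)]]) (use c Gamma_from_adm[OF _ t(2) p] in blast)

lemma U_approx:
  assumes x: "x \<in> junction" and t: "0 \<le> t" "t < T" and e: "e > 0"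
  obtains y where "adm T p t y" "y t = x" "J t y < U x t + e"
proof -
  have "\<exists>z\<in>Gamma_from T p t x. J t (apply_bcontfun z) < U x t + e"
    using cINF_less_iff[OF Gamma_from_nonempty[OF x t(2)] J_image_bdd_below[OF t], of "U x t + e"] e
    unfolding U_def by simp
  then show ?thesis using that Gamma_from_adm[OF _ t(2) p] by blast
qed

text \<open>Cost is additive in time. This half of the dynamic programming principle later bounds
  the value function from below: an arbitrary continuation z is attached to a prescribed past
  y.\<close>

lemma J_glue:
  assumes y: "adm T p 0 y" and z: "adm T p t z" and eq: "y t = z t" and t: "0 < t" "t < T"
    and v: "ac_on 0 T (\<lambda>s. norm (y s)) v"
  shows "J 0 (\<lambda>s. if s \<le> t then y s else z s) = integral {0..t} (\<lambda>\<tau>. run \<tau> (y \<tau>) (v \<tau>)) + J t z"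
proof -
  let ?g = "\<lambda>s. if s \<le> t then y s else z s"
  obtain w where w: "ac_on t T (\<lambda>s. norm (z s)) w" using adm_norm_ac[OF z] p by auto
  let ?k = "\<lambda>s. if s \<le> t then v s else w s"
  have g: "adm T p 0 ?g" by (rule adm_glue[OF y z eq]) (use t in auto)
  have "ac_on 0 t (\<lambda>s. norm (?g s)) v"
    using ac_on_cong[of 0 t "\<lambda>s. norm (?g s)" "\<lambda>s. norm (y s)"] ac_on_subinterval[OF v, of 0 t] t by simp
  moreover have "ac_on t T (\<lambda>s. norm (?g s)) w"
    using ac_on_cong[of t T "\<lambda>s. norm (?g s)" "\<lambda>s. norm (z s)"] w eq by auto
  ultimately have ac: "ac_on 0 T (\<lambda>s. norm (?g s)) ?k"
    by (rule ac_on_join) (use t in auto)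
  have ri: "(\<lambda>\<tau>. run \<tau> (?g \<tau>) (?k \<tau>)) absolutely_integrable_on {0..T}"
    by (rule adm_run_integrable[OF g order_refl ac])
  have "J 0 ?g = integral {0..T} (\<lambda>\<tau>. run \<tau> (?g \<tau>) (?k \<tau>)) + terminal (z T)"
    using J_eq[OF g order_refl _ ac] t by simp
  also have "integral {0..T} (\<lambda>\<tau>. run \<tau> (?g \<tau>) (?k \<tau>)) =
      integral {0..t} (\<lambda>\<tau>. run \<tau> (?g \<tau>) (?k \<tau>)) + integral {t..T} (\<lambda>\<tau>. run \<tau> (?g \<tau>) (?k \<tau>))"
    using t by (intro Henstock_Kurzweil_Integration.integral_combine[symmetric] integrable_on_subIcc[OF ri]) auto
  also have "integral {0..t} (\<lambda>\<tau>. run \<tau> (?g \<tau>) (?k \<tau>)) = integral {0..t} (\<lambda>\<tau>. run \<tau> (y \<tau>) (v \<tau>))"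
    by (rule integral_cong) auto
  also have "integral {t..T} (\<lambda>\<tau>. run \<tau> (?g \<tau>) (?k \<tau>)) = integral {t..T} (\<lambda>\<tau>. run \<tau> (z \<tau>) (w \<tau>))"
    by (rule integral_spike[of "{t}"]) auto
  finally show ?thesis using J_eq[OF z _ t(2) w] t by simp
qed

end

context control
begin

subsection \<open>Continuity of the value function by scaling\<close>

text \<open>Dilating a curve multiplies position and speed by c and leaves the times spent at the
  vertex unchanged, so the discontinuity of the cost at the vertex is never crossed. On an edge,
  mean values in x and in a combine with the growth bounds to order |v|^p; the powers of 2 in Q come
  from c \<le> 2.\<close>

lemma run_scale:
  assumes R: "R > 0"
  shows "\<exists>Q\<ge>0. \<forall>\<tau>\<in>{0..T}. \<forall>y\<in>junction. norm y \<le> R \<longrightarrow> (\<forall>v. \<forall>c\<in>{1/2..2}.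
      \<bar>run \<tau> (c *\<^sub>R y) (c * v) - run \<tau> y v\<bar> \<le> \<bar>c - 1\<bar> * (Q * (1 + \<bar>v\<bar> powr p)))"
proof -
  obtain k where k: "k \<ge> 0"
    "\<And>i \<tau> r a. \<tau> \<in> {0..T} \<Longrightarrow> r \<in> {0..2 * R} \<Longrightarrow> \<bar>Fx i \<tau> r a\<bar> \<le> k * (\<bar>a\<bar> powr p + 1)"
    "\<And>i \<tau> r a. \<tau> \<in> {0..T} \<Longrightarrow> r \<in> {0..2 * R} \<Longrightarrow> \<bar>Fa i \<tau> r a\<bar> \<le> k * (\<bar>a\<bar> powr (p - 1) + 1)"
    using growth[of "2 * R"] R by auto
  define Q where "Q = k * (2 powr p + 1) * R + k * (2 powr (p - 1) + 1)"
  have "\<bar>run \<tau> (c *\<^sub>R y) (c * v) - run \<tau> y v\<bar> \<le> \<bar>c - 1\<bar> * (Q * (1 + \<bar>v\<bar> powr p))"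
    if \<tau>: "\<tau> \<in> {0..T}" and y: "y \<in> junction" "norm y \<le> R" and c: "c \<in> {1/2..2}" for \<tau> y v c
    using y(1)
  proof (cases rule: junction_cases)
    case 1
    have "Q \<ge> 0" using k(1) R by (simp add: Q_def)
    then show ?thesis using 1 by (simp add: run_zero)
  next
    case (2 i r)
    have r: "0 < r" "r \<le> R" "0 < c * r" "c * r \<le> 2 * R"
      using 2 y(2) c R mult_mono[of c 2 r R] by auto
    have av: "\<bar>c * v\<bar> \<le> 2 * \<bar>v\<bar>" using c by (auto simp: abs_mult intro!: mult_right_mono)
    have "\<exists>z\<in>{min r (c * r)..max r (c * r)}. F i \<tau> (c * r) (c * v) - F i \<tau> r (c * v) = Fx i \<tau> z (c * v) * (c * r - r)"
      by (rule mvt_Icc_exists[where l = 0 and u = "2 * R"])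
        (use r R \<tau> in \<open>auto intro: DERIV_subset[OF deriv_x]\<close>)
    then obtain z where z: "z \<in> {min r (c * r)..max r (c * r)}"
      "F i \<tau> (c * r) (c * v) - F i \<tau> r (c * v) = Fx i \<tau> z (c * v) * (c * r - r)" by blast
    have "\<bar>c * v\<bar> powr p \<le> (2 * \<bar>v\<bar>) powr p" using av p by (intro powr_mono2) auto
    then have vp: "\<bar>c * v\<bar> powr p + 1 \<le> (2 powr p + 1) * (1 + \<bar>v\<bar> powr p)"
      by (simp add: powr_mult algebra_simps add_increasing add_increasing2)
    have "\<bar>Fx i \<tau> z (c * v)\<bar> \<le> k * (\<bar>c * v\<bar> powr p + 1)"
    proof (rule k(2)[OF \<tau>])
      show "z \<in> {0..2 * R}" using z(1) r by (auto simp: min_def max_def split: if_splits)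
    qed
    also have "\<dots> \<le> k * ((2 powr p + 1) * (1 + \<bar>v\<bar> powr p))" using vp k(1) by (rule mult_left_mono)
    finally have fx: "\<bar>Fx i \<tau> z (c * v)\<bar> \<le> k * ((2 powr p + 1) * (1 + \<bar>v\<bar> powr p))" .
    have "c * r - r = (c - 1) * r" by (simp add: algebra_simps)
    then have "\<bar>c * r - r\<bar> = \<bar>c - 1\<bar> * r" using r by (simp add: abs_mult)
    then have "\<bar>F i \<tau> (c * r) (c * v) - F i \<tau> r (c * v)\<bar> = \<bar>Fx i \<tau> z (c * v)\<bar> * (\<bar>c - 1\<bar> * r)"
      unfolding z(2) abs_mult by simp
    also have "\<dots> \<le> (k * ((2 powr p + 1) * (1 + \<bar>v\<bar> powr p))) * (\<bar>c - 1\<bar> * R)"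
      using fx r by (intro mult_mono mult_left_mono) auto
    finally have A: "\<bar>F i \<tau> (c * r) (c * v) - F i \<tau> r (c * v)\<bar> \<le> \<bar>c - 1\<bar> * (k * (2 powr p + 1) * R * (1 + \<bar>v\<bar> powr p))"
      by (simp add: mult_ac)
    have "\<exists>z\<in>{min v (c * v)..max v (c * v)}. F i \<tau> r (c * v) - F i \<tau> r v = Fa i \<tau> r z * (c * v - v)"
      by (rule mvt_Icc_exists[where l = "min v (c * v)" and u = "max v (c * v)"])
        (use r \<tau> deriv_a in \<open>auto intro: has_field_derivative_at_within\<close>)
    then obtain z where z: "z \<in> {min v (c * v)..max v (c * v)}"
      "F i \<tau> r (c * v) - F i \<tau> r v = Fa i \<tau> r z * (c * v - v)" by blast
    have "\<bar>z\<bar> \<le> max \<bar>v\<bar> \<bar>c * v\<bar>" using z(1) by (auto simp: min_def max_def split: if_splits)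
    then have "\<bar>z\<bar> \<le> 2 * \<bar>v\<bar>" using av by auto
    then have zp: "\<bar>z\<bar> powr (p - 1) \<le> 2 powr (p - 1) * \<bar>v\<bar> powr (p - 1)"
      using p powr_mono2[of "p - 1" "\<bar>z\<bar>" "2 * \<bar>v\<bar>"] by (simp add: powr_mult)
    have "\<bar>Fa i \<tau> r z\<bar> \<le> k * (\<bar>z\<bar> powr (p - 1) + 1)"
      using k(3)[OF \<tau>, of r i z] r R by auto
    also have "\<dots> \<le> k * (2 powr (p - 1) * \<bar>v\<bar> powr (p - 1) + 1)" using zp k(1) by (intro mult_left_mono) auto
    finally have fa: "\<bar>Fa i \<tau> r z\<bar> \<le> k * (2 powr (p - 1) * \<bar>v\<bar> powr (p - 1) + 1)" .
    have "c * v - v = (c - 1) * v" by (simp add: algebra_simps)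
    then have "\<bar>c * v - v\<bar> = \<bar>c - 1\<bar> * \<bar>v\<bar>" by (simp add: abs_mult)
    then have "\<bar>F i \<tau> r (c * v) - F i \<tau> r v\<bar> = \<bar>Fa i \<tau> r z\<bar> * (\<bar>c - 1\<bar> * \<bar>v\<bar>)"
      unfolding z(2) abs_mult by simp
    also have "\<dots> \<le> k * (2 powr (p - 1) * \<bar>v\<bar> powr (p - 1) + 1) * (\<bar>c - 1\<bar> * \<bar>v\<bar>)"
      using fa by (rule mult_right_mono) simp
    also have "\<dots> = \<bar>c - 1\<bar> * (k * (2 powr (p - 1) * (\<bar>v\<bar> * \<bar>v\<bar> powr (p - 1)) + \<bar>v\<bar>))"
      by (simp add: algebra_simps)
    also have "\<bar>v\<bar> * \<bar>v\<bar> powr (p - 1) = \<bar>v\<bar> powr p" using powr_mult_base[of "\<bar>v\<bar>" "p - 1"] by simp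
    also have "\<bar>c - 1\<bar> * (k * (2 powr (p - 1) * \<bar>v\<bar> powr p + \<bar>v\<bar>)) \<le>
        \<bar>c - 1\<bar> * (k * ((2 powr (p - 1) + 1) * (1 + \<bar>v\<bar> powr p)))"
      using k(1) abs_le_powr[of v]
      by (intro mult_left_mono) (simp_all add: algebra_simps, smt (verit) powr_ge_zero)
    finally have B: "\<bar>F i \<tau> r (c * v) - F i \<tau> r v\<bar> \<le> \<bar>c - 1\<bar> * (k * (2 powr (p - 1) + 1) * (1 + \<bar>v\<bar> powr p))"
      by (simp add: mult_ac)
    have "\<bar>F i \<tau> (c * r) (c * v) - F i \<tau> r v\<bar> \<le> \<bar>F i \<tau> (c * r) (c * v) - F i \<tau> r (c * v)\<bar> + \<bar>F i \<tau> r (c * v) - F i \<tau> r v\<bar>"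
      by simp
    also have "\<dots> \<le> \<bar>c - 1\<bar> * (k * (2 powr p + 1) * R * (1 + \<bar>v\<bar> powr p)) + \<bar>c - 1\<bar> * (k * (2 powr (p - 1) + 1) * (1 + \<bar>v\<bar> powr p))"
      using A B by (rule add_mono)
    also have "\<dots> = \<bar>c - 1\<bar> * (Q * (1 + \<bar>v\<bar> powr p))" unfolding Q_def by (simp add: distrib_left distrib_right)
    finally show ?thesis using 2 r run_edge[of r] run_edge[of "c * r"] by simp
  qed
  moreover have "Q \<ge> 0" using k(1) R by (simp add: Q_def)
  ultimately show ?thesis by blast
qed

lemma terminal_scale:
  assumes R: "R > 0" and e: "e > 0"
  shows "\<exists>d>0. \<forall>x\<in>junction. norm x \<le> R \<longrightarrow> (\<forall>c\<in>{1/2..2}. \<bar>c - 1\<bar> < d \<longrightarrow> \<bar>terminal (c *\<^sub>R x) - terminal x\<bar> \<le> e)"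
proof -
  have "\<exists>d>0. \<forall>r s. r \<in> {0..2 * R} \<longrightarrow> s \<in> {0..2 * R} \<longrightarrow> \<bar>r - s\<bar> < d \<longrightarrow> dist (g i r) (g i s) < e" for i
  proof -
    have "continuous_on {0..2 * R} (g i)" using cont_g by (rule continuous_on_subset) auto
    then show ?thesis using uniformly_continuous_IccE[OF _ e] by metis
  qed
  then obtain d where d: "\<And>i. d i > 0"
    "\<And>i r s. r \<in> {0..2 * R} \<Longrightarrow> s \<in> {0..2 * R} \<Longrightarrow> \<bar>r - s\<bar> < d i \<Longrightarrow> dist (g i r) (g i s) < e" by metis
  define m where "m = Min (range d) / R"
  have m: "m > 0" using d(1) R by (simp add: m_def)
  have "\<bar>terminal (c *\<^sub>R x) - terminal x\<bar> \<le> e"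
    if x: "x \<in> junction" "norm x \<le> R" and c: "c \<in> {1/2..2}" "\<bar>c - 1\<bar> < m" for x c
    using x(1)
  proof (cases rule: junction_cases)
    case 1
    then show ?thesis using e by simp
  next
    case (2 i r)
    have r: "0 < r" "r \<le> R" "0 < c * r" "c * r \<le> 2 * R"
      using 2 x(2) c R mult_mono[of c 2 r R] by auto
    have "c * r - r = (c - 1) * r" by (simp add: algebra_simps)
    then have "\<bar>c * r - r\<bar> = \<bar>c - 1\<bar> * r" using r by (simp add: abs_mult)
    also have "\<dots> \<le> \<bar>c - 1\<bar> * R" using r by (intro mult_left_mono) auto
    also have "\<dots> < m * R" using c(2) R by (intro mult_strict_right_mono) auto
    also have "\<dots> \<le> d i" using R by (simp add: m_def)
    finally have "dist (g i (c * r)) (g i r) < e" by (intro d(2)) (use r in auto)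
    then show ?thesis using 2 r terminal_edge[of r] terminal_edge[of "c * r"] by (simp add: dist_real_def)
  qed
  then show ?thesis using m by blast
qed

text \<open>A nearly optimal curve from r is dilated by c = s/r into a competitor from s. Coercivity
  bounds its energy and its range independently of r in [a, b], so \<open>run_scale\<close> and
  \<open>terminal_scale\<close> apply uniformly. Exchanging r and s gives continuity.\<close>

lemma U_semicontinuous:
  assumes t: "0 \<le> t" "t < T" and ab: "0 < a" and e: "e > 0"
  shows "\<exists>d>0. \<forall>r\<in>{a..b}. \<forall>s\<in>{a..b}. \<bar>s - r\<bar> < d \<longrightarrow> U (s *\<^sub>R axis i 1) t \<le> U (r *\<^sub>R axis i 1) t + e"
proof (cases "a \<le> b")
  case ab': True
  obtain B where B: "\<And>x. x \<in> junction \<Longrightarrow> \<bar>terminal x\<bar> \<le> B" using terminal_bounded by blast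
  obtain M where M: "M \<ge> 0" "\<And>\<tau> y v. \<tau> \<in> {0..T} \<Longrightarrow> y \<in> junction \<Longrightarrow> norm y \<le> b \<Longrightarrow> \<bar>run \<tau> y v\<bar> \<le> M * (1 + \<bar>v\<bar> powr p)"
    using run_bound[of b] ab ab' by auto
  \<comment> \<open>E bounds the integral of |v|^p along a nearly optimal curve: the constant curve
    costs at most M T + B, and the remaining terms account for the tolerance, the terminal cost and
    the -1 in the coercivity bound. R bounds the norm of the curve, since |v| \<le> 1 +
    |v|^p.\<close>
  define E where "E = (M * T + B + e + B) / C0 + T"
  define R where "R = b + T + E"
  have Ub: "U (r *\<^sub>R axis i 1) t \<le> M * T + B" if r: "r \<in> {a..b}" for r
  proof -
    let ?x = "r *\<^sub>R axis i 1 :: real ^ 'n"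
    have x: "?x \<in> junction" using r ab by (intro axis_scaleR_in_junction) auto
    have y: "adm T p t (\<lambda>_. ?x)" using adm_const[OF x] p by simp
    have v: "ac_on t T (\<lambda>s. norm ?x) (\<lambda>_. 0)" by (simp add: ac_on_def)
    have "integral {t..T} (\<lambda>\<tau>. run \<tau> ?x 0) \<le> integral {t..T} (\<lambda>_. M)"
    proof (rule integral_le)
      show "(\<lambda>\<tau>. run \<tau> ?x 0) integrable_on {t..T}"
        using set_lebesgue_integral_eq_integral(1)[OF adm_run_integrable[OF y t(1) v]] .
      show "run \<tau> ?x 0 \<le> M" if "\<tau> \<in> {t..T}" for \<tau>
        using M(2)[of \<tau> ?x 0] that t x r ab by simp
    qed auto
    also have "\<dots> \<le> M * T" using M(1) t by (simp add: mult.commute[of "T - t"] mult_left_mono)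
    finally have "J t (\<lambda>_. ?x) \<le> M * T + B" using J_eq[OF y t v] B[OF x] by simp
    then show ?thesis using U_le[OF y t] by simp
  qed
  have M0: "M * T + B \<ge> - B"
    using M(1) T B[OF zero_in_junction] by (simp add: add_increasing)
  have E: "E > 0" using M0 e C0 T by (auto simp: E_def intro!: add_nonneg_pos)
  have R: "R > 0" using ab ab' T E by (simp add: R_def)
  obtain Q where Q: "Q \<ge> 0" "\<And>\<tau> y v c. \<tau> \<in> {0..T} \<Longrightarrow> y \<in> junction \<Longrightarrow> norm y \<le> R \<Longrightarrow> c \<in> {1/2..2} \<Longrightarrow>
      \<bar>run \<tau> (c *\<^sub>R y) (c * v) - run \<tau> y v\<bar> \<le> \<bar>c - 1\<bar> * (Q * (1 + \<bar>v\<bar> powr p))"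
    using run_scale[OF R] by blast
  obtain d1 where d1: "d1 > 0" "\<And>x c. x \<in> junction \<Longrightarrow> norm x \<le> R \<Longrightarrow> c \<in> {1/2..2} \<Longrightarrow> \<bar>c - 1\<bar> < d1 \<Longrightarrow>
      \<bar>terminal (c *\<^sub>R x) - terminal x\<bar> \<le> e / 4"
    using terminal_scale[OF R, of "e / 4"] e by auto
  \<comment> \<open>The factor a turns |s - r| < d into a bound on |c - 1|. The three entries keep c
    in [1/2, 2] and make the changes of terminal and running cost at most e/4 each; another e/4 is
    spent on near optimality.\<close>
  define d where "d = a * min (1 / 2) (min d1 (e / (4 * (Q * (T + E) + 1))))"
  have QTE: "Q * (T + E) + 1 > 0" using Q(1) T E by (simp add: add_nonneg_pos)
  have d: "d > 0" using ab d1 e QTE by (simp add: d_def)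
  have "U (s *\<^sub>R axis i 1) t \<le> U (r *\<^sub>R axis i 1) t + e" if r: "r \<in> {a..b}" and s: "s \<in> {a..b}" and sr: "\<bar>s - r\<bar> < d" for r s
  proof -
    let ?x = "r *\<^sub>R axis i 1 :: real ^ 'n"
    have x: "?x \<in> junction" using r ab by (intro axis_scaleR_in_junction) auto
    define c where "c = s / r"
    have rp: "r > 0" using r ab by auto
    have "c - 1 = (s - r) / r" using rp by (simp add: c_def field_simps)
    then have "\<bar>c - 1\<bar> = \<bar>s - r\<bar> / r" using rp by (simp add: abs_divide)
    also have "\<dots> \<le> \<bar>s - r\<bar> / a" using r ab by (intro divide_left_mono) auto
    also have "\<dots> < d / a" using sr ab by (intro divide_strict_right_mono) auto
    also have "d / a = min (1 / 2) (min d1 (e / (4 * (Q * (T + E) + 1))))" using ab by (simp add: d_def)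
    finally have c1: "\<bar>c - 1\<bar> < 1 / 2" "\<bar>c - 1\<bar> < d1" "\<bar>c - 1\<bar> < e / (4 * (Q * (T + E) + 1))" by auto
    have c: "c \<in> {1/2..2}" using c1(1) by (auto simp: abs_if split: if_splits)
    obtain y where y: "adm T p t y" "y t = ?x" "J t y < U ?x t + e / 4"
      using U_approx[OF x t, of "e / 4"] e by auto
    obtain v0 where v0: "ac_on t T (\<lambda>s. norm (y s)) v0" using adm_norm_ac[OF y(1)] p by auto
    \<comment> \<open>At the vertex the running cost is only known to be at least -C0, which matches
      the coercive lower bound for speed zero only. The density vanishes there almost everywhere, so
      it may be set to zero.\<close>
    define v where "v s = (if y s = 0 then 0 else v0 s)" for s
    have "AE s in lebesgue. s \<in> {t..T} \<longrightarrow> norm (y s) = 0 \<longrightarrow> v0 s = 0"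
      by (rule ac_on_nonneg_zero_set[OF v0]) simp
    then have "AE s in lebesgue. s \<in> {t..T} \<longrightarrow> v s = v0 s"
      by eventually_elim (auto simp: v_def)
    then have v: "ac_on t T (\<lambda>s. norm (y s)) v" by (rule ac_on_cong_AE[OF v0])
    have ri: "(\<lambda>\<tau>. run \<tau> (y \<tau>) (v \<tau>)) integrable_on {t..T}"
      using set_lebesgue_integral_eq_integral(1)[OF adm_run_integrable[OF y(1) t(1) v]] .
    have pi: "(\<lambda>s. \<bar>v s\<bar> powr p) integrable_on {t..T}"
      using set_lebesgue_integral_eq_integral(1)[OF adm_norm_Lp[OF y(1) _ v]] p by simp
    have vi: "(\<lambda>s. \<bar>v s\<bar>) integrable_on {t..T}"
      using ac_on_absolutely_integrable[OF v] by (simp add: absolutely_integrable_on_def)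
    define I where "I = integral {t..T} (\<lambda>s. \<bar>v s\<bar> powr p)"
    have "integral {t..T} (\<lambda>s. C0 * (\<bar>v s\<bar> powr p - 1)) \<le> integral {t..T} (\<lambda>\<tau>. run \<tau> (y \<tau>) (v \<tau>))"
    proof (rule integral_le[OF _ ri])
      show "(\<lambda>s. C0 * (\<bar>v s\<bar> powr p - 1)) integrable_on {t..T}"
        by (intro integrable_on_mult_right integrable_diff pi) auto
      show "C0 * (\<bar>v s\<bar> powr p - 1) \<le> run s (y s) (v s)" if "s \<in> {t..T}" for s
        by (rule run_coercive) (use that t admD(3)[OF y(1) that] in \<open>auto simp: v_def\<close>)
    qed
    moreover have "integral {t..T} (\<lambda>s. C0 * (\<bar>v s\<bar> powr p - 1)) = C0 * (I - (T - t))"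
      using Henstock_Kurzweil_Integration.integral_diff[OF pi Henstock_Kurzweil_Integration.integrable_const_ivl[of 1]] t by (simp add: I_def)
    moreover have "integral {t..T} (\<lambda>\<tau>. run \<tau> (y \<tau>) (v \<tau>)) = J t y - terminal (y T)"
      using J_eq[OF y(1) t v] by simp
    moreover have "terminal (y T) \<ge> - B" using B[of "y T"] admD(3)[OF y(1), of T] t by auto
    ultimately have "C0 * (I - (T - t)) \<le> M * T + B + e + B"
      using y(3) Ub[OF r] e by linarith
    then have "I - (T - t) \<le> (M * T + B + e + B) / C0" using C0 by (simp add: field_simps)
    then have I: "I \<le> E" using t by (simp add: E_def)
    have I1: "integral {t..T} (\<lambda>s. 1 + \<bar>v s\<bar> powr p) = (T - t) + I"
      using Henstock_Kurzweil_Integration.integral_add[OF Henstock_Kurzweil_Integration.integrable_const_ivl[of 1] pi] t by (simp add: I_def)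
    have yR: "norm (y s) \<le> R" if s: "s \<in> {t..T}" for s
    proof -
      have "norm (y s) - norm (y t) = integral {t..s} v" using ac_on_increment[OF v, of t s] s by auto
      also have "\<dots> \<le> integral {t..s} (\<lambda>s. \<bar>v s\<bar>)"
        using s ac_on_integrable[OF v, of t s] by (intro integral_le integrable_on_subinterval[OF vi]) auto
      also have "\<dots> \<le> integral {t..T} (\<lambda>s. \<bar>v s\<bar>)"
        using s by (intro integral_subset_le integrable_on_subinterval[OF vi] vi) auto
      also have "\<dots> \<le> integral {t..T} (\<lambda>s. 1 + \<bar>v s\<bar> powr p)"
        by (intro integral_le vi integrable_add pi) (auto intro: abs_le_powr)
      also have "\<dots> \<le> T + E" using I1 I t by simp
      finally show ?thesis using y(2) r ab by (simp add: R_def)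
    qed
    have yc: "adm T p t (\<lambda>s. c *\<^sub>R y s)" by (rule adm_scaleR[OF y(1)]) (use c in auto)
    have vc: "ac_on t T (\<lambda>s. norm (c *\<^sub>R y s)) (\<lambda>s. c * v s)"
      using ac_on_bounded_linear[OF v bounded_linear_mult_right[of c]] c by simp
    have rci: "(\<lambda>\<tau>. run \<tau> (c *\<^sub>R y \<tau>) (c * v \<tau>)) integrable_on {t..T}"
      using set_lebesgue_integral_eq_integral(1)[OF adm_run_integrable[OF yc t(1) vc]] .
    have "integral {t..T} (\<lambda>\<tau>. run \<tau> (c *\<^sub>R y \<tau>) (c * v \<tau>)) - integral {t..T} (\<lambda>\<tau>. run \<tau> (y \<tau>) (v \<tau>)) =
        integral {t..T} (\<lambda>\<tau>. run \<tau> (c *\<^sub>R y \<tau>) (c * v \<tau>) - run \<tau> (y \<tau>) (v \<tau>))"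
      by (rule Henstock_Kurzweil_Integration.integral_diff[symmetric, OF rci ri])
    also have "\<dots> \<le> integral {t..T} (\<lambda>s. \<bar>c - 1\<bar> * (Q * (1 + \<bar>v s\<bar> powr p)))"
    proof (rule integral_le)
      show "(\<lambda>\<tau>. run \<tau> (c *\<^sub>R y \<tau>) (c * v \<tau>) - run \<tau> (y \<tau>) (v \<tau>)) integrable_on {t..T}"
        by (intro integrable_diff rci ri)
      show "(\<lambda>s. \<bar>c - 1\<bar> * (Q * (1 + \<bar>v s\<bar> powr p))) integrable_on {t..T}"
        by (intro integrable_on_mult_right integrable_add pi) auto
      show "run s (c *\<^sub>R y s) (c * v s) - run s (y s) (v s) \<le> \<bar>c - 1\<bar> * (Q * (1 + \<bar>v s\<bar> powr p))" if "s \<in> {t..T}" for s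
        using Q(2)[of s "y s" c "v s"] that t admD(3)[OF y(1) that] yR[OF that] c by auto
    qed
    also have "\<dots> = \<bar>c - 1\<bar> * (Q * ((T - t) + I))" using I1 by simp
    also have "\<dots> \<le> \<bar>c - 1\<bar> * (Q * (T + E) + 1)"
    proof (rule mult_left_mono)
      have "Q * ((T - t) + I) \<le> Q * (T + E)" using I t Q(1) by (intro mult_left_mono) auto
      then show "Q * ((T - t) + I) \<le> Q * (T + E) + 1" by simp
    qed simp
    also have "\<dots> \<le> e / 4" using c1(3) QTE by (simp add: field_simps less_imp_le)
    finally have "J t (\<lambda>s. c *\<^sub>R y s) - terminal (c *\<^sub>R y T) - (J t y - terminal (y T)) \<le> e / 4"
      using J_eq[OF yc t vc] J_eq[OF y(1) t v] by simp
    moreover have "\<bar>terminal (c *\<^sub>R y T) - terminal (y T)\<bar> \<le> e / 4"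
      by (rule d1(2)) (use admD(3)[OF y(1), of T] yR[of T] t c c1 in auto)
    moreover have "U (s *\<^sub>R axis i 1) t \<le> J t (\<lambda>s. c *\<^sub>R y s)"
      using U_le[OF yc t] y(2) rp by (simp add: c_def)
    ultimately show ?thesis using y(3) e by linarith
  qed
  then show ?thesis using d by blast
qed (use e in \<open>auto intro: exI[of _ 1]\<close>)

lemma U_continuous:
  assumes t: "0 \<le> t" "t < T"
  shows "continuous_on {0<..} (\<lambda>r. U (r *\<^sub>R axis i 1) t)"
proof (rule continuous_at_imp_continuous_on, rule ballI)
  fix r0 :: real assume "r0 \<in> {0<..}"
  then have r0: "r0 > 0" by simp
  show "isCont (\<lambda>r. U (r *\<^sub>R axis i 1) t) r0"
    unfolding continuous_at_eps_delta
  proof (intro allI impI)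
    fix e :: real assume e: "e > 0"
    obtain d where d: "d > 0" "\<And>r s. r \<in> {r0 / 2..2 * r0} \<Longrightarrow> s \<in> {r0 / 2..2 * r0} \<Longrightarrow> \<bar>s - r\<bar> < d \<Longrightarrow>
        U (s *\<^sub>R axis i 1) t \<le> U (r *\<^sub>R axis i 1) t + e / 2"
      using U_semicontinuous[OF t, of "r0 / 2" "e / 2" "2 * r0" i] r0 e by auto
    show "\<exists>d>0. \<forall>x'. dist x' r0 < d \<longrightarrow> dist (U (x' *\<^sub>R axis i 1) t) (U (r0 *\<^sub>R axis i 1) t) < e"
    proof (intro exI[of _ "min d (r0 / 2)"] conjI allI impI)
      fix x assume x: "dist x r0 < min d (r0 / 2)"
      then have xm: "x \<in> {r0 / 2..2 * r0}" using r0 by (auto simp: dist_real_def abs_if split: if_splits)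
      have "\<bar>x - r0\<bar> < d" "\<bar>r0 - x\<bar> < d" using x by (auto simp: dist_real_def)
      then show "dist (U (x *\<^sub>R axis i 1) t) (U (r0 *\<^sub>R axis i 1) t) < e"
        using d(2)[of r0 x] d(2)[of x r0] xm r0 e by (auto simp: dist_real_def abs_if)
    qed (use d r0 in auto)
  qed
qed

end

subsection \<open>The Euler-Lagrange equation and the derivative of the value function\<close>

text \<open>The increment is trapped between two functions touching at 0 with the same slope.
  Dividing by a negative h swaps the two bounds, hence the symmetric estimate by the sum of both
  errors.\<close>

lemma DERIV_squeeze:
  fixes f l u :: "real \<Rightarrow> real"
  assumes dl: "(l has_real_derivative D) (at 0)" and du: "(u has_real_derivative D) (at 0)" and d: "d > 0"
    and le: "\<And>h. \<bar>h\<bar> < d \<Longrightarrow> l h \<le> f h - f 0" "\<And>h. \<bar>h\<bar> < d \<Longrightarrow> f h - f 0 \<le> u h"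
    and 0: "l 0 = 0" "u 0 = 0"
  shows "(f has_real_derivative D) (at 0)"
proof -
  have "((\<lambda>h. \<bar>l h / h - D\<bar> + \<bar>u h / h - D\<bar>) \<longlongrightarrow> \<bar>D - D\<bar> + \<bar>D - D\<bar>) (at 0)"
    using dl du 0 unfolding DERIV_def by (intro tendsto_intros) simp_all
  then have lim: "((\<lambda>h. \<bar>l h / h - D\<bar> + \<bar>u h / h - D\<bar>) \<longlongrightarrow> 0) (at 0)" by simp
  have "\<forall>\<^sub>F h in at 0. norm ((f (0 + h) - f 0) / h - D) \<le> \<bar>l h / h - D\<bar> + \<bar>u h / h - D\<bar>"
    unfolding eventually_at
  proof (intro exI[of _ d] conjI ballI impI d)
    fix h :: real assume h: "h \<noteq> 0 \<and> dist h 0 < d"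
    then have b: "l h \<le> f h - f 0" "f h - f 0 \<le> u h" using le[of h] by auto
    show "norm ((f (0 + h) - f 0) / h - D) \<le> \<bar>l h / h - D\<bar> + \<bar>u h / h - D\<bar>"
    proof (cases "h > 0")
      case True
      then have "l h / h \<le> (f h - f 0) / h" "(f h - f 0) / h \<le> u h / h"
        using b by (auto intro: divide_right_mono)
      then show ?thesis by simp
    next
      case False
      then have "h < 0" using h by simp
      then have "u h / h \<le> (f h - f 0) / h" "(f h - f 0) / h \<le> l h / h"
        using b by (auto intro: divide_right_mono_neg)
      then show ?thesis by simp
    qed
  qed
  then have "((\<lambda>h. (f (0 + h) - f 0) / h - D) \<longlongrightarrow> 0) (at 0)"
    by (rule Lim_null_comparison[OF _ lim])
  then show ?thesis unfolding DERIV_def by (simp add: LIM_zero_iff)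
qed

text \<open>The tangents at x and at y are compared with f at the midpoint of x and y, the one place
  where strict convexity gives a strict inequality.\<close>

lemma strictly_convex_deriv_strict_mono:
  assumes f: "strictly_convex f" and d: "\<And>x. (f has_real_derivative f' x) (at x)" and xy: "x < y"
  shows "f' x < f' y"
proof -
  have cv: "convex_on UNIV f"
  proof (rule convex_onI)
    fix t a b :: real assume t: "0 < t" "t < 1"
    show "f ((1 - t) *\<^sub>R a + t *\<^sub>R b) \<le> (1 - t) * f a + t * f b"
    proof (cases "a = b")
      case True
      then show ?thesis by (simp add: algebra_simps)
    next
      case False
      then show ?thesis using f t unfolding strictly_convex_def by (auto simp: less_imp_le)
    qed
  qed simp
  have tan: "f' b * (a - b) \<le> f a - f b" for a b
    by (rule convex_on_imp_above_tangent[OF cv]) (use d[of b] in auto)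
  define \<delta> where "\<delta> = (y - x) / 2"
  have \<delta>: "\<delta> > 0" using xy by (simp add: \<delta>_def)
  have "x \<noteq> y \<and> 0 < (1/2::real) \<and> (1/2::real) < 1" using xy by simp
  then have "f ((1 - 1/2) * x + 1/2 * y) < (1 - 1/2) * f x + 1/2 * f y"
    using f unfolding strictly_convex_def by blast
  moreover have "(1 - 1/2) * x + 1/2 * y = x + \<delta>" by (simp add: \<delta>_def field_simps)
  ultimately have "f (x + \<delta>) - f x < f y - f (x + \<delta>)" by simp
  moreover have "f' x * \<delta> \<le> f (x + \<delta>) - f x" using tan[of x "x + \<delta>"] by simp
  moreover have e: "x + \<delta> - y = - \<delta>" by (simp add: \<delta>_def field_simps)
  have "f y - f (x + \<delta>) \<le> f' y * \<delta>" using tan[of y "x + \<delta>"] unfolding e by simp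
  ultimately have "f' x * \<delta> < f' y * \<delta>" by linarith
  then show ?thesis using \<delta> by simp
qed

context control
begin

lemma Fa_strict_mono: "\<tau> \<in> {0..T} \<Longrightarrow> 0 \<le> r \<Longrightarrow> a < b \<Longrightarrow> Fa i \<tau> r a < Fa i \<tau> r b"
  using strictly_convex_deriv_strict_mono[OF convex_F deriv_a] by blast

lemma cont_bounded:
  fixes H :: "real \<Rightarrow> real \<Rightarrow> real \<Rightarrow> real"
  assumes H: "continuous_on ({0..T} \<times> {0..} \<times> UNIV) (\<lambda>(\<tau>, r, a). H \<tau> r a :: real)"
  obtains B where "B \<ge> 0" "\<And>\<tau> r a. \<tau> \<in> {0..T} \<Longrightarrow> r \<in> {0..R} \<Longrightarrow> \<bar>a\<bar> \<le> V \<Longrightarrow> \<bar>H \<tau> r a\<bar> \<le> B"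
proof -
  have "continuous_on ({0..T} \<times> {0..R} \<times> {-V..V}) (\<lambda>(\<tau>, r, a). H \<tau> r a :: real)"
    using H by (rule continuous_on_subset) auto
  then have "bounded ((\<lambda>(\<tau>, r, a). H \<tau> r a) ` ({0..T} \<times> {0..R} \<times> {-V..V}))"
    by (intro compact_imp_bounded compact_continuous_image compact_Times) auto
  then obtain B where B: "\<forall>q\<in>{0..T} \<times> {0..R} \<times> {-V..V}. norm ((\<lambda>(\<tau>, r, a). H \<tau> r a) q) \<le> B"
    unfolding bounded_iff by blast
  show ?thesis
  proof (rule that[of "max B 0"])
    fix \<tau> r a assume "\<tau> \<in> {0..T}" "r \<in> {0..R}" "\<bar>a\<bar> \<le> V"
    then have "(\<tau>, r, a) \<in> {0..T} \<times> {0..R} \<times> {-V..V}" by auto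
    from bspec[OF B this] show "\<bar>H \<tau> r a\<bar> \<le> max B 0" by simp
  qed simp
qed

lemma comp_absolutely_integrable:
  fixes w v :: "real \<Rightarrow> real" and H :: "real \<Rightarrow> real \<Rightarrow> real \<Rightarrow> real"
  assumes H: "continuous_on ({0..T} \<times> {0..} \<times> UNIV) (\<lambda>(\<tau>, r, a). H \<tau> r a :: real)"
    and ab: "{a..b} \<subseteq> {0..T}" and w: "continuous_on {a..b} w" "\<And>\<tau>. \<tau> \<in> {a..b} \<Longrightarrow> 0 \<le> w \<tau>"
    and v: "v \<in> borel_measurable (lebesgue_on {a..b})" "\<And>\<tau>. \<tau> \<in> {a..b} \<Longrightarrow> \<bar>v \<tau>\<bar> \<le> V"
  shows "(\<lambda>\<tau>. H \<tau> (w \<tau>) (v \<tau>)) absolutely_integrable_on {a..b}"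
proof -
  obtain R where R: "\<forall>x\<in>w ` {a..b}. norm x \<le> R"
    using continuous_on_Icc_bounded_measurable(1)[OF w(1)] unfolding bounded_iff by blast
  obtain B where "B \<ge> 0" and B: "\<And>\<tau> r a. \<tau> \<in> {0..T} \<Longrightarrow> r \<in> {0..R} \<Longrightarrow> \<bar>a\<bar> \<le> V \<Longrightarrow> \<bar>H \<tau> r a\<bar> \<le> B"
    using cont_bounded[OF H, where R = R and V = V] by blast
  show ?thesis
  proof (rule measurable_bounded_by_integrable_imp_absolutely_integrable)
    show "(\<lambda>\<tau>. H \<tau> (w \<tau>) (v \<tau>)) \<in> borel_measurable (lebesgue_on {a..b})"
      by (rule measurable_comp[OF H ab _ w(2) v(1)]) (use continuous_on_Icc_bounded_measurable(2)[OF w(1)] in auto)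
    show "(\<lambda>_. B) integrable_on {a..b}" by (rule Henstock_Kurzweil_Integration.integrable_const_ivl)
    fix \<tau> assume \<tau>: "\<tau> \<in> {a..b}"
    then have "\<bar>w \<tau>\<bar> \<le> R" using R by simp
    then have "w \<tau> \<in> {0..R}" using w(2)[OF \<tau>] by simp
    then show "norm (H \<tau> (w \<tau>) (v \<tau>)) \<le> B" using B[of \<tau> "w \<tau>" "v \<tau>"] \<tau> ab v(2) by auto
  qed simp
qed

text \<open>The directional derivative of the running cost along (\<xi>, \<zeta>), by dominated
  convergence of difference quotients. The lower bound c on the position leaves room for
  perturbations of either sign, although \<open>F\<close> is differentiable in r only on the
  half-line.\<close>

lemma variation_deriv:
  fixes w v \<xi> \<zeta> :: "real \<Rightarrow> real"
  assumes ab: "{a..b} \<subseteq> {0..T}" and w: "continuous_on {a..b} w" "\<And>\<tau>. \<tau> \<in> {a..b} \<Longrightarrow> c \<le> w \<tau>" and c: "c > 0"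
    and v: "v \<in> borel_measurable (lebesgue_on {a..b})" "\<And>\<tau>. \<tau> \<in> {a..b} \<Longrightarrow> \<bar>v \<tau>\<bar> \<le> V"
    and \<xi>: "continuous_on {a..b} \<xi>" "\<And>\<tau>. \<tau> \<in> {a..b} \<Longrightarrow> \<bar>\<xi> \<tau>\<bar> \<le> X"
    and \<zeta>: "\<zeta> \<in> borel_measurable (lebesgue_on {a..b})" "\<And>\<tau>. \<tau> \<in> {a..b} \<Longrightarrow> \<bar>\<zeta> \<tau>\<bar> \<le> Z"
    and XZ: "X \<ge> 0" "Z \<ge> 0"
  shows "((\<lambda>h. integral {a..b} (\<lambda>\<tau>. F i \<tau> (w \<tau> + h * \<xi> \<tau>) (v \<tau> + h * \<zeta> \<tau>))) has_real_derivative
      integral {a..b} (\<lambda>\<tau>. Fx i \<tau> (w \<tau>) (v \<tau>) * \<xi> \<tau> + Fa i \<tau> (w \<tau>) (v \<tau>) * \<zeta> \<tau>)) (at 0)"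
  unfolding DERIV_def tendsto_at_iff_sequentially
proof (intro allI impI)
  let ?D = "integral {a..b} (\<lambda>\<tau>. Fx i \<tau> (w \<tau>) (v \<tau>) * \<xi> \<tau> + Fa i \<tau> (w \<tau>) (v \<tau>) * \<zeta> \<tau>)"
  let ?\<phi> = "\<lambda>h. integral {a..b} (\<lambda>\<tau>. F i \<tau> (w \<tau> + h * \<xi> \<tau>) (v \<tau> + h * \<zeta> \<tau>))"
  fix S :: "nat \<Rightarrow> real" assume S0: "\<forall>n. S n \<in> UNIV - {0}" and S: "S \<longlonglongrightarrow> 0"
  \<comment> \<open>Below this size |h| X < c, so the perturbed position stays positive, and |h|
    \<le> 1 keeps all arguments in a fixed compact set. The sequence is shifted by N to meet this
    bound from the start.\<close>
  define h0 where "h0 = min 1 (c / (X + 1))"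
  have h0: "h0 > 0" using c XZ by (simp add: h0_def)
  obtain N where N: "\<And>n. n \<ge> N \<Longrightarrow> \<bar>S n\<bar> < h0" using LIMSEQ_D[OF S h0] by auto
  define h where "h n = S (n + N)" for n
  have h: "h n \<noteq> 0" "\<bar>h n\<bar> < h0" for n using S0 N[of "n + N"] by (auto simp: h_def)
  have hl: "h \<longlonglongrightarrow> 0" unfolding h_def[abs_def] using S by (rule LIMSEQ_ignore_initial_segment)
  obtain W where W: "\<forall>x\<in>w ` {a..b}. norm x \<le> W"
    using continuous_on_Icc_bounded_measurable(1)[OF w(1)] unfolding bounded_iff by blast
  have hb: "\<bar>e * \<xi> \<tau>\<bar> \<le> X" "\<bar>e * \<zeta> \<tau>\<bar> \<le> Z" "\<bar>e * \<xi> \<tau>\<bar> < c" if e: "\<bar>e\<bar> < h0" and \<tau>: "\<tau> \<in> {a..b}" for e \<tau>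
  proof -
    have e1: "\<bar>e\<bar> \<le> 1" "\<bar>e\<bar> < c / (X + 1)" using e by (auto simp: h0_def)
    show "\<bar>e * \<xi> \<tau>\<bar> \<le> X" using mult_mono[OF e1(1) \<xi>(2)[OF \<tau>]] by (simp add: abs_mult)
    show "\<bar>e * \<zeta> \<tau>\<bar> \<le> Z" using mult_mono[OF e1(1) \<zeta>(2)[OF \<tau>]] by (simp add: abs_mult)
    have "\<bar>e * \<xi> \<tau>\<bar> \<le> \<bar>e\<bar> * (X + 1)" using \<xi>(2)[OF \<tau>] by (auto simp: abs_mult intro!: mult_left_mono)
    also have "\<dots> < c" using e1(2) XZ(1) by (simp add: field_simps)
    finally show "\<bar>e * \<xi> \<tau>\<bar> < c" .
  qed
  have dom: "0 \<le> w \<tau> + e * \<xi> \<tau>" "w \<tau> + e * \<xi> \<tau> \<in> {0..W + X}" "\<bar>v \<tau> + e * \<zeta> \<tau>\<bar> \<le> V + Z" "w \<tau> \<in> {0..W + X}"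
    if e: "\<bar>e\<bar> < h0" and \<tau>: "\<tau> \<in> {a..b}" for e \<tau>
  proof -
    have "\<bar>w \<tau>\<bar> \<le> W" using W \<tau> by simp
    then show "0 \<le> w \<tau> + e * \<xi> \<tau>" "w \<tau> + e * \<xi> \<tau> \<in> {0..W + X}" "\<bar>v \<tau> + e * \<zeta> \<tau>\<bar> \<le> V + Z" "w \<tau> \<in> {0..W + X}"
      unfolding atLeastAtMost_iff using hb[OF e \<tau>] w(2)[OF \<tau>] v(2)[OF \<tau>] XZ c by linarith+
  qed
  have int: "(\<lambda>\<tau>. F i \<tau> (w \<tau> + e * \<xi> \<tau>) (v \<tau> + e * \<zeta> \<tau>)) integrable_on {a..b}" if "\<bar>e\<bar> < h0" for e
  proof -
    have "(\<lambda>\<tau>. F i \<tau> (w \<tau> + e * \<xi> \<tau>) (v \<tau> + e * \<zeta> \<tau>)) absolutely_integrable_on {a..b}"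
      by (rule comp_absolutely_integrable[OF cont_F ab, where V = "V + Z"])
        (use dom[OF that] v \<zeta> in \<open>auto intro!: continuous_intros w \<xi> borel_measurable_add borel_measurable_times\<close>)
    then show ?thesis by (rule set_lebesgue_integral_eq_integral(1))
  qed
  obtain Bx where Bx: "Bx \<ge> 0" "\<And>\<tau> r a. \<tau> \<in> {0..T} \<Longrightarrow> r \<in> {0..W + X} \<Longrightarrow> \<bar>a\<bar> \<le> V + Z \<Longrightarrow> \<bar>Fx i \<tau> r a\<bar> \<le> Bx"
    using cont_bounded[OF cont_Fx[of i], where R = "W + X" and V = "V + Z"] by blast
  obtain Ba where Ba: "Ba \<ge> 0" "\<And>\<tau> r a. \<tau> \<in> {0..T} \<Longrightarrow> r \<in> {0..W + X} \<Longrightarrow> \<bar>a\<bar> \<le> V + Z \<Longrightarrow> \<bar>Fa i \<tau> r a\<bar> \<le> Ba"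
    using cont_bounded[OF cont_Fa[of i], where R = "W + X" and V = "V + Z"] by blast
  define q where "q n \<tau> = (F i \<tau> (w \<tau> + h n * \<xi> \<tau>) (v \<tau> + h n * \<zeta> \<tau>) - F i \<tau> (w \<tau>) (v \<tau>)) / h n" for n \<tau>
  \<comment> \<open>The mean value points serve for the domination and for the pointwise limit. They
    need not depend measurably on \<tau>, because \<open>q n\<close> itself is already known to be
    integrable.\<close>
  have rep: "\<exists>z y. \<bar>z - w \<tau>\<bar> \<le> \<bar>h n * \<xi> \<tau>\<bar> \<and> z \<in> {0..W + X} \<and> \<bar>y - v \<tau>\<bar> \<le> \<bar>h n * \<zeta> \<tau>\<bar> \<and> \<bar>y\<bar> \<le> V + Z \<and>
      q n \<tau> = Fx i \<tau> z (v \<tau> + h n * \<zeta> \<tau>) * \<xi> \<tau> + Fa i \<tau> (w \<tau>) y * \<zeta> \<tau>" if \<tau>: "\<tau> \<in> {a..b}" for n \<tau>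
  proof -
    have \<tau>T: "\<tau> \<in> {0..T}" using \<tau> ab by auto
    note d = dom[OF h(2)[of n] \<tau>]
    let ?e = "h n * \<xi> \<tau>" and ?f = "h n * \<zeta> \<tau>"
    have "\<exists>z\<in>{min (w \<tau>) (w \<tau> + ?e)..max (w \<tau>) (w \<tau> + ?e)}.
        F i \<tau> (w \<tau> + ?e) (v \<tau> + ?f) - F i \<tau> (w \<tau>) (v \<tau> + ?f) = Fx i \<tau> z (v \<tau> + ?f) * (w \<tau> + ?e - w \<tau>)"
      by (rule mvt_Icc_exists[where l = 0 and u = "W + X"])
        (use d \<tau>T in \<open>auto intro!: DERIV_subset[OF deriv_x]\<close>)
    then obtain z where z: "z \<in> {min (w \<tau>) (w \<tau> + ?e)..max (w \<tau>) (w \<tau> + ?e)}"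
      "F i \<tau> (w \<tau> + ?e) (v \<tau> + ?f) - F i \<tau> (w \<tau>) (v \<tau> + ?f) = Fx i \<tau> z (v \<tau> + ?f) * ?e" by auto
    have "\<exists>y\<in>{min (v \<tau>) (v \<tau> + ?f)..max (v \<tau>) (v \<tau> + ?f)}.
        F i \<tau> (w \<tau>) (v \<tau> + ?f) - F i \<tau> (w \<tau>) (v \<tau>) = Fa i \<tau> (w \<tau>) y * (v \<tau> + ?f - v \<tau>)"
      by (rule mvt_Icc_exists[where l = "min (v \<tau>) (v \<tau> + ?f)" and u = "max (v \<tau>) (v \<tau> + ?f)"])
        (use d \<tau>T in \<open>auto intro!: has_field_derivative_at_within[OF deriv_a]\<close>)
    then obtain y where y: "y \<in> {min (v \<tau>) (v \<tau> + ?f)..max (v \<tau>) (v \<tau> + ?f)}"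
      "F i \<tau> (w \<tau>) (v \<tau> + ?f) - F i \<tau> (w \<tau>) (v \<tau>) = Fa i \<tau> (w \<tau>) y * ?f" by auto
    have "F i \<tau> (w \<tau> + ?e) (v \<tau> + ?f) - F i \<tau> (w \<tau>) (v \<tau>) = Fx i \<tau> z (v \<tau> + ?f) * ?e + Fa i \<tau> (w \<tau>) y * ?f"
      using z(2) y(2) by simp
    also have "\<dots> = h n * (Fx i \<tau> z (v \<tau> + ?f) * \<xi> \<tau> + Fa i \<tau> (w \<tau>) y * \<zeta> \<tau>)"
      by (simp add: algebra_simps)
    finally have qn: "q n \<tau> = Fx i \<tau> z (v \<tau> + ?f) * \<xi> \<tau> + Fa i \<tau> (w \<tau>) y * \<zeta> \<tau>"
      unfolding q_def using h(1)[of n] by simp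
    have "\<bar>z - w \<tau>\<bar> \<le> \<bar>?e\<bar>" "z \<in> {0..W + X}" using z(1) d by (auto simp: abs_if min_def max_def split: if_splits)
    moreover have "\<bar>y - v \<tau>\<bar> \<le> \<bar>?f\<bar>" using y(1) by (auto simp: abs_if min_def max_def split: if_splits)
    moreover have "\<bar>y\<bar> \<le> V + Z" using y(1) d(3) v(2)[OF \<tau>] XZ by (auto simp: abs_if min_def max_def split: if_splits)
    ultimately show ?thesis using qn by blast
  qed
  have dc: "(\<lambda>n. integral {a..b} (q n)) \<longlonglongrightarrow> ?D"
  proof (rule dominated_convergence(2)[where h = "\<lambda>_. Bx * X + Ba * Z"])
    have F0: "(\<lambda>\<tau>. F i \<tau> (w \<tau>) (v \<tau>)) integrable_on {a..b}" using int[of 0] h0 by simp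
    show "q n integrable_on {a..b}" for n
      unfolding q_def by (intro integrable_on_divide integrable_diff int F0 h)
    show "(\<lambda>_. Bx * X + Ba * Z) integrable_on {a..b}" by (rule Henstock_Kurzweil_Integration.integrable_const_ivl)
    fix \<tau> assume \<tau>: "\<tau> \<in> {a..b}"
    have \<tau>T: "\<tau> \<in> {0..T}" using \<tau> ab by auto
    show "norm (q n \<tau>) \<le> Bx * X + Ba * Z" for n
    proof -
      obtain z y where zy: "z \<in> {0..W + X}" "\<bar>y\<bar> \<le> V + Z"
        "q n \<tau> = Fx i \<tau> z (v \<tau> + h n * \<zeta> \<tau>) * \<xi> \<tau> + Fa i \<tau> (w \<tau>) y * \<zeta> \<tau>" using rep[OF \<tau>] by blast
      have "\<bar>Fx i \<tau> z (v \<tau> + h n * \<zeta> \<tau>) * \<xi> \<tau>\<bar> \<le> Bx * X"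
        unfolding abs_mult using Bx(2)[OF \<tau>T zy(1) dom(3)[OF h(2) \<tau>]] \<xi>(2)[OF \<tau>] by (intro mult_mono) (auto simp: Bx)
      moreover have "\<bar>Fa i \<tau> (w \<tau>) y * \<zeta> \<tau>\<bar> \<le> Ba * Z"
        unfolding abs_mult using Ba(2)[OF \<tau>T dom(4)[OF h(2) \<tau>] zy(2)] \<zeta>(2)[OF \<tau>] by (intro mult_mono) (auto simp: Ba)
      ultimately show ?thesis unfolding zy(3) real_norm_def by linarith
    qed
    show "(\<lambda>n. q n \<tau>) \<longlonglongrightarrow> Fx i \<tau> (w \<tau>) (v \<tau>) * \<xi> \<tau> + Fa i \<tau> (w \<tau>) (v \<tau>) * \<zeta> \<tau>"
    proof -
      obtain z y where zy: "\<And>n. \<bar>z n - w \<tau>\<bar> \<le> \<bar>h n * \<xi> \<tau>\<bar>" "\<And>n. z n \<in> {0..W + X}" "\<And>n. \<bar>y n - v \<tau>\<bar> \<le> \<bar>h n * \<zeta> \<tau>\<bar>"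
        "\<And>n. q n \<tau> = Fx i \<tau> (z n) (v \<tau> + h n * \<zeta> \<tau>) * \<xi> \<tau> + Fa i \<tau> (w \<tau>) (y n) * \<zeta> \<tau>"
        using rep[OF \<tau>] by metis
      have e0: "(\<lambda>n. \<bar>h n * k\<bar>) \<longlonglongrightarrow> 0" for k
        using tendsto_rabs[OF tendsto_mult[OF hl tendsto_const[of k]]] by simp
      have "(\<lambda>n. z n - w \<tau>) \<longlonglongrightarrow> 0"
        by (rule Lim_null_comparison[OF _ e0[of "\<xi> \<tau>"]]) (use zy(1) in auto)
      then have z: "z \<longlonglongrightarrow> w \<tau>" by (simp add: LIM_zero_iff)
      have "(\<lambda>n. y n - v \<tau>) \<longlonglongrightarrow> 0"
        by (rule Lim_null_comparison[OF _ e0[of "\<zeta> \<tau>"]]) (use zy(3) in auto)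
      then have y: "y \<longlonglongrightarrow> v \<tau>" by (simp add: LIM_zero_iff)
      have vh: "(\<lambda>n. v \<tau> + h n * \<zeta> \<tau>) \<longlonglongrightarrow> v \<tau>"
        using tendsto_add[OF tendsto_const tendsto_mult[OF hl tendsto_const]] by (metis add_0_right mult_zero_left)
      have "w \<tau> \<in> {0..}" using dom(4)[of 0 \<tau>] \<tau> h0 by auto
      then have m: "(\<tau>, w \<tau>, v \<tau>) \<in> {0..T} \<times> {0..} \<times> UNIV" using \<tau>T by auto
      have "(\<lambda>n. (\<lambda>(\<tau>, r, a). Fx i \<tau> r a) (\<tau>, z n, v \<tau> + h n * \<zeta> \<tau>)) \<longlonglongrightarrow> (\<lambda>(\<tau>, r, a). Fx i \<tau> r a) (\<tau>, w \<tau>, v \<tau>)"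
        by (rule continuous_on_tendsto_compose[OF cont_Fx _ m])
          (use zy(2) \<tau>T in \<open>auto intro!: tendsto_Pair z vh\<close>)
      moreover have "(\<lambda>n. (\<lambda>(\<tau>, r, a). Fa i \<tau> r a) (\<tau>, w \<tau>, y n)) \<longlonglongrightarrow> (\<lambda>(\<tau>, r, a). Fa i \<tau> r a) (\<tau>, w \<tau>, v \<tau>)"
        by (rule continuous_on_tendsto_compose[OF cont_Fa _ m])
          (use m in \<open>auto intro!: tendsto_Pair y\<close>)
      ultimately show ?thesis unfolding zy(4) by (auto intro!: tendsto_intros)
    qed
  qed
  have "integral {a..b} (q n) = (?\<phi> (0 + h n) - ?\<phi> 0) / h n" for n
  proof -
    have "integral {a..b} (q n) = integral {a..b} (\<lambda>\<tau>. F i \<tau> (w \<tau> + h n * \<xi> \<tau>) (v \<tau> + h n * \<zeta> \<tau>) - F i \<tau> (w \<tau> + 0 * \<xi> \<tau>) (v \<tau> + 0 * \<zeta> \<tau>)) / h n"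
      unfolding q_def by simp
    also have "\<dots> = (?\<phi> (0 + h n) - ?\<phi> 0) / h n"
      using h0 by (subst Henstock_Kurzweil_Integration.integral_diff[OF int int]) (auto intro: h)
    finally show ?thesis .
  qed
  then have "(\<lambda>n. ((\<lambda>e. (?\<phi> (0 + e) - ?\<phi> 0) / e) \<circ> S) (n + N)) \<longlonglongrightarrow> ?D"
    using dc by (simp add: h_def)
  then show "((\<lambda>e. (?\<phi> (0 + e) - ?\<phi> 0) / e) \<circ> S) \<longlonglongrightarrow> ?D" by (rule LIMSEQ_offset)
qed

end

section \<open>Variations inside an edge and the Euler-Lagrange equation\<close>

lemma ac_on_deriv_measurable:
  assumes "ac_on a b f g" "{s..t} \<subseteq> {a..b}"
  shows "g \<in> borel_measurable (lebesgue_on {s..t})"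
proof -
  have "g absolutely_integrable_on {s..t}"
    by (rule set_integrable_subset[OF ac_on_absolutely_integrable[OF assms(1)] _ assms(2)]) simp
  then show ?thesis by (simp add: absolutely_integrable_measurable)
qed

text \<open>A time window strictly inside (0, T) during which the optimal curve stays in the open
  edge i. Variations supported in the window keep the initial and the final point, and there the
  curve is described by its norm alone.\<close>

locale optimal_curve = control T p C0 F Fx Fa K g g0
  for T p C0 :: real and F Fx Fa :: "'n::finite \<Rightarrow> real \<Rightarrow> real \<Rightarrow> real \<Rightarrow> real"
    and K :: "real \<Rightarrow> real" and g :: "'n \<Rightarrow> real \<Rightarrow> real" and g0 :: real +
  fixes \<gamma> :: "real \<Rightarrow> real ^ 'n" and v :: "real \<Rightarrow> real" and V a b :: real and i :: 'n
  assumes adm_\<gamma>: "adm T p 0 \<gamma>"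
    and optimal: "\<And>z. adm T p 0 z \<Longrightarrow> z 0 = \<gamma> 0 \<Longrightarrow> J 0 \<gamma> \<le> J 0 z"
    and ac_v: "ac_on 0 T (\<lambda>s. norm (\<gamma> s)) v"
    and v_le: "\<And>s. s \<in> {0..T} \<Longrightarrow> \<bar>v s\<bar> \<le> V"
    and ab: "0 < a" "a < b" "b < T"
    and pos: "\<And>s. s \<in> {a..b} \<Longrightarrow> 0 < \<gamma> s $ i"
begin

definition w :: "real \<Rightarrow> real" where "w s = norm (\<gamma> s)"

definition f :: "real \<Rightarrow> real" where "f s = Fa i s (w s) (v s)"

definition fx :: "real \<Rightarrow> real" where "fx s = Fx i s (w s) (v s)"

definition \<phi> :: "real \<Rightarrow> real \<Rightarrow> (real \<Rightarrow> real) \<Rightarrow> (real \<Rightarrow> real) \<Rightarrow> real \<Rightarrow> real" where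
  "\<phi> s t \<xi> \<zeta> h = integral {s..t} (\<lambda>\<tau>. F i \<tau> (w \<tau> + h * \<xi> \<tau>) (v \<tau> + h * \<zeta> \<tau>))"

lemma abT: "{a..b} \<subseteq> {0..T}"
  using ab by auto

lemma \<gamma>_eq:
  assumes s: "s \<in> {a..b}"
  shows "\<gamma> s = w s *\<^sub>R axis i 1" "0 < w s"
proof -
  have "s \<in> {0..T}" using s abT by blast
  note J = junction_component_pos[OF admD(3)[OF adm_\<gamma> this] pos[OF s]]
  show "\<gamma> s = w s *\<^sub>R axis i 1" using J by (simp add: w_def)
  show "0 < w s" using J pos[OF s] by (simp add: w_def)
qed

lemma cont_w: "continuous_on {0..T} w"
  using ac_on_continuous[OF ac_v] by (simp add: w_def[abs_def])

lemma cont_w_ab: "continuous_on {a..b} w"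
  using cont_w abT by (rule continuous_on_subset)

lemma w_lower: "\<exists>c>0. \<forall>s\<in>{a..b}. c \<le> w s"
proof -
  have "\<exists>s\<in>{a..b}. \<forall>t\<in>{a..b}. w s \<le> w t"
    by (rule continuous_attains_inf[OF _ _ cont_w_ab]) (use ab in auto)
  then show ?thesis using \<gamma>_eq(2) by blast
qed

lemma v_measurable: "{s..t} \<subseteq> {0..T} \<Longrightarrow> v \<in> borel_measurable (lebesgue_on {s..t})"
  by (rule ac_on_deriv_measurable[OF ac_v])

context
  fixes \<xi> \<zeta> :: "real \<Rightarrow> real" and X Z :: real
  assumes ac_\<xi>: "ac_on 0 T \<xi> \<zeta>" and \<zeta>_le: "\<And>s. \<bar>\<zeta> s\<bar> \<le> Z" and \<xi>_le: "\<And>s. \<bar>\<xi> s\<bar> \<le> X"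
    and outside_ab: "\<forall>s. s \<notin> {a..b} \<longrightarrow> \<xi> s = 0 \<and> \<zeta> s = 0"
begin

lemma outside: "s \<notin> {a..b} \<Longrightarrow> \<xi> s = 0" "s \<notin> {a..b} \<Longrightarrow> \<zeta> s = 0"
  using outside_ab by blast+

lemma XZ: "X \<ge> 0" "Z \<ge> 0"
  using \<xi>_le[of 0] \<zeta>_le[of 0] by linarith+

lemma \<zeta>_measurable: "{s..t} \<subseteq> {0..T} \<Longrightarrow> \<zeta> \<in> borel_measurable (lebesgue_on {s..t})"
  by (rule ac_on_deriv_measurable[OF ac_\<xi>])

lemma \<phi>_deriv:
  assumes st: "a \<le> s" "t \<le> b"
  shows "(\<phi> s t \<xi> \<zeta> has_real_derivative integral {s..t} (\<lambda>\<tau>. fx \<tau> * \<xi> \<tau> + f \<tau> * \<zeta> \<tau>)) (at 0)"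
proof -
  obtain c where c: "c > 0" "\<And>s. s \<in> {a..b} \<Longrightarrow> c \<le> w s" using w_lower by blast
  have sub: "{s..t} \<subseteq> {a..b}" "{s..t} \<subseteq> {0..T}" using st abT by auto
  show ?thesis
    unfolding \<phi>_def[abs_def] fx_def f_def
  proof (rule variation_deriv[OF sub(2) _ _ c(1), where V = V and X = X and Z = Z])
    show "continuous_on {s..t} w" using cont_w sub(2) by (rule continuous_on_subset)
    show "continuous_on {s..t} \<xi>" using ac_on_continuous[OF ac_\<xi>] sub(2) by (rule continuous_on_subset)
  qed (use c sub v_le v_measurable[OF sub(2)] \<zeta>_measurable[OF sub(2)] \<zeta>_le \<xi>_le XZ in auto)
qed

text \<open>As long as |h| X stays below the distance c to the vertex, the perturbed curve remains
  on the same edge and its norm is \<open>w + h * \<xi>\<close>. The cost then changes only within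
  [a, b], which explains the clipping by \<open>max a s\<close> and \<open>min b t\<close> when part
  of the time interval is considered.\<close>

lemma perturbation:
  assumes c: "\<forall>s\<in>{a..b}. c \<le> w s" and h: "\<bar>h\<bar> * X < c"
  defines "y \<equiv> \<lambda>s. \<gamma> s + (h * \<xi> s) *\<^sub>R axis i 1"
  shows "adm T p 0 y" "y 0 = \<gamma> 0" "y T = \<gamma> T" "ac_on 0 T (\<lambda>s. norm (y s)) (\<lambda>s. v s + h * \<zeta> s)"
    and "0 \<le> s \<Longrightarrow> t \<le> T \<Longrightarrow>
      integral {s..t} (\<lambda>\<tau>. run \<tau> (y \<tau>) (v \<tau> + h * \<zeta> \<tau>)) =
      integral {s..t} (\<lambda>\<tau>. run \<tau> (\<gamma> \<tau>) (v \<tau>)) + (\<phi> (max a s) (min b t) \<xi> \<zeta> h - \<phi> (max a s) (min b t) \<xi> \<zeta> 0)"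
proof -
  have hx: "\<bar>h * \<xi> s\<bar> < w s" if "s \<in> {a..b}" for s
  proof -
    have "\<bar>h * \<xi> s\<bar> \<le> \<bar>h\<bar> * X" unfolding abs_mult by (intro mult_left_mono \<xi>_le) simp
    also have "\<dots> < c" by (rule h)
    also have "\<dots> \<le> w s" using c that by blast
    finally show ?thesis .
  qed
  have yin: "y s = (w s + h * \<xi> s) *\<^sub>R axis i 1" "0 < w s + h * \<xi> s" if "s \<in> {a..b}" for s
    using \<gamma>_eq[OF that] hx[OF that] by (auto simp: y_def scaleR_add_left abs_if split: if_splits)
  have yout: "y s = \<gamma> s" if "s \<notin> {a..b}" for s using outside(1)[OF that] by (simp add: y_def)
  have \<xi>h: "ac_on 0 T (\<lambda>s. h * \<xi> s) (\<lambda>s. h * \<zeta> s)"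
    by (rule ac_on_bounded_linear[OF ac_\<xi> bounded_linear_mult_right])
  show adm: "adm T p 0 y"
    unfolding y_def
  proof (rule adm_add_axis[OF adm_\<gamma> \<xi>h, where B = "\<bar>h\<bar> * Z"])
    show "\<bar>h * \<zeta> s\<bar> \<le> \<bar>h\<bar> * Z" for s unfolding abs_mult by (intro mult_left_mono \<zeta>_le) simp
    show "h * \<xi> s = h * \<xi> 0" if "s \<le> 0" for s using outside(1)[of s] outside(1)[of 0] that ab by simp
    show "h * \<xi> s = h * \<xi> T" if "s \<ge> T" for s using outside(1)[of s] outside(1)[of T] that ab by simp
    show "\<gamma> s + (h * \<xi> s) *\<^sub>R axis i 1 \<in> junction" if "s \<in> {0..T}" for s
    proof (cases "s \<in> {a..b}")
      case True
      then show ?thesis using yin[OF True] axis_scaleR_in_junction[of "w s + h * \<xi> s" i] by (simp add: y_def)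
    next
      case False
      then show ?thesis using outside(1)[OF False] admD(3)[OF adm_\<gamma> that] by simp
    qed
  qed (use p in simp)
  show "y 0 = \<gamma> 0" "y T = \<gamma> T" using yout[of 0] yout[of T] ab by auto
  have "norm (y s) = norm (\<gamma> s) + h * \<xi> s" for s
  proof (cases "s \<in> {a..b}")
    case True
    then show ?thesis using yin[OF True] by (simp add: w_def)
  next
    case False
    then show ?thesis using yout[OF False] outside(1)[OF False] by simp
  qed
  then show "ac_on 0 T (\<lambda>s. norm (y s)) (\<lambda>s. v s + h * \<zeta> s)"
    using ac_on_add[OF ac_v \<xi>h] by simp
  note acy = this
  assume st: "0 \<le> s" "t \<le> T"
  let ?A = "{max a s..min b t}"
  have A: "?A = {a..b} \<inter> {s..t}" by auto
  have r1: "(\<lambda>\<tau>. run \<tau> (y \<tau>) (v \<tau> + h * \<zeta> \<tau>)) integrable_on {s..t}"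
    by (rule integrable_on_subIcc[OF adm_run_integrable[OF adm order_refl acy] st])
  have r2: "(\<lambda>\<tau>. run \<tau> (\<gamma> \<tau>) (v \<tau>)) integrable_on {s..t}"
    by (rule integrable_on_subIcc[OF adm_run_integrable[OF adm_\<gamma> order_refl ac_v] st])
  let ?F = "\<lambda>e \<tau>. F i \<tau> (w \<tau> + e * \<xi> \<tau>) (v \<tau> + e * \<zeta> \<tau>)"
  have "integral {s..t} (\<lambda>\<tau>. run \<tau> (y \<tau>) (v \<tau> + h * \<zeta> \<tau>)) - integral {s..t} (\<lambda>\<tau>. run \<tau> (\<gamma> \<tau>) (v \<tau>)) =
      integral {s..t} (\<lambda>\<tau>. run \<tau> (y \<tau>) (v \<tau> + h * \<zeta> \<tau>) - run \<tau> (\<gamma> \<tau>) (v \<tau>))"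
    by (rule Henstock_Kurzweil_Integration.integral_diff[symmetric, OF r1 r2])
  also have "\<dots> = integral {s..t} (\<lambda>\<tau>. if \<tau> \<in> {a..b} then ?F h \<tau> - ?F 0 \<tau> else 0)"
  proof (rule integral_cong)
    fix \<tau> assume "\<tau> \<in> {s..t}"
    show "run \<tau> (y \<tau>) (v \<tau> + h * \<zeta> \<tau>) - run \<tau> (\<gamma> \<tau>) (v \<tau>) = (if \<tau> \<in> {a..b} then ?F h \<tau> - ?F 0 \<tau> else 0)"
    proof (cases "\<tau> \<in> {a..b}")
      case True
      then show ?thesis using yin[OF True] \<gamma>_eq[OF True] by (simp add: run_edge)
    next
      case False
      then show ?thesis using yout[OF False] outside(2)[OF False] by auto
    qed
  qed
  also have "\<dots> = integral ?A (\<lambda>\<tau>. ?F h \<tau> - ?F 0 \<tau>)"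
    unfolding A by (rule Henstock_Kurzweil_Integration.integral_restrict_Int)
  also have "\<dots> = \<phi> (max a s) (min b t) \<xi> \<zeta> h - \<phi> (max a s) (min b t) \<xi> \<zeta> 0"
  proof -
    have sub: "?A \<subseteq> {0..T}" using st by auto
    have int: "?F e integrable_on ?A" if e: "\<And>\<tau>. \<tau> \<in> ?A \<Longrightarrow> 0 \<le> w \<tau> + e * \<xi> \<tau>" for e
    proof -
      have "?F e absolutely_integrable_on ?A"
      proof (rule comp_absolutely_integrable[OF cont_F sub _ e, where V = "V + \<bar>e\<bar> * Z"])
        show "continuous_on ?A (\<lambda>\<tau>. w \<tau> + e * \<xi> \<tau>)"
          by (intro continuous_intros continuous_on_subset[OF cont_w sub]
              continuous_on_subset[OF ac_on_continuous[OF ac_\<xi>] sub])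
        show "(\<lambda>\<tau>. v \<tau> + e * \<zeta> \<tau>) \<in> borel_measurable (lebesgue_on ?A)"
          using v_measurable[OF sub] \<zeta>_measurable[OF sub] by measurable
        show "\<bar>v \<tau> + e * \<zeta> \<tau>\<bar> \<le> V + \<bar>e\<bar> * Z" if "\<tau> \<in> ?A" for \<tau>
        proof -
          have "\<bar>e * \<zeta> \<tau>\<bar> \<le> \<bar>e\<bar> * Z" unfolding abs_mult by (intro mult_left_mono \<zeta>_le) simp
          moreover have "\<bar>v \<tau>\<bar> \<le> V" using v_le sub that by blast
          ultimately show ?thesis by linarith
        qed
      qed
      then show ?thesis by (rule set_lebesgue_integral_eq_integral(1))
    qed
    have "?F h integrable_on ?A" by (rule int) (use yin(2) in \<open>auto simp: less_imp_le\<close>)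
    moreover have "?F 0 integrable_on ?A" by (rule int) (simp add: w_def)
    ultimately show ?thesis unfolding \<phi>_def by (rule Henstock_Kurzweil_Integration.integral_diff)
  qed
  finally show "integral {s..t} (\<lambda>\<tau>. run \<tau> (y \<tau>) (v \<tau> + h * \<zeta> \<tau>)) =
      integral {s..t} (\<lambda>\<tau>. run \<tau> (\<gamma> \<tau>) (v \<tau>)) + (\<phi> (max a s) (min b t) \<xi> \<zeta> h - \<phi> (max a s) (min b t) \<xi> \<zeta> 0)"
    by simp
qed

lemma small_h: "\<exists>d>0. \<exists>c. (\<forall>s\<in>{a..b}. c \<le> w s) \<and> (\<forall>h. \<bar>h\<bar> < d \<longrightarrow> \<bar>h\<bar> * X < c)"
proof -
  obtain c where c: "c > 0" "\<And>s. s \<in> {a..b} \<Longrightarrow> c \<le> w s" using w_lower by blast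
  have "\<bar>h\<bar> * X < c" if "\<bar>h\<bar> < c / (X + 1)" for h
  proof -
    have "\<bar>h\<bar> * X \<le> \<bar>h\<bar> * (X + 1)" by (intro mult_left_mono) auto
    also have "\<dots> < c" using that XZ(1) by (simp add: field_simps)
    finally show ?thesis .
  qed
  then show ?thesis using c XZ(1) by (intro exI[of _ "c / (X + 1)"] conjI exI[of _ c]) auto
qed

lemma Euler_Lagrange_weak: "integral {a..b} (\<lambda>\<tau>. fx \<tau> * \<xi> \<tau> + f \<tau> * \<zeta> \<tau>) = 0"
proof -
  obtain d c where d: "d > 0" "\<forall>s\<in>{a..b}. c \<le> w s" "\<And>h. \<bar>h\<bar> < d \<Longrightarrow> \<bar>h\<bar> * X < c"
    using small_h by blast
  show ?thesis
  proof (rule DERIV_local_min[OF \<phi>_deriv d(1)])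
    show "\<forall>h. \<bar>0 - h\<bar> < d \<longrightarrow> \<phi> a b \<xi> \<zeta> 0 \<le> \<phi> a b \<xi> \<zeta> h"
    proof (intro allI impI)
      fix h :: real assume "\<bar>0 - h\<bar> < d"
      then have "\<bar>h\<bar> * X < c" using d(3) by simp
      note P = perturbation[OF d(2) this]
      let ?y = "\<lambda>s. \<gamma> s + (h * \<xi> s) *\<^sub>R axis i 1"
      have "J 0 \<gamma> \<le> J 0 ?y" by (rule optimal[OF P(1) P(2)])
      then have "integral {0..T} (\<lambda>\<tau>. run \<tau> (\<gamma> \<tau>) (v \<tau>)) \<le> integral {0..T} (\<lambda>\<tau>. run \<tau> (?y \<tau>) (v \<tau> + h * \<zeta> \<tau>))"
        using J_eq[OF P(1) order_refl T P(4)] J_eq[OF adm_\<gamma> order_refl T ac_v] arg_cong[OF P(3), of terminal]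
        by linarith
      then show "\<phi> a b \<xi> \<zeta> 0 \<le> \<phi> a b \<xi> \<zeta> h" using P(5)[of 0 T] ab by simp
    qed
  qed auto
qed

end

definition ext0 :: "(real \<Rightarrow> real) \<Rightarrow> real \<Rightarrow> real" where
  "ext0 \<zeta> s = (if s \<in> {a..b} then \<zeta> s else 0)"

definition prim0 :: "(real \<Rightarrow> real) \<Rightarrow> real \<Rightarrow> real" where
  "prim0 \<zeta> s = (if s \<in> {a..b} then integral {a..s} \<zeta> else 0)"

lemma ac_on_prim0_ab:
  assumes "\<zeta> absolutely_integrable_on {a..b}"
  shows "ac_on a b (prim0 \<zeta>) \<zeta>"
  by (rule ac_onI[OF assms]) (use ab in \<open>auto simp: prim0_def\<close>)

text \<open>The zero mean of \<zeta> makes its primitive return to 0 at b, so that extension by zero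
  creates no jump.\<close>

lemma ac_on_prim0:
  assumes \<zeta>: "\<zeta> absolutely_integrable_on {a..b}" "integral {a..b} \<zeta> = 0"
  shows "ac_on 0 T (prim0 \<zeta>) (ext0 \<zeta>)"
proof -
  have 1: "ac_on 0 a (prim0 \<zeta>) (\<lambda>_. 0)" using ab by (intro ac_onI) (auto simp: prim0_def)
  have 3: "ac_on b T (prim0 \<zeta>) (\<lambda>_. 0)" using ab \<zeta>(2) by (intro ac_onI) (auto simp: prim0_def)
  have "ac_on 0 b (prim0 \<zeta>) (\<lambda>x. if x \<le> a then 0 else \<zeta> x)"
    using ab by (intro ac_on_join[OF 1 ac_on_prim0_ab[OF \<zeta>(1)]]) auto
  then have "ac_on 0 T (prim0 \<zeta>) (\<lambda>x. if x \<le> b then if x \<le> a then 0 else \<zeta> x else 0)"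
    using ab by (intro ac_on_join[OF _ 3]) auto
  then show ?thesis
  proof (rule ac_on_cong_AE)
    show "AE x in lebesgue. x \<in> {0..T} \<longrightarrow> ext0 \<zeta> x = (if x \<le> b then if x \<le> a then 0 else \<zeta> x else 0)"
      using AE_lebesgue_neq[of a] by eventually_elim (auto simp: ext0_def)
  qed
qed

lemma prim0_le:
  assumes \<zeta>: "\<zeta> absolutely_integrable_on {a..b}" and Z: "\<And>s. s \<in> {a..b} \<Longrightarrow> \<bar>\<zeta> s\<bar> \<le> Z"
  shows "\<bar>prim0 \<zeta> s\<bar> \<le> Z * (b - a)"
proof (cases "s \<in> {a..b}")
  case True
  have "Z \<ge> 0" using Z[of a] ab by auto
  have "norm (integral {a..s} \<zeta>) \<le> integral {a..s} (\<lambda>_. Z)"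
    using True Z integrable_on_subIcc[OF \<zeta>, of a s] by (intro integral_norm_bound_integral) auto
  also have "\<dots> \<le> Z * (b - a)" using True \<open>Z \<ge> 0\<close> by (simp add: mult.commute mult_left_mono)
  finally show ?thesis using True by (simp add: prim0_def)
next
  case False
  have "Z \<ge> 0" using Z[of a] ab by auto
  then show ?thesis using False ab by (auto simp: prim0_def)
qed

lemma comp_ab:
  assumes H: "continuous_on ({0..T} \<times> {0..} \<times> UNIV) (\<lambda>(\<tau>, r, a). H \<tau> r a :: real)"
  shows "(\<lambda>\<tau>. H \<tau> (w \<tau>) (v \<tau>)) absolutely_integrable_on {a..b}"
    "\<exists>B. \<forall>\<tau>\<in>{a..b}. \<bar>H \<tau> (w \<tau>) (v \<tau>)\<bar> \<le> B"
proof -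
  show "(\<lambda>\<tau>. H \<tau> (w \<tau>) (v \<tau>)) absolutely_integrable_on {a..b}"
    by (rule comp_absolutely_integrable[OF H abT cont_w_ab _ v_measurable[OF abT], where V = V])
      (use v_le abT in \<open>auto simp: w_def\<close>)
  obtain W where W: "\<forall>x\<in>w ` {a..b}. norm x \<le> W"
    using continuous_on_Icc_bounded_measurable(1)[OF cont_w_ab] unfolding bounded_iff by blast
  obtain B where "B \<ge> 0" and B: "\<And>\<tau> r a. \<tau> \<in> {0..T} \<Longrightarrow> r \<in> {0..W} \<Longrightarrow> \<bar>a\<bar> \<le> V \<Longrightarrow> \<bar>H \<tau> r a\<bar> \<le> B"
    using cont_bounded[OF H, where R = W and V = V] by blast
  show "\<exists>B. \<forall>\<tau>\<in>{a..b}. \<bar>H \<tau> (w \<tau>) (v \<tau>)\<bar> \<le> B"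
  proof (intro exI ballI)
    fix \<tau> assume \<tau>: "\<tau> \<in> {a..b}"
    show "\<bar>H \<tau> (w \<tau>) (v \<tau>)\<bar> \<le> B"
    proof (rule B)
      have "\<bar>w \<tau>\<bar> \<le> W" using W \<tau> by simp
      then show "w \<tau> \<in> {0..W}" using \<gamma>_eq(2)[OF \<tau>] by simp
      show "\<tau> \<in> {0..T}" using \<tau> abT by blast
      then show "\<bar>v \<tau>\<bar> \<le> V" by (rule v_le)
    qed
  qed
qed

text \<open>The du Bois-Reymond argument, with the primitive of \<open>f - \<integral>fx\<close> minus its mean as variation.\<close>

lemma Euler_Lagrange:
  obtains P where "ac_on a b P fx" "AE s in lebesgue. s \<in> {a..b} \<longrightarrow> f s = P s"
proof -
  have fi: "f absolutely_integrable_on {a..b}" unfolding f_def[abs_def] by (rule comp_ab(1)[OF cont_Fa])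
  have fxi: "fx absolutely_integrable_on {a..b}" unfolding fx_def[abs_def] by (rule comp_ab(1)[OF cont_Fx])
  obtain Bf where Bf: "\<And>s. s \<in> {a..b} \<Longrightarrow> \<bar>f s\<bar> \<le> Bf"
    using comp_ab(2)[OF cont_Fa] unfolding f_def by blast
  define Q where "Q s = integral {a..s} fx" for s
  have Q: "ac_on a b Q fx" by (rule ac_onI[OF fxi]) (simp add: Q_def)
  have cQ: "continuous_on {a..b} Q" using ac_on_continuous[OF Q] .
  have Qi: "Q absolutely_integrable_on {a..b}" by (rule absolutely_integrable_continuous_real[OF cQ])
  obtain BQ where BQ: "\<forall>x\<in>Q ` {a..b}. norm x \<le> BQ"
    using continuous_on_Icc_bounded_measurable(1)[OF cQ] unfolding bounded_iff by blast
  \<comment> \<open>The mean value of f - Q over [a, b], so that \<zeta> = f - Q - c has integral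
    zero and is an admissible variation.\<close>
  define c where "c = integral {a..b} (\<lambda>s. f s - Q s) / (b - a)"
  define P where "P s = Q s + c" for s
  define \<zeta> where "\<zeta> s = f s - P s" for s
  have fQi: "(\<lambda>s. f s - Q s) absolutely_integrable_on {a..b}" by (rule set_integral_diff(1)[OF fi Qi])
  have "(\<lambda>s. (f s - Q s) - c) absolutely_integrable_on {a..b}"
    by (rule set_integral_diff(1)[OF fQi]) (rule absolutely_integrable_continuous_real, simp)
  then have \<zeta>i: "\<zeta> absolutely_integrable_on {a..b}" by (simp add: \<zeta>_def[abs_def] P_def algebra_simps)
  have "integral {a..b} \<zeta> = integral {a..b} (\<lambda>s. (f s - Q s) - c)" by (simp add: \<zeta>_def[abs_def] P_def algebra_simps)
  also have "\<dots> = integral {a..b} (\<lambda>s. f s - Q s) - integral {a..b} (\<lambda>_. c)"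
    by (rule Henstock_Kurzweil_Integration.integral_diff[OF set_lebesgue_integral_eq_integral(1)[OF fQi]
          Henstock_Kurzweil_Integration.integrable_const_ivl])
  also have "\<dots> = 0" using ab by (simp add: c_def)
  finally have \<zeta>0: "integral {a..b} \<zeta> = 0" .
  define Z where "Z = Bf + BQ + \<bar>c\<bar>"
  have Z: "\<bar>\<zeta> s\<bar> \<le> Z" if "s \<in> {a..b}" for s
  proof -
    have "\<bar>Q s\<bar> \<le> BQ" using BQ that by simp
    then show ?thesis using Bf[OF that] by (simp add: \<zeta>_def P_def Z_def)
  qed
  have Z0: "Z \<ge> 0" using Z[of a] ab by auto
  let ?\<xi> = "prim0 \<zeta>"
  have EL: "integral {a..b} (\<lambda>\<tau>. fx \<tau> * ?\<xi> \<tau> + f \<tau> * ext0 \<zeta> \<tau>) = 0"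
  proof (rule Euler_Lagrange_weak[OF ac_on_prim0[OF \<zeta>i \<zeta>0]])
    show "\<bar>ext0 \<zeta> s\<bar> \<le> Z" for s using Z Z0 by (simp add: ext0_def)
    show "\<bar>prim0 \<zeta> s\<bar> \<le> Z * (b - a)" for s by (rule prim0_le[OF \<zeta>i Z])
  qed (auto simp: ext0_def prim0_def)
  have \<xi>: "ac_on a b ?\<xi> \<zeta>" by (rule ac_on_prim0_ab[OF \<zeta>i])
  have P: "ac_on a b P fx"
    by (rule ac_onI[OF fxi]) (simp add: P_def Q_def)
  \<comment> \<open>P satisfies the weak equation as well, by the product rule and the vanishing of
    the variation at a and b. Subtracting it from the equation for f leaves the integral of
    \<zeta>^2, which is therefore zero.\<close>
  have prod: "ac_on a b (\<lambda>s. P s *\<^sub>R ?\<xi> s) (\<lambda>s. fx s *\<^sub>R ?\<xi> s + P s *\<^sub>R \<zeta> s)" by (rule ac_on_scaleR[OF P \<xi>])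
  have "integral {a..b} (\<lambda>s. fx s *\<^sub>R ?\<xi> s + P s *\<^sub>R \<zeta> s) = 0"
    using ac_on_increment[OF prod, of a b] ab \<zeta>0 by (simp add: prim0_def)
  then have PI: "integral {a..b} (\<lambda>s. fx s * ?\<xi> s + P s * \<zeta> s) = 0" by simp
  have i1: "(\<lambda>s. fx s * ?\<xi> s + P s * \<zeta> s) integrable_on {a..b}"
    using ac_on_integrable[OF prod, of a b] by simp
  have f\<zeta>: "(\<lambda>s. f s * \<zeta> s) absolutely_integrable_on {a..b}"
    by (rule absolutely_integrable_bounded_measurable_product_real)
      (use fi \<zeta>i Bf in \<open>auto simp: absolutely_integrable_measurable bounded_iff intro!: exI[of _ Bf]\<close>)
  have fx\<xi>: "(\<lambda>s. ?\<xi> s * fx s) absolutely_integrable_on {a..b}"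
    by (rule absolutely_integrable_bounded_measurable_product_real)
      (use continuous_on_Icc_bounded_measurable[OF ac_on_continuous[OF \<xi>]] fxi in auto)
  have i2: "(\<lambda>s. fx s * ?\<xi> s + f s * \<zeta> s) integrable_on {a..b}"
    using f\<zeta> fx\<xi> by (intro integrable_add set_lebesgue_integral_eq_integral(1)) (simp_all add: mult.commute)
  have "integral {a..b} (\<lambda>s. fx s * ?\<xi> s + f s * \<zeta> s) = 0"
    unfolding EL[symmetric] by (rule integral_cong) (simp add: ext0_def)
  then have sq0: "integral {a..b} (\<lambda>s. \<zeta> s * \<zeta> s) = 0"
    using Henstock_Kurzweil_Integration.integral_diff[OF i2 i1] PI
    by (simp add: \<zeta>_def algebra_simps)
  have sqi: "(\<lambda>s. \<zeta> s * \<zeta> s) absolutely_integrable_on {a..b}"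
    by (rule absolutely_integrable_bounded_measurable_product_real)
      (use \<zeta>i Z in \<open>auto simp: absolutely_integrable_measurable bounded_iff intro!: exI[of _ Z]\<close>)
  have "AE s in lebesgue. s \<in> {a..b} \<longrightarrow> \<zeta> s * \<zeta> s = 0"
  proof (rule AE_zero_if_interval_integrals_zero[OF sqi])
    fix s assume s: "s \<in> {a..b}"
    have "0 \<le> integral {a..s} (\<lambda>s. \<zeta> s * \<zeta> s)"
      using s by (intro integral_nonneg integrable_on_subIcc[OF sqi]) auto
    moreover have "integral {a..s} (\<lambda>s. \<zeta> s * \<zeta> s) \<le> integral {a..b} (\<lambda>s. \<zeta> s * \<zeta> s)"
      using s by (intro integral_subset_le integrable_on_subIcc[OF sqi]) auto
    ultimately show "integral {a..s} (\<lambda>s. \<zeta> s * \<zeta> s) = 0" using sq0 by simp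
  qed
  then have "AE s in lebesgue. s \<in> {a..b} \<longrightarrow> f s = P s"
    by eventually_elim (auto simp: \<zeta>_def)
  then show ?thesis using P that by blast
qed

end

text \<open>An interval around a missing point would be a null set; thus a closed set that contains
  almost every point contains all of them, endpoints included.\<close>

lemma AE_closed_Icc_subset:
  assumes C: "closed C" and ae: "AE x in lebesgue. x \<in> {a..b} \<longrightarrow> x \<in> C" and ab: "a < b"
  shows "{a..b} \<subseteq> (C :: real set)"
proof -
  obtain N where N: "negligible N" "\<And>x. x \<notin> N \<Longrightarrow> x \<in> {a..b} \<longrightarrow> x \<in> C"
    using AE_negligibleE[OF ae] by metis
  have "{a<..<b} \<subseteq> C"
  proof
    fix x assume x: "x \<in> {a<..<b}"
    show "x \<in> C"
    proof (rule ccontr)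
      assume "x \<notin> C"
      then have "x \<in> {a<..<b} - C" using x by blast
      moreover have "open ({a<..<b} - C)" using C by (intro open_Diff) auto
      ultimately obtain e where e: "e > 0" "cball x e \<subseteq> {a<..<b} - C" using open_contains_cball by blast
      have "cbox (x - e) (x + e) \<subseteq> N"
      proof
        fix z assume "z \<in> cbox (x - e) (x + e)"
        then have "z \<in> {a<..<b} - C" using e(2) by (auto simp: cball_eq_atLeastAtMost)
        then show "z \<in> N" using N(2)[of z] by auto
      qed
      then have "negligible (cbox (x - e) (x + e))" using N(1) negligible_subset by blast
      then have "box (x - e) (x + e) = {}" by (simp only: negligible_interval)
      then show False using e(1) by simp
    qed
  qed
  then have "closure {a<..<b} \<subseteq> C" using C by (rule closure_minimal)
  then show ?thesis using ab by simp
qed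

section \<open>Continuity of the speed and the derivative of the value function\<close>

context control
begin

lemma J_restrict:
  assumes y: "adm T p 0 y" and u: "ac_on 0 T (\<lambda>s. norm (y s)) u" and t: "0 \<le> t" "t < T"
  shows "J t (\<lambda>s. y (max s t)) = integral {t..T} (\<lambda>\<tau>. run \<tau> (y \<tau>) (u \<tau>)) + terminal (y T)"
proof -
  have a: "adm T p t (\<lambda>s. y (max s t))" by (rule adm_restrict[OF y]) (use t in auto)
  have eq: "norm (y (max s t)) = norm (y s)" if "t \<le> s" for s using that by (simp add: max_absorb1)
  have ac: "ac_on t T (\<lambda>s. norm (y (max s t))) u"
    using ac_on_subinterval[OF u t(1) order_refl] ac_on_cong[of t T "\<lambda>s. norm (y (max s t))" "\<lambda>s. norm (y s)" u] eq by blast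
  have "integral {t..T} (\<lambda>\<tau>. run \<tau> (y (max \<tau> t)) (u \<tau>)) = integral {t..T} (\<lambda>\<tau>. run \<tau> (y \<tau>) (u \<tau>))"
    by (rule integral_cong) (simp add: max_absorb1)
  then show ?thesis using J_eq[OF a t ac] t by (simp add: max_absorb1)
qed

end

context optimal_curve
begin

text \<open>The solutions (s, x) of \<open>Fa i s (w s) x = P s\<close> with |x| \<le> V form a
  compact set, on which the projection to s is injective because \<open>Fa\<close> is strictly
  increasing in the speed. The Euler-Lagrange equation puts (s, v s) into it for almost every s, so
  the closed projection covers [a, b], and the set is the graph of a continuous density of
  w.\<close>

lemma C1_representative:
  "\<exists>P \<alpha>. ac_on a b P fx \<and> (AE s in lebesgue. s \<in> {a..b} \<longrightarrow> f s = P s) \<and>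
    continuous_on {a..b} \<alpha> \<and> ac_on a b w \<alpha> \<and> (\<forall>s\<in>{a..b}. Fa i s (w s) (\<alpha> s) = P s)"
proof -
  obtain P where P: "ac_on a b P fx" "AE s in lebesgue. s \<in> {a..b} \<longrightarrow> f s = P s"
    by (rule Euler_Lagrange)
  have cP: "continuous_on {a..b} P" using ac_on_continuous[OF P(1)] .
  define S where "S = {a..b} \<times> {-V..V}"
  define H where "H q = Fa i (fst q) (w (fst q)) (snd q) - P (fst q)" for q
  have S: "compact S" unfolding S_def by (intro compact_Times) auto
  have cw: "continuous_on S (\<lambda>q. w (fst q))"
    by (rule continuous_on_compose2[OF cont_w_ab]) (auto simp: S_def intro!: continuous_intros)
  have cPS: "continuous_on S (\<lambda>q. P (fst q))"
    by (rule continuous_on_compose2[OF cP]) (auto simp: S_def intro!: continuous_intros)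
  have "continuous_on S (\<lambda>q. (\<lambda>(\<tau>, r, a). Fa i \<tau> r a) (fst q, w (fst q), snd q))"
  proof (rule continuous_on_compose2[OF cont_Fa])
    show "continuous_on S (\<lambda>q. (fst q, w (fst q), snd q))" by (intro continuous_intros cw)
    show "(\<lambda>q. (fst q, w (fst q), snd q)) ` S \<subseteq> {0..T} \<times> {0..} \<times> UNIV"
      using abT by (auto simp: S_def w_def)
  qed
  then have cH: "continuous_on S H" unfolding H_def[abs_def] using cPS by (auto intro: continuous_on_diff)
  define G where "G = {q \<in> S. H q = 0}"
  have "closed G" unfolding G_def
    by (rule continuous_closed_preimage_constant[OF cH compact_imp_closed[OF S]])
  then have "compact (S \<inter> G)" by (rule compact_Int_closed[OF S])
  moreover have "S \<inter> G = G" by (auto simp: G_def)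
  ultimately have G: "compact G" by simp
  have GD: "\<tau> \<in> {a..b}" "Fa i \<tau> (w \<tau>) x = P \<tau>" if "(\<tau>, x) \<in> G" for \<tau> x
    using that by (auto simp: G_def S_def H_def)
  have uniq: "x = y" if "(\<tau>, x) \<in> G" "(\<tau>, y) \<in> G" for \<tau> x y
  proof (rule ccontr)
    assume "x \<noteq> y"
    have \<tau>: "\<tau> \<in> {0..T}" "0 \<le> w \<tau>" using GD(1)[OF that(1)] abT by (auto simp: w_def)
    show False
      using Fa_strict_mono[OF \<tau>, of x y i] Fa_strict_mono[OF \<tau>, of y x i] GD(2)[OF that(1)] GD(2)[OF that(2)] \<open>x \<noteq> y\<close>
      by (cases "x < y") auto
  qed
  have vG: "(s, v s) \<in> G" if "s \<in> {a..b}" "f s = P s" for s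
    using that v_le[of s] abT by (auto simp: G_def S_def H_def f_def abs_le_iff)
  define \<alpha> where "\<alpha> \<tau> = (SOME x. (\<tau>, x) \<in> G)" for \<tau>
  have \<alpha>: "\<alpha> \<tau> = x" if "(\<tau>, x) \<in> G" for \<tau> x
    using someI[of "\<lambda>x. (\<tau>, x) \<in> G", OF that] uniq[OF _ that] unfolding \<alpha>_def by blast
  \<comment> \<open>The inverse of a continuous injection on a compact set is continuous; this gives
    continuity of \<alpha> without an implicit function theorem, for which \<open>Fa\<close> is not
    regular enough.\<close>
  have "continuous_on (fst ` G) (\<lambda>\<tau>. (\<tau>, \<alpha> \<tau>))"
    by (rule continuous_on_inv[OF _ G]) (use \<alpha> in \<open>auto intro!: continuous_intros\<close>)
  then have c\<alpha>: "continuous_on (fst ` G) \<alpha>"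
    using continuous_on_snd by fastforce
  have sub: "{a..b} \<subseteq> fst ` G"
  proof (rule AE_closed_Icc_subset)
    show "closed (fst ` G)"
      by (intro compact_imp_closed compact_continuous_image G) (auto intro!: continuous_intros)
    show "AE x in lebesgue. x \<in> {a..b} \<longrightarrow> x \<in> fst ` G"
      using P(2)
    proof eventually_elim
      case (elim s)
      then show ?case using vG[of s] by force
    qed
  qed (rule ab(2))
  have ae: "AE s in lebesgue. s \<in> {a..b} \<longrightarrow> \<alpha> s = v s"
    using P(2) by eventually_elim (use \<alpha> vG in blast)
  have "ac_on a b w v"
    unfolding w_def[abs_def] by (rule ac_on_subinterval[OF ac_v]) (use ab in simp_all)
  from ac_on_cong_AE[OF this ae] have "ac_on a b w \<alpha>" .
  moreover have "continuous_on {a..b} \<alpha>" using c\<alpha> sub by (rule continuous_on_subset)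
  moreover have "Fa i s (w s) (\<alpha> s) = P s" if s: "s \<in> {a..b}" for s
  proof -
    obtain x where x: "(s, x) \<in> G" using sub s by force
    then show ?thesis using GD(2)[OF x] \<alpha>[OF x] by simp
  qed
  ultimately show ?thesis using P by blast
qed

text \<open>The curve is bent so as to pass at time t0 through the point at distance w t0 + h. The
  bent future competes in the problem started at that point, and the bent past can be followed by
  any continuation from it. The value function is thus trapped between two functions of h that touch
  at 0 with the common slope -P t0.\<close>

lemma derivatives:
  assumes t0: "a < t0" "t0 < b"
  shows "\<exists>\<alpha>. (w has_real_derivative \<alpha>) (at t0) \<and>
    ((\<lambda>r. U (r *\<^sub>R axis i 1) t0) has_real_derivative - Fa i t0 (w t0) \<alpha>) (at (w t0))"
proof -
  obtain P \<alpha> where P: "ac_on a b P fx" "AE s in lebesgue. s \<in> {a..b} \<longrightarrow> f s = P s"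
    and \<alpha>: "continuous_on {a..b} \<alpha>" "ac_on a b w \<alpha>" "\<forall>s\<in>{a..b}. Fa i s (w s) (\<alpha> s) = P s"
    using C1_representative by blast
  have t0ab: "t0 \<in> {a..b}" using t0 by auto
  have t0T: "0 < t0" "t0 < T" using t0 ab by auto
  have "((\<lambda>s. w a + integral {a..s} \<alpha>) has_real_derivative 0 + \<alpha> t0) (at t0 within {a..b})"
    by (intro DERIV_add DERIV_const integral_has_real_derivative \<alpha>(1) t0ab)
  then have D: "((\<lambda>s. w a + integral {a..s} \<alpha>) has_real_derivative \<alpha> t0) (at t0)"
    using at_within_Icc_at[OF t0] by simp
  have dw: "(w has_real_derivative \<alpha> t0) (at t0)"
  proof (rule has_field_derivative_transform_within_open[OF D, where S = "{a<..<b}"])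
    show "w a + integral {a..s} \<alpha> = w s" if "s \<in> {a<..<b}" for s
      using ac_on_increment[OF \<alpha>(2), of a s] that by auto
  qed (use t0 in auto)

  \<comment> \<open>The slope of the tent function with value 1 at t0 and 0 at a and b.\<close>
  define \<zeta> where "\<zeta> s = (if s \<le> t0 then 1 / (t0 - a) else - (1 / (b - t0)))" for s
  have \<zeta>i: "\<zeta> absolutely_integrable_on {a..b}"
    unfolding \<zeta>_def[abs_def] using t0
    by (intro absolutely_integrable_join absolutely_integrable_continuous_real continuous_on_const) auto
  have I1: "integral {a..t0} \<zeta> = 1"
  proof -
    have "integral {a..t0} \<zeta> = integral {a..t0} (\<lambda>_. 1 / (t0 - a))" by (rule integral_cong) (simp add: \<zeta>_def)
    then show ?thesis using t0 by simp
  qed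
  have I2: "integral {t0..b} \<zeta> = - 1"
  proof -
    have "integral {t0..b} \<zeta> = integral {t0..b} (\<lambda>_. - (1 / (b - t0)))"
      by (rule integral_spike[of "{t0}"]) (auto simp: \<zeta>_def)
    then show ?thesis using t0 by simp
  qed
  have \<zeta>0: "integral {a..b} \<zeta> = 0"
    using Henstock_Kurzweil_Integration.integral_combine[of a t0 b \<zeta>] integrable_on_subIcc[OF \<zeta>i, of a b] t0 I1 I2 by simp
  define Z where "Z = 1 / (t0 - a) + 1 / (b - t0)"
  have Z: "\<bar>\<zeta> s\<bar> \<le> Z" for s using t0 by (auto simp: \<zeta>_def Z_def)
  define \<xi> where "\<xi> = prim0 \<zeta>"
  define \<zeta>' where "\<zeta>' = ext0 \<zeta>"
  have ac\<xi>: "ac_on 0 T \<xi> \<zeta>'" unfolding \<xi>_def \<zeta>'_def by (rule ac_on_prim0[OF \<zeta>i \<zeta>0])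
  have Z': "\<bar>\<zeta>' s\<bar> \<le> Z" for s
  proof -
    have "Z \<ge> 0" using t0 by (simp add: Z_def)
    then show ?thesis using Z by (simp add: \<zeta>'_def ext0_def)
  qed
  have X: "\<bar>\<xi> s\<bar> \<le> Z * (b - a)" for s unfolding \<xi>_def by (rule prim0_le[OF \<zeta>i Z])
  have out: "\<forall>s. s \<notin> {a..b} \<longrightarrow> \<xi> s = 0 \<and> \<zeta>' s = 0"
    by (auto simp: \<xi>_def \<zeta>'_def ext0_def prim0_def)
  note ctx = ac\<xi> Z' X out
  have \<xi>v: "\<xi> a = 0" "\<xi> b = 0" "\<xi> t0 = 1"
    using t0 ab I1 \<zeta>0 by (auto simp: \<xi>_def prim0_def)

  have "ac_on a b \<xi> \<zeta>" unfolding \<xi>_def by (rule ac_on_prim0_ab[OF \<zeta>i])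
  from ac_on_scaleR[OF P(1) this]
  have prod: "ac_on a b (\<lambda>s. P s * \<xi> s) (\<lambda>s. fx s * \<xi> s + P s * \<zeta> s)" by simp
  have AEeq: "AE s in lebesgue. s \<in> {a..b} \<longrightarrow> fx s * \<xi> s + f s * \<zeta>' s = fx s * \<xi> s + P s * \<zeta> s"
    using P(2) by eventually_elim (simp add: \<zeta>'_def ext0_def)
  have int: "integral {s..t} (\<lambda>\<tau>. fx \<tau> * \<xi> \<tau> + f \<tau> * \<zeta>' \<tau>) = P t * \<xi> t - P s * \<xi> s"
    if st: "a \<le> s" "s \<le> t" "t \<le> b" for s t
  proof -
    have "AE x in lebesgue. x \<in> {s..t} \<longrightarrow> fx x * \<xi> x + f x * \<zeta>' x = fx x * \<xi> x + P x * \<zeta> x"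
      using AEeq by eventually_elim (use st in auto)
    then have "integral {s..t} (\<lambda>\<tau>. fx \<tau> * \<xi> \<tau> + f \<tau> * \<zeta>' \<tau>) = integral {s..t} (\<lambda>s. fx s * \<xi> s + P s * \<zeta> s)"
      using ac_on_absolutely_integrable[OF ac_on_subinterval[OF prod, of s t]] st by (intro absolutely_integrable_AE(2)) auto
    then show ?thesis using ac_on_increment[OF prod st] by simp
  qed
  \<comment> \<open>By the Euler-Lagrange equation the first variation on a subinterval is a
    boundary term of P \<xi>. The two halves of the tent therefore contribute -P t0 and P
    t0.\<close>
  have d1: "(\<phi> t0 b \<xi> \<zeta>' has_real_derivative - P t0) (at 0)"
    using \<phi>_deriv[OF ctx, of t0 b] int[of t0 b] t0 \<xi>v by simp
  have d0: "(\<phi> a t0 \<xi> \<zeta>' has_real_derivative P t0) (at 0)"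
    using \<phi>_deriv[OF ctx, of a t0] int[of a t0] t0 \<xi>v by simp

  let ?restr = "\<lambda>y s. y (max s t0) :: real ^ 'n"
  define J0 where "J0 = J t0 (?restr \<gamma>)"
  define I0 where "I0 = integral {0..t0} (\<lambda>\<tau>. run \<tau> (\<gamma> \<tau>) (v \<tau>))"
  have glue_restr: "(\<lambda>s. if s \<le> t0 then \<gamma> s else ?restr \<gamma> s) = \<gamma>"
    by (auto simp: max_absorb1)
  have ar: "adm T p t0 (?restr \<gamma>)" by (rule adm_restrict[OF adm_\<gamma>]) (use t0T in auto)
  have J\<gamma>: "J 0 \<gamma> = I0 + J0"
    using J_glue[OF adm_\<gamma> ar _ t0T ac_v] unfolding glue_restr by (simp add: I0_def J0_def)
  define u where "u h = U ((w t0 + h) *\<^sub>R axis i 1) t0" for h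
  obtain d c where d: "d > 0" "\<forall>s\<in>{a..b}. c \<le> w s" "\<And>h. \<bar>h\<bar> < d \<Longrightarrow> \<bar>h\<bar> * (Z * (b - a)) < c"
    using small_h[OF ctx] by blast
  \<comment> \<open>The upper bound restricts the bent curve to times after t0. The lower bound
    attaches an arbitrary continuation z to the bent past and uses minimality of \<gamma> from time
    0.\<close>
  have upper: "u h \<le> J0 + (\<phi> t0 b \<xi> \<zeta>' h - \<phi> t0 b \<xi> \<zeta>' 0)"
    and lower: "J0 - (\<phi> a t0 \<xi> \<zeta>' h - \<phi> a t0 \<xi> \<zeta>' 0) \<le> u h" if h: "\<bar>h\<bar> < d" for h
  proof -
    define y where "y = (\<lambda>s. \<gamma> s + (h * \<xi> s) *\<^sub>R axis i 1)"
    have pert: "adm T p 0 y" "y 0 = \<gamma> 0" "y T = \<gamma> T" "ac_on 0 T (\<lambda>s. norm (y s)) (\<lambda>s. v s + h * \<zeta>' s)"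
      "0 \<le> s \<Longrightarrow> t \<le> T \<Longrightarrow> integral {s..t} (\<lambda>\<tau>. run \<tau> (y \<tau>) (v \<tau> + h * \<zeta>' \<tau>)) =
        integral {s..t} (\<lambda>\<tau>. run \<tau> (\<gamma> \<tau>) (v \<tau>)) +
        (\<phi> (max a s) (min b t) \<xi> \<zeta>' h - \<phi> (max a s) (min b t) \<xi> \<zeta>' 0)" for s t
      unfolding y_def by (rule perturbation[OF ctx d(2) d(3)[OF h]]; assumption)+
    have yt: "y t0 = (w t0 + h) *\<^sub>R axis i 1"
      using \<gamma>_eq(1)[OF t0ab] \<xi>v(3) by (simp add: y_def scaleR_add_left)
    have yr: "adm T p t0 (?restr y)" by (rule adm_restrict[OF pert(1)]) (use t0T in auto)
    have "u h \<le> J t0 (?restr y)"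
      using U_le[OF yr] t0T yt by (simp add: u_def)
    also have "\<dots> = integral {t0..T} (\<lambda>\<tau>. run \<tau> (y \<tau>) (v \<tau> + h * \<zeta>' \<tau>)) + terminal (y T)"
      by (rule J_restrict[OF pert(1,4)]) (use t0T in auto)
    also have "\<dots> = integral {t0..T} (\<lambda>\<tau>. run \<tau> (\<gamma> \<tau>) (v \<tau>)) + terminal (\<gamma> T) + (\<phi> t0 b \<xi> \<zeta>' h - \<phi> t0 b \<xi> \<zeta>' 0)"
      using pert(5)[of t0 T] pert(3) t0 t0T ab by (simp add: max_absorb2 min_absorb1)
    also have "integral {t0..T} (\<lambda>\<tau>. run \<tau> (\<gamma> \<tau>) (v \<tau>)) + terminal (\<gamma> T) = J0"
      unfolding J0_def by (rule J_restrict[OF adm_\<gamma> ac_v, symmetric]) (use t0T in auto)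
    finally show "u h \<le> J0 + (\<phi> t0 b \<xi> \<zeta>' h - \<phi> t0 b \<xi> \<zeta>' 0)" .
    show "J0 - (\<phi> a t0 \<xi> \<zeta>' h - \<phi> a t0 \<xi> \<zeta>' 0) \<le> u h"
      unfolding u_def
    proof (rule U_greatest)
      show "(w t0 + h) *\<^sub>R axis i 1 \<in> junction"
        using admD(3)[OF pert(1), of t0] t0T yt by simp
      fix z assume z: "adm T p t0 z" "z t0 = (w t0 + h) *\<^sub>R axis i 1"
      have eq: "y t0 = z t0" using yt z by simp
      let ?g = "\<lambda>s. if s \<le> t0 then y s else z s"
      have "adm T p 0 ?g" by (rule adm_glue[OF pert(1) z(1) eq]) (use t0T in auto)
      then have "J 0 \<gamma> \<le> J 0 ?g" by (rule optimal) (use pert(2) t0T in simp)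
      also have "\<dots> = integral {0..t0} (\<lambda>\<tau>. run \<tau> (y \<tau>) (v \<tau> + h * \<zeta>' \<tau>)) + J t0 z"
        by (rule J_glue[OF pert(1) z(1) eq t0T pert(4)])
      also have "\<dots> = I0 + (\<phi> a t0 \<xi> \<zeta>' h - \<phi> a t0 \<xi> \<zeta>' 0) + J t0 z"
        using pert(5)[of 0 t0] t0 t0T ab by (simp add: I0_def max_absorb1 min_absorb2)
      finally show "J0 - (\<phi> a t0 \<xi> \<zeta>' h - \<phi> a t0 \<xi> \<zeta>' 0) \<le> J t0 z" using J\<gamma> by simp
    qed (use t0T in auto)
  qed
  have u0: "u 0 = J0" using upper[of 0] lower[of 0] d(1) by simp
  have "(u has_real_derivative - P t0) (at 0)"
  proof (rule DERIV_squeeze[OF _ _ d(1)])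
    show "((\<lambda>h. - (\<phi> a t0 \<xi> \<zeta>' h - \<phi> a t0 \<xi> \<zeta>' 0)) has_real_derivative - P t0) (at 0)"
      using DERIV_minus[OF DERIV_diff[OF d0 DERIV_const]] by simp
    show "((\<lambda>h. \<phi> t0 b \<xi> \<zeta>' h - \<phi> t0 b \<xi> \<zeta>' 0) has_real_derivative - P t0) (at 0)"
      using DERIV_diff[OF d1 DERIV_const] by simp
    show "- (\<phi> a t0 \<xi> \<zeta>' h - \<phi> a t0 \<xi> \<zeta>' 0) \<le> u h - u 0" "u h - u 0 \<le> \<phi> t0 b \<xi> \<zeta>' h - \<phi> t0 b \<xi> \<zeta>' 0" if "\<bar>h\<bar> < d" for h
      using upper[OF that] lower[OF that] u0 by auto
  qed auto
  then have "((\<lambda>r. U (r *\<^sub>R axis i 1) t0) has_real_derivative - P t0) (at (w t0))"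
    using DERIV_shift[of "\<lambda>r. U (r *\<^sub>R axis i 1) t0" "- P t0" 0 "w t0"] by (simp add: u_def[abs_def] add.commute)
  then show ?thesis using dw bspec[OF \<alpha>(3) t0ab] by auto
qed

end

context control
begin

lemma optimal_curve_derivatives:
  assumes \<gamma>: "adm T p 0 \<gamma>" "\<And>z. adm T p 0 z \<Longrightarrow> z 0 = \<gamma> 0 \<Longrightarrow> J 0 \<gamma> \<le> J 0 z"
    and v: "ac_on 0 T (\<lambda>s. norm (\<gamma> s)) v" "\<And>s. s \<in> {0..T} \<Longrightarrow> \<bar>v s\<bar> \<le> V"
    and t: "0 < t" "t < T" and pos: "0 < \<gamma> t $ i"
  shows "\<exists>\<alpha>. ((\<lambda>s. norm (\<gamma> s)) has_real_derivative \<alpha>) (at t) \<and>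
    ((\<lambda>r. U (r *\<^sub>R axis i 1) t) has_real_derivative - Fa i t (norm (\<gamma> t)) \<alpha>) (at (norm (\<gamma> t)))"
proof -
  have "continuous_on {0..T} (\<lambda>s. \<gamma> s $ i)"
    by (intro continuous_intros adm_continuous[OF \<gamma>(1)])
  then have "continuous (at t within {0..T}) (\<lambda>s. \<gamma> s $ i)" using t by (simp add: continuous_on_eq_continuous_within)
  then obtain d where d: "d > 0" "\<And>s. s \<in> {0..T} \<Longrightarrow> dist s t < d \<Longrightarrow> dist (\<gamma> s $ i) (\<gamma> t $ i) < \<gamma> t $ i"
    unfolding continuous_within_eps_delta using pos by blast
  \<comment> \<open>Halving keeps the closed window inside (0, T) and inside the times at which
    coordinate i is positive.\<close>
  define e where "e = min d (min t (T - t)) / 2"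
  have e: "0 < e" "e < d" "e < t" "e < T - t" using d(1) t by (auto simp: e_def)
  interpret optimal_curve T p C0 F Fx Fa K g g0 \<gamma> v V "t - e" "t + e" i
  proof
    fix s assume s: "s \<in> {t - e..t + e}"
    have "dist (\<gamma> s $ i) (\<gamma> t $ i) < \<gamma> t $ i"
      by (rule d(2)) (use s e in \<open>auto simp: dist_real_def abs_if\<close>)
    then show "0 < \<gamma> s $ i" by (auto simp: dist_real_def abs_if split: if_splits)
  qed (use \<gamma> v e t in auto)
  show ?thesis using derivatives[of t] e by (simp add: w_def[abs_def] w_def)
qed

end

section \<open>The Hamiltonian\<close>

lemma coercive_attains_min:
  fixes f :: "real \<Rightarrow> real"
  assumes p: "p > 1" and C0: "C0 > 0" and low: "\<And>z. C0 * (\<bar>z\<bar> powr p - 1) \<le> f z" and c: "continuous_on UNIV f"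
  shows "\<exists>z. \<forall>y. f z + q * z \<le> f y + q * y"
proof -
  define h where "h z = f z + q * z" for z
  \<comment> \<open>For |y| \<ge> R one has C0 |y|^(p-1) \<ge> |q| + 1 and |y| \<ge> C0 + h 0, so
    that h y \<ge> |y| - C0 \<ge> h 0. Hence a minimum over [-R, R] is global.\<close>
  define R where "R = max (((\<bar>q\<bar> + 1) / C0) powr (1 / (p - 1))) (max 1 (C0 + h 0))"
  have R: "R \<ge> 1" by (simp add: R_def)
  have big: "h 0 \<le> h y" if y: "\<bar>y\<bar> \<ge> R" for y
  proof -
    have "((\<bar>q\<bar> + 1) / C0) powr (1 / (p - 1)) \<le> \<bar>y\<bar>" using y by (simp add: R_def)
    then have "(((\<bar>q\<bar> + 1) / C0) powr (1 / (p - 1))) powr (p - 1) \<le> \<bar>y\<bar> powr (p - 1)"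
      using p by (intro powr_mono2) auto
    then have "(\<bar>q\<bar> + 1) / C0 \<le> \<bar>y\<bar> powr (p - 1)"
      using p C0 by (simp add: powr_powr powr_one)
    then have "\<bar>q\<bar> + 1 \<le> C0 * \<bar>y\<bar> powr (p - 1)" using C0 by (simp add: field_simps)
    then have "(\<bar>q\<bar> + 1) * \<bar>y\<bar> \<le> C0 * \<bar>y\<bar> powr (p - 1) * \<bar>y\<bar>" by (intro mult_right_mono) auto
    also have "\<dots> = C0 * \<bar>y\<bar> powr p" using powr_mult_base[of "\<bar>y\<bar>" "p - 1"] by (simp add: mult_ac)
    finally have "(\<bar>q\<bar> + 1) * \<bar>y\<bar> \<le> C0 * \<bar>y\<bar> powr p" .
    moreover have "- (\<bar>q\<bar> * \<bar>y\<bar>) \<le> q * y" by (metis abs_ge_minus_self abs_mult minus_le_iff)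
    moreover have "C0 + h 0 \<le> \<bar>y\<bar>" using y by (simp add: R_def)
    ultimately show ?thesis using low[of y] by (simp add: h_def algebra_simps)
  qed
  have "\<exists>z\<in>{-R..R}. \<forall>y\<in>{-R..R}. h z \<le> h y"
    unfolding h_def using R by (intro continuous_attains_inf continuous_intros continuous_on_subset[OF c]) auto
  then obtain z where z: "\<And>y. y \<in> {-R..R} \<Longrightarrow> h z \<le> h y" by blast
  have "h z \<le> h y" for y
  proof (cases "y \<in> {-R..R}")
    case False
    then have "h 0 \<le> h y" by (intro big) auto
    then show ?thesis using z[of 0] R by auto
  qed (rule z)
  then show ?thesis by (auto simp: h_def)
qed

text \<open>The difference quotients of the Legendre transform lie between two maximisers,
  and maximisers depend continuously on \<open>q\<close> because the derivative is strictly increasing.\<close>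

lemma legendre_has_derivative:
  fixes f f' :: "real \<Rightarrow> real"
  assumes p: "p > 1" and C0: "C0 > 0" and low: "\<And>z. C0 * (\<bar>z\<bar> powr p - 1) \<le> f z"
    and d: "\<And>z. (f has_real_derivative f' z) (at z)" and mono: "\<And>x y. x < y \<Longrightarrow> f' x < f' y"
  defines "H \<equiv> \<lambda>q. SUP z. - q * z - f z"
  shows "\<exists>z. f' z = - q \<and> (H has_real_derivative - z) (at q)"
proof -
  have c: "continuous_on UNIV f" using DERIV_isCont[OF d] by (simp add: continuous_at_imp_continuous_on)
  obtain Z where Z: "\<And>q y. f (Z q) + q * Z q \<le> f y + q * y"
    using coercive_attains_min[OF p C0 low c] by metis
  have Z': "f' (Z q) = - q" for q
  proof -
    have "((\<lambda>z. f z + q * z) has_real_derivative f' (Z q) + q * 1) (at (Z q))"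
      by (intro DERIV_add d DERIV_cmult DERIV_ident)
    then have "f' (Z q) + q * 1 = 0" by (rule DERIV_local_min[of _ _ _ 1]) (use Z in auto)
    then show ?thesis by simp
  qed
  have bdd: "bdd_above (range (\<lambda>z. - q * z - f z))" for q
    by (rule bdd_aboveI2[where M = "- q * Z q - f (Z q)"]) (use Z[of q] in \<open>auto simp: algebra_simps\<close>)
  have HZ: "H q = - q * Z q - f (Z q)" for q
    unfolding H_def
  proof (rule antisym)
    show "(SUP z. - q * z - f z) \<le> - q * Z q - f (Z q)"
      by (rule cSUP_least) (use Z[of q] in \<open>auto simp: algebra_simps\<close>)
    show "- q * Z q - f (Z q) \<le> (SUP z. - q * z - f z)" by (rule cSUP_upper[OF _ bdd]) simp
  qed
  have Hge: "- q * z - f z \<le> H q" for q z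
    unfolding H_def by (rule cSUP_upper[OF _ bdd]) simp
  have contZ: "isCont Z q" for q
    unfolding continuous_at_eps_delta
  proof (intro allI impI)
    fix e :: real assume e: "e > 0"
    have a: "f' (Z q - e) < - q" "- q < f' (Z q + e)" using mono[of "Z q - e" "Z q"] mono[of "Z q" "Z q + e"] e Z' by auto
    \<comment> \<open>Since f'(Z x) = -x, a change of q by less than \<open>dd\<close> keeps f'(Z x)
      strictly between the values of f' at Z q - e and at Z q + e.\<close>
    define dd where "dd = min (- q - f' (Z q - e)) (f' (Z q + e) + q)"
    show "\<exists>d>0. \<forall>x'. dist x' q < d \<longrightarrow> dist (Z x') (Z q) < e"
    proof (intro exI[of _ dd] conjI allI impI)
      show "dd > 0" using a by (simp add: dd_def)
      fix x assume "dist x q < dd"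
      then have "f' (Z q - e) < f' (Z x)" "f' (Z x) < f' (Z q + e)"
        unfolding Z' by (auto simp: dd_def dist_real_def abs_if split: if_splits)
      moreover have "a < b" if "f' a < f' b" for a b using mono[of b a] that by (cases a b rule: linorder_cases) auto
      ultimately have "Z q - e < Z x" "Z x < Z q + e" by blast+
      then show "dist (Z x) (Z q) < e" unfolding dist_real_def by linarith
    qed
  qed
  have "((\<lambda>h. (H (q + h) - H q) / h - - Z q) \<longlongrightarrow> 0) (at 0)"
  proof (rule Lim_null_comparison)
    have "((\<lambda>h. Z (q + h)) \<longlongrightarrow> Z q) (at 0)"
      using contZ[of q] by (simp add: isCont_def LIM_offset_zero_iff)
    then have "((\<lambda>h. \<bar>Z q - Z (q + h)\<bar>) \<longlongrightarrow> \<bar>Z q - Z q\<bar>) (at 0)" by (intro tendsto_intros)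
    then show "((\<lambda>h. \<bar>Z q - Z (q + h)\<bar>) \<longlongrightarrow> 0) (at 0)" by simp
    show "\<forall>\<^sub>F h in at 0. norm ((H (q + h) - H q) / h - - Z q) \<le> \<bar>Z q - Z (q + h)\<bar>"
      unfolding eventually_at
    proof (intro exI[of _ 1] conjI ballI impI)
      fix h :: real assume "h \<noteq> 0 \<and> dist h 0 < 1"
      then have h: "h \<noteq> 0" by simp
      have lo: "- h * Z q \<le> H (q + h) - H q" using Hge[of "q + h" "Z q"] HZ[of q] by (simp add: algebra_simps)
      have up: "H (q + h) - H q \<le> - h * Z (q + h)" using Hge[of q "Z (q + h)"] HZ[of "q + h"] by (simp add: algebra_simps)
      have "\<bar>H (q + h) - H q + h * Z q\<bar> \<le> \<bar>h * (Z q - Z (q + h))\<bar>"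
        using lo up by (simp add: algebra_simps abs_if)
      then have "\<bar>H (q + h) - H q + h * Z q\<bar> / \<bar>h\<bar> \<le> \<bar>Z q - Z (q + h)\<bar>"
        using h by (simp add: abs_mult divide_le_eq mult.commute)
      moreover have "(H (q + h) - H q) / h - - Z q = (H (q + h) - H q + h * Z q) / h" using h by (simp add: field_simps)
      ultimately show "norm ((H (q + h) - H q) / h - - Z q) \<le> \<bar>Z q - Z (q + h)\<bar>" by (simp add: abs_divide)
    qed simp
  qed
  then have "(H has_real_derivative - Z q) (at q)" unfolding DERIV_def by (rule LIM_zero_cancel)
  then show ?thesis using Z' by blast
qed

section \<open>Measurability of the derivative of a continuous function\<close>

text \<open>Differentiability is the Cauchy property of the difference quotients at h = 0, and by
  continuity of f it is enough to test it on rational increments. Written with countably many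
  quantifiers, the condition is measurable in r.\<close>

lemma differentiable_Cauchy_criterion:
  fixes f :: "real \<Rightarrow> real"
  assumes f: "continuous_on {0<..} f" and r: "r > 0"
  defines "Q \<equiv> \<lambda>h. (f (r + h) - f r) / h"
  shows "(\<exists>D. (f has_real_derivative D) (at r)) \<longleftrightarrow>
    (\<forall>m. \<exists>n. \<forall>h k :: rat. h \<noteq> 0 \<longrightarrow> k \<noteq> 0 \<longrightarrow> \<bar>of_rat h\<bar> < 1 / Suc n \<longrightarrow> \<bar>of_rat k\<bar> < 1 / Suc n \<longrightarrow>
      0 < r + of_rat h \<longrightarrow> 0 < r + of_rat k \<longrightarrow> \<bar>Q (of_rat h) - Q (of_rat k)\<bar> \<le> 1 / Suc m)"
    (is "?L \<longleftrightarrow> ?R")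
proof
  assume ?L
  then obtain D where D: "(Q \<longlongrightarrow> D) (at 0)" unfolding DERIV_def Q_def by blast
  show ?R
  proof
    fix m :: nat
    have "1 / real (Suc m) / 2 > 0" by simp
    then have "\<forall>\<^sub>F h in at 0. dist (Q h) D < 1 / real (Suc m) / 2" using D tendstoD by blast
    then obtain d where d: "d > 0" "\<And>h. h \<noteq> 0 \<Longrightarrow> dist h 0 < d \<Longrightarrow> dist (Q h) D < 1 / real (Suc m) / 2"
      unfolding eventually_at by blast
    obtain n where n: "1 / real (Suc n) < d" using d(1) nat_approx_posE by blast
    have "\<bar>Q (of_rat h) - Q (of_rat k)\<bar> \<le> 1 / Suc m"
      if "h \<noteq> 0" "k \<noteq> 0" "\<bar>real_of_rat h\<bar> < 1 / Suc n" "\<bar>real_of_rat k\<bar> < 1 / Suc n" for h k :: rat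
    proof -
      have "dist (Q (of_rat h)) D < 1 / real (Suc m) / 2" "dist (Q (of_rat k)) D < 1 / real (Suc m) / 2"
      proof -
        have "dist (real_of_rat h) 0 < d" "dist (real_of_rat k) 0 < d"
          unfolding dist_real_def diff_0_right using that n by linarith+
        then show "dist (Q (of_rat h)) D < 1 / real (Suc m) / 2" "dist (Q (of_rat k)) D < 1 / real (Suc m) / 2"
          using d(2)[of "of_rat h"] d(2)[of "of_rat k"] that by (simp_all del: of_nat_Suc)
      qed
      from dist_triangle_half_l[OF this] show ?thesis unfolding dist_real_def by (rule less_imp_le)
    qed
    then show "\<exists>n. \<forall>h k :: rat. h \<noteq> 0 \<longrightarrow> k \<noteq> 0 \<longrightarrow> \<bar>of_rat h\<bar> < 1 / Suc n \<longrightarrow> \<bar>of_rat k\<bar> < 1 / Suc n \<longrightarrow>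
      0 < r + of_rat h \<longrightarrow> 0 < r + of_rat k \<longrightarrow> \<bar>Q (of_rat h) - Q (of_rat k)\<bar> \<le> 1 / Suc m" by blast
  qed
next
  assume R: ?R
  have cQ: "isCont Q h" if "h \<noteq> 0" "0 < r + h" for h
  proof -
    have "isCont f (r + h)" using f that(2) by (simp add: continuous_on_eq_continuous_at)
    moreover have "isCont (\<lambda>h. r + h) h" by (intro continuous_intros)
    ultimately have "isCont (\<lambda>h. f (r + h)) h" by (intro isCont_o2[where f = "\<lambda>h. r + h" and g = f])
    then show ?thesis unfolding Q_def using that by (intro continuous_intros) auto
  qed
  have approx: "\<exists>q :: nat \<Rightarrow> rat. (\<lambda>j. real_of_rat (q j)) \<longlonglongrightarrow> h" for h :: real
  proof -
    have "\<exists>q :: rat. h < of_rat q \<and> of_rat q < h + 1 / Suc j" for j :: nat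
      by (rule of_rat_dense) simp
    then obtain q :: "nat \<Rightarrow> rat" where q: "\<And>j. h < of_rat (q j)" "\<And>j. of_rat (q j) < h + 1 / Suc j" by metis
    have "(\<lambda>j. real_of_rat (q j)) \<longlonglongrightarrow> h"
    proof (rule tendsto_sandwich[where f = "\<lambda>_. h" and h = "\<lambda>j. h + 1 / Suc j"])
      show "(\<lambda>j. h + 1 / real (Suc j)) \<longlonglongrightarrow> h"
        using tendsto_add[OF tendsto_const LIMSEQ_inverse_real_of_nat] by (simp add: inverse_eq_divide)
    qed (use q in \<open>auto simp: less_imp_le\<close>)
    then show ?thesis by blast
  qed
  have real: "\<exists>n. \<forall>h k :: real. h \<noteq> 0 \<longrightarrow> k \<noteq> 0 \<longrightarrow> \<bar>h\<bar> < 1 / Suc n \<longrightarrow> \<bar>k\<bar> < 1 / Suc n \<longrightarrow>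
      0 < r + h \<longrightarrow> 0 < r + k \<longrightarrow> \<bar>Q h - Q k\<bar> \<le> 1 / Suc m" for m
  proof -
    obtain n where n: "\<And>h k :: rat. h \<noteq> 0 \<Longrightarrow> k \<noteq> 0 \<Longrightarrow> \<bar>of_rat h\<bar> < 1 / Suc n \<Longrightarrow> \<bar>of_rat k\<bar> < 1 / Suc n \<Longrightarrow>
      0 < r + of_rat h \<Longrightarrow> 0 < r + of_rat k \<Longrightarrow> \<bar>Q (of_rat h) - Q (of_rat k)\<bar> \<le> 1 / Suc m" using R by metis
    have "\<bar>Q h - Q k\<bar> \<le> 1 / Suc m"
      if hk: "h \<noteq> 0" "k \<noteq> 0" "\<bar>h\<bar> < 1 / Suc n" "\<bar>k\<bar> < 1 / Suc n" "0 < r + h" "0 < r + k" for h k :: real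
    proof -
      obtain a :: "nat \<Rightarrow> rat" where a: "(\<lambda>j. real_of_rat (a j)) \<longlonglongrightarrow> h" using approx by blast
      obtain b :: "nat \<Rightarrow> rat" where b: "(\<lambda>j. real_of_rat (b j)) \<longlonglongrightarrow> k" using approx by blast
      have ev: "\<forall>\<^sub>F j in sequentially. x j \<noteq> 0 \<and> \<bar>x j\<bar> < 1 / Suc n \<and> 0 < r + x j"
        if x: "x \<longlonglongrightarrow> l" and l: "l \<noteq> 0" "\<bar>l\<bar> < 1 / Suc n" "0 < r + l" for x :: "nat \<Rightarrow> real" and l
      proof (intro eventually_conj)
        show "\<forall>\<^sub>F j in sequentially. x j \<noteq> 0" using tendsto_imp_eventually_ne[OF x l(1)] .
        show "\<forall>\<^sub>F j in sequentially. \<bar>x j\<bar> < 1 / Suc n" using order_tendstoD(2)[OF tendsto_rabs[OF x] l(2)] .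
        show "\<forall>\<^sub>F j in sequentially. 0 < r + x j"
          using order_tendstoD(1)[OF tendsto_add[OF tendsto_const x] l(3)] .
      qed
      have "(\<lambda>j. \<bar>Q (of_rat (a j)) - Q (of_rat (b j))\<bar>) \<longlonglongrightarrow> \<bar>Q h - Q k\<bar>"
        using isCont_tendsto_compose[OF cQ[OF hk(1,5)] a] isCont_tendsto_compose[OF cQ[OF hk(2,6)] b]
        by (intro tendsto_intros)
      moreover have "\<forall>\<^sub>F j in sequentially. \<bar>Q (of_rat (a j)) - Q (of_rat (b j))\<bar> \<le> 1 / Suc m"
        using ev[OF a hk(1,3,5)] ev[OF b hk(2,4,6)] by eventually_elim (rule n; simp)
      ultimately show ?thesis by (rule tendsto_upperbound) simp
    qed
    then show ?thesis by blast
  qed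
  define x where "x j = min r 1 / (2 * real (Suc j))" for j
  have x: "x j > 0" for j using r by (simp add: x_def)
  have x0: "x \<longlonglongrightarrow> 0"
  proof -
    have "(\<lambda>j. min r 1 / 2 * (1 / real (Suc j))) \<longlonglongrightarrow> min r 1 / 2 * 0"
      by (intro tendsto_mult tendsto_const) (use LIMSEQ_inverse_real_of_nat in \<open>simp add: inverse_eq_divide\<close>)
    then show ?thesis by (simp add: x_def[abs_def])
  qed
  have "Cauchy (\<lambda>j. Q (x j))"
  proof (rule metric_CauchyI)
    fix e :: real assume "e > 0"
    then obtain m where m: "1 / real (Suc m) < e" using nat_approx_posE by blast
    obtain n where n: "\<And>h k :: real. h \<noteq> 0 \<Longrightarrow> k \<noteq> 0 \<Longrightarrow> \<bar>h\<bar> < 1 / Suc n \<Longrightarrow> \<bar>k\<bar> < 1 / Suc n \<Longrightarrow>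
      0 < r + h \<Longrightarrow> 0 < r + k \<Longrightarrow> \<bar>Q h - Q k\<bar> \<le> 1 / Suc m" using real[of m] by metis
    have "0 < 1 / real (Suc n)" by simp
    from order_tendstoD(2)[OF x0 this] obtain N where N: "\<And>j. j \<ge> N \<Longrightarrow> x j < 1 / Suc n"
      unfolding eventually_sequentially by blast
    have "dist (Q (x i)) (Q (x j)) < e" if "i \<ge> N" "j \<ge> N" for i j
      using n[of "x i" "x j"] N[OF that(1)] N[OF that(2)] x[of i] x[of j] r m by (simp add: dist_real_def)
    then show "\<exists>N. \<forall>i\<ge>N. \<forall>j\<ge>N. dist (Q (x i)) (Q (x j)) < e" by blast
  qed
  then obtain D where D: "(\<lambda>j. Q (x j)) \<longlonglongrightarrow> D" using Cauchy_convergent convergent_def by blast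
  have "(Q \<longlongrightarrow> D) (at 0)"
  proof (rule tendstoI)
    fix e :: real assume "e > 0"
    then obtain m where m: "1 / real (Suc m) < e" using nat_approx_posE by blast
    obtain n where n: "\<And>h k :: real. h \<noteq> 0 \<Longrightarrow> k \<noteq> 0 \<Longrightarrow> \<bar>h\<bar> < 1 / Suc n \<Longrightarrow> \<bar>k\<bar> < 1 / Suc n \<Longrightarrow>
      0 < r + h \<Longrightarrow> 0 < r + k \<Longrightarrow> \<bar>Q h - Q k\<bar> \<le> 1 / Suc m" using real[of m] by metis
    have n0: "0 < 1 / real (Suc n)" by simp
    have "dist (Q h) D < e" if h: "h \<noteq> 0" "dist h 0 < min (1 / Suc n) r" for h
    proof -
      have "\<forall>\<^sub>F j in sequentially. \<bar>Q h - Q (x j)\<bar> \<le> 1 / Suc m"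
        using order_tendstoD(2)[OF x0 n0]
      proof eventually_elim
        case (elim j)
        show ?case by (rule n) (use h elim x[of j] r in \<open>auto simp: dist_real_def abs_if split: if_splits\<close>)
      qed
      then have "\<bar>Q h - D\<bar> \<le> 1 / Suc m"
        by (rule tendsto_upperbound[rotated]) (auto intro!: tendsto_intros D)
      then show ?thesis using m by (simp add: dist_real_def)
    qed
    then show "\<forall>\<^sub>F h in at 0. dist (Q h) D < e"
      unfolding eventually_at using n0 r by (intro exI[of _ "min (1 / Suc n) r"]) auto
  qed
  then show ?L unfolding DERIV_def Q_def by blast
qed

text \<open>Where no derivative exists, \<open>vector_derivative\<close> chooses from an
  unsatisfiable predicate and hence returns one fixed number for all such r. The default value is
  thus a constant and does not spoil measurability.\<close>

lemma vector_derivative_halfline: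
  fixes f :: "real \<Rightarrow> real"
  assumes "r > 0"
  shows "vector_derivative f (at r within {0..}) = (if \<exists>D. (f has_real_derivative D) (at r)
    then lim (\<lambda>n. (f (r + 1 / real (Suc n)) - f r) / (1 / real (Suc n))) else (SOME x. False))"
proof -
  have at: "at r within {0..} = at r" using assms by (intro at_within_interior) auto
  show ?thesis
  proof (cases "\<exists>D. (f has_real_derivative D) (at r)")
    case True
    then obtain D where D: "(f has_real_derivative D) (at r)" by blast
    then have "vector_derivative f (at r) = D"
      by (intro vector_derivative_at) (simp add: has_real_derivative_iff_has_vector_derivative)
    moreover have "(\<lambda>n. (f (r + 1 / real (Suc n)) - f r) / (1 / real (Suc n))) \<longlonglongrightarrow> D"
    proof -
      have "(\<lambda>n. 1 / real (Suc n)) \<longlonglongrightarrow> 0" using LIMSEQ_inverse_real_of_nat by (simp add: inverse_eq_divide)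
      moreover have "((\<lambda>h. (f (r + h) - f r) / h) \<longlongrightarrow> D) (at 0)" using D by (simp add: DERIV_def)
      ultimately show ?thesis
        using tendsto_compose_eventually[of "\<lambda>h. (f (r + h) - f r) / h" D 0 "\<lambda>n. 1 / real (Suc n)" sequentially]
        by simp
    qed
    ultimately show ?thesis using True at by (simp add: limI)
  next
    case False
    then have "\<not> (f has_vector_derivative D) (at r)" for D
      by (simp add: has_real_derivative_iff_has_vector_derivative)
    then show ?thesis using False at by (simp add: vector_derivative_def)
  qed
qed

lemma borel_measurable_vector_derivative_halfline:
  fixes f :: "real \<Rightarrow> real"
  assumes f: "continuous_on {0<..} f"
  shows "(\<lambda>r. if r > 0 then vector_derivative f (at r within {0..}) else 0) \<in> borel_measurable borel"
proof -
  \<comment> \<open>Extension by zero turns f into a Borel function on the whole line; difference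
    quotients at r > 0 with r + h > 0 are not affected.\<close>
  define f0 where "f0 r = (if r \<in> {0<..} then f r else 0)" for r
  have f0[measurable]: "f0 \<in> borel_measurable borel"
    unfolding f0_def[abs_def] by (intro borel_measurable_continuous_on_if f) auto
  define Q where "Q r h = (f0 (r + h) - f0 r) / h" for r h
  have [measurable]: "(\<lambda>r. Q r h) \<in> borel_measurable borel" for h unfolding Q_def by measurable
  define P where "P r \<longleftrightarrow> (\<forall>m. \<exists>n. \<forall>h k :: rat. h \<noteq> 0 \<longrightarrow> k \<noteq> 0 \<longrightarrow> \<bar>real_of_rat h\<bar> < 1 / Suc n \<longrightarrow> \<bar>real_of_rat k\<bar> < 1 / Suc n \<longrightarrow>
      0 < r + of_rat h \<longrightarrow> 0 < r + of_rat k \<longrightarrow> \<bar>Q r (of_rat h) - Q r (of_rat k)\<bar> \<le> 1 / Suc m)" for r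
  have [measurable]: "Measurable.pred borel P" unfolding P_def[abs_def] by measurable
  have PD: "(\<exists>D. (f has_real_derivative D) (at r)) \<longleftrightarrow> P r" if "r > 0" for r
    unfolding differentiable_Cauchy_criterion[OF f that] P_def
    using that by (intro all_cong1 ex_cong1 imp_cong refl) (simp_all add: Q_def f0_def)
  have "(\<lambda>r. if r > 0 then if P r then lim (\<lambda>n. Q r (1 / real (Suc n))) else (SOME x. False) else 0) \<in> borel_measurable borel"
    by measurable
  moreover have "lim (\<lambda>n. Q r (1 / real (Suc n))) = lim (\<lambda>n. (f (r + 1 / real (Suc n)) - f r) / (1 / real (Suc n)))" if "r > 0" for r
  proof -
    have "0 < r + 1 / real (Suc n)" for n using that by (simp add: add_pos_pos)
    then show ?thesis using that by (simp add: Q_def f0_def)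
  qed
  ultimately have lims: "(\<lambda>r. if r > 0 then if P r then lim (\<lambda>n. Q r (1 / real (Suc n))) else (SOME x. False) else 0) \<in> borel_measurable borel"
    "\<And>r. r > 0 \<Longrightarrow> lim (\<lambda>n. Q r (1 / real (Suc n))) = lim (\<lambda>n. (f (r + 1 / real (Suc n)) - f r) / (1 / real (Suc n)))"
    by blast+
  have "(\<lambda>r. if r > 0 then vector_derivative f (at r within {0..}) else 0) =
      (\<lambda>r. if r > 0 then if P r then lim (\<lambda>n. Q r (1 / real (Suc n))) else (SOME x. False) else 0)"
  proof
    fix r :: real
    show "(if r > 0 then vector_derivative f (at r within {0..}) else 0) =
      (if r > 0 then if P r then lim (\<lambda>n. Q r (1 / real (Suc n))) else (SOME x. False) else 0)"
    proof (cases "r > 0")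
      case True
      show ?thesis unfolding if_P[OF True] vector_derivative_halfline[OF True] PD[OF True] lims(2)[OF True] ..
    qed simp
  qed
  then show ?thesis using lims(1) by (simp only:)
qed

section \<open>Curves of bounded speed\<close>

lemma apply_bcontfun_continuous: "continuous_on UNIV (\<lambda>y. apply_bcontfun y t)"
proof (rule continuous_at_imp_continuous_on, rule ballI)
  fix y :: "'a::topological_space \<Rightarrow>\<^sub>C 'b::metric_space"
  show "isCont (\<lambda>y. apply_bcontfun y t) y"
    unfolding continuous_at_eps_delta
  proof (intro allI impI)
    fix e :: real assume "e > 0"
    then show "\<exists>d>0. \<forall>x'. dist x' y < d \<longrightarrow> dist (apply_bcontfun x' t) (apply_bcontfun y t) < e"
      using dist_bounded[of _ t y] by (intro exI[of _ e]) (auto intro: le_less_trans)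
  qed
qed

lemma ac_on_Lipschitz:
  fixes f :: "real \<Rightarrow> 'b::euclidean_space"
  assumes f: "ac_on a b f g" and g: "AE s in lebesgue. s \<in> {a..b} \<longrightarrow> norm (g s) \<le> V"
    and st: "s \<in> {a..b}" "t \<in> {a..b}"
  shows "norm (f t - f s) \<le> V * \<bar>t - s\<bar>"
proof -
  obtain N where N: "negligible N" "\<And>x. x \<notin> N \<Longrightarrow> x \<in> {a..b} \<longrightarrow> norm (g x) \<le> V"
    using AE_negligibleE[OF g] by metis
  have main: "norm (f t - f s) \<le> V * (t - s)" if st: "a \<le> s" "s \<le> t" "t \<le> b" for s t
  proof -
    have "integral {s..t} g = integral {s..t} (\<lambda>x. if x \<in> N then 0 else g x)"
      by (rule integral_spike[OF N(1)]) auto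
    moreover have "norm (integral {s..t} (\<lambda>x. if x \<in> N then 0 else g x)) \<le> integral {s..t} (\<lambda>_. max V 0)"
    proof (rule integral_norm_bound_integral)
      have "(\<lambda>x. if x \<in> N then 0 else g x) absolutely_integrable_on {s..t}"
        by (rule absolutely_integrable_spike[OF ac_on_absolutely_integrable[OF ac_on_subinterval[OF f st(1,3)]] N(1)]) auto
      then show "(\<lambda>x. if x \<in> N then 0 else g x) integrable_on {s..t}" by (rule set_lebesgue_integral_eq_integral(1))
      show "norm (if x \<in> N then 0 else g x) \<le> max V 0" if "x \<in> {s..t}" for x
        using N(2)[of x] that st by auto
    qed (rule Henstock_Kurzweil_Integration.integrable_const_ivl)
    ultimately have *: "norm (f t - f s) \<le> max V 0 * (t - s)"
      using ac_on_increment[OF f st] st by (simp add: mult.commute)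
    \<comment> \<open>The estimate so far has \<open>max V 0\<close>. For negative V the bound on g
      fails everywhere, so [s, t] would be contained in a null set, which is impossible for s <
      t.\<close>
    show ?thesis
    proof (cases "V \<ge> 0 \<or> s = t")
      case False
      then have "s < t" "V < 0" using st by auto
      have "cbox s t \<subseteq> N"
      proof
        fix x assume x: "x \<in> cbox s t"
        show "x \<in> N"
        proof (rule ccontr)
          assume "x \<notin> N"
          then have "norm (g x) \<le> V" using N(2)[of x] x st by auto
          then show False using \<open>V < 0\<close> norm_ge_zero[of "g x"] by linarith
        qed
      qed
      then have "negligible (cbox s t)" using N(1) negligible_subset by blast
      then have "box s t = {}" by (simp only: negligible_interval)
      then show ?thesis using \<open>s < t\<close> by simp
    qed (use * in \<open>auto simp: max_absorb1\<close>)
  qed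
  show ?thesis
  proof (cases "s \<le> t")
    case True
    then show ?thesis using main[of s t] st by simp
  next
    case False
    then show ?thesis using main[of t s] st by (simp add: norm_minus_commute)
  qed
qed

lemma Gamma_LipD:
  fixes y :: "real \<Rightarrow>\<^sub>C (real ^ 'n::finite)" and T p C V :: real
  assumes y: "y \<in> Gamma_Lip T p C V" and T: "T > 0" and p: "p > 1"
  shows "adm T p 0 (apply_bcontfun y)" "apply_bcontfun y t \<in> junction" "norm (apply_bcontfun y t) \<le> C"
    "norm (apply_bcontfun y t - apply_bcontfun y s) \<le> V * \<bar>t - s\<bar>"
    "\<exists>v. ac_on 0 T (\<lambda>s. norm (apply_bcontfun y s)) v \<and> (\<forall>s. \<bar>v s\<bar> \<le> real CARD('n) * V)"
    "y \<in> Gamma_C T p C" "y \<in> Gamma_all T p"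
proof -
  let ?y = "apply_bcontfun y"
  show yC: "y \<in> Gamma_C T p C" using y by (simp add: Gamma_Lip_def)
  then obtain x where x: "x \<in> junction" "y \<in> Gamma_from T p 0 x" "Linf_norm 0 T ?y \<le> ereal C"
    by (auto simp: Gamma_C_def Gamma_C_at_def)
  show "y \<in> Gamma_all T p" using x by (auto simp: Gamma_all_def)
  show adm: "adm T p 0 ?y" using Gamma_from_adm[OF x(2) T p] by blast
  have clamp: "?y r = ?y (max 0 (min T r))" "max 0 (min T r) \<in> {0..T}" for r
    using admD(1)[OF adm, of r] admD(2)[OF adm, of r] T by (auto simp: max_def min_def)
  show "?y t \<in> junction"
    unfolding clamp(1)[of t] by (rule admD(3)[OF adm clamp(2)])
  obtain h where h: "ac_on 0 T ?y h" by (rule admE[OF adm])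
  have cy: "continuous_on {0..T} ?y" by (rule ac_on_continuous[OF h])
  have "continuous_on {0<..<T} ?y" using cy by (rule continuous_on_subset) auto
  then have "?y \<in> borel_measurable (lebesgue_on {0<..<T})" by (rule continuous_imp_measurable_on_sets_lebesgue) auto
  then have "(\<lambda>s. ereal (norm (?y s))) \<in> borel_measurable (lebesgue_on {0<..<T})" by measurable
  from esssup_AE[of "\<lambda>s. ereal (norm (?y s))" "lebesgue_on {0<..<T}"]
  have "AE s in lebesgue_on {0<..<T}. ereal (norm (?y s)) \<le> ereal C"
    by (rule eventually_mono) (rule order_trans[OF _ x(3)[unfolded Linf_norm_def]])
  then have "AE s in lebesgue. s \<in> {0<..<T} \<longrightarrow> norm (?y s) \<le> C"
    by (simp add: AE_restrict_space_iff)
  \<comment> \<open>The essential bound becomes a pointwise one, because the times at which it holds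
    form a closed set.\<close>
  with AE_lebesgue_neq[of 0] AE_lebesgue_neq[of T]
  have "AE s in lebesgue. s \<in> {0..T} \<longrightarrow> s \<in> {s \<in> {0..T}. norm (?y s) \<le> C}"
    by eventually_elim auto
  moreover have "closed {s \<in> {0..T}. norm (?y s) \<le> C}"
    by (rule continuous_on_closed_Collect_le) (auto intro!: continuous_intros cy)
  ultimately have "{0..T} \<subseteq> {s \<in> {0..T}. norm (?y s) \<le> C}" by (intro AE_closed_Icc_subset T)
  then have "norm (?y (max 0 (min T t))) \<le> C" using clamp(2)[of t] by blast
  then show "norm (?y t) \<le> C" by (simp only: clamp(1)[symmetric])
  let ?wd = "weak_deriv 0 T ?y"
  have wd: "is_weak_deriv 0 T ?y ?wd" "AE s in lebesgue. s \<in> {0<..<T} \<longrightarrow> ?wd s = h s"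
    using weak_deriv_AE_eq[OF h] T by auto
  have "AE s in lebesgue_on {0<..<T}. ereal (norm (?wd s)) \<le> ereal V"
  proof (rule eventually_mono[OF esssup_AE])
    have "esssup (lebesgue_on {0<..<T}) (\<lambda>s. ereal (norm (?wd s))) \<le> ereal V"
      using y by (simp add: Gamma_Lip_def Linf_norm_def)
    then show "ereal (norm (?wd s)) \<le> esssup (lebesgue_on {0<..<T}) (\<lambda>s. ereal (norm (?wd s))) \<Longrightarrow>
      ereal (norm (?wd s)) \<le> ereal V" for s by (rule order_trans[rotated])
  qed
  then have "AE s in lebesgue. s \<in> {0<..<T} \<longrightarrow> norm (?wd s) \<le> V"
    by (simp add: AE_restrict_space_iff)
  with wd(2) AE_lebesgue_neq[of 0] AE_lebesgue_neq[of T]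
  have hV: "AE s in lebesgue. s \<in> {0..T} \<longrightarrow> norm (h s) \<le> V"
    by eventually_elim auto
  have V0: "V \<ge> 0"
  proof -
    have "norm (?y T - ?y 0) \<le> V * \<bar>T - 0\<bar>" by (rule ac_on_Lipschitz[OF h hV]) (use T in auto)
    then have "0 \<le> V * T" using T by (smt (verit) norm_ge_zero)
    then show ?thesis using T by (simp add: zero_le_mult_iff)
  qed
  have "norm (?y (max 0 (min T t)) - ?y (max 0 (min T s))) \<le> V * \<bar>max 0 (min T t) - max 0 (min T s)\<bar>"
    by (rule ac_on_Lipschitz[OF h hV]) (rule clamp(2))+
  also have "\<dots> \<le> V * \<bar>t - s\<bar>" using V0 by (intro mult_left_mono) auto
  finally show "norm (?y t - ?y s) \<le> V * \<bar>t - s\<bar>" by (simp only: clamp(1)[symmetric])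
  \<comment> \<open>Cutting h off where it exceeds V changes it on a null set and gives a bound at
    every time, as \<open>optimal_curve\<close> requires. The factor \<open>CARD('n)\<close> arises
    because the density of the norm is the sum of the coordinates of h.\<close>
  define v where "v s = (if norm (h s) \<le> V then \<Sum>j\<in>UNIV. h s $ j else 0)" for s
  have "AE s in lebesgue. s \<in> {0..T} \<longrightarrow> v s = (\<Sum>j\<in>UNIV. h s $ j)"
    using hV by eventually_elim (simp add: v_def)
  from ac_on_cong_AE[OF ac_on_norm[OF h admD(3)[OF adm]] this]
  have "ac_on 0 T (\<lambda>s. norm (?y s)) v" .
  moreover have "\<bar>v s\<bar> \<le> real CARD('n) * V" for s
  proof (cases "norm (h s) \<le> V")
    case True
    have "\<bar>\<Sum>j\<in>UNIV. h s $ j\<bar> \<le> (\<Sum>j\<in>UNIV. \<bar>h s $ j\<bar>)" by (rule sum_abs)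
    also have "\<dots> \<le> of_nat (card (UNIV :: 'n set)) * V"
      by (rule sum_bounded_above) (rule order_trans[OF component_le_norm_cart True])
    finally have "\<bar>\<Sum>j\<in>UNIV. h s $ j\<bar> \<le> of_nat (card (UNIV :: 'n set)) * V" .
    then show ?thesis using True by (simp add: v_def)
  qed (use V0 in \<open>simp add: v_def\<close>)
  ultimately show "\<exists>v. ac_on 0 T (\<lambda>s. norm (?y s)) v \<and> (\<forall>s. \<bar>v s\<bar> \<le> real CARD('n) * V)" by blast
qed

text \<open>On curves with a common Lipschitz constant the uniform topology has a countable base given by
  the values at finitely many rational times, so the complement of the support is a null set.\<close>

lemma AE_in_measure_supp:
  fixes \<mu> :: "(real \<Rightarrow>\<^sub>C (real ^ 'n::finite)) measure"
  assumes sets: "sets \<mu> = sets (restrict_space borel S)"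
    and adm: "\<And>y. y \<in> S \<Longrightarrow> adm T p 0 (apply_bcontfun y)" and T: "T > 0"
    and Lip: "\<And>y s t. y \<in> S \<Longrightarrow> norm (apply_bcontfun y t - apply_bcontfun y s) \<le> V * \<bar>t - s\<bar>" and V: "V > 0"
  shows "AE y in \<mu>. \<forall>U. open U \<longrightarrow> y \<in> U \<longrightarrow> 0 < emeasure \<mu> (U \<inter> S)"
proof -
  have sp: "space \<mu> = S" using sets_eq_imp_space_eq[OF sets] by (simp add: space_restrict_space)
  \<comment> \<open>Curves whose values at the k + 1 times T j / (k + 1) are within 1 / (n + 1) of
    prescribed centres. With centres in a countable dense set these open sets are countably
    many.\<close>
  define Bs where "Bs = (\<lambda>(k::nat, n::nat, c::nat \<Rightarrow> real ^ 'n).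
      {y. \<forall>j\<le>k. dist (apply_bcontfun y (T * real j / real (Suc k))) (c j) < 1 / real (Suc n)})"
  obtain D :: "(real ^ 'n) set" where D: "countable D" "\<And>U. open U \<Longrightarrow> U \<noteq> {} \<Longrightarrow> \<exists>d\<in>D. d \<in> U"
    using countable_dense_exists by blast
  define Q where "Q = (SIGMA k:(UNIV::nat set). (UNIV :: nat set) \<times> PiE {..k} (\<lambda>_. D))"
  have cQ: "countable Q" unfolding Q_def
    by (intro countable_SIGMA countable_PiE D) auto
  have Bopen: "open (Bs q)" for q
  proof -
    obtain k n c where q: "q = (k, n, c)" by (cases q) auto
    have "open {y. dist (apply_bcontfun y s) z < e}" for s z e
      by (intro open_Collect_less continuous_intros continuous_on_dist apply_bcontfun_continuous)
    then have "open (\<Inter>j\<in>{..k}. {y. dist (apply_bcontfun y (T * real j / real (Suc k))) (c j) < 1 / real (Suc n)})"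
      by (intro open_INT) auto
    also have "(\<Inter>j\<in>{..k}. {y. dist (apply_bcontfun y (T * real j / real (Suc k))) (c j) < 1 / real (Suc n)}) = Bs q"
      by (auto simp: Bs_def q)
    finally show ?thesis .
  qed
  have base: "\<exists>q\<in>Q. y \<in> Bs q \<and> Bs q \<inter> S \<subseteq> U" if U: "open U" "y \<in> U" and y: "y \<in> S" for U y
  proof -
    obtain e where e: "e > 0" "ball y e \<subseteq> U" using U open_contains_ball by blast
    \<comment> \<open>Four errors below e/6 occur: both curves are moved to a sample time, and both
      are compared with the centre there.\<close>
    obtain n :: nat where n: "1 / real (Suc n) < e / 6" using nat_approx_posE[of "e / 6"] e(1) by auto
    obtain k :: nat where k: "V * T * 6 / e < real k" using reals_Archimedean2 by blast
    then have k': "V * (T / real (Suc k)) < e / 6" using e(1) by (simp add: field_simps)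
    have "\<exists>c. \<forall>j. c j \<in> D \<and> dist (apply_bcontfun y (T * real j / real (Suc k))) (c j) < 1 / real (Suc n)"
    proof (rule choice, rule allI)
      fix j
      have "\<exists>d\<in>D. d \<in> ball (apply_bcontfun y (T * real j / real (Suc k))) (1 / real (Suc n))"
        by (rule D(2)) auto
      then show "\<exists>d. d \<in> D \<and> dist (apply_bcontfun y (T * real j / real (Suc k))) d < 1 / real (Suc n)" by auto
    qed
    then obtain c where c: "\<And>j. c j \<in> D" "\<And>j. dist (apply_bcontfun y (T * real j / real (Suc k))) (c j) < 1 / real (Suc n)"
      by blast
    define q where "q = (k, n, restrict c {..k})"
    have "q \<in> Q" using c(1) by (simp add: q_def Q_def)
    moreover have "y \<in> Bs q" using c(2) by (simp add: q_def Bs_def)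
    moreover have "z \<in> U" if z: "z \<in> Bs q" "z \<in> S" for z
    proof -
      have "dist (apply_bcontfun y s) (apply_bcontfun z s) \<le> 5 * e / 6" if s: "s \<in> {0..T}" for s
      proof -
        define j where "j = nat \<lfloor>s * real (Suc k) / T\<rfloor>"
        have s0: "0 \<le> s * real (Suc k) / T" using s T by auto
        have j1: "real j \<le> s * real (Suc k) / T" "s * real (Suc k) / T < real j + 1"
          using s0 unfolding j_def by linarith+
        \<comment> \<open>The time T is not a sample time; for s = T the floor gives k + 1, and the
          last sample with index k is used instead, still within one mesh width.\<close>
        define j' where "j' = min j k"
        define r where "r = T * real j' / real (Suc k)"
        have rs: "\<bar>s - r\<bar> \<le> T / real (Suc k)"
        proof -
          have a: "s * real (Suc k) \<le> T * real (Suc k)" using s by (intro mult_right_mono) auto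
          have b: "T * real j \<le> s * real (Suc k)" "s * real (Suc k) < T * real j + T"
            using j1 T by (auto simp: field_simps)
          have "\<bar>s * real (Suc k) - T * real j'\<bar> \<le> T"
          proof (cases "j \<le> k")
            case True
            then show ?thesis using b by (simp add: j'_def min_absorb1)
          next
            case False
            then have "real (Suc k) \<le> real j" by (simp del: of_nat_Suc)
            then have "T * real (Suc k) \<le> T * real j" using T by (intro mult_left_mono) auto
            then have "T * real k + T \<le> T * real j" by (simp add: algebra_simps)
            moreover have "T * real (Suc k) = T * real k + T" by (simp add: algebra_simps)
            ultimately show ?thesis using False a b by (simp add: j'_def min_absorb2 abs_le_iff)
          qed
          moreover have "s - r = (s * real (Suc k) - T * real j') / real (Suc k)" by (simp add: r_def field_simps)
          ultimately show ?thesis by (simp add: abs_divide divide_right_mono)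
        qed
        have Vs: "dist (apply_bcontfun x s) (apply_bcontfun x r) < e / 6" if "x \<in> S" for x
        proof -
          have "dist (apply_bcontfun x s) (apply_bcontfun x r) \<le> V * \<bar>s - r\<bar>" using Lip[OF that] by (simp add: dist_norm)
          also have "\<dots> \<le> V * (T / real (Suc k))" using rs V by (intro mult_left_mono) auto
          finally show ?thesis using k' by linarith
        qed
        have "dist (apply_bcontfun z r) (c j') < 1 / real (Suc n)"
          using z(1) by (auto simp: q_def Bs_def r_def j'_def)
        then have "dist (apply_bcontfun z r) (c j') < e / 6" using n by (rule less_trans)
        moreover have "dist (apply_bcontfun y r) (c j') < e / 6"
          using c(2)[of j'] n unfolding r_def by (rule less_trans)
        moreover have "dist (apply_bcontfun y s) (apply_bcontfun z s) \<le>
            dist (apply_bcontfun y s) (c j') + dist (c j') (apply_bcontfun z s)" by (rule dist_triangle)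
        moreover have "dist (apply_bcontfun y s) (c j') \<le>
            dist (apply_bcontfun y s) (apply_bcontfun y r) + dist (apply_bcontfun y r) (c j')" by (rule dist_triangle)
        moreover have "dist (c j') (apply_bcontfun z s) \<le>
            dist (apply_bcontfun z r) (c j') + dist (apply_bcontfun z s) (apply_bcontfun z r)"
          using dist_triangle3[of "c j'" "apply_bcontfun z s" "apply_bcontfun z r"] by (simp add: dist_commute)
        ultimately show ?thesis using Vs[OF y] Vs[OF z(2)] e(1) by linarith
      qed
      then have "dist (apply_bcontfun y s) (apply_bcontfun z s) \<le> 5 * e / 6" for s
        using admD(1)[OF adm[OF y], of s] admD(1)[OF adm[OF z(2)], of s]
          admD(2)[OF adm[OF y], of s] admD(2)[OF adm[OF z(2)], of s] T
        by (cases "s \<le> 0"; cases "s \<ge> T") auto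
      then have "dist y z \<le> 5 * e / 6" by (rule dist_bound)
      then have "z \<in> ball y e" using e(1) by simp
      then show ?thesis using e(2) by blast
    qed
    ultimately show ?thesis by blast
  qed
  have "AE y in \<mu>. \<forall>q\<in>Q. emeasure \<mu> (Bs q \<inter> S) = 0 \<longrightarrow> y \<notin> Bs q"
  proof (subst AE_ball_countable[OF cQ], rule ballI)
    fix q
    have m: "Bs q \<inter> S \<in> sets \<mu>"
      unfolding sets sets_restrict_space using borel_open[OF Bopen[of q]] by auto
    show "AE y in \<mu>. emeasure \<mu> (Bs q \<inter> S) = 0 \<longrightarrow> y \<notin> Bs q"
    proof (cases "emeasure \<mu> (Bs q \<inter> S) = 0")
      case True
      then have "AE y in \<mu>. y \<notin> Bs q \<inter> S" using m by (intro AE_not_in) (simp add: null_sets_def)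
      then show ?thesis using AE_space by eventually_elim (simp add: sp)
    qed simp
  qed
  then show ?thesis
    using AE_space
  proof eventually_elim
    case (elim y)
    show ?case
    proof (intro allI impI)
      fix U assume U: "open U" "y \<in> U"
      obtain q where q: "q \<in> Q" "y \<in> Bs q" "Bs q \<inter> S \<subseteq> U" using base[OF U] elim(2) sp by blast
      have "0 < emeasure \<mu> (Bs q \<inter> S)" using elim(1) q by (auto simp: zero_less_iff_neq_zero)
      also have "\<dots> \<le> emeasure \<mu> (U \<inter> S)"
        by (rule emeasure_mono) (use q(3) U(1) in \<open>auto simp: sets sets_restrict_space\<close>)
      finally show "0 < emeasure \<mu> (U \<inter> S)" .
    qed
  qed
qed

section \<open>Relaxed equilibria on curves of bounded speed\<close>

lemma min_diff_le: "\<bar>a - b\<bar> < e \<Longrightarrow> \<bar>c - d\<bar> < e \<Longrightarrow> \<bar>min a c - min b d\<bar> \<le> e" for a b c d e :: real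
  by (auto simp: min_def abs_if split: if_splits)

lemma Min_range_diff_less:
  fixes f g :: "'n::finite \<Rightarrow> real"
  assumes "\<And>i. \<bar>f i - g i\<bar> < e"
  shows "\<bar>Min (range f) - Min (range g)\<bar> < e"
proof -
  have *: "Min (range f) < Min (range g) + e" if fg: "\<And>i. \<bar>f i - g i\<bar> < e" for f g :: "'n \<Rightarrow> real"
  proof -
    have "Min (range g) \<in> range g" by (rule Min_in) auto
    then obtain i where i: "Min (range g) = g i" by (rule rangeE)
    have "Min (range f) \<le> f i" by (rule Min_le) auto
    also have "\<dots> < g i + e" using fg[of i] by linarith
    finally show ?thesis by (simp add: i)
  qed
  have "\<bar>g i - f i\<bar> < e" for i using assms[of i] by linarith
  from *[of f g, OF assms] *[of g f, OF this] show ?thesis by linarith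
qed

text \<open>The coercivity constant C0 is a parameter so that \<open>control\<close> can be
  interpreted with it once the flow \<open>M\<close> of the equilibrium is inserted into the costs.
  \<open>\<mu>\<close> lives on Lipschitz curves, whereas the equilibrium condition is stated for
  its image on the larger set \<open>Gamma_C\<close>.\<close>

locale lipschitz_equilibrium =
  fixes T p C V C0 :: real
    and L :: "'n::finite \<Rightarrow> (real ^ 'n) measure \<Rightarrow> real \<Rightarrow> real \<Rightarrow> real"
    and Lstar :: "(real ^ 'n) measure \<Rightarrow> real"
    and G :: "'n \<Rightarrow> (real ^ 'n) measure \<Rightarrow> real \<Rightarrow> real"
    and Gstar :: "(real ^ 'n) measure \<Rightarrow> real"
    and m0 :: "(real ^ 'n) measure"
    and \<mu> :: "(real \<Rightarrow>\<^sub>C (real ^ 'n)) measure"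
    and u :: "real ^ 'n \<Rightarrow> real \<Rightarrow> real"
    and m :: "real \<Rightarrow> (real ^ 'n) measure"
  assumes T: "T > 0" and p: "p > 1" and C: "C > 0" and V: "V > 0" and C0: "C0 > 0"
    and stand: "standing_assumptions p L Lstar G Gstar"
    and lower: "\<And>m. m \<in> P1 \<Longrightarrow> - C0 \<le> Lstar m"
      "\<And>m i x a. m \<in> P1 \<Longrightarrow> 0 \<le> x \<Longrightarrow> C0 * (\<bar>a\<bar> powr p - 1) \<le> L i m x a"
    and \<mu>: "\<mu> \<in> prob_with_start m0 (Gamma_Lip T p C V)"
    and equi: "relaxed_equilibrium T p C L Lstar G Gstar m0 (view_on (Gamma_C T p C) \<mu>)"
    and mild: "mild_solution T p L Lstar G Gstar (view_on (Gamma_C T p C) \<mu>) u m"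
begin

abbreviation S :: "(real \<Rightarrow>\<^sub>C (real ^ 'n)) set" where "S \<equiv> Gamma_Lip T p C V"

abbreviation M :: "real \<Rightarrow> (real ^ 'n) measure" where "M \<equiv> push_eval \<mu>"

abbreviation crd :: "'n \<Rightarrow> real \<Rightarrow> (real \<Rightarrow>\<^sub>C (real ^ 'n)) \<Rightarrow> real" where "crd i t y \<equiv> apply_bcontfun y t $ i"

lemma prob_\<mu>: "prob_space \<mu>"
  using \<mu> by (simp add: prob_with_start_def borel_prob_on_def)

sublocale prob_space \<mu> by (rule prob_\<mu>)

lemma sets_\<mu>: "sets \<mu> = sets (restrict_space borel S)"
  using \<mu> by (simp add: prob_with_start_def borel_prob_on_def)

lemma space_\<mu>: "space \<mu> = S"
  using sets_eq_imp_space_eq[OF sets_\<mu>] by (simp add: space_restrict_space)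

lemma curve:
  assumes "y \<in> S"
  shows "adm T p 0 (apply_bcontfun y)" "apply_bcontfun y t \<in> junction" "norm (apply_bcontfun y t) \<le> C"
    "norm (apply_bcontfun y t - apply_bcontfun y s) \<le> V * \<bar>t - s\<bar>"
  using Gamma_LipD[OF assms T p] by blast+

lemma component:
  assumes "y \<in> S"
  shows "0 \<le> crd i t y" "crd i t y \<le> C"
    "\<bar>crd i t y - crd i s y\<bar> \<le> V * \<bar>t - s\<bar>"
proof -
  show "0 \<le> crd i t y" "crd i t y \<le> C"
    using junction_component(1,2)[OF curve(2)[OF assms], of t i] curve(3)[OF assms, of t] by auto
  show "\<bar>crd i t y - crd i s y\<bar> \<le> V * \<bar>t - s\<bar>"
    using component_le_norm_cart[of "apply_bcontfun y t - apply_bcontfun y s" i] curve(4)[OF assms, of t s] by simp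
qed

lemma eval_measurable: "(\<lambda>y. apply_bcontfun y t) \<in> borel_measurable \<mu>"
proof -
  have "(\<lambda>y. apply_bcontfun y t) \<in> borel_measurable (restrict_space borel S)"
    by (intro measurable_restrict_space1 borel_measurable_continuous_onI apply_bcontfun_continuous)
  then show ?thesis by (simp add: measurable_cong_sets[OF sets_\<mu> refl])
qed

lemma eval_measurable_junction: "(\<lambda>y. apply_bcontfun y t) \<in> \<mu> \<rightarrow>\<^sub>M restrict_space borel junction"
  by (rule measurable_restrict_space2[OF _ eval_measurable]) (use curve(2) space_\<mu> in auto)

lemma sets_M: "sets (M t) = sets (restrict_space borel junction)"
  by (simp add: push_eval_def)

lemma space_M: "space (M t) = junction"
  by (simp add: push_eval_def space_restrict_space)

lemma integral_M:
  fixes f :: "real ^ 'n \<Rightarrow> real"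
  assumes "f \<in> borel_measurable (restrict_space borel junction)"
  shows "(LINT x|M t. f x) = (LINT y|\<mu>. f (apply_bcontfun y t))"
    "integrable (M t) f \<longleftrightarrow> integrable \<mu> (\<lambda>y. f (apply_bcontfun y t))"
  unfolding push_eval_def
  using integral_distr[OF eval_measurable_junction assms] integrable_distr_eq[OF eval_measurable_junction assms] by auto

lemma bounded_integrable:
  fixes f :: "(real \<Rightarrow>\<^sub>C (real ^ 'n)) \<Rightarrow> real"
  assumes "f \<in> borel_measurable \<mu>" "\<And>y. y \<in> S \<Longrightarrow> \<bar>f y\<bar> \<le> B"
  shows "integrable \<mu> f"
  by (rule integrable_const_bound[OF _ assms(1)]) (use assms(2) space_\<mu> in \<open>auto intro!: AE_I2\<close>)

lemma M_P1: "M t \<in> P1"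
proof -
  have c: "continuous_on junction (\<lambda>x :: real ^ 'n. norm x)" by (intro continuous_intros)
  have "(\<lambda>x :: real ^ 'n. norm x) \<in> borel_measurable (restrict_space borel junction)"
    by (rule borel_measurable_continuous_on_restrict[OF c])
  moreover have "integrable \<mu> (\<lambda>y. norm (apply_bcontfun y t))"
    by (rule bounded_integrable[where B = C]) (use eval_measurable curve(3) in auto)
  ultimately have "integrable (M t) norm" by (simp add: integral_M)
  then have "integrable (M t) (\<lambda>x. jdist x 0)"
    by (subst Bochner_Integration.integrable_cong[where g = norm]) (auto simp: space_M jdist_zero)
  moreover have "prob_space (M t)" unfolding push_eval_def by (rule prob_space_distr[OF eval_measurable_junction])
  ultimately show ?thesis by (simp add: P1_def borel_prob_on_def sets_M)
qed

text \<open>The curves themselves couple the marginals at two times. The speed contributes V, and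
  \<open>jdist_le\<close> contributes the factor 2.\<close>

lemma M_dist: "kr_dist (M t) (M s) \<le> 2 * V * \<bar>t - s\<bar>"
  unfolding kr_dist_def
proof (rule cSUP_least)
  show "{f. \<forall>x\<in>junction. \<forall>y\<in>junction. \<bar>f x - f y\<bar> \<le> jdist x y} \<noteq> {}"
    by (auto intro!: exI[of _ "\<lambda>_. 0"] simp: jdist_def)
  fix f :: "real ^ 'n \<Rightarrow> real" assume "f \<in> {f. \<forall>x\<in>junction. \<forall>y\<in>junction. \<bar>f x - f y\<bar> \<le> jdist x y}"
  then have f: "\<bar>f x - f y\<bar> \<le> 2 * norm (x - y)" if "x \<in> junction" "y \<in> junction" for x y
    using that jdist_le[OF that] by (blast intro: order_trans)
  have "continuous_on junction f"
  proof (rule continuous_onI)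
    fix x :: "real ^ 'n" and e :: real assume x: "x \<in> junction" and e: "e > 0"
    show "\<exists>d>0. \<forall>x'\<in>junction. dist x' x < d \<longrightarrow> dist (f x') (f x) \<le> e"
      using f[OF _ x] e by (intro exI[of _ "e / 2"]) (force simp: dist_norm)
  qed
  then have fm: "f \<in> borel_measurable (restrict_space borel junction)"
    by (rule borel_measurable_continuous_on_restrict)
  have fi: "integrable \<mu> (\<lambda>y. f (apply_bcontfun y t))" for t
  proof (rule bounded_integrable[where B = "\<bar>f 0\<bar> + 2 * C"])
    show "(\<lambda>y. f (apply_bcontfun y t)) \<in> borel_measurable \<mu>" using measurable_compose[OF eval_measurable_junction fm] .
    show "\<bar>f (apply_bcontfun y t)\<bar> \<le> \<bar>f 0\<bar> + 2 * C" if "y \<in> S" for y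
      using f[OF curve(2)[OF that, of t] zero_in_junction] curve(3)[OF that, of t] by simp
  qed
  have "(LINT x|M t. f x) - (LINT x|M s. f x) = (LINT y|\<mu>. f (apply_bcontfun y t) - f (apply_bcontfun y s))"
    by (simp add: integral_M(1)[OF fm] Bochner_Integration.integral_diff[OF fi fi])
  also have "\<dots> \<le> (LINT y|\<mu>. 2 * V * \<bar>t - s\<bar>)"
  proof (rule integral_mono)
    show "integrable \<mu> (\<lambda>y. f (apply_bcontfun y t) - f (apply_bcontfun y s))" by (intro Bochner_Integration.integrable_diff fi)
    fix y assume "y \<in> space \<mu>"
    then have y: "y \<in> S" by (simp add: space_\<mu>)
    show "f (apply_bcontfun y t) - f (apply_bcontfun y s) \<le> 2 * V * \<bar>t - s\<bar>"
      using f[OF curve(2)[OF y, of t] curve(2)[OF y, of s]] curve(4)[OF y, of t s] by linarith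
  qed simp
  also have "\<dots> = 2 * V * \<bar>t - s\<bar>" by (simp add: prob_space)
  finally show "(LINT x|M t. f x) - (LINT x|M s. f x) \<le> 2 * V * \<bar>t - s\<bar>" .
qed

lemma M_close:
  assumes "\<delta> > 0"
  shows "\<exists>d>0. \<forall>s. \<bar>t - s\<bar> < d \<longrightarrow> kr_dist (M t) (M s) < \<delta>"
proof (intro exI[of _ "\<delta> / (2 * V)"] conjI allI impI)
  fix s assume "\<bar>t - s\<bar> < \<delta> / (2 * V)"
  then have "2 * V * \<bar>t - s\<bar> < \<delta>" using V by (simp add: field_simps)
  then show "kr_dist (M t) (M s) < \<delta>" using M_dist[of t s] by linarith
qed (use assms V in simp)

lemma view_measurable:
  assumes "S \<subseteq> X"
  shows "(\<lambda>y. y) \<in> \<mu> \<rightarrow>\<^sub>M restrict_space borel X"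
proof (rule measurable_restrict_space2)
  have "(\<lambda>y. y) \<in> restrict_space borel S \<rightarrow>\<^sub>M borel" by (rule measurable_restrict_space1) simp
  then show "(\<lambda>y. y) \<in> \<mu> \<rightarrow>\<^sub>M borel" by (simp add: measurable_cong_sets[OF sets_\<mu> refl])
qed (use assms space_\<mu> in auto)

lemma S_subset: "S \<subseteq> Gamma_C T p C" "S \<subseteq> Gamma_all T p"
  using Gamma_LipD(6,7)[OF _ T p] by blast+

text \<open>Evaluation factors through the inclusion of the curve spaces, so the costs, written for
  the measure viewed on \<open>Gamma_C\<close>, only see the flow \<open>M\<close>.\<close>

lemma push_view: "push_eval (view_on (Gamma_C T p C) \<mu>) = M"
proof
  fix t
  have "apply_bcontfun y t \<in> junction" if "y \<in> Gamma_C T p C" for y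
  proof -
    obtain x where "y \<in> Gamma_from T p 0 x" using \<open>y \<in> Gamma_C T p C\<close> by (auto simp: Gamma_C_def Gamma_C_at_def)
    then have a: "adm T p 0 (apply_bcontfun y)" using Gamma_from_adm(1)[OF _ T p] by blast
    consider "t \<le> 0" | "t \<in> {0..T}" | "t \<ge> T" using atLeastAtMost_iff by force
    then show ?thesis
    proof cases
      case 1
      have "apply_bcontfun y t = apply_bcontfun y 0" by (rule admD(1)[OF a 1])
      then show ?thesis using admD(3)[OF a, of 0] T by simp
    next
      case 2
      then show ?thesis by (rule admD(3)[OF a])
    next
      case 3
      have "apply_bcontfun y t = apply_bcontfun y T" by (rule admD(2)[OF a 3])
      then show ?thesis using admD(3)[OF a, of T] T by simp
    qed
  qed
  then have "(\<lambda>y. apply_bcontfun y t) \<in> restrict_space borel (Gamma_C T p C) \<rightarrow>\<^sub>M restrict_space borel junction"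
    by (intro measurable_restrict_space2 measurable_restrict_space1 borel_measurable_continuous_onI apply_bcontfun_continuous)
      (auto simp: space_restrict_space)
  from distr_distr[OF this view_measurable[OF S_subset(1)]]
  show "push_eval (view_on (Gamma_C T p C) \<mu>) t = M t"
    by (simp add: push_eval_def view_on_def o_def)
qed

lemma m_eq: "t \<in> {0..T} \<Longrightarrow> m t = M t"
  using mild by (simp add: mild_solution_def push_view)

text \<open>Locally uniform continuity in the measure combines with the Lipschitz flow
  \<open>M\<close> to joint continuity. The radius R = |r| + |a| + 1 covers a unit neighbourhood of
  the point under consideration.\<close>

lemma continuous_on_costs:
  fixes H :: "(real ^ 'n) measure \<Rightarrow> real \<Rightarrow> real \<Rightarrow> real"
  assumes c: "\<And>m. m \<in> P1 \<Longrightarrow> continuous_on ({0..} \<times> UNIV) (\<lambda>(x, a). H m x a)"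
    and u: "\<And>m R e. m \<in> P1 \<Longrightarrow> R > 0 \<Longrightarrow> e > 0 \<Longrightarrow> \<exists>\<delta>>0. \<forall>m'\<in>P1. kr_dist m m' < \<delta> \<longrightarrow>
        (\<forall>x\<in>{0..R}. \<forall>a\<in>{-R..R}. \<bar>H m' x a - H m x a\<bar> < e)"
  shows "continuous_on ({0..T} \<times> {0..} \<times> UNIV) (\<lambda>(\<tau>, r, a). H (M \<tau>) r a)"
proof (rule continuous_onI)
  fix q :: "real \<times> real \<times> real" and e :: real
  assume q: "q \<in> {0..T} \<times> {0..} \<times> UNIV" and e: "e > 0"
  obtain \<tau> r a where qe: "q = (\<tau>, r, a)" by (cases q) auto
  define R where "R = \<bar>r\<bar> + \<bar>a\<bar> + 1"
  have R: "R > 0" by (simp add: R_def)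
  obtain \<delta> where \<delta>: "\<delta> > 0" "\<And>m' x b. m' \<in> P1 \<Longrightarrow> kr_dist (M \<tau>) m' < \<delta> \<Longrightarrow> x \<in> {0..R} \<Longrightarrow> b \<in> {-R..R} \<Longrightarrow>
      \<bar>H m' x b - H (M \<tau>) x b\<bar> < e / 2"
    using u[OF M_P1[of \<tau>] R, of "e / 2"] e by auto
  obtain d where d: "d > 0" "\<And>s. \<bar>\<tau> - s\<bar> < d \<Longrightarrow> kr_dist (M \<tau>) (M s) < \<delta>" using M_close[OF \<delta>(1)] by blast
  have "(r, a) \<in> {0..} \<times> UNIV" using q qe by auto
  then obtain d' where d': "d' > 0" "\<And>z. z \<in> {0..} \<times> UNIV \<Longrightarrow> dist z (r, a) < d' \<Longrightarrow>
      dist ((\<lambda>(x, a). H (M \<tau>) x a) z) (H (M \<tau>) r a) < e / 2"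
    using c[OF M_P1[of \<tau>], unfolded continuous_on_iff, rule_format, of "(r, a)" "e / 2"] e by auto
  show "\<exists>d>0. \<forall>q'\<in>{0..T} \<times> {0..} \<times> UNIV. dist q' q < d \<longrightarrow>
      dist ((\<lambda>(\<tau>, r, a). H (M \<tau>) r a) q') ((\<lambda>(\<tau>, r, a). H (M \<tau>) r a) q) \<le> e"
  proof (intro exI[of _ "min 1 (min d d')"] conjI ballI impI)
    fix q' :: "real \<times> real \<times> real" assume q': "q' \<in> {0..T} \<times> {0..} \<times> UNIV" "dist q' q < min 1 (min d d')"
    obtain s x b where q'e: "q' = (s, x, b)" by (cases q') auto
    have ds: "dist s \<tau> \<le> dist q' q" using dist_fst_le[of q' q] by (simp add: qe q'e)
    have dxb: "dist (x, b) (r, a) \<le> dist q' q" using dist_snd_le[of q' q] by (simp add: qe q'e)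
    have dx: "dist x r \<le> dist (x, b) (r, a)" using dist_fst_le[of "(x, b)" "(r, a)"] by simp
    have db: "dist b a \<le> dist (x, b) (r, a)" using dist_snd_le[of "(x, b)" "(r, a)"] by simp
    have x: "x \<ge> 0" using q' q'e by auto
    have b1: "\<bar>x - r\<bar> < 1" "\<bar>b - a\<bar> < 1" using dx db dxb q'(2) by (auto simp: dist_real_def)
    have xb: "x \<in> {0..R}" "b \<in> {-R..R}" using b1 x unfolding R_def atLeastAtMost_iff by linarith+
    have "\<bar>\<tau> - s\<bar> < d" using ds q'(2) by (auto simp: dist_real_def)
    then have "\<bar>H (M s) x b - H (M \<tau>) x b\<bar> < e / 2" by (intro \<delta>(2) M_P1 d(2) xb)
    moreover have "dist (H (M \<tau>) x b) (H (M \<tau>) r a) < e / 2"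
      using d'(2)[of "(x, b)"] dxb q'(2) x by auto
    ultimately show "dist ((\<lambda>(\<tau>, r, a). H (M \<tau>) r a) q') ((\<lambda>(\<tau>, r, a). H (M \<tau>) r a) q) \<le> e"
      unfolding qe q'e prod.case dist_real_def by linarith
  qed (use d d' in auto)
qed

lemma L_C1: "n \<in> P1 \<Longrightarrow> C1_halfplane (L i n)"
  and L_cont: "n \<in> P1 \<Longrightarrow> R > 0 \<Longrightarrow> e > 0 \<Longrightarrow> \<exists>\<delta>>0. \<forall>m'\<in>P1. kr_dist n m' < \<delta> \<longrightarrow>
        (\<forall>x\<in>{0..R}. \<forall>a\<in>{-R..R}.
           \<bar>L i m' x a - L i n x a\<bar> < e \<and>
           \<bar>partial_x (L i m') x a - partial_x (L i n) x a\<bar> < e \<and>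
           \<bar>partial_a (L i m') x a - partial_a (L i n) x a\<bar> < e)"
proof -
  have c: "cont_P1_C1 (L i)" using stand by (simp add: standing_assumptions_def)
  show "n \<in> P1 \<Longrightarrow> C1_halfplane (L i n)"
    using c[unfolded cont_P1_C1_def, THEN conjunct1] by (rule bspec)
  show "n \<in> P1 \<Longrightarrow> R > 0 \<Longrightarrow> e > 0 \<Longrightarrow> \<exists>\<delta>>0. \<forall>m'\<in>P1. kr_dist n m' < \<delta> \<longrightarrow>
        (\<forall>x\<in>{0..R}. \<forall>a\<in>{-R..R}.
           \<bar>L i m' x a - L i n x a\<bar> < e \<and>
           \<bar>partial_x (L i m') x a - partial_x (L i n) x a\<bar> < e \<and>
           \<bar>partial_a (L i m') x a - partial_a (L i n) x a\<bar> < e)"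
    using c[unfolded cont_P1_C1_def, THEN conjunct2] by simp
qed

lemma G_Cb: "Cb_P1_Cb (G i)"
  using stand by (simp add: standing_assumptions_def)

lemma continuous_on_L:
  "continuous_on ({0..T} \<times> {0..} \<times> UNIV) (\<lambda>(\<tau>, r, a). L i (M \<tau>) r a)"
  "continuous_on ({0..T} \<times> {0..} \<times> UNIV) (\<lambda>(\<tau>, r, a). partial_x (L i (M \<tau>)) r a)"
  "continuous_on ({0..T} \<times> {0..} \<times> UNIV) (\<lambda>(\<tau>, r, a). partial_a (L i (M \<tau>)) r a)"
proof -
  have c: "continuous_on ({0..} \<times> UNIV) (\<lambda>(x, a). L i n x a)"
    "continuous_on ({0..} \<times> UNIV) (\<lambda>(x, a). partial_x (L i n) x a)"
    "continuous_on ({0..} \<times> UNIV) (\<lambda>(x, a). partial_a (L i n) x a)" if "n \<in> P1" for n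
    using L_C1[OF that, of i] unfolding C1_halfplane_def by simp_all
  have u: "\<exists>\<delta>>0. \<forall>m'\<in>P1. kr_dist n m' < \<delta> \<longrightarrow> (\<forall>x\<in>{0..R}. \<forall>a\<in>{-R..R}. \<bar>L i m' x a - L i n x a\<bar> < e)"
    "\<exists>\<delta>>0. \<forall>m'\<in>P1. kr_dist n m' < \<delta> \<longrightarrow> (\<forall>x\<in>{0..R}. \<forall>a\<in>{-R..R}. \<bar>partial_x (L i m') x a - partial_x (L i n) x a\<bar> < e)"
    "\<exists>\<delta>>0. \<forall>m'\<in>P1. kr_dist n m' < \<delta> \<longrightarrow> (\<forall>x\<in>{0..R}. \<forall>a\<in>{-R..R}. \<bar>partial_a (L i m') x a - partial_a (L i n) x a\<bar> < e)"
    if nRe: "n \<in> P1" "R > 0" "e > 0" for n R e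
  proof -
    obtain \<delta> where \<delta>: "\<delta> > 0" "\<forall>m'\<in>P1. kr_dist n m' < \<delta> \<longrightarrow>
        (\<forall>x\<in>{0..R}. \<forall>a\<in>{-R..R}.
           \<bar>L i m' x a - L i n x a\<bar> < e \<and>
           \<bar>partial_x (L i m') x a - partial_x (L i n) x a\<bar> < e \<and>
           \<bar>partial_a (L i m') x a - partial_a (L i n) x a\<bar> < e)"
      using L_cont[OF nRe, of i] by (elim exE conjE)
    show "\<exists>\<delta>>0. \<forall>m'\<in>P1. kr_dist n m' < \<delta> \<longrightarrow> (\<forall>x\<in>{0..R}. \<forall>a\<in>{-R..R}. \<bar>L i m' x a - L i n x a\<bar> < e)"
      "\<exists>\<delta>>0. \<forall>m'\<in>P1. kr_dist n m' < \<delta> \<longrightarrow> (\<forall>x\<in>{0..R}. \<forall>a\<in>{-R..R}. \<bar>partial_x (L i m') x a - partial_x (L i n) x a\<bar> < e)"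
      "\<exists>\<delta>>0. \<forall>m'\<in>P1. kr_dist n m' < \<delta> \<longrightarrow> (\<forall>x\<in>{0..R}. \<forall>a\<in>{-R..R}. \<bar>partial_a (L i m') x a - partial_a (L i n) x a\<bar> < e)"
      using \<delta> by (intro exI[of _ \<delta>]; simp)+
  qed
  show "continuous_on ({0..T} \<times> {0..} \<times> UNIV) (\<lambda>(\<tau>, r, a). L i (M \<tau>) r a)"
    by (rule continuous_on_costs[OF c(1) u(1)])
  show "continuous_on ({0..T} \<times> {0..} \<times> UNIV) (\<lambda>(\<tau>, r, a). partial_x (L i (M \<tau>)) r a)"
    by (rule continuous_on_costs[OF c(2) u(2)])
  show "continuous_on ({0..T} \<times> {0..} \<times> UNIV) (\<lambda>(\<tau>, r, a). partial_a (L i (M \<tau>)) r a)"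
    by (rule continuous_on_costs[OF c(3) u(3)])
qed

sublocale control T p C0 "\<lambda>i \<tau>. L i (M \<tau>)" "\<lambda>i \<tau>. partial_x (L i (M \<tau>))" "\<lambda>i \<tau>. partial_a (L i (M \<tau>))"
  "\<lambda>\<tau>. vertex_cost L Lstar (M \<tau>)" "\<lambda>i. G i (M T)" "min (Gstar (M T)) (Min (range (\<lambda>i. G i (M T) 0)))"
proof
  show "T > 0" "p > 1" "C0 > 0" by (rule T p C0)+
  show "continuous_on ({0..T} \<times> {0..} \<times> UNIV) (\<lambda>(\<tau>, r, a). L i (M \<tau>) r a)"
    "continuous_on ({0..T} \<times> {0..} \<times> UNIV) (\<lambda>(\<tau>, r, a). partial_x (L i (M \<tau>)) r a)"
    "continuous_on ({0..T} \<times> {0..} \<times> UNIV) (\<lambda>(\<tau>, r, a). partial_a (L i (M \<tau>)) r a)" for i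
    by (rule continuous_on_L)+
  fix i :: 'n and \<tau> r a :: real
  show "((\<lambda>r. L i (M \<tau>) r a) has_real_derivative partial_x (L i (M \<tau>)) r a) (at r within {0..})" if "0 \<le> r"
  proof -
    have "(\<lambda>r. L i (M \<tau>) r a) differentiable (at r within {0..})"
      using L_C1[OF M_P1, of i \<tau>] that by (simp add: C1_halfplane_def)
    then show ?thesis
      by (simp add: partial_x_def has_real_derivative_iff_has_vector_derivative vector_derivative_works)
  qed
  show "(L i (M \<tau>) r has_real_derivative partial_a (L i (M \<tau>)) r a) (at a)" if "0 \<le> r"
  proof -
    have "L i (M \<tau>) r differentiable (at a)"
      using L_C1[OF M_P1, of i \<tau>] that by (simp add: C1_halfplane_def)
    then show ?thesis by (simp add: partial_a_def DERIV_deriv_iff_real_differentiable)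
  qed
  show "C0 * (\<bar>a\<bar> powr p - 1) \<le> L i (M \<tau>) r a" if "0 \<le> r" by (rule lower(2)[OF M_P1 that])
  show "- C0 \<le> vertex_cost L Lstar (M \<tau>)"
  proof -
    have "C0 * (\<bar>0\<bar> powr p - 1) \<le> L i (M \<tau>) 0 0" for i by (rule lower(2)[OF M_P1 order_refl])
    then have "- C0 \<le> L i (M \<tau>) 0 0" for i using p by simp
    then show ?thesis using lower(1)[OF M_P1, of \<tau>] by (auto simp: vertex_cost_def)
  qed
  show "strictly_convex (L i (M \<tau>) r)" if "0 \<le> r"
  proof -
    have "\<forall>i. \<forall>m\<in>P1. \<forall>x\<ge>0. strictly_convex (L i m x)"
      using stand unfolding standing_assumptions_def by (elim conjE)
    then show ?thesis using M_P1 that by simp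
  qed
  show "continuous_on {0..} (G i (M T))"
    using G_Cb[of i] M_P1 by (simp add: Cb_P1_Cb_def)
next
  show "continuous_on {0..T} (\<lambda>\<tau>. vertex_cost L Lstar (M \<tau>))"
  proof (rule continuous_onI)
    fix \<tau> e :: real assume \<tau>: "\<tau> \<in> {0..T}" and e: "e > 0"
    have "Cb_P1 Lstar" using stand unfolding standing_assumptions_def by (elim conjE)
    then have "\<exists>\<delta>>0. \<forall>m'\<in>P1. kr_dist (M \<tau>) m' < \<delta> \<longrightarrow> \<bar>Lstar m' - Lstar (M \<tau>)\<bar> < e"
      using M_P1[of \<tau>] e by (simp add: Cb_P1_def)
    then obtain \<delta> where \<delta>: "\<delta> > 0" "\<And>m'. m' \<in> P1 \<Longrightarrow> kr_dist (M \<tau>) m' < \<delta> \<Longrightarrow> \<bar>Lstar m' - Lstar (M \<tau>)\<bar> < e" by blast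
    have "\<exists>\<delta>>0. \<forall>m'\<in>P1. kr_dist (M \<tau>) m' < \<delta> \<longrightarrow> \<bar>L i m' 0 0 - L i (M \<tau>) 0 0\<bar> < e" for i
    proof -
      obtain \<delta> where \<delta>: "\<delta> > 0" "\<forall>m'\<in>P1. kr_dist (M \<tau>) m' < \<delta> \<longrightarrow> (\<forall>x\<in>{0..1}. \<forall>a\<in>{-1..1}. \<bar>L i m' x a - L i (M \<tau>) x a\<bar> < e)"
        using L_cont[OF M_P1[of \<tau>] zero_less_one e, of i] by blast
      then show ?thesis by (intro exI[of _ \<delta>]) simp
    qed
    then obtain \<delta>' where \<delta>': "\<And>i. \<delta>' i > 0" "\<And>i m'. m' \<in> P1 \<Longrightarrow> kr_dist (M \<tau>) m' < \<delta>' i \<Longrightarrow> \<bar>L i m' 0 0 - L i (M \<tau>) 0 0\<bar> < e" by metis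
    have "min \<delta> (Min (range \<delta>')) > 0" using \<delta>(1) \<delta>'(1) by simp
    from M_close[OF this, of \<tau>] obtain d where d: "d > 0" "\<And>s. \<bar>\<tau> - s\<bar> < d \<Longrightarrow> kr_dist (M \<tau>) (M s) < min \<delta> (Min (range \<delta>'))" by blast
    show "\<exists>d>0. \<forall>s\<in>{0..T}. dist s \<tau> < d \<longrightarrow> dist (vertex_cost L Lstar (M s)) (vertex_cost L Lstar (M \<tau>)) \<le> e"
    proof (intro exI[of _ d] conjI ballI impI d(1))
      fix s assume "dist s \<tau> < d"
      then have "\<bar>\<tau> - s\<bar> < d" by (simp add: dist_real_def abs_minus_commute)
      from d(2)[OF this] have k: "kr_dist (M \<tau>) (M s) < \<delta>" "\<And>i. kr_dist (M \<tau>) (M s) < \<delta>' i" by auto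
      have "\<bar>Lstar (M s) - Lstar (M \<tau>)\<bar> < e" by (rule \<delta>(2)[OF M_P1 k(1)])
      moreover have "\<bar>Min (range (\<lambda>i. L i (M s) 0 0)) - Min (range (\<lambda>i. L i (M \<tau>) 0 0))\<bar> < e"
        by (rule Min_range_diff_less) (rule \<delta>'(2)[OF M_P1 k(2)])
      ultimately show "dist (vertex_cost L Lstar (M s)) (vertex_cost L Lstar (M \<tau>)) \<le> e"
        unfolding vertex_cost_def dist_real_def by (rule min_diff_le)
    qed
  qed
  show "\<exists>c\<ge>0. \<forall>i. \<forall>\<tau>\<in>{0..T}. \<forall>r\<in>{0..R}. \<forall>a.
      \<bar>partial_x (L i (M \<tau>)) r a\<bar> \<le> c * (\<bar>a\<bar> powr p + 1) \<and> \<bar>partial_a (L i (M \<tau>)) r a\<bar> \<le> c * (\<bar>a\<bar> powr (p - 1) + 1)"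
    if R: "R > 0" for R
  proof -
    obtain c where "c \<ge> 0" "\<forall>i. \<forall>m\<in>P1. \<forall>x\<in>{0..R}. \<forall>a.
        \<bar>partial_x (L i m) x a\<bar> \<le> c * (\<bar>a\<bar> powr p + 1) \<and> \<bar>partial_a (L i m) x a\<bar> \<le> c * (\<bar>a\<bar> powr (p - 1) + 1)"
    proof -
      have "\<forall>r>0. \<exists>c\<ge>0. \<forall>i. \<forall>m\<in>P1. \<forall>x\<in>{0..r}. \<forall>a.
        \<bar>partial_x (L i m) x a\<bar> \<le> c * (\<bar>a\<bar> powr p + 1) \<and>
        \<bar>partial_a (L i m) x a\<bar> \<le> c * (\<bar>a\<bar> powr (p - 1) + 1)"
        using stand unfolding standing_assumptions_def by (elim conjE)
      then show ?thesis using R that by blast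
    qed
    then show ?thesis using M_P1 by (intro exI[of _ c]) blast
  qed
  show "\<exists>B. \<forall>i. \<forall>r\<ge>0. \<bar>G i (M T) r\<bar> \<le> B"
  proof -
    have "\<exists>B. \<forall>r\<ge>0. \<bar>G i (M T) r\<bar> \<le> B" for i
      using G_Cb[of i] M_P1[of T] unfolding Cb_P1_Cb_def by blast
    then obtain B where B: "\<And>i r. r \<ge> 0 \<Longrightarrow> \<bar>G i (M T) r\<bar> \<le> B i" by metis
    have "\<bar>G i (M T) r\<bar> \<le> Max (range B)" if "r \<ge> 0" for i r
      using B[OF that, of i] by (rule order_trans) simp
    then show ?thesis by blast
  qed
qed

lemma total_cost_eq: "total_cost T L Lstar G Gstar (view_on (Gamma_C T p C) \<mu>) t z = J t (apply_bcontfun z)"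
  unfolding total_cost_def J_def run_def terminal_def running_cost_def terminal_cost_def push_view ..

lemma u_eq: "x \<in> junction \<Longrightarrow> t \<in> {0..T} \<Longrightarrow> u x t = U x t"
  using mild unfolding mild_solution_def U_def total_cost_eq by blast

definition optimal :: "(real \<Rightarrow>\<^sub>C (real ^ 'n)) \<Rightarrow> bool" where
  "optimal y \<longleftrightarrow> y \<in> S \<and> (\<forall>z. adm T p 0 z \<longrightarrow> z 0 = apply_bcontfun y 0 \<longrightarrow> J 0 (apply_bcontfun y) \<le> J 0 z)"

lemma AE_supp: "AE y in \<mu>. \<forall>U. open U \<longrightarrow> y \<in> U \<longrightarrow> 0 < emeasure \<mu> (U \<inter> S)"
  by (rule AE_in_measure_supp[OF sets_\<mu> _ T _ V]) (rule curve, assumption)+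

text \<open>The equilibrium condition concerns the support, which has full measure by
  \<open>AE_supp\<close>. Open sets have the same mass under \<open>\<mu>\<close> and under its view
  on \<open>Gamma_C\<close>, so points of the support remain in the support of the viewed measure,
  and competitors are passed from \<open>Gamma_from\<close> to \<open>adm\<close>.\<close>

lemma AE_optimal: "AE y in \<mu>. optimal y"
  using AE_supp AE_space
proof eventually_elim
  case (elim y)
  then have y: "y \<in> S" by (simp add: space_\<mu>)
  let ?\<nu> = "view_on (Gamma_C T p C) \<mu>"
  have sp: "space ?\<nu> = Gamma_C T p C" by (simp add: view_on_def space_restrict_space)
  have "y \<in> measure_supp ?\<nu>"
    unfolding measure_supp_def mem_Collect_eq sp
  proof (intro conjI allI impI)
    show "y \<in> Gamma_C T p C" using y S_subset by blast
    fix W :: "(real \<Rightarrow>\<^sub>C (real ^ 'n)) set" assume W: "open W \<and> y \<in> W"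
    have "W \<inter> Gamma_C T p C \<in> sets (restrict_space borel (Gamma_C T p C))"
      unfolding sets_restrict_space using W borel_open[of W] by (auto simp: Int_commute)
    then have "emeasure ?\<nu> (W \<inter> Gamma_C T p C) = emeasure \<mu> ((\<lambda>y. y) -` (W \<inter> Gamma_C T p C) \<inter> space \<mu>)"
      unfolding view_on_def by (rule emeasure_distr[OF view_measurable[OF S_subset(1)]])
    also have "(\<lambda>y. y) -` (W \<inter> Gamma_C T p C) \<inter> space \<mu> = W \<inter> S" using S_subset(1) by (auto simp: space_\<mu>)
    finally show "0 < emeasure ?\<nu> (W \<inter> Gamma_C T p C)" using elim(1) W by simp
  qed
  then obtain x where x: "y \<in> Gamma_C_at T p C x"
    "\<And>z. z \<in> Gamma_from T p 0 x \<Longrightarrow> total_cost T L Lstar G Gstar ?\<nu> 0 y \<le> total_cost T L Lstar G Gstar ?\<nu> 0 z"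
    using equi unfolding relaxed_equilibrium_def by blast
  have yx: "apply_bcontfun y 0 = x" using x(1) by (simp add: Gamma_C_at_def Gamma_from_def)
  show ?case
    unfolding optimal_def
  proof (intro conjI allI impI y)
    fix z :: "real \<Rightarrow> real ^ 'n" assume z: "adm T p 0 z" "z 0 = apply_bcontfun y 0"
    obtain z' where z': "z' \<in> Gamma_from T p 0 (z 0)" "apply_bcontfun z' = z" using adm_Gamma_from[OF z(1) T p] by blast
    then have "z' \<in> Gamma_from T p 0 x" using z(2) yx by simp
    from x(2)[OF this] show "J 0 (apply_bcontfun y) \<le> J 0 z" by (simp add: total_cost_eq z'(2))
  qed
qed


section \<open>The drift along optimal curves\<close>

text \<open>A limit along fixed right difference quotients exists as a term for every curve and time
  and is measurable in both; it is the derivative wherever the coordinate is differentiable. A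
  choice of weak derivative for each curve would offer no measurability in the curve.\<close>

definition velocity :: "'n \<Rightarrow> real \<Rightarrow> (real \<Rightarrow>\<^sub>C (real ^ 'n)) \<Rightarrow> real" where
  "velocity i t y = lim (\<lambda>n. (crd i (t + 1 / real (Suc n)) y - crd i t y) * real (Suc n))"

text \<open>With A and B the time and space derivatives of a function of position and time, this is
  its rate of change along the curve while the curve is in the open edge, and 0 otherwise.\<close>

abbreviation integrand :: "'n \<Rightarrow> (real \<Rightarrow> real \<Rightarrow> real) \<Rightarrow> (real \<Rightarrow> real \<Rightarrow> real) \<Rightarrow>
    real \<Rightarrow> (real \<Rightarrow>\<^sub>C (real ^ 'n)) \<Rightarrow> real" where
  "integrand i A B s y \<equiv>
     (if 0 < crd i s y then A (crd i s y) s + velocity i s y * B (crd i s y) s else 0)"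

lemma component_measurable: "(\<lambda>y. crd i t y) \<in> borel_measurable \<mu>"
  by (rule measurable_compose[OF eval_measurable]) (intro borel_measurable_continuous_onI continuous_intros)

lemma velocity_measurable: "velocity i t \<in> borel_measurable \<mu>"
  unfolding velocity_def[abs_def] using component_measurable by measurable

lemma hamiltonian_deriv:
  assumes t: "t \<in> {0..T}" and r: "0 \<le> r"
  obtains z where "partial_a (L i (M t)) r z = - q" "deriv (\<lambda>q. hamiltonian L m i r q t) q = - z"
proof -
  have "\<exists>z. partial_a (L i (M t)) r z = - q \<and>
      ((\<lambda>q. SUP \<zeta>. - q * \<zeta> - L i (M t) r \<zeta>) has_real_derivative - z) (at q)"
    by (rule legendre_has_derivative[OF p C0 coercive[OF t r] deriv_a[OF t r] Fa_strict_mono[OF t r]])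
  then obtain z where z: "partial_a (L i (M t)) r z = - q"
    "((\<lambda>q. SUP \<zeta>. - q * \<zeta> - L i (M t) r \<zeta>) has_real_derivative - z) (at q)" by blast
  have "(\<lambda>q. hamiltonian L m i r q t) = (\<lambda>q. SUP \<zeta>. - q * \<zeta> - L i (M t) r \<zeta>)"
    by (simp add: hamiltonian_def m_eq[OF t])
  then show ?thesis using that[OF z(1)] DERIV_imp_deriv[OF z(2)] by simp
qed

text \<open>The slope of the value function determines the speed: both the actual speed and the
  maximiser in the Hamiltonian solve the same equation for \<open>partial_a\<close>, which is
  injective in the speed. Near t the coordinate i and the norm of the curve coincide, so the
  derivative of one is that of the other.\<close>

lemma optimal_drift:
  assumes y: "optimal y" and t: "0 < t" "t < T" and pos: "0 < crd i t y"
  shows "((\<lambda>s. crd i s y) has_real_derivative velocity i t y) (at t)"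
    "Hp L m u i (apply_bcontfun y t) t = - velocity i t y"
proof -
  let ?y = "apply_bcontfun y"
  have yS: "y \<in> S" using y by (simp add: optimal_def)
  obtain v where v: "ac_on 0 T (\<lambda>s. norm (?y s)) v" "\<forall>s. \<bar>v s\<bar> \<le> real CARD('n) * V"
    using Gamma_LipD(5)[OF yS T p] by blast
  define r where "r = norm (?y t)"
  have yt: "?y t = r *\<^sub>R axis i 1" "0 < r"
    using junction_component_pos[OF curve(2)[OF yS] pos] pos by (simp_all add: r_def)
  have "\<exists>\<alpha>. ((\<lambda>s. norm (?y s)) has_real_derivative \<alpha>) (at t) \<and>
    ((\<lambda>r. U (r *\<^sub>R axis i 1) t) has_real_derivative - partial_a (L i (M t)) (norm (?y t)) \<alpha>) (at (norm (?y t)))"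
    by (rule optimal_curve_derivatives[OF curve(1)[OF yS] _ v(1) _ t pos]) (use y v(2) in \<open>auto simp: optimal_def\<close>)
  then obtain \<alpha> where \<alpha>: "((\<lambda>s. norm (?y s)) has_real_derivative \<alpha>) (at t)"
    "((\<lambda>r. U (r *\<^sub>R axis i 1) t) has_real_derivative - partial_a (L i (M t)) r \<alpha>) (at r)" unfolding r_def by blast
  have "continuous_on UNIV (\<lambda>s. ?y s $ i)"
    using apply_bcontfun[of y] unfolding bcontfun_def by (auto intro!: continuous_intros)
  then have op: "open {s. 0 < ?y s $ i}" by (intro open_Collect_less continuous_on_const)
  have dyi: "((\<lambda>s. ?y s $ i) has_real_derivative \<alpha>) (at t)"
    by (rule has_field_derivative_transform_within_open[OF \<alpha>(1) op])
      (use pos junction_component_pos(3)[OF curve(2)[OF yS]] in auto)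
  have "(\<lambda>n. (?y (t + 1 / real (Suc n)) $ i - ?y t $ i) * real (Suc n)) \<longlonglongrightarrow> \<alpha>"
  proof -
    have "(\<lambda>n. 1 / real (Suc n)) \<longlonglongrightarrow> 0" using LIMSEQ_inverse_real_of_nat by (simp add: inverse_eq_divide)
    moreover have "((\<lambda>h. (?y (t + h) $ i - ?y t $ i) / h) \<longlongrightarrow> \<alpha>) (at 0)" using dyi by (simp add: DERIV_def)
    ultimately show ?thesis
      using tendsto_compose_eventually[of "\<lambda>h. (?y (t + h) $ i - ?y t $ i) / h" \<alpha> 0 "\<lambda>n. 1 / real (Suc n)" sequentially]
      by simp
  qed
  then have v\<alpha>: "velocity i t y = \<alpha>" unfolding velocity_def by (rule limI)
  then show "((\<lambda>s. ?y s $ i) has_real_derivative velocity i t y) (at t)" using dyi by simp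
  have tT: "t \<in> {0..T}" using t by simp
  have "((\<lambda>r. u (r *\<^sub>R axis i 1) t) has_real_derivative - partial_a (L i (M t)) r \<alpha>) (at r)"
    by (rule has_field_derivative_transform_within_open[OF \<alpha>(2) open_greaterThan[of 0]])
      (use yt(2) u_eq[OF axis_scaleR_in_junction tT] in auto)
  then have "((\<lambda>r. u (r *\<^sub>R axis i 1) t) has_vector_derivative - partial_a (L i (M t)) r \<alpha>) (at r)"
    by (simp add: has_real_derivative_iff_has_vector_derivative)
  then have "vector_derivative (\<lambda>r. u (r *\<^sub>R axis i 1) t) (at r) = - partial_a (L i (M t)) r \<alpha>"
    by (rule vector_derivative_at)
  moreover have "at r within {0..} = at r" using yt(2) by (intro at_within_interior) auto
  ultimately have ed: "edge_deriv i (\<lambda>z. u z t) (?y t) = - partial_a (L i (M t)) r \<alpha>"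
    unfolding edge_deriv_def r_def[symmetric] by simp
  obtain z where z: "partial_a (L i (M t)) r z = - edge_deriv i (\<lambda>z. u z t) (?y t)"
    "deriv (\<lambda>q. hamiltonian L m i r q t) (edge_deriv i (\<lambda>z. u z t) (?y t)) = - z"
    by (rule hamiltonian_deriv[OF tT less_imp_le[OF yt(2)]])
  \<comment> \<open>Injectivity of the strictly increasing function
    \<open>partial_a (L i (M t)) r\<close>.\<close>
  have "z = \<alpha>"
    using Fa_strict_mono[OF tT less_imp_le[OF yt(2)], of z \<alpha> i] Fa_strict_mono[OF tT less_imp_le[OF yt(2)], of \<alpha> z i] z(1) ed
    by (cases z \<alpha> rule: linorder_cases) auto
  then show "Hp L m u i (?y t) t = - velocity i t y"
    using z(2) v\<alpha> unfolding Hp_def r_def by simp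
qed

lemma velocity_bound:
  assumes y: "optimal y" and t: "0 < t" "t < T" and pos: "0 < crd i t y"
  shows "\<bar>velocity i t y\<bar> \<le> V"
proof -
  let ?w = "\<lambda>s. crd i s y"
  have yS: "y \<in> S" using y by (simp add: optimal_def)
  have "((\<lambda>h. (?w (t + h) - ?w t) / h) \<longlongrightarrow> velocity i t y) (at 0)"
    using optimal_drift(1)[OF y t pos] by (simp add: DERIV_def)
  then have "((\<lambda>h. \<bar>(?w (t + h) - ?w t) / h\<bar>) \<longlongrightarrow> \<bar>velocity i t y\<bar>) (at 0)" by (rule tendsto_rabs)
  moreover have "\<forall>\<^sub>F h in at 0. \<bar>(?w (t + h) - ?w t) / h\<bar> \<le> V"
    unfolding eventually_at
  proof (intro exI[of _ 1] conjI ballI impI)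
    fix h :: real assume "h \<noteq> 0 \<and> dist h 0 < 1"
    then show "\<bar>(?w (t + h) - ?w t) / h\<bar> \<le> V"
      using component(3)[OF yS, of "t + h" i t] by (simp add: abs_divide divide_le_eq)
  qed simp
  ultimately show ?thesis by (rule tendsto_upperbound) simp
qed

text \<open>Legendre duality holds for every real slope, also for the default slope at points where
  u is not differentiable. By strict monotonicity, the sublevel set -Hp \<le> c at r > 0 is the set
  where -D_x u is at most \<open>partial_a\<close> at speed c, so no measurable inverse has to be
  constructed.\<close>

lemma Hp_measurable:
  assumes t: "t \<in> {0<..<T}"
  shows "(\<lambda>r. if r > 0 then Hp L m u i (r *\<^sub>R axis i 1) t else 0) \<in> borel_measurable borel"
proof -
  have tT: "t \<in> {0..T}" "0 \<le> t" "t < T" using t by auto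
  define q where "q r = edge_deriv i (\<lambda>z. u z t) (r *\<^sub>R axis i 1)" for r
  have "continuous_on {0<..} (\<lambda>r. u (r *\<^sub>R axis i 1) t)"
    by (rule continuous_on_eq[OF U_continuous[OF tT(2,3), of i]])
      (use u_eq[OF axis_scaleR_in_junction tT(1)] in auto)
  from borel_measurable_vector_derivative_halfline[OF this]
  have "(\<lambda>r. if r > 0 then vector_derivative (\<lambda>r. u (r *\<^sub>R axis i 1) t) (at r within {0..}) else 0) \<in> borel_measurable borel" .
  moreover have "(\<lambda>r. if r > 0 then vector_derivative (\<lambda>r. u (r *\<^sub>R axis i 1) t) (at r within {0..}) else 0) =
      (\<lambda>r. if r > 0 then q r else 0)"
    by (auto simp: q_def edge_deriv_def)
  ultimately have qm: "(\<lambda>r. if r > 0 then q r else 0) \<in> borel_measurable borel" by simp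
  define Z where "Z r = (if r > 0 then - Hp L m u i (r *\<^sub>R axis i 1) t else 0)" for r
  have Z: "partial_a (L i (M t)) r (Z r) = - q r" if r: "r > 0" for r
  proof -
    obtain z where z: "partial_a (L i (M t)) r z = - q r"
      "deriv (\<lambda>q. hamiltonian L m i r q t) (q r) = - z"
      by (rule hamiltonian_deriv[OF tT(1) less_imp_le[OF r]])
    have "Hp L m u i (r *\<^sub>R axis i 1) t = - z" using z(2) r by (simp add: Hp_def q_def)
    then show ?thesis using z(1) r by (simp add: Z_def)
  qed
  have "Z \<in> borel_measurable borel"
  proof (rule borel_measurableI_le)
    fix c
    have cA: "continuous_on {0<..} (\<lambda>r. (\<lambda>(\<tau>, r, a). partial_a (L i (M \<tau>)) r a) (t, r, c))"
      by (rule continuous_on_compose2[OF cont_Fa]) (use tT in \<open>auto intro!: continuous_intros\<close>)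
    have Am: "(\<lambda>r. if r \<in> {0<..} then partial_a (L i (M t)) r c else 0) \<in> borel_measurable borel"
      by (rule borel_measurable_continuous_on_if) (use cA in auto)
    have "{r \<in> space borel. Z r \<le> c} = {r. 0 < r \<and> - (if r > 0 then q r else 0) \<le> (if r \<in> {0<..} then partial_a (L i (M t)) r c else 0)} \<union>
        {r. r \<le> 0 \<and> 0 \<le> c}"
    proof -
      have "Z r \<le> c \<longleftrightarrow> - q r \<le> partial_a (L i (M t)) r c" if r: "r > 0" for r
        using Fa_strict_mono[OF tT(1) less_imp_le[OF r], of "Z r" c i] Fa_strict_mono[OF tT(1) less_imp_le[OF r], of c "Z r" i] Z[OF r]
        by (cases "Z r" c rule: linorder_cases) auto
      then show ?thesis by (auto simp: Z_def split: if_splits)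
    qed
    also have "\<dots> \<in> sets borel"
      using qm Am by measurable
    finally show "{r \<in> space borel. Z r \<le> c} \<in> sets borel" .
  qed
  then have "(\<lambda>r. - Z r) \<in> borel_measurable borel" by measurable
  moreover have "(\<lambda>r. - Z r) = (\<lambda>r. if r > 0 then Hp L m u i (r *\<^sub>R axis i 1) t else 0)" by (auto simp: Z_def)
  ultimately show ?thesis by simp
qed

text \<open>The integrand is a Borel function of the coordinate \<open>x $ i\<close> and can be
  pulled back to the curves, where the drift equals minus the velocity almost surely. The bound on
  the velocity makes it integrable, although the drift need not be bounded off the optimal
  curves.\<close>

lemma slice:
  fixes A B :: "real \<Rightarrow> real"
  assumes t: "t \<in> {0<..<T}" and A: "continuous_on {0<..} A" and B: "continuous_on {0<..} B"
    and bA: "\<And>r. 0 < r \<Longrightarrow> r \<le> C \<Longrightarrow> \<bar>A r\<bar> \<le> c" and bB: "\<And>r. 0 < r \<Longrightarrow> r \<le> C \<Longrightarrow> \<bar>B r\<bar> \<le> c"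
    and X: "\<And>r. 0 < r \<Longrightarrow> X (r *\<^sub>R axis i 1) = A r - Hp L m u i (r *\<^sub>R axis i 1) t * B r"
      "\<And>x. x \<in> junction \<Longrightarrow> \<not> 0 < x $ i \<Longrightarrow> X x = 0"
  shows "integrable (M t) X"
    "(LINT x|M t. X x) = (LINT y|\<mu>. (if 0 < crd i t y
        then A (crd i t y) + velocity i t y * B (crd i t y) else 0))"
proof -
  have fA: "(\<lambda>r. if r \<in> {0<..} then A r else 0) \<in> borel_measurable borel"
    and fB: "(\<lambda>r. if r \<in> {0<..} then B r else 0) \<in> borel_measurable borel"
    by (rule borel_measurable_continuous_on_if; use A B in simp)+
  define h where "h r = (if r \<in> {0<..} then A r else 0) -
      (if r > 0 then Hp L m u i (r *\<^sub>R axis i 1) t else 0) * (if r \<in> {0<..} then B r else 0)" for r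
  have h: "h \<in> borel_measurable borel" unfolding h_def[abs_def] using fA fB Hp_measurable[OF t, of i] by measurable
  have Xh: "X x = h (x $ i)" if x: "x \<in> junction" for x
  proof (cases "0 < x $ i")
    case True
    then show ?thesis using X(1)[OF True] junction_component_pos(2)[OF x True] by (simp add: h_def)
  next
    case False
    then show ?thesis using X(2)[OF x False] by (simp add: h_def)
  qed
  have "(\<lambda>x. h (x $ i)) \<in> borel_measurable (restrict_space borel junction)"
    by (intro measurable_restrict_space1 measurable_compose[OF _ h] borel_measurable_continuous_onI continuous_intros)
  then have Xm: "X \<in> borel_measurable (restrict_space borel junction)"
    by (subst measurable_cong[where g = "\<lambda>x. h (x $ i)"]) (auto simp: space_restrict_space Xh)
  have ae: "AE y in \<mu>. X (apply_bcontfun y t) = (if 0 < crd i t y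
        then A (crd i t y) + velocity i t y * B (crd i t y) else 0) \<and>
      \<bar>X (apply_bcontfun y t)\<bar> \<le> c + V * c"
    using AE_optimal
  proof eventually_elim
    case (elim y)
    then have yS: "y \<in> S" by (simp add: optimal_def)
    show ?case
    proof (cases "0 < crd i t y")
      case True
      let ?w = "crd i t y"
      have wC: "?w \<le> C" using component(2)[OF yS] .
      have yt: "apply_bcontfun y t = ?w *\<^sub>R axis i 1" using junction_component_pos(2)[OF curve(2)[OF yS] True] .
      have "X (apply_bcontfun y t) = A ?w - Hp L m u i (apply_bcontfun y t) t * B ?w"
        using X(1)[OF True] yt by simp
      also have "\<dots> = A ?w + velocity i t y * B ?w" using optimal_drift(2)[OF elim _ _ True] t by simp
      finally have e: "X (apply_bcontfun y t) = A ?w + velocity i t y * B ?w" .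
      have "\<bar>velocity i t y * B ?w\<bar> \<le> V * c"
        unfolding abs_mult using velocity_bound[OF elim _ _ True] bB[OF True wC] t V by (intro mult_mono) auto
      then have "\<bar>A ?w + velocity i t y * B ?w\<bar> \<le> c + V * c" using bA[OF True wC] by linarith
      then show ?thesis using e True by simp
    next
      case False
      have "0 \<le> c" using bA[OF C] by (metis abs_ge_zero order_refl order_trans)
      then have "0 \<le> c + V * c" using V by simp
      then show ?thesis using X(2)[OF curve(2)[OF yS] False] False by simp
    qed
  qed
  have Xym: "(\<lambda>y. X (apply_bcontfun y t)) \<in> borel_measurable \<mu>"
    using measurable_compose[OF eval_measurable_junction Xm] .
  have "AE y in \<mu>. norm (X (apply_bcontfun y t)) \<le> c + V * c"
    using ae by eventually_elim (elim conjE, simp only: real_norm_def)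
  then have "integrable \<mu> (\<lambda>y. X (apply_bcontfun y t))"
    by (rule integrable_const_bound[OF _ Xym])
  then show "integrable (M t) X" by (simp add: integral_M(2)[OF Xm])
  have wm: "(\<lambda>y. crd i t y) \<in> borel_measurable \<mu>" by (rule component_measurable)
  define R where "R y = (if 0 < crd i t y then (if crd i t y \<in> {0<..} then A (crd i t y) else 0) +
      velocity i t y * (if crd i t y \<in> {0<..} then B (crd i t y) else 0) else 0)" for y
  have "R \<in> borel_measurable \<mu>"
    unfolding R_def[abs_def]
    using measurable_compose[OF wm fA] measurable_compose[OF wm fB] velocity_measurable[of i t] wm by measurable
  moreover have "R = (\<lambda>y. (if 0 < crd i t y
        then A (crd i t y) + velocity i t y * B (crd i t y) else 0))" by (auto simp: R_def)
  ultimately have Rm: "(\<lambda>y. (if 0 < crd i t y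
        then A (crd i t y) + velocity i t y * B (crd i t y) else 0)) \<in> borel_measurable \<mu>" by simp
  have "(LINT x|M t. X x) = (LINT y|\<mu>. X (apply_bcontfun y t))" by (rule integral_M(1)[OF Xm])
  also have "\<dots> = (LINT y|\<mu>. (if 0 < crd i t y
        then A (crd i t y) + velocity i t y * B (crd i t y) else 0))"
    by (rule Bochner_Integration.integral_cong_AE[OF Xym Rm]) (rule eventually_mono[OF ae], erule conjunct1)
  finally show "(LINT x|M t. X x) = (LINT y|\<mu>. (if 0 < crd i t y
        then A (crd i t y) + velocity i t y * B (crd i t y) else 0))" .
qed

end

lemma set_integrable_imp_loc_integrable:
  fixes f :: "real \<Rightarrow> 'b::euclidean_space"
  assumes "set_integrable lebesgue {a<..<b} f"
  shows "loc_integrable a b f"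
  unfolding loc_integrable_def
proof (intro conjI allI impI)
  show "f \<in> borel_measurable (lebesgue_on {a<..<b})"
    by (rule absolutely_integrable_imp_measurable_Ioo) (use assms in \<open>simp add: set_integrable_Ioo_iff\<close>)
  show "set_integrable lebesgue K f" if "compact K \<and> K \<subseteq> {a<..<b}" for K
    by (rule set_integrable_subset[OF assms]) (use that in \<open>auto intro: lmeasurable_compact fmeasurableD\<close>)
qed

section \<open>Joint measurability, the identity along one curve, and Fubini\<close>

context lipschitz_equilibrium
begin

text \<open>Time is rounded down to multiples of 1 / (n + 1). For each n only countably many
  evaluations occur, each measurable in the curve, and the common Lipschitz constant gives
  convergence.\<close>

lemma component_joint_measurable:
  "(\<lambda>z. crd i (fst z) (snd z)) \<in> borel_measurable ((borel :: real measure) \<Otimes>\<^sub>M \<mu>)"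
proof (rule borel_measurable_LIMSEQ_real)
  fix z assume "z \<in> space ((borel :: real measure) \<Otimes>\<^sub>M \<mu>)"
  then have y: "snd z \<in> S" by (auto simp: space_pair_measure space_\<mu>)
  let ?w = "\<lambda>t. crd i t (snd z)"
  let ?t = "\<lambda>n. real_of_int \<lfloor>fst z * real (Suc n)\<rfloor> / real (Suc n)"
  have "(\<lambda>n. ?w (?t n) - ?w (fst z)) \<longlonglongrightarrow> 0"
  proof (rule Lim_null_comparison)
    show "\<forall>\<^sub>F n in sequentially. norm (?w (?t n) - ?w (fst z)) \<le> V * inverse (real (Suc n))"
    proof (intro always_eventually allI)
      fix n
      have "\<bar>real_of_int \<lfloor>fst z * real (Suc n)\<rfloor> - fst z * real (Suc n)\<bar> \<le> 1" by linarith
      moreover have "?t n - fst z = (real_of_int \<lfloor>fst z * real (Suc n)\<rfloor> - fst z * real (Suc n)) * inverse (real (Suc n))"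
        by (simp add: field_simps)
      ultimately have "\<bar>?t n - fst z\<bar> \<le> inverse (real (Suc n))"
        by (simp add: abs_mult mult_le_cancel_right1 del: of_nat_Suc)
      then have "V * \<bar>?t n - fst z\<bar> \<le> V * inverse (real (Suc n))" using V by (intro mult_left_mono) auto
      then show "norm (?w (?t n) - ?w (fst z)) \<le> V * inverse (real (Suc n))"
        using component(3)[OF y, of "?t n" i "fst z"] unfolding real_norm_def by linarith
    qed
    show "(\<lambda>n. V * inverse (real (Suc n))) \<longlonglongrightarrow> 0"
      using tendsto_mult_right_zero[OF LIMSEQ_inverse_real_of_nat] by simp
  qed
  then show "(\<lambda>n. ?w (?t n)) \<longlonglongrightarrow> ?w (fst z)" by (rule LIM_zero_cancel)
next
  fix n
  show "(\<lambda>z. crd i (real_of_int \<lfloor>fst z * real (Suc n)\<rfloor> / real (Suc n)) (snd z)) \<in> borel_measurable (borel \<Otimes>\<^sub>M \<mu>)"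
  proof (rule measurable_compose_countable[where f = "\<lambda>(k::int) z. crd i (real_of_int k / real (Suc n)) (snd z)"
        and g = "\<lambda>z. \<lfloor>fst z * real (Suc n)\<rfloor>"])
    show "(\<lambda>z. crd i (real_of_int k / real (Suc n)) (snd z)) \<in> borel_measurable (borel \<Otimes>\<^sub>M \<mu>)" for k
      by (rule measurable_compose[OF measurable_snd component_measurable])
    show "(\<lambda>z. \<lfloor>fst z * real (Suc n)\<rfloor>) \<in> (borel \<Otimes>\<^sub>M \<mu>) \<rightarrow>\<^sub>M count_space UNIV" by measurable
  qed
qed

lemma velocity_joint_measurable:
  "(\<lambda>z. velocity i (fst z) (snd z)) \<in> borel_measurable ((borel :: real measure) \<Otimes>\<^sub>M \<mu>)"
proof -
  have "(\<lambda>z. (fst z + c, snd z)) \<in> (borel \<Otimes>\<^sub>M \<mu>) \<rightarrow>\<^sub>M (borel \<Otimes>\<^sub>M \<mu>)" for c :: real by measurable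
  from measurable_compose[OF this component_joint_measurable[of i]]
  have s: "(\<lambda>z. crd i (fst z + c) (snd z)) \<in> borel_measurable (borel \<Otimes>\<^sub>M \<mu>)" for c by simp
  show ?thesis unfolding velocity_def
    using s component_joint_measurable[of i]
    by (intro borel_measurable_lim_metric borel_measurable_times borel_measurable_diff) auto
qed

lemma component_continuous: "continuous_on X (\<lambda>s. crd i s y)"
  using apply_bcontfun[of y] unfolding bcontfun_def
  by (auto intro!: continuous_on_component elim: continuous_on_subset)

text \<open>On a window where the coordinate is positive, the velocity is an everywhere defined
  bounded derivative and hence a density. Countably many windows exhaust the positive times inside
  (0, T); at the remaining times any density vanishes almost everywhere by
  \<open>ac_on_nonneg_zero_set\<close>.\<close>

lemma velocity_ac:
  assumes y: "optimal y"
  shows "ac_on 0 T (\<lambda>s. crd i s y) (\<lambda>s. if 0 < crd i s y then velocity i s y else 0)"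
proof -
  let ?w = "\<lambda>s. crd i s y"
  have yS: "y \<in> S" using y by (simp add: optimal_def)
  obtain h where "ac_on 0 T (apply_bcontfun y) h" using admE[OF curve(1)[OF yS]] by blast
  from ac_on_bounded_linear[OF this bounded_linear_vec_nth[of i]]
  have g: "ac_on 0 T ?w (\<lambda>s. h s $ i)" .
  \<comment> \<open>Rational endpoints, so that the exceptional sets of all windows together remain
    null.\<close>
  have "AE x in lebesgue. \<forall>a b :: rat. 0 < a \<longrightarrow> a < b \<longrightarrow> of_rat b < T \<longrightarrow>
      (\<forall>s\<in>{of_rat a..of_rat b}. 0 < ?w s) \<longrightarrow> x \<in> {of_rat a..of_rat b} \<longrightarrow> h x $ i = velocity i x y"
    unfolding AE_all_countable
  proof (intro allI)
    fix a b :: rat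
    let ?a = "of_rat a :: real" and ?b = "of_rat b :: real"
    show "AE x in lebesgue. 0 < a \<longrightarrow> a < b \<longrightarrow> ?b < T \<longrightarrow>
      (\<forall>s\<in>{?a..?b}. 0 < ?w s) \<longrightarrow> x \<in> {?a..?b} \<longrightarrow> h x $ i = velocity i x y"
    proof (cases "0 < a \<and> a < b \<and> ?b < T \<and> (\<forall>s\<in>{?a..?b}. 0 < ?w s)")
      case True
      then have ab: "0 < ?a" "?a < ?b" "?b < T" and pos: "\<And>s. s \<in> {?a..?b} \<Longrightarrow> 0 < ?w s"
        by (auto simp: of_rat_less)
      have d: "(?w has_real_derivative velocity i s y) (at s)" and bd: "\<bar>velocity i s y\<bar> \<le> V" if "s \<in> {?a..?b}" for s
        using optimal_drift(1)[OF y _ _ pos[OF that]] velocity_bound[OF y _ _ pos[OF that]] that ab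
        by (auto intro: less_le_trans[OF ab(1)])
      have hi: "((\<lambda>s. velocity i s y) has_integral (?w t - ?w ?a)) {?a..t}" if "t \<in> {?a..?b}" for t
        using that d
        by (intro fundamental_theorem_of_calculus)
          (auto simp: has_real_derivative_iff_has_vector_derivative[symmetric] intro: has_field_derivative_at_within)
      have "ac_on ?a ?b ?w (\<lambda>s. velocity i s y)"
      proof (rule ac_onI)
        show "(\<lambda>s. velocity i s y) absolutely_integrable_on {?a..?b}"
          by (rule absolutely_integrable_integrable_bound[where g = "\<lambda>_. V"])
            (use bd hi[of ?b] ab in \<open>auto intro: has_integral_integrable\<close>)
        show "?w s - ?w ?a = integral {?a..s} (\<lambda>s. velocity i s y)" if "?a \<le> s" "s \<le> ?b" for s
          using integral_unique[OF hi[of s]] that by simp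
      qed
      moreover have "ac_on ?a ?b ?w (\<lambda>s. h s $ i)" by (rule ac_on_subinterval[OF g]) (use ab in auto)
      ultimately have "AE x in lebesgue. x \<in> {?a..?b} \<longrightarrow> velocity i x y = h x $ i" by (rule ac_on_deriv_unique)
      then show ?thesis by eventually_elim auto
    qed auto
  qed
  moreover have "AE x in lebesgue. x \<in> {0..T} \<longrightarrow> ?w x = 0 \<longrightarrow> h x $ i = 0"
    by (rule ac_on_nonneg_zero_set[OF g]) (rule component(1)[OF yS])
  moreover have "AE x in lebesgue. x \<noteq> (0::real)" "AE x in lebesgue. x \<noteq> T" by (rule AE_lebesgue_neq)+
  ultimately have "AE x in lebesgue. x \<in> {0..T} \<longrightarrow> (if 0 < ?w x then velocity i x y else 0) = h x $ i"
  proof eventually_elim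
    case (elim x)
    show ?case
    proof
      assume x: "x \<in> {0..T}"
      show "(if 0 < ?w x then velocity i x y else 0) = h x $ i"
      proof (cases "0 < ?w x")
        case False
        then have "?w x = 0" using component(1)[OF yS, of x i] by simp
        then show ?thesis using elim(2) x by simp
      next
        case True
        have "open {s. 0 < ?w s}" by (intro open_Collect_less continuous_on_const component_continuous)
        then obtain e where e: "e > 0" "\<And>s. \<bar>s - x\<bar> < e \<Longrightarrow> 0 < ?w s"
          using True unfolding open_dist by (auto simp: dist_real_def)
        obtain a where a: "max 0 (x - e) < of_rat a" "of_rat a < x" using of_rat_dense[of "max 0 (x - e)" x] x elim(3) e by auto
        obtain b where b: "x < of_rat b" "of_rat b < min T (x + e)" using of_rat_dense[of x "min T (x + e)"] x elim(4) e by auto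
        have "0 < a" using a by (simp add: zero_less_of_rat_iff)
        moreover have "a < b" using a b by (metis less_trans of_rat_less)
        moreover have "\<forall>s\<in>{of_rat a..of_rat b}. 0 < ?w s"
        proof
          fix s :: real assume "s \<in> {of_rat a..of_rat b}"
          then show "0 < ?w s" using a b by (intro e(2)) auto
        qed
        ultimately have "h x $ i = velocity i x y" using elim(1) a b by auto
        then show ?thesis using True by simp
      qed
    qed
  qed
  then show ?thesis by (rule ac_on_cong_AE[OF g])
qed

text \<open>Subtracting \<Phi>(0, s) makes the quantity vanish at the vertex, so that its rate is
  zero on {w = 0} and only times in the open edge contribute. The boundary terms disappear with
  \<eta>.\<close>

lemma curve_identity:
  assumes y: "optimal y" and \<eta>: "\<eta> \<in> test_fun 0 T"
    and cr: "continuous_on ({0..C} \<times> {0..T}) (\<lambda>(r, t). \<Phi>r r t)"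
    and ct: "continuous_on ({0..C} \<times> {0..T}) (\<lambda>(r, t). \<Phi>t r t)"
    and dr: "\<And>r t. r \<in> {0..C} \<Longrightarrow> t \<in> {0..T} \<Longrightarrow> ((\<lambda>r. \<Phi> r t) has_real_derivative \<Phi>r r t) (at r within {0..C})"
    and dt: "\<And>r t. r \<in> {0..C} \<Longrightarrow> t \<in> {0..T} \<Longrightarrow> ((\<lambda>t. \<Phi> r t) has_real_derivative \<Phi>t r t) (at t within {0..T})"
  shows "(LINT s:{0<..<T}|lebesgue. (\<Phi> (crd i s y) s - \<Phi> 0 s) * deriv \<eta> s) =
    - (LINT s:{0<..<T}|lebesgue. (integrand i (\<lambda>r t. \<Phi>t r t - \<Phi>t 0 t) \<Phi>r s y) * \<eta> s)"
proof -
  let ?w = "\<lambda>s. crd i s y"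
  let ?v = "\<lambda>s. if 0 < ?w s then velocity i s y else 0"
  let ?f = "\<lambda>s. \<Phi> (?w s) s - \<Phi> 0 s"
  define g where "g s = (if 0 < ?w s then \<Phi>t (?w s) s - \<Phi>t 0 s + velocity i s y * \<Phi>r (?w s) s else 0)" for s
  have yS: "y \<in> S" using y by (simp add: optimal_def)
  have wl: "?w s \<in> {0..C}" for s using component(1,2)[OF yS] by simp
  have z: "0 \<in> {0..C}" using C by simp
  have "ac_on 0 T (\<lambda>s. (\<lambda>r t. \<Phi> r t - \<Phi> 0 t) (?w s) s) (\<lambda>s. (\<lambda>r t. \<Phi>t r t - \<Phi>t 0 t) (?w s) s + \<Phi>r (?w s) s * ?v s)"
  proof (rule ac_on_chain[OF velocity_ac[OF y] wl cr])
    have "continuous_on ({0..C} \<times> {0..T}) (\<lambda>z. (\<lambda>(r, t). \<Phi>t r t) (0, snd z))"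
      by (rule continuous_on_compose2[OF ct]) (use C in \<open>auto intro!: continuous_intros\<close>)
    from continuous_on_diff[OF ct this]
    show "continuous_on ({0..C} \<times> {0..T}) (\<lambda>(r, t). \<Phi>t r t - \<Phi>t 0 t)" by (simp add: case_prod_unfold)
    fix r t assume rt: "r \<in> {0..C}" "t \<in> {0..T}"
    show "((\<lambda>r. \<Phi> r t - \<Phi> 0 t) has_real_derivative \<Phi>r r t) (at r within {0..C})"
      using DERIV_diff[OF dr[OF rt] DERIV_const] by simp
    show "((\<lambda>t. \<Phi> r t - \<Phi> 0 t) has_real_derivative \<Phi>t r t - \<Phi>t 0 t) (at t within {0..T})"
      by (rule DERIV_diff[OF dt[OF rt] dt[OF z rt(2)]])
  qed
  moreover have "(\<lambda>s. (\<lambda>r t. \<Phi>t r t - \<Phi>t 0 t) (?w s) s + \<Phi>r (?w s) s * ?v s) = g"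
  proof
    fix s show "(\<lambda>r t. \<Phi>t r t - \<Phi>t 0 t) (?w s) s + \<Phi>r (?w s) s * ?v s = g s"
      using component(1)[OF yS, of s i] by (cases "0 < ?w s") (auto simp: g_def mult.commute)
  qed
  ultimately have f: "ac_on 0 T ?f g" by simp
  have \<eta>0: "\<eta> 0 = 0" "\<eta> T = 0" using test_funD(4)[OF \<eta>] T by auto
  have "ac_on 0 T (\<lambda>s. \<eta> s *\<^sub>R ?f s) (\<lambda>s. deriv \<eta> s *\<^sub>R ?f s + \<eta> s *\<^sub>R g s)"
    by (rule ac_on_scaleR[OF ac_on_test_fun[OF \<eta>] f])
  from ac_on_increment[OF this, of 0 T]
  have "integral {0..T} (\<lambda>s. ?f s * deriv \<eta> s + g s * \<eta> s) = 0" using T \<eta>0 by (simp add: mult.commute)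
  moreover have i1: "(\<lambda>s. ?f s * deriv \<eta> s) absolutely_integrable_on {0..T}"
    by (intro absolutely_integrable_continuous_real continuous_on_mult ac_on_continuous[OF f] test_funD(2)[OF \<eta>])
  moreover have i2: "(\<lambda>s. g s * \<eta> s) absolutely_integrable_on {0..T}"
  proof -
    note b = continuous_on_Icc_bounded_measurable[OF test_funD(3)[OF \<eta>], of 0 T]
    have "(\<lambda>s. \<eta> s * g s) absolutely_integrable_on {0..T}"
      by (rule absolutely_integrable_bounded_measurable_product_real[OF b(2) _ b(1) ac_on_absolutely_integrable[OF f]]) simp
    then show ?thesis by (simp add: mult.commute)
  qed
  ultimately have "integral {0..T} (\<lambda>s. ?f s * deriv \<eta> s) = - integral {0..T} (\<lambda>s. g s * \<eta> s)"
    using Henstock_Kurzweil_Integration.integral_add[of "\<lambda>s. ?f s * deriv \<eta> s" "{0..T}" "\<lambda>s. g s * \<eta> s"]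
    by (simp add: set_lebesgue_integral_eq_integral(1))
  then show ?thesis
    unfolding g_def[symmetric] by (simp add: set_integral_Ioo[OF i1] set_integral_Ioo[OF i2])
qed

text \<open>The bound along optimal curves gives integrability on the product, because almost every
  curve is optimal. The product is formed with \<open>lborel\<close>, for which joint measurability
  is available; the Lebesgue integrals over time agree with it by completion, and k is extended by
  zero to a Borel function.\<close>

lemma fubini_dist:
  fixes g :: "real \<Rightarrow> (real \<Rightarrow>\<^sub>C (real ^ 'n)) \<Rightarrow> real"
  assumes g: "(\<lambda>z. indicator {0<..<T} (fst z) * g (fst z) (snd z)) \<in> borel_measurable (borel \<Otimes>\<^sub>M \<mu>)"
    and b: "\<And>s y. s \<in> {0<..<T} \<Longrightarrow> optimal y \<Longrightarrow> \<bar>g s y\<bar> \<le> B"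
    and f: "\<And>s. s \<in> {0<..<T} \<Longrightarrow> f s = (LINT y|\<mu>. g s y)"
    and k: "continuous_on {0..T} k"
  shows "set_integrable lebesgue {0<..<T} (\<lambda>s. f s * k s)"
    "(LINT s:{0<..<T}|lebesgue. f s * k s) = (LINT y|\<mu>. (LINT s:{0<..<T}|lebesgue. g s y * k s))"
    "(\<lambda>y. LINT s:{0<..<T}|lebesgue. g s y * k s) \<in> borel_measurable \<mu>"
proof -
  interpret P: pair_sigma_finite lborel \<mu> by unfold_locales
  define K where "K s = (if s \<in> {0..T} then k s else 0)" for s
  have Km: "K \<in> borel_measurable borel" unfolding K_def[abs_def] by (rule borel_measurable_continuous_on_if[OF _ k]) auto
  obtain Kb where Kb: "\<And>s. s \<in> {0..T} \<Longrightarrow> \<bar>k s\<bar> \<le> Kb"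
    using continuous_on_Icc_bounded_measurable(1)[OF k] unfolding bounded_iff by (metis imageI real_norm_def)
  define h where "h s y = indicator {0<..<T} s * g s y * K s" for s y
  have sets_pair: "sets (lborel \<Otimes>\<^sub>M \<mu>) = sets (borel \<Otimes>\<^sub>M \<mu>)" by (intro sets_pair_measure_cong) auto
  have "(\<lambda>z. h (fst z) (snd z)) \<in> borel_measurable (borel \<Otimes>\<^sub>M \<mu>)"
    unfolding h_def using g measurable_compose[OF measurable_fst Km, of "\<mu>"] by measurable
  then have hm: "(\<lambda>(s, y). h s y) \<in> borel_measurable (lborel \<Otimes>\<^sub>M \<mu>)"
    by (simp add: case_prod_unfold measurable_cong_sets[OF sets_pair refl])
  have I: "integrable (lborel \<Otimes>\<^sub>M \<mu>) (indicator ({0<..<T} \<times> space \<mu>) :: _ \<Rightarrow> real)"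
    using T by (simp add: integrable_indicator_iff emeasure_pair_measure_Times emeasure_space_1)
  have I': "integrable (lborel \<Otimes>\<^sub>M \<mu>) (\<lambda>z. B * Kb * indicator ({0<..<T} \<times> space \<mu>) z)"
    using I by simp
  have hb: "\<bar>h s y\<bar> \<le> \<bar>B * Kb * indicator ({0<..<T} \<times> space \<mu>) (s, y)\<bar>" if y: "optimal y" "y \<in> space \<mu>" for s y
  proof (cases "s \<in> {0<..<T}")
    case True
    then have "\<bar>g s y * K s\<bar> \<le> B * Kb" unfolding abs_mult
      using b[OF True y(1)] Kb[of s] by (intro mult_mono) (auto simp: K_def)
    then show ?thesis using True y(2) by (simp add: h_def)
  qed (simp add: h_def)
  have hi: "integrable (lborel \<Otimes>\<^sub>M \<mu>) (\<lambda>(s, y). h s y)"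
  proof (rule Bochner_Integration.integrable_bound[OF I' hm])
    show "AE z in lborel \<Otimes>\<^sub>M \<mu>. norm (case z of (s, y) \<Rightarrow> h s y) \<le> norm (B * Kb * indicator ({0<..<T} \<times> space \<mu>) z)"
    proof (rule P.AE_pair_measure)
      show "{z \<in> space (lborel \<Otimes>\<^sub>M \<mu>). norm (case z of (s, y) \<Rightarrow> h s y) \<le> norm (B * Kb * indicator ({0<..<T} \<times> space \<mu>) z)} \<in> sets (lborel \<Otimes>\<^sub>M \<mu>)"
        by (intro borel_measurable_le measurable_compose[OF hm borel_measurable_norm]
            measurable_compose[OF borel_measurable_integrable[OF I'] borel_measurable_norm])
      show "AE s in lborel. AE y in \<mu>. norm (case (s, y) of (s, y) \<Rightarrow> h s y) \<le> norm (B * Kb * indicator ({0<..<T} \<times> space \<mu>) (s, y))"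
        by (intro AE_I2 AE_mp[OF AE_optimal AE_I2]) (use hb in simp)
    qed
  qed
  have F1: "indicator {0<..<T} s *\<^sub>R (f s * k s) = (LINT y|\<mu>. h s y)" for s
    using f[of s] by (cases "s \<in> {0<..<T}") (auto simp: h_def K_def)
  have i1: "integrable lborel (\<lambda>s. LINT y|\<mu>. h s y)" by (rule P.integrable_fst'[OF hi, simplified])
  show "set_integrable lebesgue {0<..<T} (\<lambda>s. f s * k s)"
    unfolding set_integrable_def F1 using i1 by (simp add: integrable_completion borel_measurable_integrable)
  have F2: "(LINT s:{0<..<T}|lebesgue. g s y * k s) = (LINT s|lborel. h s y)" if y: "y \<in> space \<mu>" for y
  proof -
    have "(\<lambda>s. h s y) \<in> borel_measurable lborel" using measurable_compose[OF measurable_Pair2'[OF y] hm] by simp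
    then have "(LINT s|lborel. h s y) = (LINT s|lebesgue. h s y)" by (rule integral_completion[symmetric])
    also have "\<dots> = (LINT s:{0<..<T}|lebesgue. g s y * k s)"
      unfolding set_lebesgue_integral_def by (rule Bochner_Integration.integral_cong) (auto simp: h_def K_def split: split_indicator)
    finally show ?thesis by simp
  qed
  have "(\<lambda>y. LINT s|lborel. h s y) \<in> borel_measurable \<mu>"
    by (rule borel_measurable_integrable[OF P.integrable_snd[OF hi]])
  then show "(\<lambda>y. LINT s:{0<..<T}|lebesgue. g s y * k s) \<in> borel_measurable \<mu>"
    by (subst measurable_cong[OF F2])
  have "(LINT s:{0<..<T}|lebesgue. f s * k s) = (LINT s|lborel. (LINT y|\<mu>. h s y))"
    unfolding set_lebesgue_integral_def F1 using i1 by (intro integral_completion) (simp add: borel_measurable_integrable)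
  also have "\<dots> = (LINT y|\<mu>. (LINT s|lborel. h s y))" by (rule P.Fubini_integral[OF hi, symmetric])
  also have "\<dots> = (LINT y|\<mu>. (LINT s:{0<..<T}|lebesgue. g s y * k s))"
    by (rule Bochner_Integration.integral_cong) (simp_all add: F2)
  finally show "(LINT s:{0<..<T}|lebesgue. f s * k s) = (LINT y|\<mu>. (LINT s:{0<..<T}|lebesgue. g s y * k s))" .
qed

end

lemma set_integrable_continuous_Ioo: "continuous_on {a..b} k \<Longrightarrow> set_integrable lebesgue {a<..<b} k"
  for k :: "real \<Rightarrow> real"
  by (simp add: set_integrable_Ioo_iff absolutely_integrable_continuous_real)

lemma set_integral_Ioo_by_parts:
  fixes f f' :: "real \<Rightarrow> real"
  assumes \<eta>: "\<eta> \<in> test_fun a b" and ab: "a \<le> b"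
    and f: "\<And>x. x \<in> {a..b} \<Longrightarrow> (f has_real_derivative f' x) (at x within {a..b})" and f': "continuous_on {a..b} f'"
  shows "(LINT s:{a<..<b}|lebesgue. f s * deriv \<eta> s) = - (LINT s:{a<..<b}|lebesgue. f' s * \<eta> s)"
proof -
  have ac: "ac_on a b f f'"
    by (rule ac_on_C1) (use f f' in \<open>simp_all add: has_real_derivative_iff_has_vector_derivative\<close>)
  have "ac_on a b (\<lambda>s. \<eta> s *\<^sub>R f s) (\<lambda>s. deriv \<eta> s *\<^sub>R f s + \<eta> s *\<^sub>R f' s)"
    by (rule ac_on_scaleR[OF ac_on_test_fun[OF \<eta>] ac])
  from ac_on_increment[OF this, of a b]
  have "integral {a..b} (\<lambda>s. f s * deriv \<eta> s + f' s * \<eta> s) = 0"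
    using ab test_funD(4)[OF \<eta>, of a] test_funD(4)[OF \<eta>, of b] by (simp add: mult.commute)
  moreover have i: "(\<lambda>s. f s * deriv \<eta> s) absolutely_integrable_on {a..b}" "(\<lambda>s. f' s * \<eta> s) absolutely_integrable_on {a..b}"
    by (intro absolutely_integrable_continuous_real continuous_on_mult ac_on_continuous[OF ac] f' test_funD(2,3)[OF \<eta>])+
  ultimately have "integral {a..b} (\<lambda>s. f s * deriv \<eta> s) = - integral {a..b} (\<lambda>s. f' s * \<eta> s)"
    using Henstock_Kurzweil_Integration.integral_add[of "\<lambda>s. f s * deriv \<eta> s" "{a..b}" "\<lambda>s. f' s * \<eta> s"]
    by (simp add: set_lebesgue_integral_eq_integral(1))
  then show ?thesis by (simp add: set_integral_Ioo[OF i(1)] set_integral_Ioo[OF i(2)])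
qed

lemma set_lebesgue_integral_cong_Ioo:
  fixes f g :: "real \<Rightarrow> real"
  assumes "\<And>s. s \<in> {a<..<b} \<Longrightarrow> f s = g s"
  shows "(LINT s:{a<..<b}|lebesgue. f s) = (LINT s:{a<..<b}|lebesgue. g s)"
    "set_integrable lebesgue {a<..<b} f = set_integrable lebesgue {a<..<b} g"
  by (rule set_lebesgue_integral_cong, simp, use assms in simp)
    (rule set_integrable_cong, simp_all add: assms)

context lipschitz_equilibrium
begin

section \<open>Averages over the equilibrium\<close>

definition avg :: "'n \<Rightarrow> (real \<Rightarrow> real \<Rightarrow> real) \<Rightarrow> (real \<Rightarrow> real \<Rightarrow> real) \<Rightarrow> real \<Rightarrow> real" where
  "avg i A B s = (LINT y|\<mu>. integrand i A B s y)"

abbreviation box :: "(real \<times> real) set" where "box \<equiv> {0..C} \<times> {0..T}"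

lemma box_bounded:
  fixes A :: "real \<Rightarrow> real \<Rightarrow> real"
  assumes "continuous_on box (\<lambda>(r, s). A r s)"
  shows "\<exists>c>0. \<forall>r\<in>{0..C}. \<forall>s\<in>{0..T}. \<bar>A r s\<bar> \<le> c"
proof -
  have "compact ((\<lambda>(r, s). A r s) ` box)" by (intro compact_continuous_image assms compact_Times compact_Icc)
  then have "bounded ((\<lambda>(r, s). A r s) ` box)" by (rule compact_imp_bounded)
  then obtain c where c: "c > 0 \<and> (\<forall>x\<in>(\<lambda>(r, s). A r s) ` box. norm x \<le> c)"
    unfolding bounded_pos by (elim exE)
  have "\<bar>A r s\<bar> \<le> c" if rs: "r \<in> {0..C}" "s \<in> {0..T}" for r s
  proof -
    have "(r, s) \<in> box" using rs by (rule SigmaI)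
    from bspec[OF c[THEN conjunct2] imageI[OF this]] show ?thesis by simp
  qed
  then show ?thesis using c by blast
qed

lemma integrand_bounded:
  assumes A: "continuous_on box (\<lambda>(r, s). A r s)" and B: "continuous_on box (\<lambda>(r, s). B r s)"
  shows "\<exists>c. \<forall>s\<in>{0<..<T}. \<forall>y. optimal y \<longrightarrow> \<bar>integrand i A B s y\<bar> \<le> c"
proof -
  obtain a b where ab: "a > 0" "b > 0" "\<And>r s. r \<in> {0..C} \<Longrightarrow> s \<in> {0..T} \<Longrightarrow> \<bar>A r s\<bar> \<le> a"
    "\<And>r s. r \<in> {0..C} \<Longrightarrow> s \<in> {0..T} \<Longrightarrow> \<bar>B r s\<bar> \<le> b"
    using box_bounded[OF A] box_bounded[OF B] by blast
  show ?thesis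
  proof (intro exI[of _ "a + V * b"] ballI allI impI)
    fix s y assume s: "s \<in> {0<..<T}" and y: "optimal y"
    let ?w = "crd i s y"
    have w: "?w \<in> {0..C}" "s \<in> {0..T}" using component(1,2)[of y s i] y s by (auto simp: optimal_def)
    show "\<bar>if 0 < ?w then A ?w s + velocity i s y * B ?w s else 0\<bar> \<le> a + V * b"
    proof (cases "0 < ?w")
      case True
      have "\<bar>velocity i s y * B ?w s\<bar> \<le> V * b"
        unfolding abs_mult using velocity_bound[OF y _ _ True] s ab(4)[OF w] V by (intro mult_mono) auto
      then show ?thesis using ab(3)[OF w] True by simp
    qed (use ab V in simp)
  qed
qed

text \<open>A and B are controlled only on the box and are extended by zero outside it. For times
  inside (0, T) the curves never leave the box, so nothing changes along them.\<close>

lemma integrand_joint_measurable: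
  assumes A: "continuous_on box (\<lambda>(r, s). A r s)" and B: "continuous_on box (\<lambda>(r, s). B r s)"
  shows "(\<lambda>z. indicator {0<..<T} (fst z) * (integrand i A B (fst z) (snd z)))
    \<in> borel_measurable ((borel :: real measure) \<Otimes>\<^sub>M \<mu>)" (is "?g \<in> _")
proof -
  let ?w = "\<lambda>z. crd i (fst z) (snd z)"
  note wm = component_joint_measurable[of i] and vm = velocity_joint_measurable[of i]
  have bx: "box \<in> sets borel" by (intro borel_closed closed_Times closed_atLeastAtMost)
  have E: "(\<lambda>q. if q \<in> box then (\<lambda>(r, s). A r s) q else 0) \<in> borel_measurable borel"
    "(\<lambda>q. if q \<in> box then (\<lambda>(r, s). B r s) q else 0) \<in> borel_measurable borel"
    using borel_measurable_continuous_on_if[OF bx A continuous_on_const] borel_measurable_continuous_on_if[OF bx B continuous_on_const]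
    by blast+
  have "(\<lambda>z. (?w z, fst z)) \<in> ((borel :: real measure) \<Otimes>\<^sub>M \<mu>) \<rightarrow>\<^sub>M (borel :: (real \<times> real) measure)"
    unfolding borel_prod[symmetric] using wm by measurable
  note E' = measurable_compose[OF this E(1)] measurable_compose[OF this E(2)]
  have "(\<lambda>z. indicator {0<..<T} (fst z) * (if 0 < ?w z
     then (if (?w z, fst z) \<in> box then (\<lambda>(r, s). A r s) (?w z, fst z) else 0) +
       velocity i (fst z) (snd z) * (if (?w z, fst z) \<in> box then (\<lambda>(r, s). B r s) (?w z, fst z) else 0) else 0) :: real)
    \<in> borel_measurable ((borel :: real measure) \<Otimes>\<^sub>M \<mu>)" (is "?h \<in> _")
    using E' wm vm by measurable
  moreover have "?h z = ?g z" if "z \<in> space ((borel :: real measure) \<Otimes>\<^sub>M \<mu>)" for z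
  proof -
    have "snd z \<in> S" using that by (auto simp: space_pair_measure space_\<mu>)
    then show ?thesis using component(1,2)[of "snd z" "fst z" i] by (auto split: split_indicator)
  qed
  ultimately show ?thesis by (rule measurable_cong[THEN iffD1, rotated])
qed

lemma integrand_integrable:
  assumes A: "continuous_on box (\<lambda>(r, s). A r s)" and B: "continuous_on box (\<lambda>(r, s). B r s)" and s: "s \<in> {0<..<T}"
  shows "integrable \<mu> (\<lambda>y. integrand i A B s y)"
proof -
  obtain c where c: "\<forall>s\<in>{0<..<T}. \<forall>y. optimal y \<longrightarrow> \<bar>integrand i A B s y\<bar> \<le> c"
    using integrand_bounded[OF A B, of i] by blast
  have "(\<lambda>y. (s, y)) \<in> \<mu> \<rightarrow>\<^sub>M ((borel :: real measure) \<Otimes>\<^sub>M \<mu>)" by simp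
  from measurable_compose[OF this integrand_joint_measurable[OF A B, of i]] s
  have "(\<lambda>y. integrand i A B s y) \<in> borel_measurable \<mu>"
    by (simp cong: if_cong)
  moreover have "AE y in \<mu>. norm (integrand i A B s y) \<le> c"
    by (rule eventually_mono[OF AE_optimal]) (use c s in \<open>simp only: real_norm_def\<close>)
  ultimately show ?thesis by (intro integrable_const_bound)
qed

lemma avg_fubini:
  assumes A: "continuous_on box (\<lambda>(r, s). A r s)" and B: "continuous_on box (\<lambda>(r, s). B r s)" and k: "continuous_on {0..T} k"
  shows "set_integrable lebesgue {0<..<T} (\<lambda>s. avg i A B s * k s)"
    "(LINT s:{0<..<T}|lebesgue. avg i A B s * k s) = (LINT y|\<mu>. (LINT s:{0<..<T}|lebesgue. integrand i A B s y * k s))"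
    "(\<lambda>y. LINT s:{0<..<T}|lebesgue. integrand i A B s y * k s) \<in> borel_measurable \<mu>"
proof -
  obtain c where c: "\<forall>s\<in>{0<..<T}. \<forall>y. optimal y \<longrightarrow> \<bar>integrand i A B s y\<bar> \<le> c"
    using integrand_bounded[OF A B, of i] by blast
  note F = fubini_dist[where f = "avg i A B", OF integrand_joint_measurable[OF A B, of i] _ avg_def k, of c]
  show "set_integrable lebesgue {0<..<T} (\<lambda>s. avg i A B s * k s)"
    by (rule F(1)) (use c in blast)
  show "(LINT s:{0<..<T}|lebesgue. avg i A B s * k s) = (LINT y|\<mu>. (LINT s:{0<..<T}|lebesgue. integrand i A B s y * k s))"
    by (rule F(2)) (use c in blast)
  show "(\<lambda>y. LINT s:{0<..<T}|lebesgue. integrand i A B s y * k s) \<in> borel_measurable \<mu>"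
    by (rule F(3)) (use c in blast)
qed

abbreviation mass :: "'n \<Rightarrow> real \<Rightarrow> real" where "mass i \<equiv> avg i (\<lambda>_ _. 1) (\<lambda>_ _. 0)"

lemma continuous_on_box_const: "continuous_on box (\<lambda>(r, s). c)"
  by (simp add: case_prod_unfold)

lemmas mass_fubini = avg_fubini[OF continuous_on_box_const[of 1] continuous_on_box_const[of 0]]

lemma avg_shift:
  assumes A: "continuous_on box (\<lambda>(r, s). A r s)" and B: "continuous_on box (\<lambda>(r, s). B r s)" and s: "s \<in> {0<..<T}"
  shows "avg i (\<lambda>r s. A r s - c s) B s = avg i A B s - c s * mass i s"
proof -
  have "avg i (\<lambda>r s. A r s - c s) B s = (LINT y|\<mu>. integrand i A B s y -
     c s * (integrand i (\<lambda>_ _. 1) (\<lambda>_ _. 0) s y))"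
    unfolding avg_def by (rule Bochner_Integration.integral_cong) auto
  also have "\<dots> = avg i A B s - c s * mass i s"
    unfolding avg_def
    by (subst Bochner_Integration.integral_diff[OF integrand_integrable[OF A B s]
          integrable_mult_right[OF integrand_integrable[OF continuous_on_box_const continuous_on_box_const s]]]) simp
  finally show ?thesis .
qed

lemma avg_bounds:
  assumes A: "continuous_on box (\<lambda>(r, s). A r s)" and s: "s \<in> {0<..<T}"
    and b: "\<And>r. r \<in> {0..C} \<Longrightarrow> 0 \<le> A r s" "\<And>r. r \<in> {0..C} \<Longrightarrow> A r s \<le> 1"
  shows "0 \<le> avg i A (\<lambda>_ _. 0) s" "avg i A (\<lambda>_ _. 0) s \<le> 1"
proof -
  have w: "crd i s y \<in> {0..C}" if "y \<in> space \<mu>" for y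
    using component(1,2)[of y s i] that by (simp add: space_\<mu>)
  show "0 \<le> avg i A (\<lambda>_ _. 0) s" unfolding avg_def
    by (rule Bochner_Integration.integral_nonneg) (use b(1)[OF w] in simp)
  have "avg i A (\<lambda>_ _. 0) s \<le> (LINT y|\<mu>. 1)" unfolding avg_def
    by (rule integral_mono[OF integrand_integrable[OF A continuous_on_box_const s]]) (use b(2)[OF w] in auto)
  then show "avg i A (\<lambda>_ _. 0) s \<le> 1" by (simp add: prob_space)
qed

text \<open>The curve identity is averaged over \<mu> and the subtracted vertex values are put back.
  They appear multiplied by \<open>mass i\<close> and as the derivative of the product \<Phi>(0, s)
  \<eta>(s), so this term becomes minus the product of the vertex value and the flux.\<close>

lemma avg_weak:
  assumes \<eta>: "\<eta> \<in> test_fun 0 T"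
    and c: "continuous_on box (\<lambda>(r, t). \<Phi> r t)"
    and cr: "continuous_on box (\<lambda>(r, t). \<Phi>r r t)"
    and ct: "continuous_on box (\<lambda>(r, t). \<Phi>t r t)"
    and dr: "\<And>r t. r \<in> {0..C} \<Longrightarrow> t \<in> {0..T} \<Longrightarrow> ((\<lambda>r. \<Phi> r t) has_real_derivative \<Phi>r r t) (at r within {0..C})"
    and dt: "\<And>r t. r \<in> {0..C} \<Longrightarrow> t \<in> {0..T} \<Longrightarrow> ((\<lambda>t. \<Phi> r t) has_real_derivative \<Phi>t r t) (at t within {0..T})"
  shows "(LINT s:{0<..<T}|lebesgue. avg i \<Phi> (\<lambda>_ _. 0) s * deriv \<eta> s) =
    (LINT s:{0<..<T}|lebesgue. mass i s * (\<Phi>t 0 s * \<eta> s + \<Phi> 0 s * deriv \<eta> s)) -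
    (LINT s:{0<..<T}|lebesgue. avg i \<Phi>t \<Phi>r s * \<eta> s)"
proof -
  note z = continuous_on_box_const[of 0]
  have vert: "continuous_on {0..T} (\<lambda>t. F 0 t)" "continuous_on box (\<lambda>(r, t). F r t - F 0 t)"
    if F: "continuous_on box (\<lambda>(r, t). F r t)" for F :: "real \<Rightarrow> real \<Rightarrow> real"
  proof -
    have "continuous_on {0..T} (\<lambda>t. (\<lambda>(r, t). F r t) (0, t))"
      by (rule continuous_on_compose2[OF F]) (use C in \<open>auto intro!: continuous_intros\<close>)
    then show "continuous_on {0..T} (\<lambda>t. F 0 t)" by simp
    have "continuous_on box (\<lambda>z. (\<lambda>(r, t). F r t) (0, snd z))"
      by (rule continuous_on_compose2[OF F]) (use C in \<open>auto intro!: continuous_intros\<close>)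
    from continuous_on_diff[OF F this] show "continuous_on box (\<lambda>(r, t). F r t - F 0 t)" by (simp add: case_prod_unfold)
  qed
  have \<eta>c: "continuous_on {0..T} \<eta>" "continuous_on {0..T} (deriv \<eta>)" by (rule test_funD(2,3)[OF \<eta>])+
  note F1 = avg_fubini[OF vert(2)[OF c] z \<eta>c(2), of i] and F2 = avg_fubini[OF vert(2)[OF ct] cr \<eta>c(1), of i]
  have "(LINT s:{0<..<T}|lebesgue. avg i (\<lambda>r t. \<Phi> r t - \<Phi> 0 t) (\<lambda>_ _. 0) s * deriv \<eta> s) =
      (LINT y|\<mu>. - (LINT s:{0<..<T}|lebesgue. (integrand i (\<lambda>r t. \<Phi>t r t - \<Phi>t 0 t) \<Phi>r s y) * \<eta> s))"
    unfolding F1(2)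
  proof (rule integral_cong_AE[OF F1(3)])
    show "(\<lambda>y. - (LINT s:{0<..<T}|lebesgue. (integrand i (\<lambda>r t. \<Phi>t r t - \<Phi>t 0 t) \<Phi>r s y) * \<eta> s)) \<in> borel_measurable \<mu>"
      using F2(3) by (rule borel_measurable_uminus)
    show "AE y in \<mu>. (LINT s:{0<..<T}|lebesgue. (integrand i (\<lambda>r t. \<Phi> r t - \<Phi> 0 t) (\<lambda>_ _. 0) s y) * deriv \<eta> s) =
      - (LINT s:{0<..<T}|lebesgue. (integrand i (\<lambda>r t. \<Phi>t r t - \<Phi>t 0 t) \<Phi>r s y) * \<eta> s)"
      using AE_optimal
    proof eventually_elim
      case (elim y)
      then have yS: "y \<in> S" by (simp add: optimal_def)
      have "(LINT s:{0<..<T}|lebesgue. (integrand i (\<lambda>r t. \<Phi> r t - \<Phi> 0 t) (\<lambda>_ _. 0) s y) * deriv \<eta> s) =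
        (LINT s:{0<..<T}|lebesgue. (\<Phi> (crd i s y) s - \<Phi> 0 s) * deriv \<eta> s)"
      proof (rule set_lebesgue_integral_cong_Ioo(1))
        fix s
        show "(integrand i (\<lambda>r t. \<Phi> r t - \<Phi> 0 t) (\<lambda>_ _. 0) s y) * deriv \<eta> s =
          (\<Phi> (crd i s y) s - \<Phi> 0 s) * deriv \<eta> s"
          using component(1)[OF yS, of s i] by (cases "0 < crd i s y") auto
      qed
      also have "\<dots> = - (LINT s:{0<..<T}|lebesgue. (integrand i (\<lambda>r t. \<Phi>t r t - \<Phi>t 0 t) \<Phi>r s y) * \<eta> s)"
        by (rule curve_identity[OF elim \<eta> cr ct dr dt])
      finally show ?case .
    qed
  qed
  also have "\<dots> = - (LINT s:{0<..<T}|lebesgue. avg i (\<lambda>r t. \<Phi>t r t - \<Phi>t 0 t) \<Phi>r s * \<eta> s)"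
    unfolding F2(2) by simp
  finally have e: "(LINT s:{0<..<T}|lebesgue. avg i (\<lambda>r t. \<Phi> r t - \<Phi> 0 t) (\<lambda>_ _. 0) s * deriv \<eta> s) =
      - (LINT s:{0<..<T}|lebesgue. avg i (\<lambda>r t. \<Phi>t r t - \<Phi>t 0 t) \<Phi>r s * \<eta> s)" .
  have m: "set_integrable lebesgue {0<..<T} (\<lambda>s. mass i s * (\<Phi> 0 s * deriv \<eta> s))"
    "set_integrable lebesgue {0<..<T} (\<lambda>s. mass i s * (\<Phi>t 0 s * \<eta> s))"
    by (intro mass_fubini(1) continuous_on_mult vert(1) c ct \<eta>c)+
  have e1: "(LINT s:{0<..<T}|lebesgue. avg i (\<lambda>r t. \<Phi> r t - \<Phi> 0 t) (\<lambda>_ _. 0) s * deriv \<eta> s) =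
      (LINT s:{0<..<T}|lebesgue. avg i \<Phi> (\<lambda>_ _. 0) s * deriv \<eta> s) - (LINT s:{0<..<T}|lebesgue. mass i s * (\<Phi> 0 s * deriv \<eta> s))"
    by (subst set_integral_diff(2)[OF avg_fubini(1)[OF c z \<eta>c(2)] m(1), symmetric], rule set_lebesgue_integral_cong_Ioo(1))
      (simp add: avg_shift[OF c z] algebra_simps)
  have e2: "(LINT s:{0<..<T}|lebesgue. avg i (\<lambda>r t. \<Phi>t r t - \<Phi>t 0 t) \<Phi>r s * \<eta> s) =
      (LINT s:{0<..<T}|lebesgue. avg i \<Phi>t \<Phi>r s * \<eta> s) - (LINT s:{0<..<T}|lebesgue. mass i s * (\<Phi>t 0 s * \<eta> s))"
    by (subst set_integral_diff(2)[OF avg_fubini(1)[OF ct cr \<eta>c(1)] m(2), symmetric], rule set_lebesgue_integral_cong_Ioo(1))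
      (simp add: avg_shift[OF ct cr] algebra_simps)
  have e3: "(LINT s:{0<..<T}|lebesgue. mass i s * (\<Phi>t 0 s * \<eta> s + \<Phi> 0 s * deriv \<eta> s)) =
      (LINT s:{0<..<T}|lebesgue. mass i s * (\<Phi>t 0 s * \<eta> s)) + (LINT s:{0<..<T}|lebesgue. mass i s * (\<Phi> 0 s * deriv \<eta> s))"
    by (subst set_integral_add(2)[OF m(2) m(1), symmetric]) (simp add: algebra_simps)
  show ?thesis using e e1 e2 e3 by linarith
qed

end

section \<open>One-sided derivatives and cutoff functions\<close>

lemma at_within_atLeast_neq_bot: "0 \<le> x \<Longrightarrow> at x within {0..} \<noteq> bot" for x :: real
proof
  assume x: "0 \<le> x" "at x within {0..} = bot"
  then have "{x<..} \<subseteq> {0..}" by auto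
  from at_le[OF this, of x] x(2) show False by (simp add: bot_unique)
qed

lemma edge_deriv_eq:
  assumes "0 \<le> r" "((\<lambda>r. f (r *\<^sub>R axis i 1)) has_real_derivative d) (at r within {0..})"
  shows "edge_deriv i f (r *\<^sub>R axis i 1) = d"
  using assms vector_derivative_within[OF at_within_atLeast_neq_bot[OF assms(1)]]
  by (simp add: edge_deriv_def has_real_derivative_iff_has_vector_derivative)

lemma smooth_on2_derivE:
  assumes "smooth_on2 R S f"
  obtains fr ft where "continuous_on (R \<times> S) (\<lambda>(r, s). f r s)" "continuous_on (R \<times> S) (\<lambda>(r, s). fr r s)"
    "continuous_on (R \<times> S) (\<lambda>(r, s). ft r s)"
    "\<And>r s. r \<in> R \<Longrightarrow> s \<in> S \<Longrightarrow> ((\<lambda>r. f r s) has_real_derivative fr r s) (at r within R)"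
    "\<And>r s. r \<in> R \<Longrightarrow> s \<in> S \<Longrightarrow> ((\<lambda>s. f r s) has_real_derivative ft r s) (at s within S)"
proof -
  obtain D where D: "\<And>r s. r \<in> R \<Longrightarrow> s \<in> S \<Longrightarrow> D 0 0 r s = f r s"
    "\<And>j k. continuous_on (R \<times> S) (\<lambda>(r, s). D j k r s)"
    "\<And>j k r s. r \<in> R \<Longrightarrow> s \<in> S \<Longrightarrow> ((\<lambda>r. D j k r s) has_real_derivative D (Suc j) k r s) (at r within R)"
    "\<And>j k r s. r \<in> R \<Longrightarrow> s \<in> S \<Longrightarrow> ((\<lambda>s. D j k r s) has_real_derivative D j (Suc k) r s) (at s within S)"
    using assms unfolding smooth_on2_def by metis
  show ?thesis
  proof (rule that[OF _ D(2) D(2)])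
    show "continuous_on (R \<times> S) (\<lambda>(r, s). f r s)"
      by (rule continuous_on_eq[OF D(2)[of 0 0]]) (use D(1) in auto)
    fix r s assume rs: "r \<in> R" "s \<in> S"
    show "((\<lambda>r. f r s) has_real_derivative D (Suc 0) 0 r s) (at r within R)"
      by (rule has_field_derivative_transform_within[OF D(3)[OF rs] zero_less_one]) (use rs D(1) in auto)
    show "((\<lambda>s. f r s) has_real_derivative D 0 (Suc 0) r s) (at s within S)"
      by (rule has_field_derivative_transform_within[OF D(4)[OF rs] zero_less_one]) (use rs D(1) in auto)
  qed
qed

text \<open>The radial profile of the cutoff with its one-sided derivative. The value
  \<open>g' 0 = 0\<close> matters because the integral with the cutoff runs over the whole edge
  including the vertex, where the drift carries no information.\<close>

lemma cutoffE:
  assumes c: "cutoff i \<psi>"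
  obtains g' where "\<And>r. 0 \<le> r \<Longrightarrow> ((\<lambda>r. \<psi> (r *\<^sub>R axis i 1)) has_real_derivative g' r) (at r within {0..})"
    "continuous_on {0..} g'" "\<psi> 0 = 0" "g' 0 = 0" "\<And>r. 0 \<le> r \<Longrightarrow> 0 \<le> \<psi> (r *\<^sub>R axis i 1)"
    "\<And>r. 0 \<le> r \<Longrightarrow> \<psi> (r *\<^sub>R axis i 1) \<le> 1" "\<And>r. 1 \<le> r \<Longrightarrow> \<psi> (r *\<^sub>R axis i 1) = 1"
proof -
  let ?g = "\<lambda>r. \<psi> (r *\<^sub>R axis i 1)"
  have "smooth_on {0..} ?g" using c by (simp add: cutoff_def smooth_junction_def)
  then obtain g' where g': "smooth_on {0..} g'" "\<And>r. r \<in> {0..} \<Longrightarrow> (?g has_real_derivative g' r) (at r within {0..})"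
    by (rule smooth_on_derivE) blast
  obtain g'' where "\<And>r. r \<in> {0..} \<Longrightarrow> (g' has_real_derivative g'' r) (at r within {0..})"
    by (rule smooth_on_derivE[OF g'(1)]) blast
  then have cg': "continuous_on {0..} g'" by (intro DERIV_continuous_on)
  have jd: "jdist (r *\<^sub>R axis i 1) 0 = r" if "0 \<le> r" for r
    using jdist_zero[OF axis_scaleR_in_junction[OF that]] that by simp
  have supp: "{x \<in> junction. \<psi> x \<noteq> 0} \<subseteq> jsupp \<psi>" "0 \<notin> jsupp \<psi>" "closed (jsupp \<psi>)"
    using c by (auto simp: jsupp_def cutoff_def intro: closure_subset[THEN subsetD])
  have "open (- jsupp \<psi>)" using supp(3) by (simp add: open_Compl)
  then obtain d where d: "d > 0" "ball 0 d \<subseteq> - jsupp \<psi>" using supp(2) openE[of "- jsupp \<psi>" 0] by blast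
  have near: "?g r = 0" if "0 \<le> r" "r < d" for r
  proof -
    have "r *\<^sub>R axis i (1 :: real) \<in> ball 0 d" using that by simp
    then show ?thesis using d(2) supp(1) axis_scaleR_in_junction[OF that(1), of i] by blast
  qed
  have \<psi>0: "\<psi> 0 = 0" using near[of 0] d(1) by simp
  have mono: "?g r \<le> ?g s" if "0 \<le> r" "r \<le> s" for r s
    using c that jd[of r] jd[of s] by (simp add: cutoff_def axis_scaleR_in_edge)
  have one: "?g r = 1" if "1 \<le> r" for r
    using c that jd[of r] by (simp add: cutoff_def axis_scaleR_in_edge)
  \<comment> \<open>The support is closed and avoids the vertex, so the profile vanishes near 0 and
    uniqueness of one-sided derivatives gives \<open>g' 0 = 0\<close>.\<close>
  have "(?g has_real_derivative g' 0) (at 0 within {0..})" by (rule g'(2)) simp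
  then have "((\<lambda>_. 0) has_real_derivative g' 0) (at (0::real) within {0..})"
    by (rule has_field_derivative_transform_within[OF _ d(1)]) (use near in auto)
  then have "((\<lambda>_. 0) has_vector_derivative g' 0) (at (0::real) within {0..})"
    by (simp add: has_real_derivative_iff_has_vector_derivative)
  from vector_derivative_unique_within[OF at_within_atLeast_neq_bot[OF order_refl] this has_vector_derivative_const]
  have g'0: "g' 0 = 0" .
  show ?thesis
  proof (rule that[OF g'(2) cg' \<psi>0 g'0 _ _ one])
    show "0 \<le> ?g r" if "0 \<le> r" for r using mono[OF order_refl that] \<psi>0 by simp
    show "?g r \<le> 1" if "0 \<le> r" for r
      using mono[OF that, of "max r 1"] one[of "max r 1"] by simp
  qed auto
qed


lemma integral_norm_bound_Ioo:
  fixes f :: "real \<Rightarrow> real"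
  assumes f: "set_integrable lebesgue {a<..<b} f" and ab: "a \<le> b" and b: "\<And>s. s \<in> {a<..<b} \<Longrightarrow> \<bar>f s\<bar> \<le> c"
  shows "\<bar>LINT s:{a<..<b}|lebesgue. f s\<bar> \<le> c * (b - a)"
proof -
  have c: "set_integrable lebesgue {a<..<b} (\<lambda>_. c)" by (rule set_integrable_continuous_Ioo) simp
  have "\<bar>LINT s:{a<..<b}|lebesgue. f s\<bar> \<le> (LINT s:{a<..<b}|lebesgue. \<bar>f s\<bar>)"
    using set_integral_norm_bound[OF f] by simp
  also have "\<dots> \<le> (LINT s:{a<..<b}|lebesgue. c)"
    by (rule set_integral_mono[OF set_integrable_abs[OF f] c]) (use b in auto)
  also have "\<dots> = c * (b - a)" using c ab by (simp add: set_integrable_Ioo_iff set_integral_Ioo)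
  finally show ?thesis .
qed

context lipschitz_equilibrium
begin

text \<open>The curves stay within distance C of the vertex, so continuity on the compact box
  provides the bounds that \<open>slice\<close> asks for.\<close>

lemma slice_avg:
  assumes A: "continuous_on ({0..} \<times> {0..T}) (\<lambda>(r, s). A r s)" and B: "continuous_on ({0..} \<times> {0..T}) (\<lambda>(r, s). B r s)"
    and t: "t \<in> {0<..<T}"
    and X: "\<And>r. 0 < r \<Longrightarrow> X (r *\<^sub>R axis i 1) = A r t - Hp L m u i (r *\<^sub>R axis i 1) t * B r t"
      "\<And>x. x \<in> junction \<Longrightarrow> \<not> 0 < x $ i \<Longrightarrow> X x = 0"
  shows "integrable (M t) X" "(LINT x|M t. X x) = avg i A B t"
proof -
  have cont: "continuous_on {0<..} (\<lambda>r. F r t)"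
    if F: "continuous_on ({0..} \<times> {0..T}) (\<lambda>(r, s). F r s)" for F :: "real \<Rightarrow> real \<Rightarrow> real"
  proof -
    have "continuous_on {0<..} (\<lambda>r. (\<lambda>(r, s). F r s) (r, t))"
      by (rule continuous_on_compose2[OF F]) (use t in \<open>auto intro!: continuous_intros\<close>)
    then show ?thesis by simp
  qed
  have sub: "box \<subseteq> {0..} \<times> {0..T}" by auto
  obtain a b where ab: "a > 0" "b > 0" "\<forall>r\<in>{0..C}. \<forall>s\<in>{0..T}. \<bar>A r s\<bar> \<le> a" "\<forall>r\<in>{0..C}. \<forall>s\<in>{0..T}. \<bar>B r s\<bar> \<le> b"
    using box_bounded[OF continuous_on_subset[OF A sub]] box_bounded[OF continuous_on_subset[OF B sub]] by blast
  have bA: "\<bar>A r t\<bar> \<le> a + b" and bB: "\<bar>B r t\<bar> \<le> a + b" if r: "0 < r" "r \<le> C" for r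
  proof -
    have rt: "r \<in> {0..C}" "t \<in> {0..T}" using r t by auto
    show "\<bar>A r t\<bar> \<le> a + b" using ab(3)[rule_format, OF rt] ab(2) by linarith
    show "\<bar>B r t\<bar> \<le> a + b" using ab(4)[rule_format, OF rt] ab(1) by linarith
  qed
  note s = slice[of t "\<lambda>r. A r t" "\<lambda>r. B r t" "a + b" X i, OF t cont[OF A] cont[OF B] bA bB X]
  show "integrable (M t) X" by (rule s(1))
  show "(LINT x|M t. X x) = avg i A B t" unfolding avg_def by (rule s(2))
qed

lemma slice_integrableI:
  assumes "\<And>t. t \<in> {0<..<T} \<Longrightarrow> integrable (M t) (F t)" "\<And>t. t \<in> {0<..<T} \<Longrightarrow> (LINT x|M t. F t x) = f t"
    and f: "set_integrable lebesgue {0<..<T} f"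
  shows "slice_integrable T m F"
  unfolding slice_integrable_def
proof
  have mM: "m t = M t" if "t \<in> {0<..<T}" for t using m_eq[of t] that by simp
  show "AE t in lebesgue_on {0<..<T}. integrable (m t) (F t)"
    by (rule AE_I2) (simp add: assms(1) mM)
  show "loc_integrable 0 T (\<lambda>t. LINT x|m t. F t x)"
    by (rule set_integrable_imp_loc_integrable, subst set_lebesgue_integral_cong_Ioo(2)[where g = f])
      (simp_all add: assms mM)
qed

lemma avg_integrable:
  assumes "continuous_on ({0..} \<times> {0..T}) (\<lambda>(r, s). A r s)" "continuous_on ({0..} \<times> {0..T}) (\<lambda>(r, s). B r s)"
    and k: "continuous_on {0..T} k"
  shows "set_integrable lebesgue {0<..<T} (\<lambda>s. avg i A B s * k s)" "set_integrable lebesgue {0<..<T} (avg i A B)"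
proof -
  have sub: "box \<subseteq> {0..} \<times> {0..T}" by auto
  note c = continuous_on_subset[OF assms(1) sub] continuous_on_subset[OF assms(2) sub]
  show "set_integrable lebesgue {0<..<T} (\<lambda>s. avg i A B s * k s)" by (rule avg_fubini(1)[OF c k])
  show "set_integrable lebesgue {0<..<T} (avg i A B)"
    using avg_fubini(1)[OF c, of "\<lambda>_. 1" i] by simp
qed

lemma mass_integrable: "continuous_on {0..T} k \<Longrightarrow> set_integrable lebesgue {0<..<T} (\<lambda>s. mass i s * k s)"
  by (rule mass_fubini(1))

lemma edge_borel: "edge i - {0} \<in> sets borel"
  by (intro sets.Diff borel_closed closed_edge) auto

lemma indicator_edge:
  fixes x :: "real ^ 'n"
  shows "x \<in> junction \<Longrightarrow> indicator (edge i - {0}) x = (if 0 < x $ i then 1 else 0 :: real)"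
  using edge_minus_zero_iff[of x i] by (auto simp: indicator_def)

lemma integral_edge_indicator:
  assumes t: "t \<in> {0<..<T}"
  shows "integrable (M t) (indicator (edge i - {0}) :: _ \<Rightarrow> real)" "(LINT x|M t. indicator (edge i - {0}) x) = mass i t"
proof -
  have c: "continuous_on ({0..} \<times> {0..T}) (\<lambda>(r, s). c)" for c :: real by (simp add: case_prod_unfold)
  have X: "indicator (edge i - {0}) (r *\<^sub>R axis i 1) = 1 - Hp L m u i (r *\<^sub>R axis i 1) t * 0" if "0 < r" for r
    using scaleR_axis_edge_iff[OF that, of i i] by (simp add: indicator_def)
  show "integrable (M t) (indicator (edge i - {0}) :: _ \<Rightarrow> real)" "(LINT x|M t. indicator (edge i - {0}) x) = mass i t"
    by (rule slice_avg[OF c c t X], assumption, simp add: indicator_edge)+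
qed

lemma measure_edge: "t \<in> {0<..<T} \<Longrightarrow> measure (m t) (edge i - {0}) = mass i t"
proof -
  assume t: "t \<in> {0<..<T}"
  have "edge i - {0} \<subseteq> junction" using edge_subset_junction by blast
  then have "measure (M t) (edge i - {0}) = (LINT x|M t. indicator (edge i - {0}) x)"
    by (simp add: space_M Int_absorb2)
  then show ?thesis using integral_edge_indicator(2)[OF t] m_eq[of t] t by simp
qed

lemma integral_view:
  assumes t: "t \<in> {0<..<T}"
  shows "(LINT y|view_on (Gamma_all T p) \<mu>. indicator (edge i - {0}) (apply_bcontfun y t) :: real) = mass i t"
proof -
  have "(\<lambda>y. apply_bcontfun y t) \<in> borel_measurable (restrict_space borel (Gamma_all T p))"
    by (intro measurable_restrict_space1 borel_measurable_continuous_onI apply_bcontfun_continuous)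
  from measurable_compose[OF this borel_measurable_indicator[OF edge_borel[of i]]]
  have m: "(\<lambda>y. indicator (edge i - {0}) (apply_bcontfun y t) :: real) \<in> borel_measurable (restrict_space borel (Gamma_all T p))" .
  have "(LINT y|view_on (Gamma_all T p) \<mu>. indicator (edge i - {0}) (apply_bcontfun y t) :: real) =
      (LINT y|\<mu>. indicator (edge i - {0}) (apply_bcontfun y t))"
    unfolding view_on_def by (rule integral_distr[OF view_measurable[OF S_subset(2)] m])
  also have "\<dots> = mass i t" unfolding avg_def
    by (rule Bochner_Integration.integral_cong) (use indicator_edge[OF curve(2)] in \<open>simp_all add: space_\<mu>\<close>)
  finally show ?thesis .
qed

lemma sum_edges:
  fixes x :: "real ^ 'n"
  assumes "x \<in> junction"
  shows "(\<Sum>i\<in>UNIV. indicator (edge i - {0}) x) + indicator {0} x = (1 :: real)"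
  using assms
proof (cases rule: junction_cases)
  case (2 i r)
  have "(\<Sum>j\<in>UNIV. indicator (edge j - {0}) x) = (\<Sum>j\<in>UNIV. if i = j then 1 else 0 :: real)"
    unfolding 2 indicator_def using scaleR_axis_edge_iff[OF 2(1), of i] by simp
  then show ?thesis using 2 by (simp add: axis_eq_0_iff)
qed simp

lemma measure_vertex: "t \<in> {0<..<T} \<Longrightarrow> measure (m t) {0} = 1 - (\<Sum>i\<in>UNIV. mass i t)"
proof -
  assume t: "t \<in> {0<..<T}"
  interpret P: prob_space "M t" using M_P1[of t] by (simp add: P1_def borel_prob_on_def)
  have "measure (M t) {0} = (LINT x|M t. indicator {0} x)"
    by (simp add: space_M zero_in_junction)
  also have "\<dots> = (LINT x|M t. 1 - (\<Sum>i\<in>UNIV. indicator (edge i - {0}) x))"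
    by (rule Bochner_Integration.integral_cong) (use sum_edges in \<open>auto simp: space_M algebra_simps\<close>)
  also have "\<dots> = 1 - (\<Sum>i\<in>UNIV. mass i t)"
    by (subst Bochner_Integration.integral_diff)
      (simp_all add: integral_edge_indicator[OF t] P.prob_space Bochner_Integration.integral_sum del: Bochner_Integration.integral_indicator)
  finally show ?thesis using m_eq[of t] t by simp
qed

section \<open>The flux into an edge\<close>

text \<open>The distributional derivative of the edge mass, written out. Taking it as the definition
  leaves the limit of the cutoffs as the statement with content.\<close>

definition flux :: "'n \<Rightarrow> (real \<Rightarrow> real) \<Rightarrow> real" where
  "flux i \<eta> = - (LINT s:{0<..<T}|lebesgue. mass i s * deriv \<eta> s)"

lemma distribution_flux: "distribution 0 T (flux i)"
  unfolding distribution_def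
proof (intro conjI ballI allI impI)
  fix \<eta> \<theta> :: "real \<Rightarrow> real" and c d :: real
  assume \<eta>: "\<eta> \<in> test_fun 0 T" and \<theta>: "\<theta> \<in> test_fun 0 T"
  have "deriv (\<lambda>s. c * \<eta> s + d * \<theta> s) s = c * deriv \<eta> s + d * deriv \<theta> s" for s
    by (intro DERIV_imp_deriv DERIV_add DERIV_cmult test_funD(1)[OF \<eta>] test_funD(1)[OF \<theta>])
  then have "flux i (\<lambda>s. c * \<eta> s + d * \<theta> s) =
      - (LINT s:{0<..<T}|lebesgue. c * (mass i s * deriv \<eta> s) + d * (mass i s * deriv \<theta> s))"
    by (simp add: flux_def algebra_simps)
  also have "\<dots> = c * flux i \<eta> + d * flux i \<theta>"
    using mass_integrable[OF test_funD(2)[OF \<eta>], of i] mass_integrable[OF test_funD(2)[OF \<theta>], of i]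
    by (subst set_integral_add(2)) (simp_all add: flux_def)
  finally show "flux i (\<lambda>s. c * \<eta> s + d * \<theta> s) = c * flux i \<eta> + d * flux i \<theta>" .
next
  fix K :: "real set"
  show "\<exists>B n. \<forall>\<eta>\<in>test_fun 0 T. closure {s. \<eta> s \<noteq> 0} \<subseteq> K \<longrightarrow> \<bar>flux i \<eta>\<bar> \<le> B * (\<Sum>k\<le>n. SUP s. \<bar>(deriv ^^ k) \<eta> s\<bar>)"
  proof (intro exI[of _ T] exI[of _ 1] ballI impI)
    fix \<eta> assume \<eta>: "\<eta> \<in> test_fun 0 T"
    \<comment> \<open>Boundedness is needed for \<open>SUP\<close> to be a genuine upper bound. The
      order n = 1 and the constant T work because the edge mass lies in [0, 1].\<close>
    have bdd: "bdd_above (range (\<lambda>s. \<bar>f s\<bar>))" if f: "continuous_on {0..T} f" "\<And>x. x \<notin> {0<..<T} \<Longrightarrow> f x = 0" for f :: "real \<Rightarrow> real"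
    proof -
      obtain c where c: "\<forall>x\<in>f ` {0..T}. norm x \<le> c"
        using continuous_on_Icc_bounded_measurable(1)[OF f(1)] unfolding bounded_iff by (elim exE)
      have "\<bar>f s\<bar> \<le> max c 0" for s
        using c f(2)[of s] by (cases "s \<in> {0<..<T}") (auto simp: le_max_iff_disj)
      then show ?thesis by (intro bdd_aboveI[of _ "max c 0"]) auto
    qed
    have b0: "bdd_above (range (\<lambda>s. \<bar>\<eta> s\<bar>))" and b1: "bdd_above (range (\<lambda>s. \<bar>deriv \<eta> s\<bar>))"
      by (intro bdd test_funD(2,3,4,5)[OF \<eta>]; assumption)+
    have "\<bar>\<eta> 0\<bar> \<le> (SUP s. \<bar>\<eta> s\<bar>)" by (rule cSUP_upper[OF UNIV_I b0])
    then have s0: "0 \<le> (SUP s. \<bar>\<eta> s\<bar>)" by linarith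
    have d: "\<bar>deriv \<eta> s\<bar> \<le> (SUP s. \<bar>deriv \<eta> s\<bar>)" for s by (rule cSUP_upper[OF UNIV_I b1])
    have "\<bar>flux i \<eta>\<bar> \<le> (SUP s. \<bar>deriv \<eta> s\<bar>) * (T - 0)"
      unfolding flux_def abs_minus_cancel
    proof (rule integral_norm_bound_Ioo[OF mass_integrable[OF test_funD(2)[OF \<eta>]]])
      fix s assume s: "s \<in> {0<..<T}"
      have "0 \<le> mass i s" "mass i s \<le> 1" by (rule avg_bounds[OF continuous_on_box_const s]; simp)+
      then have "\<bar>mass i s * deriv \<eta> s\<bar> \<le> 1 * \<bar>deriv \<eta> s\<bar>" unfolding abs_mult by (intro mult_right_mono) auto
      then show "\<bar>mass i s * deriv \<eta> s\<bar> \<le> (SUP s. \<bar>deriv \<eta> s\<bar>)" using d[of s] by linarith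
    qed (use T in simp)
    also have "\<dots> \<le> T * (\<Sum>k\<le>1. SUP s. \<bar>(deriv ^^ k) \<eta> s\<bar>)"
      using T s0 by (simp add: field_simps)
    finally show "\<bar>flux i \<eta>\<bar> \<le> T * (\<Sum>k\<le>1. SUP s. \<bar>(deriv ^^ k) \<eta> s\<bar>)" .
  qed
qed

lemma dist_deriv_mass:
  assumes "\<And>t. t \<in> {0<..<T} \<Longrightarrow> f t = mass i t"
  shows "dist_deriv (dist_of_fun 0 T f) \<eta> = flux i \<eta>"
  unfolding dist_deriv_def dist_of_fun_def flux_def
  using set_lebesgue_integral_cong_Ioo(1)[of 0 T "\<lambda>s. f s * deriv \<eta> s" "\<lambda>s. mass i s * deriv \<eta> s"] assms by simp

lemma loc_integrable_mass:
  assumes "\<And>t. t \<in> {0<..<T} \<Longrightarrow> f t = mass i t"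
  shows "loc_integrable 0 T f"
proof (rule set_integrable_imp_loc_integrable)
  have "set_integrable lebesgue {0<..<T} (mass i)" using mass_integrable[of "\<lambda>_. 1" i] by simp
  then show "set_integrable lebesgue {0<..<T} f" using set_lebesgue_integral_cong_Ioo(2)[of 0 T f "mass i"] assms by simp
qed


text \<open>The scaled cutoff vanishes at the vertex, so \<open>avg_weak\<close> has no vertex term:
  pairing its drift integral with \<eta> equals minus the pairing of its average with the derivative
  of \<eta>. The singular factor 1/\<epsilon> has disappeared, and the averages converge boundedly
  to the edge mass, whatever the profile \<psi>.\<close>

lemma cutoff_flux:
  assumes \<psi>: "cutoff i \<psi>"
  shows "\<epsilon> > 0 \<Longrightarrow> slice_integrable T m
      (\<lambda>t x. indicator (edge i) x * (edge_deriv i (\<lambda>z. \<psi> ((1 / \<epsilon>) *\<^sub>R z)) x * Hp L m u i x t))"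
    "\<eta> \<in> test_fun 0 T \<Longrightarrow>
      ((\<lambda>\<epsilon>. dist_of_fun 0 T (\<lambda>t. - (LINT x|m t. indicator (edge i) x *
          (edge_deriv i (\<lambda>z. \<psi> ((1 / \<epsilon>) *\<^sub>R z)) x * Hp L m u i x t))) \<eta>) \<longlongrightarrow> flux i \<eta>) (at_right 0)"
proof -
  obtain g' where g': "\<And>r. 0 \<le> r \<Longrightarrow> ((\<lambda>r. \<psi> (r *\<^sub>R axis i 1)) has_real_derivative g' r) (at r within {0..})"
    "continuous_on {0..} g'" "\<psi> 0 = 0" "g' 0 = 0" "\<And>r. 0 \<le> r \<Longrightarrow> 0 \<le> \<psi> (r *\<^sub>R axis i 1)"
    "\<And>r. 0 \<le> r \<Longrightarrow> \<psi> (r *\<^sub>R axis i 1) \<le> 1" "\<And>r. 1 \<le> r \<Longrightarrow> \<psi> (r *\<^sub>R axis i 1) = 1"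
    by (rule cutoffE[OF \<psi>]) blast
  let ?g = "\<lambda>\<epsilon> r t :: real. \<psi> ((1 / \<epsilon>) *\<^sub>R r *\<^sub>R axis i 1)"
  let ?g' = "\<lambda>\<epsilon> r t :: real. g' ((1 / \<epsilon>) * r) * (1 / \<epsilon>)"
  let ?X = "\<lambda>\<epsilon> t x. indicator (edge i) x * (edge_deriv i (\<lambda>z. \<psi> ((1 / \<epsilon>) *\<^sub>R z)) x * Hp L m u i x t)"
  have z: "continuous_on ({0..} \<times> {0..T}) (\<lambda>(r, s). 0 :: real)" by (simp add: case_prod_unfold)
  have sub: "box \<subseteq> {0..} \<times> {0..T}" by auto
  have dg: "((\<lambda>r. ?g \<epsilon> r t) has_real_derivative ?g' \<epsilon> r t) (at r within {0..})" if \<epsilon>: "\<epsilon> > 0" and r: "0 \<le> r" for \<epsilon> r t :: real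
  proof -
    have "((\<lambda>r. \<psi> (r *\<^sub>R axis i 1)) has_real_derivative g' ((1 / \<epsilon>) * r)) (at ((1 / \<epsilon>) * r) within (\<lambda>r. (1 / \<epsilon>) * r) ` {0..})"
      by (rule has_field_derivative_subset[OF g'(1)]) (use \<epsilon> r in auto)
    moreover have "((\<lambda>r. (1 / \<epsilon>) * r) has_real_derivative 1 / \<epsilon>) (at r within {0..})"
      using DERIV_cmult[OF DERIV_ident, of "1 / \<epsilon>"] by simp
    ultimately show ?thesis using DERIV_image_chain by (fastforce simp: o_def)
  qed
  have cg': "continuous_on ({0..} \<times> {0..T}) (\<lambda>(r, s). ?g' \<epsilon> r s)" if \<epsilon>: "\<epsilon> > 0" for \<epsilon> :: real
  proof -
    have "continuous_on ({0..} \<times> {0..T}) (\<lambda>z :: real \<times> real. g' ((1 / \<epsilon>) * fst z))"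
      by (rule continuous_on_compose2[OF g'(2) continuous_on_mult_left[OF continuous_on_fst[OF continuous_on_id]]])
        (use \<epsilon> in auto)
    from continuous_on_mult_right[OF this, of "1 / \<epsilon>"] show ?thesis by (simp add: case_prod_unfold)
  qed
  have cg: "continuous_on ({0..} \<times> {0..T}) (\<lambda>(r, s). ?g \<epsilon> r s)" if \<epsilon>: "\<epsilon> > 0" for \<epsilon> :: real
  proof -
    have "continuous_on {0..} (\<lambda>r. ?g \<epsilon> r 0)" by (rule DERIV_continuous_on[where D = "\<lambda>r. ?g' \<epsilon> r 0"]) (use dg[OF \<epsilon>] in auto)
    then have "continuous_on ({0..} \<times> {0..T}) (\<lambda>z. ?g \<epsilon> (fst z) 0)"
      by (rule continuous_on_compose2) (auto intro!: continuous_intros)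
    then show ?thesis by (simp add: case_prod_unfold)
  qed
  have ncg': "continuous_on ({0..} \<times> {0..T}) (\<lambda>(r, s). - ?g' \<epsilon> r s)" if \<epsilon>: "\<epsilon> > 0" for \<epsilon> :: real
    using continuous_on_minus[OF cg'[OF \<epsilon>]] by (simp add: case_prod_unfold)
  have S: "integrable (M t) (?X \<epsilon> t)" "(LINT x|M t. ?X \<epsilon> t x) = avg i (\<lambda>_ _. 0) (\<lambda>r s. - ?g' \<epsilon> r s) t"
    if t: "t \<in> {0<..<T}" and \<epsilon>: "\<epsilon> > 0" for t \<epsilon>
  proof -
    have ed: "edge_deriv i (\<lambda>z. \<psi> ((1 / \<epsilon>) *\<^sub>R z)) (r *\<^sub>R axis i 1) = ?g' \<epsilon> r t" if "0 \<le> r" for r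
      by (rule edge_deriv_eq[OF that dg[OF \<epsilon> that]])
    have X1: "?X \<epsilon> t (r *\<^sub>R axis i 1) = 0 - Hp L m u i (r *\<^sub>R axis i 1) t * - ?g' \<epsilon> r t" if r: "0 < r" for r
      using ed[of r] axis_scaleR_in_edge[of r i] r by simp
    have X0: "?X \<epsilon> t x = 0" if x: "x \<in> junction" "\<not> 0 < x $ i" for x
    proof (cases "x \<in> edge i")
      case True
      then have "x = 0" using x edge_minus_zero_iff[of x i] by blast
      then show ?thesis using ed[of 0] g'(4) by simp
    qed simp
    show "integrable (M t) (?X \<epsilon> t)" "(LINT x|M t. ?X \<epsilon> t x) = avg i (\<lambda>_ _. 0) (\<lambda>r s. - ?g' \<epsilon> r s) t"
      by (rule slice_avg[OF z ncg'[OF \<epsilon>] t X1 X0]; assumption)+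
  qed
  show "slice_integrable T m (?X \<epsilon>)" if \<epsilon>: "\<epsilon> > 0"
    by (rule slice_integrableI[OF S(1) S(2)])
      (use \<epsilon> avg_integrable(2)[OF z ncg'[OF \<epsilon>], of "\<lambda>_. 0" i] in auto)
  show "((\<lambda>\<epsilon>. dist_of_fun 0 T (\<lambda>t. - (LINT x|m t. ?X \<epsilon> t x)) \<eta>) \<longlongrightarrow> flux i \<eta>) (at_right 0)"
    if \<eta>: "\<eta> \<in> test_fun 0 T"
  proof -
    have \<eta>c: "continuous_on {0..T} \<eta>" "continuous_on {0..T} (deriv \<eta>)" by (rule test_funD(2,3)[OF \<eta>])+
    \<comment> \<open>The point of the argument: an integral with slopes of size 1/\<epsilon> is
      rewritten through the cutoff itself, which stays between 0 and 1.\<close>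
    have e: "dist_of_fun 0 T (\<lambda>t. - (LINT x|m t. ?X \<epsilon> t x)) \<eta> =
        - (LINT s:{0<..<T}|lebesgue. avg i (?g \<epsilon>) (\<lambda>_ _. 0) s * deriv \<eta> s)" if \<epsilon>: "\<epsilon> > 0" for \<epsilon>
    proof -
      have "dist_of_fun 0 T (\<lambda>t. - (LINT x|m t. ?X \<epsilon> t x)) \<eta> = (LINT s:{0<..<T}|lebesgue. avg i (\<lambda>_ _. 0) (?g' \<epsilon>) s * \<eta> s)"
        unfolding dist_of_fun_def
      proof (rule set_lebesgue_integral_cong_Ioo(1))
        fix s assume s: "s \<in> {0<..<T}"
        have "(LINT x|m s. ?X \<epsilon> s x) = avg i (\<lambda>_ _. 0) (\<lambda>r s. - ?g' \<epsilon> r s) s"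
          using S(2)[OF s \<epsilon>] m_eq[of s] s by simp
        also have "\<dots> = (LINT y|\<mu>. - (integrand i (\<lambda>_ _. 0) (?g' \<epsilon>) s y))"
          unfolding avg_def by (rule Bochner_Integration.integral_cong) auto
        also have "\<dots> = - avg i (\<lambda>_ _. 0) (?g' \<epsilon>) s" unfolding avg_def by (rule Bochner_Integration.integral_minus)
        finally show "- (LINT x|m s. ?X \<epsilon> s x) * \<eta> s = avg i (\<lambda>_ _. 0) (?g' \<epsilon>) s * \<eta> s" by simp
      qed
      moreover have "(LINT s:{0<..<T}|lebesgue. avg i (?g \<epsilon>) (\<lambda>_ _. 0) s * deriv \<eta> s) =
        (LINT s:{0<..<T}|lebesgue. mass i s * (0 * \<eta> s + ?g \<epsilon> 0 s * deriv \<eta> s)) -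
        (LINT s:{0<..<T}|lebesgue. avg i (\<lambda>_ _. 0) (?g' \<epsilon>) s * \<eta> s)"
      proof (rule avg_weak[OF \<eta> continuous_on_subset[OF cg[OF \<epsilon>] sub] continuous_on_subset[OF cg'[OF \<epsilon>] sub] continuous_on_box_const])
        show "((\<lambda>r. ?g \<epsilon> r t) has_real_derivative ?g' \<epsilon> r t) (at r within {0..C})" if "r \<in> {0..C}" for r t
          by (rule has_field_derivative_subset[OF dg[OF \<epsilon>]]) (use that in auto)
      qed simp
      ultimately show ?thesis using g'(3) by (simp add: set_lebesgue_integral_def)
    qed
    have lim: "((\<lambda>\<epsilon>. - (LINT s:{0<..<T}|lebesgue. avg i (?g \<epsilon>) (\<lambda>_ _. 0) s * deriv \<eta> s)) \<longlongrightarrow> flux i \<eta>) (at_right 0)"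
      unfolding tendsto_at_iff_sequentially
    proof (intro allI impI)
      fix \<epsilon> :: "nat \<Rightarrow> real" assume "\<forall>n. \<epsilon> n \<in> {0<..} - {0}" and \<epsilon>0: "\<epsilon> \<longlonglongrightarrow> 0"
      then have \<epsilon>: "\<epsilon> n > 0" for n by simp
      \<comment> \<open>At a fixed time, the cutoff on each curve with positive coordinate is
        eventually exactly 1; dominated convergence over the curves applies, and a second one over
        time follows below.\<close>
      have a: "(\<lambda>n. avg i (?g (\<epsilon> n)) (\<lambda>_ _. 0) s) \<longlonglongrightarrow> mass i s" if s: "s \<in> {0<..<T}" for s
        unfolding avg_def
      proof (rule integral_dominated_convergence[where w = "\<lambda>_. 1"])
        show "AE y in \<mu>. (\<lambda>n. integrand i (?g (\<epsilon> n)) (\<lambda>_ _. 0) s y)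
            \<longlonglongrightarrow> (integrand i (\<lambda>_ _. 1) (\<lambda>_ _. 0) s y)"
        proof (rule AE_I2)
          fix y
          show "(\<lambda>n. integrand i (?g (\<epsilon> n)) (\<lambda>_ _. 0) s y)
            \<longlonglongrightarrow> (integrand i (\<lambda>_ _. 1) (\<lambda>_ _. 0) s y)"
          proof (cases "0 < crd i s y")
            case True
            then have "\<forall>\<^sub>F n in sequentially. \<epsilon> n < crd i s y" using \<epsilon>0 by (rule order_tendstoD(2)[rotated])
            then have "\<forall>\<^sub>F n in sequentially. ?g (\<epsilon> n) (crd i s y) s = 1"
            proof eventually_elim
              case (elim n)
              then have "1 \<le> (1 / \<epsilon> n) * crd i s y" using \<epsilon>[of n] by (simp add: field_simps)
              from g'(7)[OF this] show ?case by simp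
            qed
            then have "(\<lambda>n. ?g (\<epsilon> n) (crd i s y) s) \<longlonglongrightarrow> 1" by (rule tendsto_eventually)
            then show ?thesis using True by simp
          qed simp
        qed
        show "AE y in \<mu>. norm (integrand i (?g (\<epsilon> n)) (\<lambda>_ _. 0) s y) \<le> 1" for n
        proof (rule AE_I2)
          fix y
          show "norm (integrand i (?g (\<epsilon> n)) (\<lambda>_ _. 0) s y) \<le> 1"
            using g'(5,6)[of "(1 / \<epsilon> n) * crd i s y"] \<epsilon>[of n] by (cases "0 < crd i s y") auto
        qed
        show "(\<lambda>y. integrand i (?g (\<epsilon> n)) (\<lambda>_ _. 0) s y) \<in> borel_measurable \<mu>" for n
          by (rule borel_measurable_integrable[OF integrand_integrable[OF continuous_on_subset[OF cg[OF \<epsilon>] sub] continuous_on_box_const s]])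
        show "(\<lambda>y. integrand i (\<lambda>_ _. 1) (\<lambda>_ _. 0) s y) \<in> borel_measurable \<mu>"
          by (rule borel_measurable_integrable[OF integrand_integrable[OF continuous_on_box_const continuous_on_box_const s]])
      qed simp
      have b: "\<bar>avg i (?g (\<epsilon> n)) (\<lambda>_ _. 0) s\<bar> \<le> 1" if s: "s \<in> {0<..<T}" for n s
      proof -
        have r: "0 \<le> ?g (\<epsilon> n) r s" "?g (\<epsilon> n) r s \<le> 1" if "r \<in> {0..C}" for r
          using g'(5,6)[of "(1 / \<epsilon> n) * r"] \<epsilon>[of n] that by auto
        show ?thesis using avg_bounds[OF continuous_on_subset[OF cg[OF \<epsilon>] sub] s r] by simp
      qed
      have "(\<lambda>n. LINT s:{0<..<T}|lebesgue. avg i (?g (\<epsilon> n)) (\<lambda>_ _. 0) s * deriv \<eta> s) \<longlonglongrightarrow>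
          (LINT s:{0<..<T}|lebesgue. mass i s * deriv \<eta> s)"
        unfolding set_lebesgue_integral_def
      proof (rule integral_dominated_convergence[where w = "\<lambda>s. indicator {0<..<T} s *\<^sub>R \<bar>deriv \<eta> s\<bar>"])
        show "(\<lambda>s. indicator {0<..<T} s *\<^sub>R (mass i s * deriv \<eta> s)) \<in> borel_measurable lebesgue"
          using mass_integrable[OF \<eta>c(2), of i] unfolding set_integrable_def by (rule borel_measurable_integrable)
        show "(\<lambda>s. indicator {0<..<T} s *\<^sub>R (avg i (?g (\<epsilon> n)) (\<lambda>_ _. 0) s * deriv \<eta> s)) \<in> borel_measurable lebesgue" for n
          using avg_integrable(1)[OF cg[OF \<epsilon>] z \<eta>c(2)] unfolding set_integrable_def by (rule borel_measurable_integrable)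
        show "integrable lebesgue (\<lambda>s. indicator {0<..<T} s *\<^sub>R \<bar>deriv \<eta> s\<bar>)"
          using set_integrable_abs[OF set_integrable_continuous_Ioo[OF \<eta>c(2)]] unfolding set_integrable_def .
        show "AE s in lebesgue. (\<lambda>n. indicator {0<..<T} s *\<^sub>R (avg i (?g (\<epsilon> n)) (\<lambda>_ _. 0) s * deriv \<eta> s))
            \<longlonglongrightarrow> indicator {0<..<T} s *\<^sub>R (mass i s * deriv \<eta> s)"
        proof (rule AE_I2)
          fix s
          show "(\<lambda>n. indicator {0<..<T} s *\<^sub>R (avg i (?g (\<epsilon> n)) (\<lambda>_ _. 0) s * deriv \<eta> s))
            \<longlonglongrightarrow> indicator {0<..<T} s *\<^sub>R (mass i s * deriv \<eta> s)"
          proof (cases "s \<in> {0<..<T}")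
            case True
            then show ?thesis using tendsto_mult_right[OF a[OF True], of "deriv \<eta> s"] by simp
          qed simp
        qed
        show "AE s in lebesgue. norm (indicator {0<..<T} s *\<^sub>R (avg i (?g (\<epsilon> n)) (\<lambda>_ _. 0) s * deriv \<eta> s))
            \<le> indicator {0<..<T} s *\<^sub>R \<bar>deriv \<eta> s\<bar>" for n
        proof (rule AE_I2)
          fix s
          show "norm (indicator {0<..<T} s *\<^sub>R (avg i (?g (\<epsilon> n)) (\<lambda>_ _. 0) s * deriv \<eta> s))
            \<le> indicator {0<..<T} s *\<^sub>R \<bar>deriv \<eta> s\<bar>"
            using mult_right_mono[OF b[of s n], of "\<bar>deriv \<eta> s\<bar>"] by (cases "s \<in> {0<..<T}") (auto simp: abs_mult)
        qed
      qed
      then show "((\<lambda>\<epsilon>. - (LINT s:{0<..<T}|lebesgue. avg i (?g \<epsilon>) (\<lambda>_ _. 0) s * deriv \<eta> s)) \<circ> \<epsilon>) \<longlonglongrightarrow> flux i \<eta>"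
        unfolding flux_def o_def by (rule tendsto_minus)
    qed
    show "((\<lambda>\<epsilon>. dist_of_fun 0 T (\<lambda>t. - (LINT x|m t. ?X \<epsilon> t x)) \<eta>) \<longlongrightarrow> flux i \<eta>) (at_right 0)"
      by (rule Lim_transform_eventually[OF lim]) (auto simp: eventually_at_right_field e intro!: exI[of _ 1])
  qed
qed

end

section \<open>Balance laws on the edges and at the vertex\<close>

lemma set_integral_sum:
  fixes f :: "'i \<Rightarrow> 'a \<Rightarrow> real"
  assumes "\<And>i. i \<in> I \<Longrightarrow> set_integrable M A (f i)"
  shows "set_integrable M A (\<lambda>x. \<Sum>i\<in>I. f i x)"
    "(LINT x:A|M. (\<Sum>i\<in>I. f i x)) = (\<Sum>i\<in>I. LINT x:A|M. f i x)"
  using assms unfolding set_integrable_def set_lebesgue_integral_def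
  by (simp_all add: sum_distrib_left Bochner_Integration.integral_sum)

context lipschitz_equilibrium
begin

lemma zero_cont: "continuous_on ({0..} \<times> {0..T}) (\<lambda>(r, s). 0 :: real)"
  by (simp add: case_prod_unfold)

lemma sum_mass_integral:
  assumes k: "continuous_on {0..T} k"
  shows "set_integrable lebesgue {0<..<T} (\<lambda>s. (1 - (\<Sum>i\<in>UNIV. mass i s)) * k s)"
    "(LINT s:{0<..<T}|lebesgue. (1 - (\<Sum>i\<in>UNIV. mass i s)) * k s) =
      (LINT s:{0<..<T}|lebesgue. k s) - (\<Sum>i\<in>UNIV. LINT s:{0<..<T}|lebesgue. mass i s * k s)"
proof -
  have s: "set_integrable lebesgue {0<..<T} (\<lambda>s. \<Sum>i\<in>UNIV. mass i s * k s)"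
    by (rule set_integral_sum(1)) (simp_all add: mass_integrable[OF k])
  have e: "(\<lambda>s. (1 - (\<Sum>i\<in>UNIV. mass i s)) * k s) = (\<lambda>s. k s - (\<Sum>i\<in>UNIV. mass i s * k s))"
    by (simp add: left_diff_distrib sum_distrib_right)
  show "set_integrable lebesgue {0<..<T} (\<lambda>s. (1 - (\<Sum>i\<in>UNIV. mass i s)) * k s)"
    unfolding e by (rule set_integral_diff(1)[OF set_integrable_continuous_Ioo[OF k] s])
  show "(LINT s:{0<..<T}|lebesgue. (1 - (\<Sum>i\<in>UNIV. mass i s)) * k s) =
      (LINT s:{0<..<T}|lebesgue. k s) - (\<Sum>i\<in>UNIV. LINT s:{0<..<T}|lebesgue. mass i s * k s)"
    unfolding e set_integral_diff(2)[OF set_integrable_continuous_Ioo[OF k] s]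
    by (subst set_integral_sum(2)) (simp_all add: mass_integrable[OF k])
qed

context
  fixes \<phi> :: "real ^ 'n \<Rightarrow> real \<Rightarrow> real"
  assumes smooth: "smooth_junction_time T \<phi>"
begin

abbreviation \<phi>r :: "'n \<Rightarrow> real \<Rightarrow> real \<Rightarrow> real" where
  "\<phi>r i r s \<equiv> vector_derivative (\<lambda>r. \<phi> (r *\<^sub>R axis i 1) s) (at r within {0..})"

abbreviation \<phi>t :: "'n \<Rightarrow> real \<Rightarrow> real \<Rightarrow> real" where
  "\<phi>t i r s \<equiv> vector_derivative (\<phi> (r *\<^sub>R axis i 1)) (at s within {0..T})"

lemma
  shows edge_cont: "continuous_on ({0..} \<times> {0..T}) (\<lambda>(r, s). \<phi> (r *\<^sub>R axis i 1) s)"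
    and edge_cont_r: "continuous_on ({0..} \<times> {0..T}) (\<lambda>(r, s). \<phi>r i r s)"
    and edge_cont_t: "continuous_on ({0..} \<times> {0..T}) (\<lambda>(r, s). \<phi>t i r s)"
    and edge_DERIV_r: "0 \<le> r \<Longrightarrow> s \<in> {0..T} \<Longrightarrow>
      ((\<lambda>r. \<phi> (r *\<^sub>R axis i 1) s) has_real_derivative \<phi>r i r s) (at r within {0..})"
    and edge_DERIV_t: "0 \<le> r \<Longrightarrow> s \<in> {0..T} \<Longrightarrow>
      ((\<lambda>s. \<phi> (r *\<^sub>R axis i 1) s) has_real_derivative \<phi>t i r s) (at s within {0..T})"
proof -
  have "smooth_on2 {0..} {0..T} (\<lambda>r s. \<phi> (r *\<^sub>R axis i 1) s)"
    using smooth by (simp add: smooth_junction_time_def)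
  then obtain fr ft where f: "continuous_on ({0..} \<times> {0..T}) (\<lambda>(r, s). \<phi> (r *\<^sub>R axis i 1) s)"
    "continuous_on ({0..} \<times> {0..T}) (\<lambda>(r, s). fr r s)" "continuous_on ({0..} \<times> {0..T}) (\<lambda>(r, s). ft r s)"
    "\<And>r s. r \<in> {0..} \<Longrightarrow> s \<in> {0..T} \<Longrightarrow> ((\<lambda>r. \<phi> (r *\<^sub>R axis i 1) s) has_real_derivative fr r s) (at r within {0..})"
    "\<And>r s. r \<in> {0..} \<Longrightarrow> s \<in> {0..T} \<Longrightarrow> (\<phi> (r *\<^sub>R axis i 1) has_real_derivative ft r s) (at s within {0..T})"
    by (rule smooth_on2_derivE) blast
  have r: "\<phi>r i r s = fr r s" if "0 \<le> r" "s \<in> {0..T}" for r s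
    using f(4)[of r s] that
    by (intro vector_derivative_within at_within_atLeast_neq_bot)
      (simp_all add: has_real_derivative_iff_has_vector_derivative)
  have t: "\<phi>t i r s = ft r s" if "0 \<le> r" "s \<in> {0..T}" for r s
    using f(5)[of r s] that T
    by (intro vector_derivative_within_closed_interval)
      (simp_all add: has_real_derivative_iff_has_vector_derivative)
  show "continuous_on ({0..} \<times> {0..T}) (\<lambda>(r, s). \<phi> (r *\<^sub>R axis i 1) s)" by (rule f(1))
  show "continuous_on ({0..} \<times> {0..T}) (\<lambda>(r, s). \<phi>r i r s)"
    by (rule continuous_on_eq[OF f(2)]) (use r in auto)
  show "continuous_on ({0..} \<times> {0..T}) (\<lambda>(r, s). \<phi>t i r s)"
    by (rule continuous_on_eq[OF f(3)]) (use t in auto)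
  show "((\<lambda>r. \<phi> (r *\<^sub>R axis i 1) s) has_real_derivative \<phi>r i r s) (at r within {0..})"
    "((\<lambda>s. \<phi> (r *\<^sub>R axis i 1) s) has_real_derivative \<phi>t i r s) (at s within {0..T})"
    if "0 \<le> r" "s \<in> {0..T}"
    using f(4,5)[of r s] r[OF that] t[OF that] that by simp_all
qed

abbreviation edge_avg :: "'n \<Rightarrow> real \<Rightarrow> real" where
  "edge_avg i \<equiv> avg i (\<lambda>r s. \<phi> (r *\<^sub>R axis i 1) s) (\<lambda>_ _. 0)"

abbreviation edge_rate :: "'n \<Rightarrow> real \<Rightarrow> real" where
  "edge_rate i \<equiv> avg i (\<phi>t i) (\<phi>r i)"

lemma deriv_time:
  assumes "0 \<le> r" "s \<in> {0<..<T}"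
  shows "deriv (\<phi> (r *\<^sub>R axis i 1)) s = \<phi>t i r s"
proof -
  have "at s within {0..T} = at s" using assms(2) by (intro at_within_interior) auto
  then show ?thesis using edge_DERIV_t[OF assms(1), of s i] assms(2) by (simp add: DERIV_imp_deriv)
qed

lemma edge_avg_slice:
  assumes t: "t \<in> {0<..<T}"
  shows "integrable (M t) (\<lambda>x. indicator (edge i - {0}) x * \<phi> x t)"
    "(LINT x|M t. indicator (edge i - {0}) x * \<phi> x t) = edge_avg i t"
proof -
  have X: "indicator (edge i - {0}) (r *\<^sub>R axis i 1) * \<phi> (r *\<^sub>R axis i 1) t =
      \<phi> (r *\<^sub>R axis i 1) t - Hp L m u i (r *\<^sub>R axis i 1) t * 0" if "0 < r" for r
    using scaleR_axis_edge_iff[OF that, of i i] by (simp add: indicator_def)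
  show "integrable (M t) (\<lambda>x. indicator (edge i - {0}) x * \<phi> x t)"
    "(LINT x|M t. indicator (edge i - {0}) x * \<phi> x t) = edge_avg i t"
    by (rule slice_avg[OF edge_cont zero_cont t X], assumption, simp add: indicator_edge)+
qed

lemma edge_rate_slice:
  assumes t: "t \<in> {0<..<T}"
  shows "integrable (M t) (\<lambda>x. indicator (edge i - {0}) x *
           (deriv (\<phi> x) t - Hp L m u i x t * edge_deriv i (\<lambda>z. \<phi> z t) x))"
    "(LINT x|M t. indicator (edge i - {0}) x *
           (deriv (\<phi> x) t - Hp L m u i x t * edge_deriv i (\<lambda>z. \<phi> z t) x)) = edge_rate i t"
proof -
  have X: "indicator (edge i - {0}) (r *\<^sub>R axis i 1) * (deriv (\<phi> (r *\<^sub>R axis i 1)) t -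
      Hp L m u i (r *\<^sub>R axis i 1) t * edge_deriv i (\<lambda>z. \<phi> z t) (r *\<^sub>R axis i 1)) =
      \<phi>t i r t - Hp L m u i (r *\<^sub>R axis i 1) t * \<phi>r i r t" if r: "0 < r" for r
  proof -
    have "edge_deriv i (\<lambda>z. \<phi> z t) (r *\<^sub>R axis i 1) = \<phi>r i r t"
      by (rule edge_deriv_eq) (use r t edge_DERIV_r in auto)
    then show ?thesis using scaleR_axis_edge_iff[OF r, of i i] deriv_time[of r t i] r t by (simp add: indicator_def)
  qed
  show "integrable (M t) (\<lambda>x. indicator (edge i - {0}) x *
           (deriv (\<phi> x) t - Hp L m u i x t * edge_deriv i (\<lambda>z. \<phi> z t) x))"
    "(LINT x|M t. indicator (edge i - {0}) x *
           (deriv (\<phi> x) t - Hp L m u i x t * edge_deriv i (\<lambda>z. \<phi> z t) x)) = edge_rate i t"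
    by (rule slice_avg[OF edge_cont_t edge_cont_r t X], assumption, simp add: indicator_edge)+
qed

lemma vertex_cont:
  "continuous_on {0..T} (\<phi> 0)" "continuous_on {0..T} (\<phi>t i 0)"
proof -
  have "continuous_on {0..T} (\<lambda>t. (\<lambda>(r, s). \<phi> (r *\<^sub>R axis i 1) s) (0, t))"
    by (rule continuous_on_compose2[OF edge_cont]) (auto intro!: continuous_intros)
  then show "continuous_on {0..T} (\<phi> 0)" by simp
  have "continuous_on {0..T} (\<lambda>t. (\<lambda>(r, s). \<phi>t i r s) (0, t))"
    by (rule continuous_on_compose2[OF edge_cont_t]) (auto intro!: continuous_intros)
  then show "continuous_on {0..T} (\<phi>t i 0)" by simp
qed

lemma vertex_deriv: "s \<in> {0..T} \<Longrightarrow> (\<phi> 0 has_real_derivative \<phi>t i 0 s) (at s within {0..T})"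
  using edge_DERIV_t[of 0 s i] by simp

text \<open>All edges share the function \<open>\<phi> 0\<close>, so its time derivative at interior
  times may be read off along any edge j. The free index lets the sum over i be taken with one
  common vertex derivative.\<close>

lemma edge_weak:
  assumes \<eta>: "\<eta> \<in> test_fun 0 T"
  shows "(LINT s:{0<..<T}|lebesgue. edge_avg i s * deriv \<eta> s) =
    (LINT s:{0<..<T}|lebesgue. mass i s * (\<phi>t j 0 s * \<eta> s + \<phi> 0 s * deriv \<eta> s)) -
    (LINT s:{0<..<T}|lebesgue. edge_rate i s * \<eta> s)"
proof -
  have sub: "box \<subseteq> {0..} \<times> {0..T}" by auto
  have "(LINT s:{0<..<T}|lebesgue. edge_avg i s * deriv \<eta> s) =
    (LINT s:{0<..<T}|lebesgue. mass i s * (\<phi>t i 0 s * \<eta> s + \<phi> (0 *\<^sub>R axis i 1) s * deriv \<eta> s)) -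
    (LINT s:{0<..<T}|lebesgue. edge_rate i s * \<eta> s)"
  proof (rule avg_weak[OF \<eta> continuous_on_subset[OF edge_cont sub] continuous_on_subset[OF edge_cont_r sub] continuous_on_subset[OF edge_cont_t sub]])
    fix r t assume rt: "r \<in> {0..C}" "t \<in> {0..T}"
    then have r: "0 \<le> r" by simp
    show "((\<lambda>r. \<phi> (r *\<^sub>R axis i 1) t) has_real_derivative \<phi>r i r t) (at r within {0..C})"
      by (rule has_field_derivative_subset[OF edge_DERIV_r[OF r rt(2)]]) auto
    show "((\<lambda>t. \<phi> (r *\<^sub>R axis i 1) t) has_real_derivative \<phi>t i r t) (at t within {0..T})"
      by (rule edge_DERIV_t[OF r rt(2)])
  qed
  moreover have "\<phi>t i 0 s = \<phi>t j 0 s" if "s \<in> {0<..<T}" for s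
    using deriv_time[of 0 s i] deriv_time[of 0 s j] that by simp
  then have "(LINT s:{0<..<T}|lebesgue. mass i s * (\<phi>t i 0 s * \<eta> s + \<phi> 0 s * deriv \<eta> s)) =
      (LINT s:{0<..<T}|lebesgue. mass i s * (\<phi>t j 0 s * \<eta> s + \<phi> 0 s * deriv \<eta> s))"
    by (intro set_lebesgue_integral_cong_Ioo(1)) simp
  ultimately show ?thesis by simp
qed

lemma edge_balance:
  "slice_integrable T m (\<lambda>t x. indicator (edge i - {0}) x * \<phi> x t)"
  "slice_integrable T m (\<lambda>t x. indicator (edge i - {0}) x *
           (deriv (\<phi> x) t - Hp L m u i x t * edge_deriv i (\<lambda>z. \<phi> z t) x))"
  "\<eta> \<in> test_fun 0 T \<Longrightarrow> dist_deriv (dist_of_fun 0 T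
              (\<lambda>t. LINT x|m t. indicator (edge i - {0}) x * \<phi> x t)) \<eta> =
            dist_mult (\<phi> 0) (flux i) \<eta> +
            dist_of_fun 0 T (\<lambda>t. LINT x|m t. indicator (edge i - {0}) x *
              (deriv (\<phi> x) t - Hp L m u i x t * edge_deriv i (\<lambda>z. \<phi> z t) x)) \<eta>"
proof -
  have one: "continuous_on {0..T} (\<lambda>_. 1 :: real)" by simp
  show "slice_integrable T m (\<lambda>t x. indicator (edge i - {0}) x * \<phi> x t)"
    by (rule slice_integrableI[OF edge_avg_slice avg_integrable(2)[OF edge_cont zero_cont one]])
  show "slice_integrable T m (\<lambda>t x. indicator (edge i - {0}) x *
           (deriv (\<phi> x) t - Hp L m u i x t * edge_deriv i (\<lambda>z. \<phi> z t) x))"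
    by (rule slice_integrableI[OF edge_rate_slice avg_integrable(2)[OF edge_cont_t edge_cont_r one]])
  assume \<eta>: "\<eta> \<in> test_fun 0 T"
  have mM: "m t = M t" if "t \<in> {0<..<T}" for t using m_eq[of t] that by simp
  have "dist_deriv (dist_of_fun 0 T (\<lambda>t. LINT x|m t. indicator (edge i - {0}) x * \<phi> x t)) \<eta> =
      - (LINT s:{0<..<T}|lebesgue. edge_avg i s * deriv \<eta> s)"
    unfolding dist_deriv_def dist_of_fun_def
    by (intro arg_cong[where f = uminus] set_lebesgue_integral_cong_Ioo(1)) (simp add: edge_avg_slice(2) mM)
  moreover have "dist_of_fun 0 T (\<lambda>t. LINT x|m t. indicator (edge i - {0}) x *
              (deriv (\<phi> x) t - Hp L m u i x t * edge_deriv i (\<lambda>z. \<phi> z t) x)) \<eta> =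
      (LINT s:{0<..<T}|lebesgue. edge_rate i s * \<eta> s)"
    unfolding dist_of_fun_def
    by (intro set_lebesgue_integral_cong_Ioo(1)) (simp add: edge_rate_slice(2) mM)
  \<comment> \<open>The flux tested with \<phi>(0, s) \<eta>(s) differentiates this product, which
    reproduces the vertex term of \<open>edge_weak\<close> with opposite sign.\<close>
  moreover have "dist_mult (\<phi> 0) (flux i) \<eta> = - (LINT s:{0<..<T}|lebesgue. mass i s * (\<phi>t i 0 s * \<eta> s + \<phi> 0 s * deriv \<eta> s))"
    unfolding dist_mult_def flux_def
  proof (intro arg_cong[where f = uminus] set_lebesgue_integral_cong_Ioo(1))
    fix s assume s: "s \<in> {0<..<T}"
    have "at s within {0..T} = at s" using s by (intro at_within_interior) auto
    then have "(\<phi> 0 has_real_derivative \<phi>t i 0 s) (at s)" using vertex_deriv[of s i] s by simp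
    from DERIV_imp_deriv[OF DERIV_mult[OF this test_funD(1)[OF \<eta>]]]
    show "mass i s * deriv (\<lambda>s. \<phi> 0 s * \<eta> s) s = mass i s * (\<phi>t i 0 s * \<eta> s + \<phi> 0 s * deriv \<eta> s)"
      by (simp add: mult.commute add.commute)
  qed
  ultimately show "dist_deriv (dist_of_fun 0 T
              (\<lambda>t. LINT x|m t. indicator (edge i - {0}) x * \<phi> x t)) \<eta> =
            dist_mult (\<phi> 0) (flux i) \<eta> +
            dist_of_fun 0 T (\<lambda>t. LINT x|m t. indicator (edge i - {0}) x *
              (deriv (\<phi> x) t - Hp L m u i x t * edge_deriv i (\<lambda>z. \<phi> z t) x)) \<eta>"
    using edge_weak[OF \<eta>, of i i] by linarith
qed

lemma total_slice:
  assumes t: "t \<in> {0<..<T}"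
  shows "integrable (M t) (\<lambda>x. \<phi> x t)"
    "(LINT x|M t. \<phi> x t) = (\<Sum>i\<in>UNIV. edge_avg i t) + (1 - (\<Sum>i\<in>UNIV. mass i t)) * \<phi> 0 t"
proof -
  interpret P: prob_space "M t" using M_P1[of t] by (simp add: P1_def borel_prob_on_def)
  have e: "\<phi> x t = (\<Sum>i\<in>UNIV. indicator (edge i - {0}) x * \<phi> x t) + (1 - (\<Sum>i\<in>UNIV. indicator (edge i - {0}) x)) * \<phi> 0 t"
    if x: "x \<in> space (M t)" for x
  proof -
    have s: "(\<Sum>i\<in>UNIV. indicator (edge i - {0}) x) = (1 :: real) - indicator {0} x"
      using sum_edges[of x] x space_M by (simp add: algebra_simps)
    show ?thesis unfolding sum_distrib_right[symmetric] s by (simp split: split_indicator)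
  qed
  have i1: "integrable (M t) (\<lambda>x. \<Sum>i\<in>UNIV. indicator (edge i - {0}) x * \<phi> x t)"
    by (intro Bochner_Integration.integrable_sum edge_avg_slice(1)[OF t])
  have i3: "integrable (M t) (\<lambda>x. \<Sum>i\<in>UNIV. indicator (edge i - {0}) x :: real)"
    by (intro Bochner_Integration.integrable_sum integral_edge_indicator(1)[OF t])
  then have i2: "integrable (M t) (\<lambda>x. (1 - (\<Sum>i\<in>UNIV. indicator (edge i - {0}) x)) * \<phi> 0 t)"
    by (intro integrable_mult_left Bochner_Integration.integrable_diff) simp_all
  have "(LINT x|M t. \<phi> x t) = (LINT x|M t. (\<Sum>i\<in>UNIV. indicator (edge i - {0}) x * \<phi> x t) + (1 - (\<Sum>i\<in>UNIV. indicator (edge i - {0}) x)) * \<phi> 0 t)"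
    by (rule Bochner_Integration.integral_cong[OF refl e])
  also have "\<dots> = (\<Sum>i\<in>UNIV. edge_avg i t) + (LINT x|M t. 1 - (\<Sum>i\<in>UNIV. indicator (edge i - {0}) x)) * \<phi> 0 t"
    by (simp only: Bochner_Integration.integral_add[OF i1 i2] integral_mult_left_zero
        Bochner_Integration.integral_sum[OF edge_avg_slice(1)[OF t]] edge_avg_slice(2)[OF t])
  also have "(LINT x|M t. 1 - (\<Sum>i\<in>UNIV. indicator (edge i - {0}) x)) = 1 - (\<Sum>i\<in>UNIV. mass i t)"
    by (subst Bochner_Integration.integral_diff[OF _ i3])
      (simp_all add: integral_edge_indicator[OF t] P.prob_space Bochner_Integration.integral_sum del: Bochner_Integration.integral_indicator)
  finally show "(LINT x|M t. \<phi> x t) = (\<Sum>i\<in>UNIV. edge_avg i t) + (1 - (\<Sum>i\<in>UNIV. mass i t)) * \<phi> 0 t" .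
  show "integrable (M t) (\<lambda>x. \<phi> x t)"
    by (subst Bochner_Integration.integrable_cong[OF refl e], assumption) (rule Bochner_Integration.integrable_add[OF i1 i2])
qed

text \<open>The flux terms of the edges cancel against the change of the mass at the vertex, which
  is 1 minus the sum of the edge masses. Integration by parts in the term without mass leaves the
  contribution of the time derivative of \<open>\<phi> 0\<close>, weighted by the vertex
  mass.\<close>

lemma total_balance:
  "slice_integrable T m (\<lambda>t x. \<phi> x t)"
  "loc_integrable 0 T (\<lambda>t. measure (m t) {0} * deriv (\<phi> 0) t)"
  "\<eta> \<in> test_fun 0 T \<Longrightarrow> dist_deriv (dist_of_fun 0 T (\<lambda>t. LINT x|m t. \<phi> x t)) \<eta> =
         dist_of_fun 0 T
           (\<lambda>t. measure (m t) {0} * deriv (\<phi> 0) t +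
             (\<Sum>i\<in>UNIV. LINT x|m t. indicator (edge i - {0}) x *
               (deriv (\<phi> x) t - Hp L m u i x t * edge_deriv i (\<lambda>z. \<phi> z t) x))) \<eta>"
proof -
  \<comment> \<open>An arbitrary edge along which the time derivative at the vertex is written, so
    that all vertex terms below have the same form and cancel literally.\<close>
  fix j :: 'n
  let ?mv = "\<lambda>s. 1 - (\<Sum>i\<in>UNIV. mass i s)"
  have mM: "m t = M t" if "t \<in> {0<..<T}" for t using m_eq[of t] that by simp
  have mv: "measure (M t) {0} = ?mv t" if "t \<in> {0<..<T}" for t using measure_vertex[OF that] mM[OF that] by simp
  have one: "continuous_on {0..T} (\<lambda>_. 1 :: real)" by simp
  have d0: "deriv (\<phi> 0) s = \<phi>t j 0 s" if "s \<in> {0<..<T}" for s using deriv_time[of 0 s j] that by simp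
  have I: "set_integrable lebesgue {0<..<T} (\<lambda>s. \<Sum>i\<in>UNIV. edge_avg i s * k s)" if k: "continuous_on {0..T} k" for k
    by (rule set_integral_sum(1)) (simp_all add: avg_integrable(1)[OF edge_cont zero_cont k])
  have I': "set_integrable lebesgue {0<..<T} (\<lambda>s. \<Sum>i\<in>UNIV. edge_rate i s * k s)" if k: "continuous_on {0..T} k" for k
    by (rule set_integral_sum(1)) (simp_all add: avg_integrable(1)[OF edge_cont_t edge_cont_r k])
  have "set_integrable lebesgue {0<..<T} (\<lambda>s. (\<Sum>i\<in>UNIV. edge_avg i s) + ?mv s * \<phi> 0 s)"
    using set_integral_add(1)[OF I[OF one] sum_mass_integral(1)[OF vertex_cont(1)]] by simp
  from slice_integrableI[OF total_slice this]
  show "slice_integrable T m (\<lambda>t x. \<phi> x t)" .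
  show "loc_integrable 0 T (\<lambda>t. measure (m t) {0} * deriv (\<phi> 0) t)"
    by (rule set_integrable_imp_loc_integrable, subst set_lebesgue_integral_cong_Ioo(2)[where g = "\<lambda>s. ?mv s * \<phi>t j 0 s"])
      (simp add: measure_vertex d0, rule sum_mass_integral(1)[OF vertex_cont(2)])
  assume \<eta>: "\<eta> \<in> test_fun 0 T"
  have \<eta>c: "continuous_on {0..T} \<eta>" "continuous_on {0..T} (deriv \<eta>)" by (rule test_funD(2,3)[OF \<eta>])+
  note k1 = continuous_on_mult[OF vertex_cont(1) \<eta>c(2)] and k2 = continuous_on_mult[OF vertex_cont(2)[of j] \<eta>c(1)]
  have "dist_deriv (dist_of_fun 0 T (\<lambda>t. LINT x|m t. \<phi> x t)) \<eta> =
      - (LINT s:{0<..<T}|lebesgue. (\<Sum>i\<in>UNIV. edge_avg i s * deriv \<eta> s) + ?mv s * (\<phi> 0 s * deriv \<eta> s))"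
    unfolding dist_deriv_def dist_of_fun_def
    by (intro arg_cong[where f = uminus] set_lebesgue_integral_cong_Ioo(1))
      (simp add: total_slice(2) mM distrib_right sum_distrib_right)
  also have "\<dots> = - (\<Sum>i\<in>UNIV. LINT s:{0<..<T}|lebesgue. edge_avg i s * deriv \<eta> s) - (LINT s:{0<..<T}|lebesgue. \<phi> 0 s * deriv \<eta> s) +
      (\<Sum>i\<in>UNIV. LINT s:{0<..<T}|lebesgue. mass i s * (\<phi> 0 s * deriv \<eta> s))"
    unfolding set_integral_add(2)[OF I[OF \<eta>c(2)] sum_mass_integral(1)[OF k1]] sum_mass_integral(2)[OF k1]
    by (subst set_integral_sum(2)) (simp_all add: avg_integrable(1)[OF edge_cont zero_cont \<eta>c(2)])
  also have "(\<Sum>i\<in>UNIV. LINT s:{0<..<T}|lebesgue. edge_avg i s * deriv \<eta> s) =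
      (\<Sum>i\<in>UNIV. (LINT s:{0<..<T}|lebesgue. mass i s * (\<phi>t j 0 s * \<eta> s)) + (LINT s:{0<..<T}|lebesgue. mass i s * (\<phi> 0 s * deriv \<eta> s)) -
        (LINT s:{0<..<T}|lebesgue. edge_rate i s * \<eta> s))"
    by (rule sum.cong[OF refl], subst edge_weak[OF \<eta>, of _ j], subst set_integral_add(2)[OF mass_integrable[OF k2] mass_integrable[OF k1], symmetric])
      (simp add: distrib_left)
  also have "(LINT s:{0<..<T}|lebesgue. \<phi> 0 s * deriv \<eta> s) = - (LINT s:{0<..<T}|lebesgue. \<phi>t j 0 s * \<eta> s)"
    by (rule set_integral_Ioo_by_parts[OF \<eta> less_imp_le[OF T] vertex_deriv vertex_cont(2)])
  finally have e1: "dist_deriv (dist_of_fun 0 T (\<lambda>t. LINT x|m t. \<phi> x t)) \<eta> =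
      (LINT s:{0<..<T}|lebesgue. \<phi>t j 0 s * \<eta> s) - (\<Sum>i\<in>UNIV. LINT s:{0<..<T}|lebesgue. mass i s * (\<phi>t j 0 s * \<eta> s)) +
      (\<Sum>i\<in>UNIV. LINT s:{0<..<T}|lebesgue. edge_rate i s * \<eta> s)"
    by (simp add: sum.distrib sum_subtractf)
  have "dist_of_fun 0 T (\<lambda>t. measure (m t) {0} * deriv (\<phi> 0) t +
             (\<Sum>i\<in>UNIV. LINT x|m t. indicator (edge i - {0}) x *
               (deriv (\<phi> x) t - Hp L m u i x t * edge_deriv i (\<lambda>z. \<phi> z t) x))) \<eta> =
      (LINT s:{0<..<T}|lebesgue. ?mv s * (\<phi>t j 0 s * \<eta> s) + (\<Sum>i\<in>UNIV. edge_rate i s * \<eta> s))"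
    unfolding dist_of_fun_def
    by (intro set_lebesgue_integral_cong_Ioo(1))
      (simp add: mv d0 edge_rate_slice(2) mM distrib_right sum_distrib_right)
  also have "\<dots> = (LINT s:{0<..<T}|lebesgue. \<phi>t j 0 s * \<eta> s) - (\<Sum>i\<in>UNIV. LINT s:{0<..<T}|lebesgue. mass i s * (\<phi>t j 0 s * \<eta> s)) +
      (\<Sum>i\<in>UNIV. LINT s:{0<..<T}|lebesgue. edge_rate i s * \<eta> s)"
    unfolding set_integral_add(2)[OF sum_mass_integral(1)[OF k2] I'[OF \<eta>c(1)]] sum_mass_integral(2)[OF k2]
    by (subst set_integral_sum(2)) (simp_all add: avg_integrable(1)[OF edge_cont_t edge_cont_r \<eta>c(1)])
  finally show "dist_deriv (dist_of_fun 0 T (\<lambda>t. LINT x|m t. \<phi> x t)) \<eta> =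
         dist_of_fun 0 T
           (\<lambda>t. measure (m t) {0} * deriv (\<phi> 0) t +
             (\<Sum>i\<in>UNIV. LINT x|m t. indicator (edge i - {0}) x *
               (deriv (\<phi> x) t - Hp L m u i x t * edge_deriv i (\<lambda>z. \<phi> z t) x))) \<eta>"
    using e1 by simp
qed

end

text \<open>Conservation of total mass: the derivative of the constant 1 is zero against every test
  function, and what remains is minus the sum of the derivatives of the edge masses.\<close>

lemma vertex_balance:
  "loc_integrable 0 T (\<lambda>t. measure (m t) {0})"
  "\<eta> \<in> test_fun 0 T \<Longrightarrow>
    dist_deriv (dist_of_fun 0 T (\<lambda>t. measure (m t) {0})) \<eta> + (\<Sum>i\<in>UNIV. flux i \<eta>) = 0"
proof -
  have one: "continuous_on {0..T} (\<lambda>_. 1 :: real)" by simp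
  show "loc_integrable 0 T (\<lambda>t. measure (m t) {0})"
  proof (rule set_integrable_imp_loc_integrable)
    have "set_integrable lebesgue {0<..<T} (\<lambda>s. 1 - (\<Sum>i\<in>UNIV. mass i s))"
      using sum_mass_integral(1)[OF one] by simp
    then show "set_integrable lebesgue {0<..<T} (\<lambda>t. measure (m t) {0})"
      by (subst set_lebesgue_integral_cong_Ioo(2)[OF measure_vertex])
  qed
  assume \<eta>: "\<eta> \<in> test_fun 0 T"
  have \<eta>c: "continuous_on {0..T} (deriv \<eta>)" by (rule test_funD(2)[OF \<eta>])
  have "dist_deriv (dist_of_fun 0 T (\<lambda>t. measure (m t) {0})) \<eta> =
      - (LINT s:{0<..<T}|lebesgue. (1 - (\<Sum>i\<in>UNIV. mass i s)) * deriv \<eta> s)"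
    unfolding dist_deriv_def dist_of_fun_def
    by (intro arg_cong[where f = uminus] set_lebesgue_integral_cong_Ioo(1)) (simp add: measure_vertex)
  moreover have "(LINT s:{0<..<T}|lebesgue. deriv \<eta> s) = 0"
    using set_integral_Ioo_by_parts[OF \<eta> less_imp_le[OF T], of "\<lambda>_. 1" "\<lambda>_. 0"]
    by (simp add: set_lebesgue_integral_def)
  ultimately show "dist_deriv (dist_of_fun 0 T (\<lambda>t. measure (m t) {0})) \<eta> + (\<Sum>i\<in>UNIV. flux i \<eta>) = 0"
    by (simp add: sum_mass_integral(2)[OF \<eta>c] flux_def sum_negf)
qed

end

theorem theorem3p9:
  fixes T p C V :: real
    and L :: "'n::finite \<Rightarrow> (real ^ 'n) measure \<Rightarrow> real \<Rightarrow> real \<Rightarrow> real"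
    and Lstar :: "(real ^ 'n) measure \<Rightarrow> real"
    and G :: "'n \<Rightarrow> (real ^ 'n) measure \<Rightarrow> real \<Rightarrow> real"
    and Gstar :: "(real ^ 'n) measure \<Rightarrow> real"
    and m0 :: "(real ^ 'n) measure"
    and \<mu> :: "(real \<Rightarrow>\<^sub>C (real ^ 'n)) measure"
    and u :: "real ^ 'n \<Rightarrow> real \<Rightarrow> real"
    and m :: "real \<Rightarrow> (real ^ 'n) measure"
  assumes "CARD('n) > 1" and "T > 0" and "p > 1" and "C > 0" and "V > 0"
    and "m0 \<in> borel_prob_on junction" and "bounded (measure_supp m0)"
    and "standing_assumptions p L Lstar G Gstar"
    and "\<forall>i. \<forall>m'\<in>P1. C1_halfline (G i m')"
    and "\<mu> \<in> prob_with_start m0 (Gamma_Lip T p C V)"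
    and "relaxed_equilibrium T p C L Lstar G Gstar m0 (view_on (Gamma_C T p C) \<mu>)"
    and "mild_solution T p L Lstar G Gstar (view_on (Gamma_C T p C) \<mu>) u m"
  shows "\<exists>q :: 'n \<Rightarrow> (real \<Rightarrow> real) \<Rightarrow> real.
    (\<forall>i. distribution 0 T (q i)) \<and>
    (\<forall>i \<psi>. cutoff i \<psi> \<longrightarrow>
      (\<forall>\<epsilon>>0. slice_integrable T m
         (\<lambda>t x. indicator (edge i) x * (edge_deriv i (\<lambda>z. \<psi> ((1 / \<epsilon>) *\<^sub>R z)) x * Hp L m u i x t))) \<and>
      (\<forall>\<eta>\<in>test_fun 0 T.
         ((\<lambda>\<epsilon>. dist_of_fun 0 T
             (\<lambda>t. - (LINT x|m t. indicator (edge i) x *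
                       (edge_deriv i (\<lambda>z. \<psi> ((1 / \<epsilon>) *\<^sub>R z)) x * Hp L m u i x t))) \<eta>)
          \<longlongrightarrow> q i \<eta>) (at_right 0))) \<and>
    (\<forall>i. loc_integrable 0 T (\<lambda>t. measure (m t) (edge i - {0})) \<and>
      loc_integrable 0 T (\<lambda>t. LINT \<gamma>|view_on (Gamma_all T p) \<mu>.
         indicator (edge i - {0}) (apply_bcontfun \<gamma> t) :: real) \<and>
      (\<forall>\<eta>\<in>test_fun 0 T.
         dist_deriv (dist_of_fun 0 T (\<lambda>t. measure (m t) (edge i - {0}))) \<eta> =
         dist_deriv (dist_of_fun 0 T (\<lambda>t. LINT \<gamma>|view_on (Gamma_all T p) \<mu>.
           indicator (edge i - {0}) (apply_bcontfun \<gamma> t))) \<eta> \<and>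
         dist_deriv (dist_of_fun 0 T (\<lambda>t. LINT \<gamma>|view_on (Gamma_all T p) \<mu>.
           indicator (edge i - {0}) (apply_bcontfun \<gamma> t))) \<eta> = q i \<eta>)) \<and>
    (\<forall>\<phi> :: real ^ 'n \<Rightarrow> real \<Rightarrow> real.
      smooth_junction_time T \<phi> \<and>
      (\<exists>K. compact K \<and> K \<subseteq> junction \<and> (\<forall>t\<in>{0..T}. jsupp (\<lambda>x. \<phi> x t) \<subseteq> K)) \<longrightarrow>
      (\<forall>i. slice_integrable T m (\<lambda>t x. indicator (edge i - {0}) x * \<phi> x t) \<and>
         slice_integrable T m (\<lambda>t x. indicator (edge i - {0}) x *
           (deriv (\<phi> x) t - Hp L m u i x t * edge_deriv i (\<lambda>z. \<phi> z t) x)) \<and>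
         (\<forall>\<eta>\<in>test_fun 0 T.
            dist_deriv (dist_of_fun 0 T
              (\<lambda>t. LINT x|m t. indicator (edge i - {0}) x * \<phi> x t)) \<eta> =
            dist_mult (\<phi> 0) (q i) \<eta> +
            dist_of_fun 0 T (\<lambda>t. LINT x|m t. indicator (edge i - {0}) x *
              (deriv (\<phi> x) t - Hp L m u i x t * edge_deriv i (\<lambda>z. \<phi> z t) x)) \<eta>)) \<and>
      slice_integrable T m (\<lambda>t x. \<phi> x t) \<and>
      loc_integrable 0 T (\<lambda>t. measure (m t) {0} * deriv (\<phi> 0) t) \<and>
      (\<forall>\<eta>\<in>test_fun 0 T.
         dist_deriv (dist_of_fun 0 T (\<lambda>t. LINT x|m t. \<phi> x t)) \<eta> =
         dist_of_fun 0 T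
           (\<lambda>t. measure (m t) {0} * deriv (\<phi> 0) t +
             (\<Sum>i\<in>UNIV. LINT x|m t. indicator (edge i - {0}) x *
               (deriv (\<phi> x) t - Hp L m u i x t * edge_deriv i (\<lambda>z. \<phi> z t) x))) \<eta>)) \<and>
    loc_integrable 0 T (\<lambda>t. measure (m t) {0}) \<and>
    (\<forall>\<eta>\<in>test_fun 0 T.
       dist_deriv (dist_of_fun 0 T (\<lambda>t. measure (m t) {0})) \<eta> + (\<Sum>i\<in>UNIV. q i \<eta>) = 0)"
proof -
  \<comment> \<open>The lower bound in the standing assumptions provides the constant that both
    locales carry.\<close>
  obtain C0 where C0: "C0 > 0" "\<And>n. n \<in> P1 \<Longrightarrow> - C0 \<le> Lstar n"
    "\<And>n i x a. n \<in> P1 \<Longrightarrow> 0 \<le> x \<Longrightarrow> C0 * (\<bar>a\<bar> powr p - 1) \<le> L i n x a"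
  proof -
    have "\<exists>C0>0. \<forall>n\<in>P1. Lstar n \<ge> - C0 \<and> (\<forall>i. \<forall>x\<ge>0. \<forall>a. L i n x a \<ge> C0 * (\<bar>a\<bar> powr p - 1))"
      using assms(8) unfolding standing_assumptions_def by (elim conjE)
    then show ?thesis using that by blast
  qed
  interpret lipschitz_equilibrium T p C V C0 L Lstar G Gstar m0 \<mu> u m
    by unfold_locales (use assms(2-5,8,10-12) C0 in blast)+
  \<comment> \<open>The witness \<open>flux\<close> is fixed before any cutoff is considered, which
    is how independence of \<psi> is expressed.\<close>
  show ?thesis
    by (intro exI[of _ flux] conjI allI impI ballI; (elim conjE)?;
        (simp only: dist_deriv_mass[OF measure_edge] dist_deriv_mass[OF integral_view]
         | rule distribution_flux cutoff_flux edge_balance total_balance vertex_balance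
             loc_integrable_mass[OF measure_edge] loc_integrable_mass[OF integral_view]; assumption))
qed

end
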